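(* Consider the Inverse Linear Feasibility Problem with a target set fixing one variable to zero: given $A\in\mathbb{Q}^{m\times n}$, $B\in\mathbb{Q}^{m\times k}$, $b\in\mathbb{Q}^m$, $C\in\mathbb{Q}^{n\times k}$, $c\in\mathbb{Q}^n$, a polyhedron $X=\{x\in\mathbb{R}^k \mid Dx\le d\}$ with $D\in\mathbb{Q}^{g\times k}$, $d\in\mathbb{Q}^g$, and an index $i\in\{1,\dots,n\}$, let $Y=\{y\in\mathbb{R}^n\mid y_i=0\}$ and let $\mathrm{Opt}(x)$ denote the set of optimal solutions of the parametric LP with parameter $x$, which is either in natural form, $\min\{(Cx+c)^\top y \mid Ay\le Bx+b,\ y\in\mathbb{R}^n\}$, or in standard form, $\min\{(Cx+c)^\top y \mid Ay= Bx+b,\ y\in\mathbb{R}^n,\ y\ge 0\}$. Decide (optimistic scenario) whether there exists $x\in X$ with $\mathrm{Opt}(x)\cap Y\ne\emptyset$; (pessimistic scenario) whether there exists $x\in X$ with $\emptyset\ne\mathrm{Opt}(x)\subseteq Y$. For each of the two forms of the LP, both the optimistic and the pessimistic decision problem are NP-complete, and they remain NP-complete when restricted to instances with fixed objective function, i.e., with $C=0$.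
   Context: All input data are rational and given in the usual binary encoding. $\mathrm{Opt}(x)$ is empty if the LP for parameter $x$ is infeasible or unbounded. *)

theory Defs
  imports
    Complex_Main
    "HOL-Computational_Algebra.Polynomial"
    "Jordan_Normal_Form.Matrix"
begin

section \<open>Turing machines, polynomial time, NP-completeness\<close>

text \<open>
  Deterministic multi-tape Turing machines. Every tape is two-way infinite and carries symbols
  from the alphabet consisting of the blank \<^term>\<open>None\<close> and the two bits; a larger tape alphabet
  would change running times only by a constant factor. The states are the numbers below
  \<open>tm_states M\<close>; state 0 is initial, state 1 is halting.
\<close>

type_synonym symbol = "bool option"

datatype move = MoveLeft | MoveStay | MoveRight

record tm =
  tm_tapes :: nat
  tm_states :: nat
  tm_delta :: "nat \<Rightarrow> symbol list \<Rightarrow> nat \<times> (symbol \<times> move) list"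

definition tm_wf :: "tm \<Rightarrow> bool" where
  "tm_wf M \<longleftrightarrow> 1 \<le> tm_tapes M \<and> 2 \<le> tm_states M \<and>
     (\<forall>q < tm_states M. \<forall>ss. length ss = tm_tapes M \<longrightarrow>
        fst (tm_delta M q ss) < tm_states M \<and> length (snd (tm_delta M q ss)) = tm_tapes M)"

type_synonym tape = "(int \<Rightarrow> symbol) \<times> int"  \<comment> \<open>cell contents and head position\<close>
type_synonym config = "nat \<times> tape list"

fun tape_read :: "tape \<Rightarrow> symbol" where
  "tape_read (cells, h) = cells h"

fun move_head :: "move \<Rightarrow> int \<Rightarrow> int" where
  "move_head MoveLeft h = h - 1"
| "move_head MoveStay h = h"
| "move_head MoveRight h = h + 1"

fun tape_act :: "symbol \<times> move \<Rightarrow> tape \<Rightarrow> tape" where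
  "tape_act (s, mv) (cells, h) = (cells(h := s), move_head mv h)"

fun tm_step :: "tm \<Rightarrow> config \<Rightarrow> config" where
  "tm_step M (q, ts) =
     (if q = 1 then (q, ts)
      else (case tm_delta M q (map tape_read ts) of (q', as) \<Rightarrow> (q', map2 tape_act as ts)))"

definition word_tape :: "bool list \<Rightarrow> tape" where
  "word_tape w = ((\<lambda>z. if 0 \<le> z \<and> z < int (length w) then Some (w ! nat z) else None), 0)"

text \<open>The j-th input word is written on tape j; all further tapes are initially blank.\<close>

definition tm_init :: "tm \<Rightarrow> bool list list \<Rightarrow> config" where
  "tm_init M ws = (0, map (\<lambda>j. word_tape (if j < length ws then ws ! j else [])) [0..<tm_tapes M])"

text \<open>The output word is read off tape 0, from cell 0 up to the first blank.\<close>

definition tape_output :: "tape \<Rightarrow> bool list \<Rightarrow> bool" where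
  "tape_output t w \<longleftrightarrow> (\<forall>j < length w. fst t (int j) = Some (w ! j)) \<and> fst t (int (length w)) = None"

text \<open>Since the halting configuration is a fixed point of \<^const>\<open>tm_step\<close>, the following says
  that M halts on the inputs \<open>ws\<close> after at most \<open>T\<close> steps with output \<open>w\<close>.\<close>

definition tm_computes :: "tm \<Rightarrow> bool list list \<Rightarrow> nat \<Rightarrow> bool list \<Rightarrow> bool" where
  "tm_computes M ws T w \<longleftrightarrow>
     (case (tm_step M ^^ T) (tm_init M ws) of (q, ts) \<Rightarrow> q = 1 \<and> tape_output (ts ! 0) w)"

definition polytime_function :: "(bool list \<Rightarrow> bool list) \<Rightarrow> bool" where
  "polytime_function f \<longleftrightarrow>
     (\<exists>M (p :: nat poly). tm_wf M \<and> (\<forall>x. tm_computes M [x] (poly p (length x)) (f x)))"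

definition polytime_relation :: "(bool list \<Rightarrow> bool list \<Rightarrow> bool) \<Rightarrow> bool" where
  "polytime_relation V \<longleftrightarrow>
     (\<exists>M (p :: nat poly). tm_wf M \<and> 2 \<le> tm_tapes M \<and>
        (\<forall>x u. tm_computes M [x, u] (poly p (length x + length u)) [V x u]))"

definition in_NP :: "bool list set \<Rightarrow> bool" where
  "in_NP L \<longleftrightarrow>
     (\<exists>V (p :: nat poly). polytime_relation V \<and>
        (\<forall>x. x \<in> L \<longleftrightarrow> (\<exists>u. length u \<le> poly p (length x) \<and> V x u)))"

definition polytime_reducible :: "bool list set \<Rightarrow> bool list set \<Rightarrow> bool" where
  "polytime_reducible L L' \<longleftrightarrow> (\<exists>f. polytime_function f \<and> (\<forall>x. x \<in> L \<longleftrightarrow> f x \<in> L'))"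

definition NP_hard :: "bool list set \<Rightarrow> bool" where
  "NP_hard L \<longleftrightarrow> (\<forall>L'. in_NP L' \<longrightarrow> polytime_reducible L' L)"

definition NP_complete :: "bool list set \<Rightarrow> bool" where
  "NP_complete L \<longleftrightarrow> in_NP L \<and> NP_hard L"


section \<open>Inverse linear feasibility with one variable fixed to zero\<close>

text \<open>The dimensions are part of the instance. Indices are 0-based, so \<open>ix P\<close> ranges over
  \<open>{0..<dim_n P}\<close>.\<close>

record inverse_lp =
  dim_m :: nat
  dim_n :: nat
  dim_k :: nat
  dim_g :: nat
  A_of :: "rat mat"
  B_of :: "rat mat"
  b_of :: "rat vec"
  C_of :: "rat mat"
  c_of :: "rat vec"
  D_of :: "rat mat"
  d_of :: "rat vec"
  ix :: nat

definition valid_instance :: "inverse_lp \<Rightarrow> bool" where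
  "valid_instance P \<longleftrightarrow>
     A_of P \<in> carrier_mat (dim_m P) (dim_n P) \<and>
     B_of P \<in> carrier_mat (dim_m P) (dim_k P) \<and>
     b_of P \<in> carrier_vec (dim_m P) \<and>
     C_of P \<in> carrier_mat (dim_n P) (dim_k P) \<and>
     c_of P \<in> carrier_vec (dim_n P) \<and>
     D_of P \<in> carrier_mat (dim_g P) (dim_k P) \<and>
     d_of P \<in> carrier_vec (dim_g P) \<and>
     ix P < dim_n P"

abbreviation real_mat :: "rat mat \<Rightarrow> real mat" where
  "real_mat \<equiv> map_mat real_of_rat"

abbreviation real_vec :: "rat vec \<Rightarrow> real vec" where
  "real_vec \<equiv> map_vec real_of_rat"

definition X_set :: "inverse_lp \<Rightarrow> real vec set" where
  "X_set P = {x \<in> carrier_vec (dim_k P). real_mat (D_of P) *\<^sub>v x \<le> real_vec (d_of P)}"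

definition Y_set :: "inverse_lp \<Rightarrow> real vec set" where
  "Y_set P = {y \<in> carrier_vec (dim_n P). y $ ix P = 0}"

datatype lp_form = Natural_Form | Standard_Form

definition lp_rhs :: "inverse_lp \<Rightarrow> real vec \<Rightarrow> real vec" where
  "lp_rhs P x = real_mat (B_of P) *\<^sub>v x + real_vec (b_of P)"

fun lp_feasible :: "lp_form \<Rightarrow> inverse_lp \<Rightarrow> real vec \<Rightarrow> real vec set" where
  "lp_feasible Natural_Form P x =
     {y \<in> carrier_vec (dim_n P). real_mat (A_of P) *\<^sub>v y \<le> lp_rhs P x}"
| "lp_feasible Standard_Form P x =
     {y \<in> carrier_vec (dim_n P). real_mat (A_of P) *\<^sub>v y = lp_rhs P x \<and> 0\<^sub>v (dim_n P) \<le> y}"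

definition lp_objective :: "inverse_lp \<Rightarrow> real vec \<Rightarrow> real vec \<Rightarrow> real" where
  "lp_objective P x y = (real_mat (C_of P) *\<^sub>v x + real_vec (c_of P)) \<bullet> y"

definition Opt :: "lp_form \<Rightarrow> inverse_lp \<Rightarrow> real vec \<Rightarrow> real vec set" where
  "Opt form P x =
     {y \<in> lp_feasible form P x. \<forall>z \<in> lp_feasible form P x. lp_objective P x y \<le> lp_objective P x z}"

definition optimistic :: "lp_form \<Rightarrow> inverse_lp \<Rightarrow> bool" where
  "optimistic form P \<longleftrightarrow> (\<exists>x \<in> X_set P. Opt form P x \<inter> Y_set P \<noteq> {})"

definition pessimistic :: "lp_form \<Rightarrow> inverse_lp \<Rightarrow> bool" where
  "pessimistic form P \<longleftrightarrow> (\<exists>x \<in> X_set P. {} \<noteq> Opt form P x \<and> Opt form P x \<subseteq> Y_set P)"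

definition fixed_objective :: "inverse_lp \<Rightarrow> bool" where
  "fixed_objective P \<longleftrightarrow> C_of P = 0\<^sub>m (dim_n P) (dim_k P)"


section \<open>Binary encoding of instances\<close>

text \<open>Binary digits, least significant first; no leading zeros.\<close>

fun nat_bits :: "nat \<Rightarrow> bool list" where
  "nat_bits n = (if n = 0 then [] else odd n # nat_bits (n div 2))"

declare nat_bits.simps [simp del]

text \<open>To make encodings self-delimiting, every digit is preceded by \<^term>\<open>True\<close>, and the end
  of the number is marked by \<^term>\<open>False\<close>.\<close>

definition enc_nat :: "nat \<Rightarrow> bool list" where
  "enc_nat n = concat (map (\<lambda>b. [True, b]) (nat_bits n)) @ [False]"

definition enc_int :: "int \<Rightarrow> bool list" where
  "enc_int z = (z < 0) # enc_nat (nat \<bar>z\<bar>)"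

text \<open>\<^const>\<open>quotient_of\<close> yields the reduced fraction with positive denominator.\<close>

definition enc_rat :: "rat \<Rightarrow> bool list" where
  "enc_rat r = (case quotient_of r of (p, q) \<Rightarrow> enc_int p @ enc_nat (nat q))"

definition enc_vec :: "rat vec \<Rightarrow> bool list" where
  "enc_vec v = concat (map enc_rat (list_of_vec v))"

definition enc_mat :: "rat mat \<Rightarrow> bool list" where
  "enc_mat M = concat (map enc_rat (concat (mat_to_list M)))"

text \<open>Although dimensions are written in binary, they are bounded by the length of the encoding
  of a valid instance: \<open>b\<close>, \<open>c\<close>, \<open>d\<close> have \<open>m\<close>, \<open>n\<close>, \<open>g\<close> entries, and \<open>C\<close> has \<open>n * k \<ge> k\<close> entries.\<close>

definition enc_instance :: "inverse_lp \<Rightarrow> bool list" where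
  "enc_instance P =
     enc_nat (dim_m P) @ enc_nat (dim_n P) @ enc_nat (dim_k P) @ enc_nat (dim_g P) @
     enc_mat (A_of P) @ enc_mat (B_of P) @ enc_vec (b_of P) @
     enc_mat (C_of P) @ enc_vec (c_of P) @
     enc_mat (D_of P) @ enc_vec (d_of P) @ enc_nat (ix P)"

definition problem_language :: "(inverse_lp \<Rightarrow> bool) \<Rightarrow> bool list set" where
  "problem_language Q = {enc_instance P | P. valid_instance P \<and> Q P}"

end

theory Submission
  imports Defs
begin

text \<open>
  Membership. By LP duality, a feasible \<open>y\<close> is optimal if and only if there is a
  nonnegative multiplier vector \<open>L\<close> supported on the tight rows with \<open>A\<^sup>T L = - (C x + c)\<close>; and all optimal
  solutions have \<open>p\<close>-th coordinate \<open>y\<^sub>p = 0\<close> if and only if in addition both \<open>e\<^sub>p\<close> and \<open>- e\<^sub>p\<close> are, up to positive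
  scaling, combinations of the tight rows with coefficients that are nonnegative wherever \<open>L\<close> vanishes
  (the rows with positive multiplier are equations on the optimal face). Once the tight rows and the zeros of \<open>L\<close>
  are fixed, these conditions are linear in all unknowns including \<open>x\<close>, so a solution of polynomial size exists.
  An equality constrained LP is turned into inequalities first.

  Hardness. By the Cook-Levin theorem it suffices to encode a set of clauses. Let \<open>X\<close> be the relaxation of the clauses
  to the unit cube, and let the LP maximize \<open>y\<^sub>0 = \<Sum>\<^sub>v y\<^sub>v\<close> subject to \<open>0 \<le> y\<^sub>v \<le> min x\<^sub>v (1 - x\<^sub>v)\<close>. Its optimal value is 0 if and
  only if \<open>x\<close> is integral, in which case \<open>y = 0\<close> throughout. The objective is fixed, and both scenarios coincide.

  Polynomial-time computability on Turing machines is reduced to closure properties: while programs with stacks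
  compile to machines, trees are coded on stacks, and data types are coded as trees.
\<close>

section \<open>Structured programs for multi-tape machines\<close>

text \<open>Every polynomial-time claim has to come out of closure rules, so both directions are
  arranged to need little more than list folds with bounded intermediate results. Hence the verifier
  never decodes its input: the certificate contains the instance itself, which is encoded again and
  compared with the input, and Bezout coefficients replace the computation of greatest common
  divisors. The conditions of an optimality certificate involve strict inequalities and, for each
  row, an alternative between tightness and a zero multiplier. A common factor \<open>t\<close>
  makes them homogeneous, so that after scaling strictness becomes a lower bound 1, and the
  alternatives are settled by reading the tight rows and the zero multipliers off a certificate over
  the reals. Determinants are avoided in bounding the solution of the resulting linear system:
  Siegel's lemma, a pigeonhole argument, is applied to the Gram system of the constraints that are
  tight at a vertex.\<close>

datatype com =
    Skip
  | Act "symbol list \<Rightarrow> (symbol \<times> move) list"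
  | Seq com com
  | If "symbol list \<Rightarrow> bool" com com
  | While "symbol list \<Rightarrow> bool" com

definition idle :: "symbol list \<Rightarrow> (symbol \<times> move) list" where
  "idle ss = map (\<lambda>s. (s, MoveStay)) ss"

text \<open>The remaining program serves as the control state. Every control decision is a step of
  its own with resting heads, so that one call is exactly one machine step and depends on the
  scanned symbols only.\<close>

fun next_com :: "com \<Rightarrow> symbol list \<Rightarrow> com \<times> (symbol \<times> move) list" where
  "next_com Skip ss = (Skip, idle ss)"
| "next_com (Act f) ss = (Skip, f ss)"
| "next_com (Seq a b) ss =
     (if a = Skip then (b, idle ss) else (Seq (fst (next_com a ss)) b, snd (next_com a ss)))"
| "next_com (If p a b) ss = (if p ss then a else b, idle ss)"
| "next_com (While p a) ss = (if p ss then Seq a (While p a) else Skip, idle ss)"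

definition keeps_length :: "nat \<Rightarrow> (symbol list \<Rightarrow> (symbol \<times> move) list) \<Rightarrow> bool" where
  "keeps_length K f \<longleftrightarrow> (\<forall>ss. length ss = K \<longrightarrow> length (f ss) = K)"

fun wf_com :: "nat \<Rightarrow> com \<Rightarrow> bool" where
  "wf_com K Skip = True"
| "wf_com K (Act f) = keeps_length K f"
| "wf_com K (Seq a b) = (wf_com K a \<and> wf_com K b)"
| "wf_com K (If p a b) = (wf_com K a \<and> wf_com K b)"
| "wf_com K (While p a) = wf_com K a"

fun com_step :: "com \<times> tape list \<Rightarrow> com \<times> tape list" where
  "com_step (c, ts) = (if c = Skip then (c, ts)
     else (fst (next_com c (map tape_read ts)), map2 tape_act (snd (next_com c (map tape_read ts))) ts))"

text \<open>\<open>Skip\<close> is a fixed point of \<open>com_step\<close>, so \<open>n\<close> is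
  an upper bound on the running time, not its exact value.\<close>

definition runs :: "com \<Rightarrow> tape list \<Rightarrow> nat \<Rightarrow> tape list \<Rightarrow> bool" where
  "runs c ts n ts' \<longleftrightarrow> (com_step ^^ n) (c, ts) = (Skip, ts')"

lemma map2_idle: "map2 tape_act (idle (map tape_read ts)) ts = ts"
proof (induction ts)
  case Nil then show ?case by (simp add: idle_def)
next
  case (Cons t ts)
  obtain c h where "t = (c, h)" by (cases t)
  with Cons show ?case by (auto simp: idle_def)
qed

lemma com_step_Skip_pow [simp]: "(com_step ^^ n) (Skip, ts) = (Skip, ts)"
  by (induction n) auto

lemma runs_mono: "runs c ts n ts' \<Longrightarrow> n \<le> m \<Longrightarrow> runs c ts m ts'"
proof -
  assume a: "runs c ts n ts'" "n \<le> m"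
  then have "(com_step ^^ m) (c, ts) = (com_step ^^ (m - n)) ((com_step ^^ n) (c, ts))"
    using funpow_add[of "m - n" n com_step] by simp
  then show ?thesis using a(1) unfolding runs_def by simp
qed

lemma runs_Skip: "runs Skip ts n ts"
  by (simp add: runs_def)

lemma runs_Act: "runs (Act f) ts 1 (map2 tape_act (f (map tape_read ts)) ts)"
  by (simp add: runs_def)

lemma runs_step:
  assumes "com_step (c, ts) = (c', ts1)" "runs c' ts1 n ts'"
  shows "runs c ts (Suc n) ts'"
  using assms unfolding runs_def by (simp add: funpow_Suc_right del: funpow.simps com_step.simps)

lemma runs_If:
  assumes "runs (if p (map tape_read ts) then a else b) ts n ts'"
  shows "runs (If p a b) ts (Suc n) ts'"
  by (rule runs_step[OF _ assms]) (simp add: map2_idle)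

text \<open>The sequence mirrors the run of \<open>a\<close> only until \<open>a\<close> first
  becomes \<open>Skip\<close>. This may happen before step \<open>n\<close>, whence some
  \<open>m \<le> n\<close> instead of \<open>n\<close> itself.\<close>

lemma Seq_reaches:
  assumes "(com_step ^^ n) (a, ts) = (Skip, ts1)"
  shows "\<exists>m\<le>n. (com_step ^^ m) (Seq a b, ts) = (Seq Skip b, ts1)"
  using assms
proof (induction n arbitrary: a ts)
  case 0 then show ?case by auto
next
  case (Suc n)
  show ?case
  proof (cases "a = Skip")
    case True then show ?thesis using Suc.prems by (intro exI[of _ 0]) auto
  next
    case False
    obtain a' ts' where st: "com_step (a, ts) = (a', ts')" by (cases "com_step (a, ts)")
    with Suc.prems have "(com_step ^^ n) (a', ts') = (Skip, ts1)"
      by (simp add: funpow_Suc_right del: funpow.simps com_step.simps)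
    then obtain m where m: "m \<le> n" "(com_step ^^ m) (Seq a' b, ts') = (Seq Skip b, ts1)"
      using Suc.IH by blast
    have "com_step (Seq a b, ts) = (Seq a' b, ts')" using st False by auto
    then have "(com_step ^^ Suc m) (Seq a b, ts) = (Seq Skip b, ts1)"
      using m by (simp add: funpow_Suc_right del: funpow.simps com_step.simps)
    then show ?thesis using m(1) by (intro exI[of _ "Suc m"]) simp
  qed
qed

lemma runs_Seq:
  assumes "runs a ts n ts1" "runs b ts1 m ts2"
  shows "runs (Seq a b) ts (n + m + 1) ts2"
proof -
  obtain k where k: "k \<le> n" "(com_step ^^ k) (Seq a b, ts) = (Seq Skip b, ts1)"
    using Seq_reaches assms(1) unfolding runs_def by blast
  have "com_step (Seq Skip b, ts1) = (b, ts1)" by (simp add: map2_idle)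
  then have "(com_step ^^ Suc m) (Seq Skip b, ts1) = (Skip, ts2)"
    using assms(2) unfolding runs_def
    by (simp add: funpow_Suc_right del: funpow.simps com_step.simps)
  then have "runs (Seq a b) ts (Suc m + k) ts2"
    unfolding runs_def funpow_add using k(2) by simp
  then show ?thesis by (rule runs_mono) (use k in simp)
qed

lemma runs_While_False: "\<not> p (map tape_read ts) \<Longrightarrow> runs (While p a) ts 1 ts"
  by (simp add: runs_def map2_idle)

lemma runs_While_True:
  assumes "p (map tape_read ts)" "runs a ts n ts1" "runs (While p a) ts1 m ts2"
  shows "runs (While p a) ts (n + m + 2) ts2"
proof -
  have "runs (Seq a (While p a)) ts (n + m + 1) ts2" by (rule runs_Seq[OF assms(2,3)])
  then have "runs (While p a) ts (Suc (n + m + 1)) ts2"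
    by (rule runs_step[rotated]) (simp add: assms(1) map2_idle)
  then show ?thesis by simp
qed

section \<open>Compilation of programs to machines\<close>

fun residuals :: "com \<Rightarrow> com set" where
  "residuals Skip = {Skip}"
| "residuals (Act f) = {Act f, Skip}"
| "residuals (Seq a b) = (\<lambda>x. Seq x b) ` residuals a \<union> residuals b"
| "residuals (If p a b) = {If p a b} \<union> residuals a \<union> residuals b"
| "residuals (While p a) = {While p a, Skip} \<union> (\<lambda>x. Seq x (While p a)) ` residuals a"

text \<open>A loop unfolds to a sequence that ends in the same loop, so only finitely many programs
  can remain during a run, and these can be the states of a machine.\<close>

lemma finite_residuals: "finite (residuals c)"
  by (induction c) auto

lemma self_residual: "c \<in> residuals c"
  by (induction c) auto

lemma residuals_closed: "x \<in> residuals c \<Longrightarrow> fst (next_com x ss) \<in> residuals c"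
  by (induction c arbitrary: x) (auto simp: self_residual split: if_splits)

lemma residuals_wf: "wf_com K c \<Longrightarrow> x \<in> residuals c \<Longrightarrow> wf_com K x"
proof (induction c arbitrary: x)
  case (Seq a b)
  from Seq.prems(2) consider y where "x = Seq y b" "y \<in> residuals a" | "x \<in> residuals b" by auto
  then show ?case
  proof cases
    case 1
    have "wf_com K y" by (rule Seq.IH(1)) (use 1 Seq.prems(1) in simp_all)
    then show ?thesis using 1 Seq.prems(1) by simp
  next
    case 2
    show ?thesis by (rule Seq.IH(2)) (use 2 Seq.prems(1) in simp_all)
  qed
next
  case (If p a b)
  from If.prems(2) consider "x = If p a b" | "x \<in> residuals a" | "x \<in> residuals b" by auto
  then show ?case
  proof cases
    case 1 then show ?thesis using If.prems(1) by simp
  next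
    case 2
    show ?thesis by (rule If.IH(1)) (use 2 If.prems(1) in simp_all)
  next
    case 3
    show ?thesis by (rule If.IH(2)) (use 3 If.prems(1) in simp_all)
  qed
next
  case (While p a)
  from While.prems(2) consider "x = While p a" | "x = Skip" | y where "x = Seq y (While p a)" "y \<in> residuals a"
    by auto
  then show ?case
  proof cases
    case 1 then show ?thesis using While.prems(1) by simp
  next
    case 2 then show ?thesis by simp
  next
    case 3
    have "wf_com K y" by (rule While.IH) (use 3 While.prems(1) in simp_all)
    then show ?thesis using 3 While.prems(1) by simp
  qed
qed auto

lemma next_com_length: "wf_com K c \<Longrightarrow> length ss = K \<Longrightarrow> length (snd (next_com c ss)) = K"
  by (induction c) (auto simp: idle_def keeps_length_def)

text \<open>The initial state has number 0 and the halting state number 1 by convention, so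
  \<open>c\<close> and \<open>Skip\<close> receive these; the assumption
  \<open>c \<noteq> Skip\<close> keeps them apart.\<close>

lemma numbering_exists:
  assumes "finite S" "c \<noteq> Skip"
  shows "\<exists>num (N :: nat). inj_on num (S \<union> {c, Skip}) \<and> num c = 0 \<and> num Skip = 1 \<and> 2 \<le> N \<and>
    (\<forall>x \<in> S \<union> {c, Skip}. num x < N)"
proof -
  let ?S = "S - {c, Skip}"
  obtain g where g: "bij_betw g ?S {0..<card ?S}"
    using ex_bij_betw_finite_nat[of ?S] assms(1) by auto
  define num where "num = (\<lambda>x. if x = c then 0 else if x = Skip then 1 else g x + 2)"
  have "inj_on g ?S" using g by (simp add: bij_betw_def)
  then have "inj_on num (S \<union> {c, Skip})"
  proof (intro inj_onI)
    fix x y assume xy: "x \<in> S \<union> {c, Skip}" "y \<in> S \<union> {c, Skip}" "num x = num y"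
    show "x = y"
    proof (cases "x \<in> {c, Skip} \<or> y \<in> {c, Skip}")
      case True then show ?thesis using xy(3) assms(2) by (auto simp: num_def split: if_splits)
    next
      case False
      then have "g x = g y" using xy(3) by (simp add: num_def)
      then show ?thesis using \<open>inj_on g ?S\<close> xy(1,2) False by (meson DiffI UnE inj_onD)
    qed
  qed
  moreover have "num x < card ?S + 2" if "x \<in> S \<union> {c, Skip}" for x
    using that bij_betwE[OF g] unfolding num_def by fastforce
  ultimately show ?thesis
    using assms(2) by (intro exI[of _ num] exI[of _ "card ?S + 2"]) (auto simp: num_def)
qed

text \<open>The machine is \<open>com_step\<close> on the numbered residuals, so the simulation is
  step by step and time bounds carry over unchanged.\<close>

lemma machine_of_com:
  assumes wf: "wf_com K c" and K: "1 \<le> K" and c: "c \<noteq> Skip"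
  shows "\<exists>M. tm_wf M \<and> tm_tapes M = K \<and>
    (\<forall>ts n ts'. length ts = K \<longrightarrow> runs c ts n ts' \<longrightarrow> (tm_step M ^^ n) (0, ts) = (1, ts'))"
proof -
  define S where "S = residuals c \<union> {c, Skip}"
  obtain num :: "com \<Rightarrow> nat" and N where num: "inj_on num S" "num c = 0" "num Skip = 1" "2 \<le> N" "\<And>x. x \<in> S \<Longrightarrow> num x < N"
    using numbering_exists[OF finite_residuals c, of c] unfolding S_def by blast
  \<comment> \<open>A number that belongs to no residual is never reached; sending it to the halting
    state keeps the machine well-formed.\<close>
  define \<delta> where "\<delta> q ss =
    (if q \<in> num ` S then (num (fst (next_com (inv_into S num q) ss)), snd (next_com (inv_into S num q) ss))
     else (1, idle ss))" for q ss
  define M where "M = \<lparr>tm_tapes = K, tm_states = N, tm_delta = \<delta>\<rparr>"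
  have closed: "fst (next_com x ss) \<in> S" if "x \<in> S" for x ss
    using that residuals_closed[of x c ss] self_residual[of c] unfolding S_def by auto
  have wfS: "wf_com K x" if "x \<in> S" for x
    using that residuals_wf[OF wf] wf unfolding S_def by auto
  have "tm_wf M"
    unfolding tm_wf_def M_def \<delta>_def
    using K num(4,5) closed next_com_length[OF wfS] num(1)
    by (auto simp: idle_def)
  moreover have sim: "tm_step M (num x, ts) = (num (fst (com_step (x, ts))), snd (com_step (x, ts)))"
    if "x \<in> S" for x ts
  proof (cases "x = Skip")
    case True then show ?thesis by (simp add: num)
  next
    case False
    have "Skip \<in> S" by (simp add: S_def)
    then have "num x \<noteq> 1" using num(1,3) that False by (metis inj_onD)
    then show ?thesis using that False num(1) by (simp add: M_def \<delta>_def)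
  qed
  have "(tm_step M ^^ n) (num x, ts) = (1, ts')" if "x \<in> S" "runs x ts n ts'" for x ts n ts'
    using that
  proof (induction n arbitrary: x ts)
    case 0 then show ?case by (simp add: runs_def num)
  next
    case (Suc n)
    obtain x1 ts1 where st: "com_step (x, ts) = (x1, ts1)" by (cases "com_step (x, ts)")
    then have "x1 \<in> S" using Suc.prems(1) closed by (auto split: if_splits)
    moreover have "runs x1 ts1 n ts'"
      using Suc.prems(2) st unfolding runs_def
      by (simp add: funpow_Suc_right del: funpow.simps com_step.simps)
    ultimately have "(tm_step M ^^ n) (num x1, ts1) = (1, ts')" by (rule Suc.IH)
    then show ?case using sim[OF Suc.prems(1), of ts] st
      by (simp add: funpow_Suc_right del: funpow.simps com_step.simps)
  qed
  from this[of c] have "\<forall>ts n ts'. length ts = K \<longrightarrow> runs c ts n ts' \<longrightarrow> (tm_step M ^^ n) (0, ts) = (1, ts')"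
    using num(2) by (simp add: S_def)
  ultimately show ?thesis by (intro exI[of _ M]) (simp add: M_def)
qed

section \<open>Stack programs\<close>

text \<open>Tapes 0 and 1 hold the input words. Tape \<open>i + 2\<close> carries a stack with its top under the head
  and growing to the left; only a prefix of the stack contents is specified.\<close>

definition holds_stack :: "tape \<Rightarrow> bool list \<Rightarrow> bool" where
  "holds_stack t l \<longleftrightarrow> (\<forall>j < length l. fst t (snd t + int j) = Some (l ! j))"

definition stacks :: "tape list \<Rightarrow> (nat \<Rightarrow> bool list) \<Rightarrow> bool" where
  "stacks ts st \<longleftrightarrow> length ts = 6 \<and> (\<forall>i<4. holds_stack (ts ! (i + 2)) (st i))"

text \<open>A Hoare triple for total correctness with a time bound. It quantifies over all tapes
  whose stacks begin as \<open>st\<close> says, so a program cannot rely on cells outside the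
  specified prefixes, and it guarantees that the two input tapes are left alone.\<close>

definition tri :: "com \<Rightarrow> (nat \<Rightarrow> bool list) \<Rightarrow> nat \<Rightarrow> (nat \<Rightarrow> bool list) \<Rightarrow> bool" where
  "tri c st n st' \<longleftrightarrow> wf_com 6 c \<and> (\<forall>ts. stacks ts st \<longrightarrow>
     (\<exists>ts'. runs c ts n ts' \<and> stacks ts' st' \<and> ts' ! 0 = ts ! 0 \<and> ts' ! 1 = ts ! 1))"

definition act :: "nat \<Rightarrow> (symbol \<Rightarrow> symbol \<times> move) \<Rightarrow> com" where
  "act k g = Act (\<lambda>ss. (idle ss)[k := g (ss ! k)])"

text \<open>An action writes before it moves, whereas a push has to move before it writes; hence two
  actions.\<close>

definition push :: "nat \<Rightarrow> bool \<Rightarrow> com" where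
  "push i b = Seq (act (i + 2) (\<lambda>s. (s, MoveLeft))) (act (i + 2) (\<lambda>s. (Some b, MoveStay)))"

definition pop :: "nat \<Rightarrow> com" where
  "pop i = act (i + 2) (\<lambda>s. (s, MoveRight))"

definition top_true :: "nat \<Rightarrow> symbol list \<Rightarrow> bool" where
  "top_true i ss \<longleftrightarrow> ss ! (i + 2) = Some True"

lemma runs_act:
  assumes "k < length ts"
  shows "runs (act k g) ts 1 (ts[k := tape_act (g (tape_read (ts ! k))) (ts ! k)])"
proof -
  have "map2 tape_act ((idle (map tape_read ts))[k := g (map tape_read ts ! k)]) ts
     = (map2 tape_act (idle (map tape_read ts)) ts)[k := tape_act (g (tape_read (ts ! k))) (ts ! k)]"
    using assms by (intro nth_equalityI) (auto simp: idle_def nth_list_update)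
  then show ?thesis
    unfolding act_def using runs_Act[of "\<lambda>ss. (idle ss)[k := g (ss ! k)]" ts] by (simp add: map2_idle)
qed

lemma wf_act [simp]: "wf_com K (act k g)"
  by (simp add: act_def idle_def keeps_length_def)

lemma wf_push [simp]: "wf_com K (push i b)"
  by (simp add: push_def)

lemma wf_pop [simp]: "wf_com K (pop i)"
  by (simp add: pop_def)

lemma tri_wf: "tri c st n st' \<Longrightarrow> wf_com 6 c"
  by (simp add: tri_def)

lemma tri_mono: "tri c st n st' \<Longrightarrow> n \<le> m \<Longrightarrow> tri c st m st'"
  unfolding tri_def using runs_mono by blast

lemma tri_Skip: "tri Skip st n st"
  unfolding tri_def using runs_Skip by auto

lemma tri_Seq:
  assumes "tri a st n st1" "tri b st1 m st2"
  shows "tri (Seq a b) st (n + m + 1) st2"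
  unfolding tri_def
proof (intro conjI allI impI)
  fix ts assume s: "stacks ts st"
  then obtain ts1 where 1: "runs a ts n ts1" "stacks ts1 st1" "ts1 ! 0 = ts ! 0" "ts1 ! 1 = ts ! 1"
    using assms(1) unfolding tri_def by blast
  then obtain ts2 where "runs b ts1 m ts2" "stacks ts2 st2" "ts2 ! 0 = ts1 ! 0" "ts2 ! 1 = ts1 ! 1"
    using assms(2) unfolding tri_def by blast
  then show "\<exists>ts'. runs (Seq a b) ts (n + m + 1) ts' \<and> stacks ts' st2 \<and> ts' ! 0 = ts ! 0 \<and> ts' ! 1 = ts ! 1"
    using runs_Seq 1 by metis
qed (use assms in \<open>auto simp: tri_def\<close>)

lemma stacks_update:
  assumes "stacks ts st" "i < 4" "holds_stack t l"
  shows "stacks (ts[i + 2 := t]) (st(i := l))"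
  using assms unfolding stacks_def by (auto simp: nth_list_update)

lemma stacks_length: "stacks ts st \<Longrightarrow> length ts = 6"
  by (simp add: stacks_def)

lemma tri_pop:
  assumes "i < 4" "st i = b # l"
  shows "tri (pop i) st 2 (st(i := l))"
  unfolding tri_def
proof (intro conjI allI impI)
  fix ts assume s: "stacks ts st"
  obtain c h where t: "ts ! (i + 2) = (c, h)" by (cases "ts ! (i + 2)")
  have hs: "holds_stack (c, h) (b # l)" using s assms t unfolding stacks_def by auto
  have "holds_stack (c(h := c h), h + 1) l"
    unfolding holds_stack_def
  proof (intro allI impI)
    fix j assume "j < length l"
    then show "fst (c(h := c h), h + 1) (snd (c(h := c h), h + 1) + int j) = Some (l ! j)"
      using hs[unfolded holds_stack_def, rule_format, of "Suc j"] by (simp add: algebra_simps)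
  qed
  then have "stacks (ts[i + 2 := (c(h := c h), h + 1)]) (st(i := l))"
    by (rule stacks_update[OF s assms(1)])
  moreover have "runs (pop i) ts 1 (ts[i + 2 := (c(h := c h), h + 1)])"
    unfolding pop_def using runs_act[of "i + 2" ts "\<lambda>s. (s, MoveRight)"] stacks_length[OF s] assms(1) t by simp
  then have "runs (pop i) ts 2 (ts[i + 2 := (c(h := c h), h + 1)])"
    by (rule runs_mono) simp
  ultimately show "\<exists>ts'. runs (pop i) ts 2 ts' \<and> stacks ts' (st(i := l)) \<and> ts' ! 0 = ts ! 0 \<and> ts' ! 1 = ts ! 1"
    by (intro exI[of _ "ts[i + 2 := (c(h := c h), h + 1)]"]) auto
qed simp

lemma tri_push:
  assumes "i < 4"
  shows "tri (push i b) st 3 (st(i := b # st i))"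
  unfolding tri_def
proof (intro conjI allI impI)
  fix ts assume s: "stacks ts st"
  note len = stacks_length[OF s]
  obtain c h where t: "ts ! (i + 2) = (c, h)" by (cases "ts ! (i + 2)")
  have hs: "holds_stack (c, h) (st i)" using s assms t unfolding stacks_def by auto
  define ts1 where "ts1 = ts[i + 2 := (c, h - 1)]"
  define ts2 where "ts2 = ts[i + 2 := (c(h - 1 := Some b), h - 1)]"
  have "runs (act (i + 2) (\<lambda>s. (s, MoveLeft))) ts 1 ts1"
    using runs_act[of "i + 2" ts "\<lambda>s. (s, MoveLeft)"] len assms t by (simp add: ts1_def)
  moreover have "runs (act (i + 2) (\<lambda>s. (Some b, MoveStay))) ts1 1 ts2"
    using runs_act[of "i + 2" ts1 "\<lambda>s. (Some b, MoveStay)"] len assms by (simp add: ts1_def ts2_def)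
  ultimately have "runs (push i b) ts (1 + 1 + 1) ts2"
    unfolding push_def by (rule runs_Seq)
  then have "runs (push i b) ts 3 ts2" by (simp add: numeral_3_eq_3)
  moreover have "holds_stack (c(h - 1 := Some b), h - 1) (b # st i)"
    using hs unfolding holds_stack_def by (auto simp: nth_Cons split: nat.split)
  then have "stacks ts2 (st(i := b # st i))"
    unfolding ts2_def by (rule stacks_update[OF s assms])
  ultimately show "\<exists>ts'. runs (push i b) ts 3 ts' \<and> stacks ts' (st(i := b # st i)) \<and> ts' ! 0 = ts ! 0 \<and> ts' ! 1 = ts ! 1"
    by (intro exI[of _ ts2]) (auto simp: ts2_def)
qed simp

lemma stacks_top:
  assumes "stacks ts st" "i < 4" "st i = b # l"
  shows "top_true i (map tape_read ts) = b"
proof -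
  obtain c h where t: "ts ! (i + 2) = (c, h)" by (cases "ts ! (i + 2)")
  have "holds_stack (c, h) (b # l)" using assms t unfolding stacks_def by auto
  then have "c h = Some b" unfolding holds_stack_def by (metis add.right_neutral fst_conv length_greater_0_conv list.distinct(1) nth_Cons_0 of_nat_0 snd_conv)
  then show ?thesis using assms t unfolding top_true_def stacks_def by auto
qed

lemma tri_If:
  assumes "i < 4" "st i = b # l" "wf_com 6 c1" "wf_com 6 c2" "tri (if b then c1 else c2) st n st'"
  shows "tri (If (top_true i) c1 c2) st (n + 1) st'"
  unfolding tri_def
proof (intro conjI allI impI)
  fix ts assume s: "stacks ts st"
  then obtain ts' where "runs (if b then c1 else c2) ts n ts'" "stacks ts' st'" "ts' ! 0 = ts ! 0" "ts' ! 1 = ts ! 1"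
    using assms(5) unfolding tri_def by blast
  then show "\<exists>ts'. runs (If (top_true i) c1 c2) ts (n + 1) ts' \<and> stacks ts' st' \<and> ts' ! 0 = ts ! 0 \<and> ts' ! 1 = ts ! 1"
    using runs_If[of "top_true i" ts c1 c2 n ts'] stacks_top[OF s assms(1,2)] by auto
qed (simp add: assms)

lemma tri_While_False:
  assumes "i < 4" "st i = False # l" "wf_com 6 c"
  shows "tri (While (top_true i) c) st 2 st"
  unfolding tri_def
proof (intro conjI allI impI)
  fix ts assume s: "stacks ts st"
  show "\<exists>ts'. runs (While (top_true i) c) ts 2 ts' \<and> stacks ts' st \<and> ts' ! 0 = ts ! 0 \<and> ts' ! 1 = ts ! 1"
  proof (intro exI[of _ ts] conjI)
    show "runs (While (top_true i) c) ts 2 ts"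
      by (rule runs_mono[OF runs_While_False]) (simp_all add: stacks_top[OF s assms(1,2)])
  qed (simp_all add: s)
qed (simp add: assms)

lemma tri_While_True:
  assumes "i < 4" "st i = True # l" "tri c st n st1" "tri (While (top_true i) c) st1 m st2"
  shows "tri (While (top_true i) c) st (n + m + 2) st2"
  unfolding tri_def
proof (intro conjI allI impI)
  fix ts assume s: "stacks ts st"
  then obtain ts1 where 1: "runs c ts n ts1" "stacks ts1 st1" "ts1 ! 0 = ts ! 0" "ts1 ! 1 = ts ! 1"
    using assms(3) unfolding tri_def by blast
  then obtain ts2 where "runs (While (top_true i) c) ts1 m ts2" "stacks ts2 st2" "ts2 ! 0 = ts1 ! 0" "ts2 ! 1 = ts1 ! 1"
    using assms(4) unfolding tri_def by blast
  then show "\<exists>ts'. runs (While (top_true i) c) ts (n + m + 2) ts' \<and> stacks ts' st2 \<and> ts' ! 0 = ts ! 0 \<and> ts' ! 1 = ts ! 1"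
    using runs_While_True[of "top_true i" ts c n ts1 m ts2] 1 stacks_top[OF s assms(1,2)] by auto
qed (use assms in \<open>auto simp: tri_def\<close>)

section \<open>Polynomial time functions on trees\<close>

datatype tree = Leaf | Node tree tree

text \<open>Prefix code; being self-delimiting, it lets trees be stacked on a tape without separators.\<close>

fun code :: "tree \<Rightarrow> bool list" where
  "code Leaf = [False]"
| "code (Node l r) = True # code l @ code r"

definition tsz :: "tree \<Rightarrow> nat" where
  "tsz t = length (code t)"

lemma tsz_simps [simp]: "tsz Leaf = 1" "tsz (Node l r) = 1 + tsz l + tsz r"
  by (simp_all add: tsz_def)

lemma tsz_pos: "1 \<le> tsz t"
  by (cases t) auto

lemma code_nonempty [simp]: "code t \<noteq> []"
  by (cases t) auto

lemma tri_pop': "i < 4 \<Longrightarrow> st i \<noteq> [] \<Longrightarrow> tri (pop i) st 2 (st(i := tl (st i)))"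
  by (cases "st i") (auto intro: tri_pop)

lemma tri_cong: "tri c st n st1 \<Longrightarrow> st1 = st2 \<Longrightarrow> n \<le> m \<Longrightarrow> tri c st m st2"
  using tri_mono by blast

text \<open>In the temporary copy on stack 2 every digit lies below a \<open>True\<close>. The
  \<open>False\<close> pushed underneath the whole copy then stops the loop that empties it.\<close>

definition mark :: "bool list \<Rightarrow> bool \<Rightarrow> bool list" where
  "mark r b = True # b # r"

definition grab_body :: "nat \<Rightarrow> com" where
  "grab_body i = If (top_true i)
     (Seq (pop i) (Seq (push 3 True) (Seq (push 2 True) (push 2 True))))
     (Seq (pop i) (Seq (pop 3) (Seq (push 2 False) (push 2 True))))"

definition grab :: "nat \<Rightarrow> com" where
  "grab i = Seq (push 2 False) (Seq (push 3 False) (Seq (push 3 True)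
     (Seq (While (top_true 3) (grab_body i)) (pop 3))))"

lemma tri_grab_body:
  assumes "i < 2" "st i = b # s" "st 3 = True # c"
  shows "tri (grab_body i) st 16 (st(i := s, 3 := (if b then True # True # c else c), 2 := mark (st 2) b))"
proof -
  let ?f = "st(i := s, 3 := (if b then True # True # c else c), 2 := mark (st 2) b)"
  have "tri (Seq (pop i) (Seq (push 3 True) (Seq (push 2 True) (push 2 True)))) st 15 ?f" if "b"
    by (rule tri_cong[OF tri_Seq[OF tri_pop' tri_Seq[OF tri_push tri_Seq[OF tri_push tri_push]]]])
      (use assms that in \<open>auto simp: mark_def fun_eq_iff\<close>)
  moreover have "tri (Seq (pop i) (Seq (pop 3) (Seq (push 2 False) (push 2 True)))) st 15 ?f" if "\<not> b"
    by (rule tri_cong[OF tri_Seq[OF tri_pop' tri_Seq[OF tri_pop' tri_Seq[OF tri_push tri_push]]]])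
      (use assms that in \<open>auto simp: mark_def fun_eq_iff\<close>)
  ultimately have "tri (grab_body i) st (15 + 1) ?f"
    unfolding grab_body_def using assms
    by (intro tri_If[where b=b and l=s]) (simp_all split: if_splits)
  then show ?thesis by (rule tri_mono) simp
qed

text \<open>Stack 3 counts in unary the subtrees still to be read.\<close>

lemma tri_grab_loop:
  assumes "i < 2" "tri (While (top_true 3) (grab_body i)) (st(i := s, 3 := c, 2 := foldl mark q (code t))) n fin"
  shows "tri (While (top_true 3) (grab_body i)) (st(i := code t @ s, 3 := True # c, 2 := q)) (n + 18 * tsz t) fin"
  using assms(2)
proof (induction t arbitrary: s c q n)
  case Leaf
  let ?st = "st(i := code Leaf @ s, 3 := True # c, 2 := q)"
  have 2: "tri (grab_body i) ?st 16 (st(i := s, 3 := c, 2 := foldl mark q (code Leaf)))"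
    by (rule tri_cong[OF tri_grab_body[where b=False and s=s and c=c]])
      (use assms(1) in \<open>auto simp: fun_eq_iff\<close>)
  show ?case
    by (rule tri_mono[OF tri_While_True[OF _ _ 2 Leaf, where l=c]]) simp_all
next
  case (Node l r)
  let ?st = "st(i := code (Node l r) @ s, 3 := True # c, 2 := q)"
  let ?st1 = "st(i := code l @ code r @ s, 3 := True # True # c, 2 := mark q True)"
  \<comment> \<open>The hypotheses are stated for an arbitrary continuation of the loop, so they
    chain: \<open>r\<close> is read after \<open>l\<close>, hence its hypothesis supplies the
    continuation in the one for \<open>l\<close>.\<close>
  have 1: "tri (While (top_true 3) (grab_body i)) ?st1 (n + 18 * tsz r + 18 * tsz l) fin"
    by (rule Node.IH(1), rule Node.IH(2)) (use Node.prems in simp)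
  have 2: "tri (grab_body i) ?st 16 ?st1"
    by (rule tri_cong[OF tri_grab_body[where b=True and s="code l @ code r @ s" and c=c]])
      (use assms(1) in \<open>auto simp: fun_eq_iff\<close>)
  show ?case
    by (rule tri_mono[OF tri_While_True[OF _ _ 2 1, where l=c]]) simp_all
qed

lemma tri_grab:
  assumes "i < 2" "st i = code t @ s"
  shows "tri (grab i) st (40 * tsz t) (st(i := s, 2 := foldl mark (False # st 2) (code t)))"
proof -
  let ?c = "False # st 3" and ?q = "False # st 2"
  let ?f = "st(i := s, 3 := ?c, 2 := foldl mark ?q (code t))"
  let ?s0 = "st(2 := ?q)" let ?s1 = "?s0(3 := ?c)" let ?s2 = "?s1(3 := True # ?c)"
  have "tri (While (top_true 3) (grab_body i)) ?f 2 ?f"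
    by (rule tri_While_False[where l="st 3"]) (auto simp: grab_body_def)
  then have *: "tri (While (top_true 3) (grab_body i)) (st(i := code t @ s, 3 := True # ?c, 2 := ?q)) (2 + 18 * tsz t) ?f"
    by (rule tri_grab_loop[OF assms(1)])
  have "st(i := code t @ s, 3 := True # ?c, 2 := ?q) = ?s2"
    using assms by (auto simp: fun_eq_iff)
  from * this have 4: "tri (While (top_true 3) (grab_body i)) ?s2 (2 + 18 * tsz t) ?f" by simp
  have 1: "tri (push 2 False) st 3 ?s0" by (rule tri_push) simp
  have 2: "tri (push 3 False) ?s0 3 ?s1" by (rule tri_cong[OF tri_push]) auto
  have 3: "tri (push 3 True) ?s1 3 ?s2" by (rule tri_cong[OF tri_push]) auto
  have 5: "tri (pop 3) ?f 2 (st(i := s, 2 := foldl mark ?q (code t)))"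
    by (rule tri_cong[OF tri_pop[where b=False and l="st 3"]]) (use assms(1) in \<open>auto simp: fun_eq_iff\<close>)
  show ?thesis
    unfolding grab_def
    by (rule tri_mono[OF tri_Seq[OF 1 tri_Seq[OF 2 tri_Seq[OF 3 tri_Seq[OF 4 5]]]]])
      (use tsz_pos[of t] in simp)
qed

fun pushes :: "nat list \<Rightarrow> bool \<Rightarrow> com" where
  "pushes [] b = Skip"
| "pushes (j # js) b = Seq (push j b) (pushes js b)"

definition spread :: "nat list \<Rightarrow> bool list \<Rightarrow> (nat \<Rightarrow> bool list) \<Rightarrow> nat \<Rightarrow> bool list" where
  "spread js l st = (\<lambda>i. if i \<in> set js then l @ st i else st i)"

lemma tri_pushes:
  assumes "distinct js" "\<forall>j \<in> set js. j < 4"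
  shows "tri (pushes js b) st (4 * length js) (spread js [b] st)"
  using assms
proof (induction js arbitrary: st)
  case Nil then show ?case by (simp add: spread_def tri_Skip)
next
  case (Cons j js)
  show ?case
    by (simp, rule tri_cong, rule tri_Seq, rule tri_push, use Cons in simp, rule Cons.IH)
      (use Cons.prems in \<open>auto simp: spread_def fun_eq_iff\<close>)
qed

definition put_body :: "nat list \<Rightarrow> com" where
  "put_body js = Seq (pop 2) (If (top_true 2) (Seq (pop 2) (pushes js True)) (Seq (pop 2) (pushes js False)))"

definition put :: "nat list \<Rightarrow> com" where
  "put js = Seq (While (top_true 2) (put_body js)) (pop 2)"

text \<open>The last digit lies on top of the copy, hence the induction from the end of the list.
  Pushing the digits in this order restores the orientation of \<open>l\<close>.\<close>

lemma tri_put_loop: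
  assumes js: "distinct js" "\<forall>j \<in> set js. j < 2"
    and "tri (While (top_true 2) (put_body js)) ((spread js l st)(2 := q)) n fin"
  shows "tri (While (top_true 2) (put_body js)) (st(2 := foldl mark q l)) (n + (10 + 4 * length js) * length l) fin"
  using assms(3)
proof (induction l arbitrary: st n rule: rev_induct)
  case Nil
  have "spread js [] st = st" by (auto simp: spread_def fun_eq_iff)
  then show ?case using Nil by simp
next
  case (snoc b l)
  let ?q = "foldl mark q l"
  let ?st = "st(2 := foldl mark q (l @ [b]))"
  let ?m = "4 * length js"
  let ?s2 = "(spread js [b] st)(2 := ?q)"
  have js2: "2 \<notin> set js" "\<forall>j \<in> set js. j < 4" using js by auto
  have 1: "tri (pop 2) ?st 2 (st(2 := b # ?q))"
    by (rule tri_cong[OF tri_pop[where b=True and l="b # ?q"]]) (auto simp: mark_def)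
  have 2: "tri (pop 2) (st(2 := b # ?q)) 2 (st(2 := ?q))"
    by (rule tri_cong[OF tri_pop[where b=b and l="?q"]]) auto
  have 3: "tri (pushes js b) (st(2 := ?q)) ?m ?s2"
    by (rule tri_cong[OF tri_pushes[OF js(1) js2(2)]]) (use js2 in \<open>auto simp: spread_def fun_eq_iff\<close>)
  have p: "tri (Seq (pop 2) (pushes js b)) (st(2 := b # ?q)) (2 + ?m + 1) ?s2"
    by (rule tri_Seq[OF 2 3])
  have wf: "wf_com 6 (pushes js b)" for b using tri_pushes[OF js(1) js2(2)] tri_wf by blast
  have i: "tri (If (top_true 2) (Seq (pop 2) (pushes js True)) (Seq (pop 2) (pushes js False)))
      (st(2 := b # ?q)) (2 + ?m + 1 + 1) ?s2"
    by (rule tri_If[where b=b and l="?q"]) (use p wf in \<open>auto split: if_splits\<close>)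
  have b: "tri (put_body js) ?st (2 + (2 + ?m + 1 + 1) + 1) ?s2"
    unfolding put_body_def by (rule tri_Seq[OF 1 i])
  have "spread js l (spread js [b] st) = spread js (l @ [b]) st"
    by (auto simp: spread_def fun_eq_iff)
  from snoc.prems this[symmetric] have "tri (While (top_true 2) (put_body js)) ((spread js l (spread js [b] st))(2 := q)) n fin"
    by (simp only:)
  then have r: "tri (While (top_true 2) (put_body js)) ?s2 (n + (10 + ?m) * length l) fin"
    by (rule snoc.IH)
  show ?case
    by (rule tri_mono[OF tri_While_True[OF _ _ b r, where l="b # ?q"]])
      (simp_all add: mark_def algebra_simps)
qed

text \<open>The targets \<open>js\<close> determine the effect: the empty list drops the tree on top
  of stack \<open>i\<close>, the other stack alone moves it, and \<open>[0, 1]\<close> leaves it on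
  both stacks. The detour over stack 2 undoes the reversal that popping and pushing cause.\<close>

definition transfer :: "nat \<Rightarrow> nat list \<Rightarrow> com" where
  "transfer i js = Seq (grab i) (put js)"

lemma tri_transfer:
  assumes "distinct js" "\<forall>j \<in> set js. j < 2" "i < 2" "st i = code t @ s"
  shows "tri (transfer i js) st ((60 + 10 * length js) * tsz t) (spread js (code t) (st(i := s)))"
proof -
  let ?q = "False # st 2"
  let ?f = "(spread js (code t) (st(i := s)))(2 := ?q)"
  have wf: "wf_com 6 (pushes js b)" for b
  proof -
    have "\<forall>j \<in> set js. j < 4" using assms(2) by auto
    then show ?thesis using tri_wf[OF tri_pushes[of js]] assms(1) by blast
  qed
  have "tri (While (top_true 2) (put_body js)) ?f 2 ?f"
    by (rule tri_While_False[where l="st 2"]) (auto simp: wf put_body_def)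
  then have 1: "tri (While (top_true 2) (put_body js)) (st(i := s, 2 := foldl mark ?q (code t)))
      (2 + (10 + 4 * length js) * length (code t)) ?f"
    by (rule tri_put_loop[OF assms(1,2)])
  have eq: "?f(2 := st 2) = spread js (code t) (st(i := s))"
    using assms(2,3) by (auto simp: spread_def fun_eq_iff)
  have "tri (pop 2) ?f 2 (spread js (code t) (st(i := s)))"
    by (rule tri_cong[OF tri_pop[where b=False and l="st 2"] eq]) auto
  then have 2: "tri (put js) (st(i := s, 2 := foldl mark ?q (code t)))
      (2 + (10 + 4 * length js) * length (code t) + 2 + 1) (spread js (code t) (st(i := s)))"
    unfolding put_def by (rule tri_Seq[OF 1])
  show ?thesis
    unfolding transfer_def
    by (rule tri_mono[OF tri_Seq[OF tri_grab[where st=st, OF assms(3,4)] 2]])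
      (use tsz_pos[of t] in \<open>auto simp: tsz_def[symmetric] algebra_simps\<close>)
qed

lemma tri_drop: "st 0 = code t @ s \<Longrightarrow> tri (transfer 0 []) st (60 * tsz t) (st(0 := s))"
  by (rule tri_cong[OF tri_transfer[where t=t and s=s]]) (auto simp: spread_def)

lemma tri_dup: "st 0 = code t @ s \<Longrightarrow> tri (transfer 0 [0, 1]) st (80 * tsz t) (st(1 := code t @ st 1))"
  by (rule tri_cong[OF tri_transfer[where t=t and s=s]]) (auto simp: spread_def fun_eq_iff)

lemma tri_save: "st 0 = code t @ s \<Longrightarrow> tri (transfer 0 [1]) st (70 * tsz t) (st(0 := s, 1 := code t @ st 1))"
  by (rule tri_cong[OF tri_transfer[where t=t and s=s]]) (auto simp: spread_def fun_eq_iff)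

lemma tri_load: "st 1 = code t @ s \<Longrightarrow> tri (transfer 1 [0]) st (70 * tsz t) (st(1 := s, 0 := code t @ st 0))"
  by (rule tri_cong[OF tri_transfer[where t=t and s=s]]) (auto simp: spread_def fun_eq_iff)

lemma poly_nat_mono: "x \<le> y \<Longrightarrow> poly (p :: nat poly) x \<le> poly p y"
  by (induction p) (auto intro: mult_le_mono)

text \<open>Decoding is total, so that any guessed tree stands for some value of the type; only the
  round trip that starts with \<open>to_tree\<close> has to be exact.\<close>

class enc =
  fixes to_tree :: "'a \<Rightarrow> tree" and from_tree :: "tree \<Rightarrow> 'a"
  assumes from_to [simp]: "from_tree (to_tree x) = x"

abbreviation cd :: "'a::enc \<Rightarrow> bool list" where
  "cd x \<equiv> code (to_tree x)"

abbreviation sz :: "'a::enc \<Rightarrow> nat" where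
  "sz x \<equiv> tsz (to_tree x)"

text \<open>A program replaces the topmost tree of stack 0 and preserves all else that is specified,
  so it can be used as a subroutine. One polynomial bounds the time and the size of the result; the
  size bound is what makes composition polynomial.\<close>

definition computes :: "('a::enc \<Rightarrow> bool) \<Rightarrow> com \<Rightarrow> nat poly \<Rightarrow> ('a \<Rightarrow> 'b::enc) \<Rightarrow> bool" where
  "computes D c p F \<longleftrightarrow> wf_com 6 c \<and> (\<forall>x. D x \<longrightarrow> sz (F x) \<le> poly p (sz x) \<and>
     (\<forall>st s. st 0 = cd x @ s \<longrightarrow> tri c st (poly p (sz x)) (st(0 := cd (F x) @ s))))"

text \<open>The predicate \<open>D\<close> records an invariant of the arguments: loops and case
  distinctions are claimed correct only on arguments that can occur.\<close>

definition PTon :: "('a::enc \<Rightarrow> bool) \<Rightarrow> ('a \<Rightarrow> 'b::enc) \<Rightarrow> bool" where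
  "PTon D F \<longleftrightarrow> (\<exists>c p. computes D c p F)"

abbreviation PT :: "('a::enc \<Rightarrow> 'b::enc) \<Rightarrow> bool" where
  "PT \<equiv> PTon (\<lambda>_. True)"

lemma PTonI:
  assumes "wf_com 6 c" "\<And>x. D x \<Longrightarrow> sz (F x) \<le> poly p (sz x)"
    and "\<And>x st s. D x \<Longrightarrow> st 0 = cd x @ s \<Longrightarrow> tri c st (poly q (sz x)) (st(0 := cd (F x) @ s))"
  shows "PTon D F"
proof -
  have "computes D c (p + q) F"
    unfolding computes_def
  proof (intro allI conjI impI)
    show "sz (F x) \<le> poly (p + q) (sz x)" if "D x" for x
      using assms(2)[OF that] by simp
    show "tri c st (poly (p + q) (sz x)) (st(0 := cd (F x) @ s))" if "D x" "st 0 = cd x @ s" for x st s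
      by (rule tri_mono[OF assms(3)[where st=st and x=x and s=s, OF that]]) simp
  qed (rule assms(1))
  then show ?thesis unfolding PTon_def by blast
qed

lemma computesD:
  assumes "computes D c p F"
  shows "wf_com 6 c" and "D x \<Longrightarrow> sz (F x) \<le> poly p (sz x)"
    and "D x \<Longrightarrow> st 0 = cd x @ s \<Longrightarrow> tri c st (poly p (sz x)) (st(0 := cd (F x) @ s))"
  using assms by (auto simp: computes_def)

lemma PTon_mono: "PTon D F \<Longrightarrow> (\<And>x. E x \<Longrightarrow> D x) \<Longrightarrow> PTon E F"
  unfolding PTon_def computes_def by blast

text \<open>A function that does not change the code is computed by the empty program; changes of
  type are of this kind.\<close>

lemma PTon_coerce:
  assumes "\<And>x. D x \<Longrightarrow> to_tree (F x) = to_tree x"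
  shows "PTon D F"
proof (rule PTonI)
  show "sz (F x) \<le> poly [:0, 1:] (sz x)" if "D x" for x using assms[OF that] by simp
  show "tri Skip st (poly [:0, 1:] (sz x)) (st(0 := cd (F x) @ s))" if "D x" "st 0 = cd x @ s" for x s and st :: "nat \<Rightarrow> bool list"
    using tri_Skip that assms by (metis fun_upd_triv)
qed simp

lemma PTon_comp:
  assumes "PTon D F" "PTon E G" "\<And>x. D x \<Longrightarrow> E (F x)"
  shows "PTon D (\<lambda>x. G (F x))"
proof -
  obtain c p d q where F: "computes D c p F" and G: "computes E d q G"
    using assms unfolding PTon_def by blast
  show ?thesis
  proof (rule PTonI)
    show "sz (G (F x)) \<le> poly (pcompose q p) (sz x)" if "D x" for x
      using computesD(2)[OF G, OF assms(3), OF that] poly_nat_mono[OF computesD(2)[OF F, of x], of q] that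
      by (simp add: poly_pcompose)
    show "tri (Seq c d) st (poly (p + pcompose q p + [:1:]) (sz x)) (st(0 := cd (G (F x)) @ s))"
      if D: "D x" and that: "st 0 = cd x @ s" for x s and st :: "nat \<Rightarrow> bool list"
      using tri_mono[OF tri_Seq[OF computesD(3)[OF F, of x st s, OF D that] computesD(3)[OF G, of "F x" "st(0 := cd (F x) @ s)" s]],
          of "poly (p + pcompose q p + [:1:]) (sz x)"]
        poly_nat_mono[OF computesD(2)[OF F, of x, OF D], of q] assms(3)[OF D]
      by (simp add: poly_pcompose)
  qed (use computesD(1)[OF F] computesD(1)[OF G] in simp)
qed

fun push_all :: "nat \<Rightarrow> bool list \<Rightarrow> com" where
  "push_all i [] = Skip"
| "push_all i (b # l) = Seq (push_all i l) (push i b)"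

lemma tri_push_all: "i < 4 \<Longrightarrow> tri (push_all i l) st (4 * length l) (st(i := l @ st i))"
proof (induction l)
  case Nil then show ?case by (simp add: tri_Skip)
next
  case (Cons b l)
  show ?case
    by (simp, rule tri_cong, rule tri_Seq, rule Cons.IH, rule Cons.prems, rule tri_push, rule Cons.prems) auto
qed

lemma wf_push_all [simp]: "wf_com K (push_all i l)"
  by (induction l) auto

lemma wf_transfer [simp]: "wf_com 6 (transfer 0 [])" "wf_com 6 (transfer 0 [0, 1])" "wf_com 6 (transfer 0 [1])" "wf_com 6 (transfer 1 [0])"
  using tri_wf[OF tri_drop[of "\<lambda>_. code Leaf" Leaf "[]"]] tri_wf[OF tri_dup[of "\<lambda>_. code Leaf" Leaf "[]"]]
    tri_wf[OF tri_save[of "\<lambda>_. code Leaf" Leaf "[]"]] tri_wf[OF tri_load[of "\<lambda>_. code Leaf" Leaf "[]"]]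
  by simp_all

lemmas wf_transfer' [simp] = wf_transfer[unfolded One_nat_def]

lemma PTon_const: "PTon D (\<lambda>_. u)"
proof (rule PTonI)
  show "sz u \<le> poly [:sz u:] (sz x)" for x :: 'a by simp
  show "tri (Seq (transfer 0 []) (push_all 0 (cd u))) st (poly [:4 * sz u + 1, 60:] (sz x)) (st(0 := cd u @ s))"
    if "st 0 = cd x @ s" for x :: 'a and s and st :: "nat \<Rightarrow> bool list"
    by (rule tri_cong, rule tri_Seq, rule tri_drop[where st=st and t="to_tree x" and s=s, OF that], rule tri_push_all)
      (auto simp: tsz_def)
qed simp

text \<open>Stack 1 keeps a copy of the argument. The right part is computed first, since in the
  code of a node it lies below the left part.\<close>

lemma PTon_Node:
  assumes "PTon D F" "PTon D G" and eq: "\<And>x. D x \<Longrightarrow> to_tree (H x) = Node (to_tree (F x)) (to_tree (G x))"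
  shows "PTon D H"
proof -
  obtain c p d q where F: "computes D c p F" and G: "computes D d q G"
    using assms unfolding PTon_def by blast
  show ?thesis
  proof (rule PTonI)
    show "sz (H x) \<le> poly (p + q + [:1:]) (sz x)" if "D x" for x
      using computesD(2)[OF G, OF that] computesD(2)[OF F, OF that] eq[OF that] by simp
    fix x s and st :: "nat \<Rightarrow> bool list" assume D: "D x" and 0: "st 0 = cd x @ s"
    let ?n = "sz x"
    have 1: "tri (transfer 0 [0, 1]) st (80 * ?n) (st(1 := cd x @ st 1))" (is "tri _ _ _ ?st1")
      by (rule tri_dup[where st=st and t="to_tree x" and s=s, OF 0])
    have 2: "tri d ?st1 (poly q ?n) (?st1(0 := cd (G x) @ s))" (is "tri _ _ _ ?st2")
      by (rule computesD(3)[OF G]) (simp_all add: 0 D)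
    have 3: "tri (transfer 1 [0]) ?st2 (70 * ?n) (?st2(1 := st 1, 0 := cd x @ ?st2 0))" (is "tri _ _ _ ?st3")
      by (rule tri_load) simp
    have 4: "tri c ?st3 (poly p ?n) (?st3(0 := cd (F x) @ cd (G x) @ s))" (is "tri _ _ _ ?st4")
      by (rule computesD(3)[OF F]) (simp_all add: D)
    have 5: "tri (push 0 True) ?st4 3 (?st4(0 := True # ?st4 0))"
      by (rule tri_push) simp
    show "tri (Seq (transfer 0 [0, 1]) (Seq d (Seq (transfer 1 [0]) (Seq c (push 0 True))))) st
        (poly (p + q + [:10, 150:]) ?n) (st(0 := cd (H x) @ s))"
      by (rule tri_cong[OF tri_Seq[OF 1 tri_Seq[OF 2 tri_Seq[OF 3 tri_Seq[OF 4 5]]]]])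
        (auto simp: fun_eq_iff eq[OF D])
  qed (use computesD(1)[OF F] computesD(1)[OF G] in simp)
qed

fun left :: "tree \<Rightarrow> tree" where
  "left Leaf = Leaf"
| "left (Node l r) = l"

fun right :: "tree \<Rightarrow> tree" where
  "right Leaf = Leaf"
| "right (Node l r) = r"

lemma PTon_right:
  assumes "\<And>x. D x \<Longrightarrow> to_tree (F x) = right (to_tree x)"
  shows "PTon D F"
proof (rule PTonI)
  have "tsz (right t) \<le> tsz t" for t by (cases t) auto
  then show "sz (F x) \<le> poly [:0, 1:] (sz x)" if "D x" for x using assms[OF that] by simp
  fix x s and st :: "nat \<Rightarrow> bool list" assume D: "D x" and 0: "st 0 = cd x @ s"
  have "tri (If (top_true 0) (Seq (pop 0) (transfer 0 [])) Skip) st (poly [:10, 60:] (tsz t)) (st(0 := code (right t) @ s))"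
    if 0: "st 0 = code t @ s" for t
  proof (cases t)
    case Leaf
    then have "tri Skip st 2 (st(0 := False # s))"
      using tri_Skip[of st 2] 0 by (metis append_Cons append_Nil code.simps(1) fun_upd_triv)
    then show ?thesis
      using 0 Leaf by (intro tri_mono[OF tri_If[where b=False and l=s and n=2]]) auto
  next
    case (Node a b)
    then have 1: "tri (pop 0) st 2 (st(0 := code a @ code b @ s))"
      using 0 by (intro tri_pop) auto
    have "tri (Seq (pop 0) (transfer 0 [])) st (2 + 60 * tsz a + 1) (st(0 := code b @ s))"
      by (rule tri_cong[OF tri_Seq[OF 1 tri_drop]]) auto
    then show ?thesis
      using 0 Node by (intro tri_mono[OF tri_If[where b=True and l="code a @ code b @ s"]]) auto
  qed
  from this[OF 0] show "tri (If (top_true 0) (Seq (pop 0) (transfer 0 [])) Skip) st (poly [:10, 60:] (sz x)) (st(0 := cd (F x) @ s))"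
    using assms[OF D] by simp
qed simp

lemma PTon_left:
  assumes "\<And>x. D x \<Longrightarrow> to_tree (F x) = left (to_tree x)"
  shows "PTon D F"
proof (rule PTonI)
  have "tsz (left t) \<le> tsz t" for t by (cases t) auto
  then show "sz (F x) \<le> poly [:0, 1:] (sz x)" if "D x" for x using assms[OF that] by simp
  let ?c = "Seq (pop 0) (Seq (transfer 0 [1]) (Seq (transfer 0 []) (transfer 1 [0])))"
  fix x s and st :: "nat \<Rightarrow> bool list" assume D: "D x" and 0: "st 0 = cd x @ s"
  have "tri (If (top_true 0) ?c Skip) st (poly [:20, 200:] (tsz t)) (st(0 := code (left t) @ s))"
    if 0: "st 0 = code t @ s" for t
  proof (cases t)
    case Leaf
    then have "tri Skip st 2 (st(0 := False # s))"
      using tri_Skip[of st 2] 0 by (metis append_Cons append_Nil code.simps(1) fun_upd_triv)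
    then show ?thesis
      using 0 Leaf by (intro tri_mono[OF tri_If[where b=False and l=s and n=2]]) auto
  next
    case (Node a b)
    then have 1: "tri (pop 0) st 2 (st(0 := code a @ code b @ s))" (is "tri _ _ _ ?st1")
      using 0 by (intro tri_pop) auto
    have 2: "tri (transfer 0 [1]) ?st1 (70 * tsz a) (?st1(0 := code b @ s, 1 := code a @ ?st1 1))" (is "tri _ _ _ ?st2")
      by (rule tri_save) simp
    have 3: "tri (transfer 0 []) ?st2 (60 * tsz b) (?st2(0 := s))" (is "tri _ _ _ ?st3")
      by (rule tri_drop) simp
    have 4: "tri (transfer 1 [0]) ?st3 (70 * tsz a) (?st3(1 := st 1, 0 := code a @ ?st3 0))"
      by (rule tri_load) simp
    have "tri ?c st (2 + (70 * tsz a + (60 * tsz b + 70 * tsz a + 1) + 1) + 1) (st(0 := code a @ s))"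
      by (rule tri_cong[OF tri_Seq[OF 1 tri_Seq[OF 2 tri_Seq[OF 3 4]]]]) (auto simp: fun_eq_iff)
    then show ?thesis
      using 0 Node by (intro tri_mono[OF tri_If[where b=True and l="code a @ code b @ s"]]) auto
  qed
  from this[OF 0] show "tri (If (top_true 0) ?c Skip) st (poly [:20, 200:] (sz x)) (st(0 := cd (F x) @ s))"
    using assms[OF D] by simp
qed simp

text \<open>The first digit of a code tells a node from a leaf. The decision is taken before the
  value of \<open>H\<close> is dropped, so that the control state remembers it while the argument is
  restored from stack 1.\<close>

lemma PTon_branch:
  assumes "PTon D H" "PTon (\<lambda>x. D x \<and> to_tree (H x) \<noteq> Leaf) F" "PTon (\<lambda>x. D x \<and> to_tree (H x) = Leaf) G"
  shows "PTon D (\<lambda>x. if to_tree (H x) \<noteq> Leaf then F x else G x)"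
proof -
  obtain h r c p d q where H: "computes D h r H" and F: "computes (\<lambda>x. D x \<and> to_tree (H x) \<noteq> Leaf) c p F"
    and G: "computes (\<lambda>x. D x \<and> to_tree (H x) = Leaf) d q G"
    using assms unfolding PTon_def by blast
  have wf: "wf_com 6 c" "wf_com 6 d" "wf_com 6 h"
    using computesD(1)[OF F] computesD(1)[OF G] computesD(1)[OF H] by auto
  let ?e = "\<lambda>c. Seq (transfer 0 []) (Seq (transfer 1 [0]) c)"
  show ?thesis
  proof (rule PTonI)
    show "sz (if to_tree (H x) \<noteq> Leaf then F x else G x) \<le> poly (p + q) (sz x)" if "D x" for x
      using computesD(2)[OF G, of x] computesD(2)[OF F, of x] that by auto
    fix x s and st :: "nat \<Rightarrow> bool list" assume D: "D x" and 0: "st 0 = cd x @ s"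
    let ?n = "sz x" and ?R = "if to_tree (H x) \<noteq> Leaf then F x else G x"
    have 1: "tri (transfer 0 [0, 1]) st (80 * ?n) (st(1 := cd x @ st 1))" (is "tri _ _ _ ?st1")
      by (rule tri_dup[where st=st and t="to_tree x" and s=s, OF 0])
    have 2: "tri h ?st1 (poly r ?n) (?st1(0 := cd (H x) @ s))" (is "tri _ _ _ ?st2")
      by (rule computesD(3)[OF H]) (simp_all add: 0 D)
    have 3: "tri (transfer 0 []) ?st2 (60 * poly r ?n) (?st2(0 := s))" (is "tri _ _ _ ?st3")
      by (rule tri_mono[OF tri_drop]) (use computesD(2)[OF H, of x] D in auto)
    have 4: "tri (transfer 1 [0]) ?st3 (70 * ?n) (?st3(1 := st 1, 0 := cd x @ ?st3 0))" (is "tri _ _ _ ?st4")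
      by (rule tri_load) simp
    let ?b = "to_tree (H x) \<noteq> Leaf"
    have 5: "tri (if ?b then c else d) ?st4 (poly p ?n + poly q ?n) (?st4(0 := cd ?R @ s))"
      using computesD(3)[OF F, of x ?st4 s] computesD(3)[OF G, of x ?st4 s] D
      by (auto intro: tri_mono)
    have 6: "tri (?e (if ?b then c else d)) ?st2 (60 * poly r ?n + (70 * ?n + (poly p ?n + poly q ?n) + 1) + 1) (?st4(0 := cd ?R @ s))"
      by (rule tri_Seq[OF 3 tri_Seq[OF 4 5]])
    have 7: "tri (If (top_true 0) (?e c) (?e d)) ?st2 (60 * poly r ?n + (70 * ?n + (poly p ?n + poly q ?n) + 1) + 1 + 1) (?st4(0 := cd ?R @ s))"
    proof (rule tri_If[where b="?b" and l="tl (cd (H x)) @ s"])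
      show "?st2 0 = ?b # tl (cd (H x)) @ s" by (cases "to_tree (H x)") auto
      show "tri (if ?b then ?e c else ?e d) ?st2 (60 * poly r ?n + (70 * ?n + (poly p ?n + poly q ?n) + 1) + 1) (?st4(0 := cd ?R @ s))"
        using 6 by (simp only: if_distrib)
    qed (simp_all add: wf)
    show "tri (Seq (transfer 0 [0, 1]) (Seq h (If (top_true 0) (?e c) (?e d)))) st
        (poly (p + q + [:61:] * r + [:10, 150:]) ?n) (st(0 := cd ?R @ s))"
      by (rule tri_cong[OF tri_Seq[OF 1 tri_Seq[OF 2 7]]]) (auto simp: fun_eq_iff)
  qed (simp add: wf)
qed

text \<open>The left component of a state is the loop guard: a node continues, a leaf stops. The
  bound \<open>B\<close> concerns all intermediate states, since polynomially many polynomial-time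
  rounds may otherwise produce values of exponential size.\<close>

definition iterates_to :: "('a::enc \<Rightarrow> 'a) \<Rightarrow> nat \<Rightarrow> nat \<Rightarrow> 'a \<Rightarrow> 'a \<Rightarrow> bool" where
  "iterates_to F k B x u \<longleftrightarrow> (\<forall>i<k. \<exists>a b s. to_tree ((F ^^ i) x) = Node (Node a b) s) \<and>
     (\<forall>i\<le>k. sz ((F ^^ i) x) \<le> B) \<and> (\<exists>s. to_tree ((F ^^ k) x) = Node Leaf s) \<and> u = (F ^^ k) x"

lemma iterates_to_Suc:
  "iterates_to F (Suc k) B x u \<Longrightarrow> \<exists>a b s. to_tree x = Node (Node a b) s \<and> sz x \<le> B \<and> iterates_to F k B (F x) u"
proof -
  assume a: "iterates_to F (Suc k) B x u"
  have sh: "(F ^^ Suc i) x = (F ^^ i) (F x)" for i by (simp add: funpow_Suc_right del: funpow.simps)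
  have "\<exists>a b s. to_tree x = Node (Node a b) s"
    using a unfolding iterates_to_def by (elim conjE, drule_tac x=0 in spec) simp
  moreover have "sz x \<le> B"
    using a unfolding iterates_to_def by (elim conjE, drule_tac x=0 in spec, drule_tac x=0 in spec) simp
  moreover have "iterates_to F k B (F x) u"
    using a unfolding iterates_to_def sh[symmetric] by (auto simp del: funpow.simps)
  ultimately show ?thesis by blast
qed

lemma iterates_to_Node: "iterates_to F k B x u \<Longrightarrow> \<exists>l r. to_tree x = Node l r"
proof (cases k)
  case 0 then show "iterates_to F k B x u \<Longrightarrow> ?thesis" unfolding iterates_to_def by auto
next
  case (Suc n)
  assume "iterates_to F k B x u"
  then have "\<exists>a b s. to_tree ((F ^^ 0) x) = Node (Node a b) s" using Suc unfolding iterates_to_def by blast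
  then show ?thesis by auto
qed

lemma PT_while:
  fixes F :: "'a::enc \<Rightarrow> 'a"
  assumes "PT F" and "\<And>x. D x \<Longrightarrow> \<exists>k \<le> poly q (sz x). iterates_to F k (poly q (sz x)) x (R x)"
  shows "PTon D R"
proof -
  obtain c p where F: "computes (\<lambda>_. True) c p F" using assms(1) unfolding PTon_def by blast
  \<comment> \<open>Between rounds the leading \<open>True\<close> of the state is kept off the
    stack, so that the first digit of the guard is on top. A round restores it, runs
    \<open>c\<close> and removes it again.\<close>
  let ?b = "Seq (push 0 True) (Seq c (pop 0))"
  let ?w = "While (top_true 0) ?b"
  have wf: "wf_com 6 c" using computesD(1)[OF F] .
  have loop: "tri ?w (st(0 := tl (cd x) @ s)) (k * (poly p B + 20) + 2) (st(0 := tl (cd u) @ s))"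
    if "iterates_to F k B x u" for k B x u st s
    using that
  proof (induction k arbitrary: x)
    case 0
    then obtain s' where "to_tree x = Node Leaf s'" "u = x" by (auto simp: iterates_to_def)
    then show ?case by (intro tri_cong[OF tri_While_False[where l="code s' @ s"]]) (auto simp: wf)
  next
    case (Suc k)
    then obtain a b r where t: "to_tree x = Node (Node a b) r" "sz x \<le> B" and it: "iterates_to F k B (F x) u"
      using iterates_to_Suc by blast
    from iterates_to_Node[OF it] obtain l r where lr: "to_tree (F x) = Node l r" by blast
    have 1: "tri (push 0 True) (st(0 := tl (cd x) @ s)) 3 (st(0 := cd x @ s))"
      by (rule tri_cong[OF tri_push]) (auto simp: t)
    have 2: "tri c (st(0 := cd x @ s)) (poly p B) (st(0 := cd (F x) @ s))"
    proof (rule tri_cong[OF computesD(3)[OF F, where x=x and st="st(0 := cd x @ s)" and s=s]])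
      show "poly p (sz x) \<le> poly p B" by (rule poly_nat_mono[OF t(2)])
    qed simp_all
    have 3: "tri (pop 0) (st(0 := cd (F x) @ s)) 2 (st(0 := tl (cd (F x)) @ s))"
      by (rule tri_cong[OF tri_pop[where b=True and l="tl (cd (F x)) @ s"]]) (auto simp: lr)
    have "tri ?w (st(0 := tl (cd x) @ s)) ((3 + (poly p B + 2 + 1) + 1) + (k * (poly p B + 20) + 2) + 2) (st(0 := tl (cd u) @ s))"
    proof (rule tri_While_True[OF _ _ tri_Seq[OF 1 tri_Seq[OF 2 3]] Suc.IH[OF it]])
      show "(st(0 := tl (cd x) @ s)) 0 = True # tl (tl (cd x)) @ s" by (simp add: t(1))
    qed simp
    then show ?case by (rule tri_mono) simp
  qed
  show ?thesis
  proof (rule PTonI)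
    show "sz (R x) \<le> poly q (sz x)" if "D x" for x
    proof -
      obtain k where "iterates_to F k (poly q (sz x)) x (R x)" using assms(2)[OF \<open>D x\<close>] by blast
      then show ?thesis by (auto simp: iterates_to_def)
    qed
    fix x s and st :: "nat \<Rightarrow> bool list" assume D: "D x" and 0: "st 0 = cd x @ s"
    obtain k where k: "k \<le> poly q (sz x)" "iterates_to F k (poly q (sz x)) x (R x)" using assms(2)[OF D] by blast
    have "\<exists>l r. to_tree x = Node l r" by (rule iterates_to_Node[OF k(2)])
    then have 1: "tri (pop 0) st 2 (st(0 := tl (cd x) @ s))"
      using 0 by (intro tri_cong[OF tri_pop[where b=True and l="tl (cd x) @ s"]]) auto
    have 2: "tri ?w (st(0 := tl (cd x) @ s)) (poly q (sz x) * (poly p (poly q (sz x)) + 20) + 2) (st(0 := tl (cd (R x)) @ s))"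
      by (rule tri_mono[OF loop[OF k(2)]]) (use k(1) in simp)
    have R: "True # tl (cd (R x)) = cd (R x)"
      using k(2) unfolding iterates_to_def by auto
    have 3: "tri (push 0 True) (st(0 := tl (cd (R x)) @ s)) 3 (st(0 := cd (R x) @ s))"
      by (rule tri_cong[OF tri_push]) (simp_all add: R flip: append_Cons)
    show "tri (Seq (pop 0) (Seq ?w (push 0 True))) st (poly (q * (pcompose p q + [:20:]) + [:20:]) (sz x)) (st(0 := cd (R x) @ s))"
      by (rule tri_cong[OF tri_Seq[OF 1 tri_Seq[OF 2 3]]]) (auto simp: poly_pcompose algebra_simps)
  qed (simp add: wf)
qed


section \<open>A library of polynomial time functions\<close>

instantiation tree :: enc
begin
definition "to_tree_tree (t :: tree) = t"
definition "from_tree_tree (t :: tree) = t"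
instance by standard (simp add: to_tree_tree_def from_tree_tree_def)
end

instantiation bool :: enc
begin
definition "to_tree_bool b = (if b then Node Leaf Leaf else Leaf)"
definition "from_tree_bool t = (t \<noteq> Leaf)"
instance by standard (simp add: to_tree_bool_def from_tree_bool_def)
end

instantiation prod :: (enc, enc) enc
begin
definition "to_tree_prod p = Node (to_tree (fst p)) (to_tree (snd p))"
definition "from_tree_prod t = (from_tree (left t), from_tree (right t))"
instance by standard (simp add: to_tree_prod_def from_tree_prod_def)
end

fun spine :: "tree \<Rightarrow> tree list" where
  "spine Leaf = []"
| "spine (Node a b) = a # spine b"

instantiation list :: (enc) enc
begin
fun to_tree_list :: "'a list \<Rightarrow> tree" where
  "to_tree_list [] = Leaf"
| "to_tree_list (a # l) = Node (to_tree a) (to_tree_list l)"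
definition "from_tree_list t = map from_tree (spine t)"
instance
proof
  show "from_tree (to_tree l) = l" for l :: "'a list"
    by (induction l) (auto simp: from_tree_list_def)
qed
end

text \<open>Unary, so that arithmetic on \<open>nat\<close> is only used for dimensions and indices; binary numbers are bit lists.\<close>

instantiation nat :: enc
begin
fun to_tree_nat :: "nat \<Rightarrow> tree" where
  "to_tree_nat 0 = Leaf"
| "to_tree_nat (Suc n) = Node Leaf (to_tree_nat n)"
definition "from_tree_nat t = length (spine t)"
instance
proof
  show "from_tree (to_tree n) = n" for n :: nat
    by (induction n) (auto simp: from_tree_nat_def)
qed
end

lemmas to_tree_simps = to_tree_tree_def to_tree_bool_def to_tree_prod_def

lemma to_tree_list_Leaf [simp]: "to_tree (l :: 'a::enc list) = Leaf \<longleftrightarrow> l = []"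
  by (cases l) auto

lemma sz_prod [simp]: "sz (a, b) = 1 + sz a + sz b"
  by (simp add: to_tree_simps)

lemma sz_bool: "sz (b :: bool) \<le> 3"
  by (simp add: to_tree_simps)

lemma sz_nat [simp]: "sz (n :: nat) = 2 * n + 1"
  by (induction n) auto

lemma sz_list [simp]: "sz [] = 1" "sz (a # l) = 1 + sz a + sz l"
  by simp_all

lemma sz_pos: "1 \<le> sz x"
  by (rule tsz_pos)

lemma sz_elem: "a \<in> set l \<Longrightarrow> sz a < sz l"
  by (induction l) auto

lemma length_le_sz: "length l < sz l"
  by (induction l) (use sz_pos in \<open>auto simp: less_Suc_eq_le trans_le_add2\<close>)

lemma sz_append: "sz (k @ l) + 1 = sz k + sz l"
  by (induction k) auto

lemma sz_rev [simp]: "sz (rev l) = sz l"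
proof (induction l)
  case (Cons a l)
  then show ?case using sz_append[of "rev l" "[a]"] by simp
qed simp

lemma sz_drop: "sz (drop n l) \<le> sz l"
proof (induction l arbitrary: n)
  case (Cons a l) then show ?case by (cases n) (auto intro: le_SucI trans_le_add2)
qed simp

lemma sz_list_le: "(\<And>a. a \<in> set l \<Longrightarrow> sz a \<le> c) \<Longrightarrow> sz l \<le> 1 + length l * (1 + c)"
proof (induction l)
  case (Cons a l)
  then have "sz l \<le> 1 + length l * (1 + c)" "sz a \<le> c" by auto
  then show ?case by simp
qed simp

lemma sz_bools: "sz (l :: bool list) \<le> 1 + 4 * length l"
  using sz_list_le[of l 3] sz_bool by (simp add: mult.commute)

lemma from_tree_tree_id [simp]: "from_tree t = (t :: tree)" "to_tree t = (t :: tree)"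
  by (simp_all add: from_tree_tree_def to_tree_tree_def)

named_theorems PT_intros

text \<open>Size bounds are not computed by a program, but they are derived by structural rules just
  like \<open>PT\<close>.\<close>

definition PB :: "('a::enc \<Rightarrow> nat) \<Rightarrow> bool" where
  "PB h \<longleftrightarrow> (\<exists>p. \<forall>x. h x \<le> poly p (sz x))"

lemma PB_const [PT_intros]: "PB (\<lambda>_. c)"
  unfolding PB_def by (rule exI[of _ "[:c:]"]) simp

lemma PB_add [PT_intros]: "PB f \<Longrightarrow> PB g \<Longrightarrow> PB (\<lambda>x. f x + g x)"
  unfolding PB_def by (metis add_mono poly_add)

lemma PB_mult [PT_intros]: "PB f \<Longrightarrow> PB g \<Longrightarrow> PB (\<lambda>x. f x * g x)"
  unfolding PB_def by (metis mult_le_mono poly_mult)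

lemma PB_le: "PB f \<Longrightarrow> (\<And>x. g x \<le> f x) \<Longrightarrow> PB g"
  unfolding PB_def by (meson le_trans)

lemma PB_sz: "PT f \<Longrightarrow> PB (\<lambda>x. sz (f x))"
  unfolding PB_def PTon_def using computesD(2) by metis

lemma PB_poly: "PB f \<Longrightarrow> PB (\<lambda>x. poly p (f x))"
proof -
  assume "PB f"
  then obtain q where "\<And>x. f x \<le> poly q (sz x)" unfolding PB_def by blast
  then have "poly p (f x) \<le> poly (pcompose p q) (sz x)" for x
    using poly_nat_mono by (simp add: poly_pcompose)
  then show ?thesis unfolding PB_def by blast
qed

lemma PT_id [PT_intros]: "PT (\<lambda>x. x)"
  by (rule PTon_coerce) simp

lemma PT_const [PT_intros]: "PT (\<lambda>_. c)"
  by (rule PTon_const)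

lemma PT_comp: "PT f \<Longrightarrow> PT g \<Longrightarrow> PT (\<lambda>x. g (f x))"
  by (rule PTon_comp) auto

lemma PTon_cong: "PTon D f \<Longrightarrow> (\<And>x. f x = g x) \<Longrightarrow> PTon D g"
  by (metis ext)

lemma PT_coerce_comp: "PT f \<Longrightarrow> (\<And>x. to_tree (g x) = to_tree x) \<Longrightarrow> PT (\<lambda>e. g (f e))"
  by (rule PT_comp) (auto intro: PTon_coerce)

lemma PT_Pair [PT_intros]: "PT f \<Longrightarrow> PT g \<Longrightarrow> PT (\<lambda>x. (f x, g x))"
  by (rule PTon_Node) (auto simp: to_tree_simps)

lemma PT_fst [PT_intros]: "PT f \<Longrightarrow> PT (\<lambda>x. fst (f x))"
  by (rule PT_comp) (auto intro!: PTon_left simp: to_tree_simps)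

lemma PT_snd [PT_intros]: "PT f \<Longrightarrow> PT (\<lambda>x. snd (f x))"
  by (rule PT_comp) (auto intro!: PTon_right simp: to_tree_simps)

lemma PT_left [PT_intros]: "PT f \<Longrightarrow> PT (\<lambda>x. left (f x))"
  by (rule PT_comp) (auto intro!: PTon_left simp: to_tree_simps)

lemma PT_right [PT_intros]: "PT f \<Longrightarrow> PT (\<lambda>x. right (f x))"
  by (rule PT_comp) (auto intro!: PTon_right simp: to_tree_simps)

lemma PT_Cons [PT_intros]: "PT f \<Longrightarrow> PT g \<Longrightarrow> PT (\<lambda>x. f x # g x)"
  by (rule PTon_Node) auto

lemma PT_Suc [PT_intros]: "PT f \<Longrightarrow> PT (\<lambda>x. Suc (f x))"
  by (rule PTon_Node[of _ "\<lambda>_. Leaf"]) (auto intro: PT_intros simp: to_tree_simps)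

lemma PTon_if:
  assumes "PTon D b" "PTon (\<lambda>x. D x \<and> b x) f" "PTon (\<lambda>x. D x \<and> \<not> b x) g"
  shows "PTon D (\<lambda>x. if b x then f x else g x)"
proof -
  have b: "(to_tree (b x) \<noteq> Leaf) = b x" "(to_tree (b x) = Leaf) = (\<not> b x)" for x by (simp_all add: to_tree_simps)
  show ?thesis using PTon_branch[of D b f g] assms unfolding b not_not by blast
qed

lemma PT_if [PT_intros]: "PT b \<Longrightarrow> PT f \<Longrightarrow> PT g \<Longrightarrow> PT (\<lambda>x. if b x then f x else g x)"
  by (rule PTon_if) (auto elim: PTon_mono)

lemma PT_not [PT_intros]: "PT b \<Longrightarrow> PT (\<lambda>x. \<not> b x)"
  by (rule PTon_cong[of _ "\<lambda>x. if b x then False else True"], (intro PT_if PT_const; assumption)) auto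

lemma PT_conj [PT_intros]: "PT a \<Longrightarrow> PT b \<Longrightarrow> PT (\<lambda>x. a x \<and> b x)"
  by (rule PTon_cong[of _ "\<lambda>x. if a x then b x else False"], (intro PT_if PT_const PT_not; assumption)) auto

lemma PT_disj [PT_intros]: "PT a \<Longrightarrow> PT b \<Longrightarrow> PT (\<lambda>x. a x \<or> b x)"
  by (rule PTon_cong[of _ "\<lambda>x. if a x then True else b x"], (intro PT_if PT_const PT_not; assumption)) auto

lemma PT_imp [PT_intros]: "PT a \<Longrightarrow> PT b \<Longrightarrow> PT (\<lambda>x. a x \<longrightarrow> b x)"
  by (rule PTon_cong[of _ "\<lambda>x. if a x then b x else True"], (intro PT_if PT_const PT_not; assumption)) auto

lemma PT_iff [PT_intros]: "PT a \<Longrightarrow> PT b \<Longrightarrow> PT (\<lambda>x. a x = (b x :: bool))"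
  by (rule PTon_cong[of _ "\<lambda>x. if a x then b x else \<not> b x"], (intro PT_if PT_const PT_not; assumption)) auto

lemma PT_comp2: "PT (\<lambda>p. g (fst p) (snd p)) \<Longrightarrow> PT a \<Longrightarrow> PT b \<Longrightarrow> PT (\<lambda>e. g (a e) (b e))"
  using PT_comp[of "\<lambda>e. (a e, b e)" "\<lambda>p. g (fst p) (snd p)"] by (simp add: PT_Pair)

text \<open>A bound variable becomes the second component of an extended environment. The rules for
  binders below have the same shape, so that goals about \<open>PT\<close> are solved by following
  the structure of the term.\<close>

lemma PT_Let [PT_intros]:
  "PT f \<Longrightarrow> PT (\<lambda>p. g (fst p) (snd p)) \<Longrightarrow> PT (\<lambda>e. Let (f e) (g e))"
  using PT_comp[of "\<lambda>e. (e, f e)" "\<lambda>p. g (fst p) (snd p)"] by (simp add: PT_intros)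

lemma PT_null [PT_intros]: "PT f \<Longrightarrow> PT (\<lambda>x. f x = [])"
proof -
  have "PT (\<lambda>l :: 'b list. if to_tree l \<noteq> Leaf then False else True)"
    by (rule PTon_branch) (auto intro: PTon_const PT_id)
  then have *: "PT (\<lambda>l :: 'b list. l = [])" by (rule PTon_cong) auto
  show "PT f \<Longrightarrow> PT (\<lambda>x. f x = [])" by (rule PT_comp[OF _ *])
qed

text \<open>The head of an empty list is unspecified, so the selectors match the subtrees of the
  code on nonempty lists only; the domain predicate expresses this restriction.\<close>

lemma PT_case_list [PT_intros]:
  assumes "PT l" "PT f" "PT (\<lambda>p. g (fst p) (fst (snd p)) (snd (snd p)))"
  shows "PT (\<lambda>e. case l e of [] \<Rightarrow> f e | a # r \<Rightarrow> g e a r)"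
proof -
  let ?D = "\<lambda>x. \<not> l x = []"
  have l: "PTon ?D l" using assms(1) by (rule PTon_mono) simp
  have "PTon (\<lambda>l. l \<noteq> []) hd" by (rule PTon_left) (auto simp: neq_Nil_conv)
  then have h: "PTon ?D (\<lambda>e. hd (l e))" by (rule PTon_comp[OF l]) simp
  have "PTon (\<lambda>l. l \<noteq> []) tl" by (rule PTon_right) (auto simp: neq_Nil_conv)
  then have t: "PTon ?D (\<lambda>e. tl (l e))" by (rule PTon_comp[OF l]) simp
  have i: "PTon ?D (\<lambda>e. e)" by (rule PTon_coerce) simp
  have ht: "PTon ?D (\<lambda>e. (hd (l e), tl (l e)))"
    by (rule PTon_Node[OF h t]) (simp add: to_tree_simps)
  have "PTon ?D (\<lambda>e. (e, hd (l e), tl (l e)))"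
    by (rule PTon_Node[OF i ht]) (simp add: to_tree_simps)
  from PTon_comp[OF this assms(3)] have "PTon ?D (\<lambda>e. g e (hd (l e)) (tl (l e)))" by simp
  then have "PT (\<lambda>e. if l e = [] then f e else g e (hd (l e)) (tl (l e)))"
    by (intro PTon_if) (use assms in \<open>auto intro: PT_intros elim: PTon_mono\<close>)
  moreover have "(if l e = [] then f e else g e (hd (l e)) (tl (l e))) = (case l e of [] \<Rightarrow> f e | a # r \<Rightarrow> g e a r)" for e
    by (cases "l e") auto
  ultimately show ?thesis by simp
qed

text \<open>The loop state holds the rest of the list, the environment and the accumulator, and the
  list itself acts as the guard. The accumulator is bounded after every prefix because
  \<open>PT_while\<close> demands a bound on all intermediate states.\<close>

lemma PT_fold:
  fixes f :: "'e::enc \<Rightarrow> 'a::enc \<Rightarrow> 's::enc \<Rightarrow> 's"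
  assumes "PT l" "PT s0" "PT (\<lambda>p. f (fst p) (fst (snd p)) (snd (snd p)))" "PB h"
    and bound: "\<And>e k. k \<le> length (l e) \<Longrightarrow> sz (fold (f e) (take k (l e)) (s0 e)) \<le> h e"
  shows "PT (\<lambda>e. fold (f e) (l e) (s0 e))"
proof -
  define F :: "'a list \<times> 'e \<times> 's \<Rightarrow> 'a list \<times> 'e \<times> 's" where
    "F = (\<lambda>x. case fst x of [] \<Rightarrow> x | a # r \<Rightarrow> (r, fst (snd x), f (fst (snd x)) a (snd (snd x))))"
  define R :: "'a list \<times> 'e \<times> 's \<Rightarrow> 'a list \<times> 'e \<times> 's" where
    "R = (\<lambda>x. ([], fst (snd x), fold (f (fst (snd x))) (fst x) (snd (snd x))))"
  have "PT (\<lambda>p. f (fst (snd (fst p))) (fst (snd p)) (snd (snd (fst p))))" (is "PT ?g")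
    using PT_comp[of "\<lambda>p. (fst (snd (fst p)), fst (snd p), snd (snd (fst p)))", OF _ assms(3)]
    by (simp add: PT_intros)
  then have F: "PT F" unfolding F_def by (intro PT_intros) (simp_all add: PT_intros)
  have iter: "(F ^^ i) (l, e, s) = (drop i l, e, fold (f e) (take i l) s)" if "i \<le> length l" for i l e s
    using that
  proof (induction i)
    case (Suc i)
    then have "drop i l = l ! i # drop (Suc i) l" by (simp add: Cons_nth_drop_Suc)
    then show ?case using Suc by (simp add: F_def take_Suc_conv_app_nth)
  qed simp
  obtain p where p: "\<And>e. h e \<le> poly p (sz e)" using assms(4) unfolding PB_def by blast
  define q where "q = p + [:2, 3:]"
  \<comment> \<open>The bound \<open>h\<close> is known only for runs that start from
    \<open>s0 e\<close>, so the loop is claimed correct for such initial states.\<close>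
  define D where "D = (\<lambda>x. \<exists>e. x = (l e, e, s0 e))"
  have "PTon D R"
  proof (rule PT_while[OF F])
    fix x assume "D x"
    then obtain e where x: "x = (l e, e, s0 e)" unfolding D_def by blast
    let ?B = "poly q (sz x)" and ?k = "length (l e)"
    have px: "poly p (sz e) \<le> poly p (sz x)" by (rule poly_nat_mono) (simp add: x)
    have "iterates_to F ?k ?B x (R x)"
      unfolding iterates_to_def x iter[OF order_refl]
    proof (intro conjI allI impI)
      fix i assume "i < ?k"
      then have "drop i (l e) = l e ! i # drop (Suc i) (l e)" by (simp add: Cons_nth_drop_Suc)
      then show "\<exists>a b s. to_tree ((F ^^ i) (l e, e, s0 e)) = Node (Node a b) s"
        using \<open>i < ?k\<close> by (auto simp: iter to_tree_simps)
    next
      fix i assume "i \<le> ?k"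
      then have "sz (fold (f e) (take i (l e)) (s0 e)) \<le> poly p (sz x)" "sz (drop i (l e)) \<le> sz (l e)"
        using bound[of i e] p[of e] px sz_drop by (meson le_trans)+
      then show "sz ((F ^^ i) (l e, e, s0 e)) \<le> poly q (sz (l e, e, s0 e))"
        using \<open>i \<le> ?k\<close> unfolding q_def by (simp add: iter x)
    qed (auto simp: to_tree_simps R_def)
    moreover have "?k \<le> ?B"
      using length_le_sz[of "l e"] unfolding q_def by (simp add: x)
    ultimately show "\<exists>k\<le>?B. iterates_to F k ?B x (R x)" by blast
  qed
  then have "PT (\<lambda>e. R (l e, e, s0 e))"
    by (rule PTon_comp[rotated]) (auto simp: D_def intro!: PT_Pair PT_id assms(1,2))
  then have "PT (\<lambda>e. snd (snd (R (l e, e, s0 e))))" by (intro PT_intros)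
  then show ?thesis by (simp add: R_def)
qed

lemma fold_sz_add:
  assumes "\<And>a s. a \<in> set l \<Longrightarrow> sz (f a s) \<le> sz s + c"
  shows "sz (fold f l s) \<le> sz s + length l * c"
  using assms
proof (induction l arbitrary: s)
  case (Cons a l)
  from Cons.prems[of a s] have "sz (f a s) \<le> sz s + c" by simp
  moreover have "sz (fold f l (f a s)) \<le> sz (f a s) + length l * c" using Cons by simp
  ultimately show ?case by simp
qed simp

text \<open>If a round adds an amount that does not depend on the accumulator, all intermediate
  sizes stay polynomial.\<close>

lemma PT_fold_add:
  assumes "PT l" "PT s0" "PT (\<lambda>p. f (fst p) (fst (snd p)) (snd (snd p)))" "PB c"
    and bound: "\<And>e a s. a \<in> set (l e) \<Longrightarrow> sz (f e a s) \<le> sz s + c e"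
  shows "PT (\<lambda>e. fold (f e) (l e) (s0 e))"
proof (rule PT_fold[OF assms(1-3)])
  show "PB (\<lambda>e. sz (s0 e) + sz (l e) * c e)"
    by (intro PT_intros PB_sz assms)
  fix e k assume "k \<le> length (l e)"
  have "sz (fold (f e) (take k (l e)) (s0 e)) \<le> sz (s0 e) + length (take k (l e)) * c e"
    by (rule fold_sz_add) (auto intro: bound dest: in_set_takeD)
  also have "\<dots> \<le> sz (s0 e) + sz (l e) * c e"
    using length_le_sz[of "l e"] by (intro add_left_mono mult_right_mono) auto
  finally show "sz (fold (f e) (take k (l e)) (s0 e)) \<le> sz (s0 e) + sz (l e) * c e" .
qed

lemma PT_rev [PT_intros]:
  assumes "PT l" shows "PT (\<lambda>e. rev (l e))"
proof -
  have "PT (\<lambda>e. fold (\<lambda>a s. a # s) (l e) [])"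
  proof (rule PT_fold_add[OF assms])
    show "PB (\<lambda>e. sz (l e) + 1)" by (intro PT_intros PB_sz assms)
    show "sz (a # s) \<le> sz s + (sz (l e) + 1)" if "a \<in> set (l e)" for e a s
      using sz_elem[OF that] by simp
  qed (intro PT_intros)+
  then show ?thesis by (simp add: fold_Cons_rev)
qed

lemma PT_append [PT_intros]:
  assumes "PT k" "PT l" shows "PT (\<lambda>e. k e @ l e)"
proof -
  have "PT (\<lambda>e. fold (\<lambda>a s. a # s) (rev (k e)) (l e))"
  proof (rule PT_fold_add[OF PT_rev[OF assms(1)] assms(2)])
    show "PB (\<lambda>e. sz (k e) + 1)" by (intro PT_intros PB_sz assms)
    show "sz (a # s) \<le> sz s + (sz (k e) + 1)" if "a \<in> set (rev (k e))" for e a s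
      using sz_elem[of a "k e"] that by simp
  qed (intro PT_intros)+
  then show ?thesis by (simp add: fold_Cons_rev)
qed

lemma PT_map [PT_intros]:
  assumes "PT l" and g: "PT (\<lambda>p. g (fst p) (snd p))"
  shows "PT (\<lambda>e. map (g e) (l e))"
proof -
  obtain p where p: "\<And>x. sz (g (fst x) (snd x)) \<le> poly p (sz x)" using PB_sz[OF g] unfolding PB_def by blast
  have "PT (\<lambda>e. fold (\<lambda>a s. g e a # s) (l e) [])"
  proof (rule PT_fold_add[OF assms(1)])
    show "PB (\<lambda>e. poly p (1 + sz e + sz (l e)) + 1)" by (intro PT_intros PB_poly PB_sz assms)
    show "sz (g e a # s) \<le> sz s + (poly p (1 + sz e + sz (l e)) + 1)" if "a \<in> set (l e)" for e a s
    proof -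
      have "sz (g e a) \<le> poly p (1 + sz e + sz (l e))"
        using p[of "(e, a)"] sz_elem[OF that] poly_nat_mono[of "sz (e, a)" "1 + sz e + sz (l e)" p] by simp
      then show ?thesis by simp
    qed
    show "PT (\<lambda>p. g (fst p) (fst (snd p)) # snd (snd p))"
      by (intro PT_intros PT_comp2[OF g])
  qed (intro PT_intros)+
  then have "PT (\<lambda>e. rev (fold (\<lambda>a s. g e a # s) (l e) []))" by (rule PT_rev)
  moreover have "rev (fold (\<lambda>a s. g e a # s) l s) = rev s @ map (g e) l" for e s and l :: "'b list"
    by (induction l arbitrary: s) auto
  ultimately show ?thesis by simp
qed

lemma PT_concat [PT_intros]:
  assumes "PT l" shows "PT (\<lambda>e. concat (l e))"
proof -
  have "PT (\<lambda>e. fold (\<lambda>a s. a @ s) (rev (l e)) [])"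
  proof (rule PT_fold_add)
    show "PB (\<lambda>e. sz (l e))" by (intro PT_intros PB_sz assms)
    show "sz (a @ s) \<le> sz s + sz (l e)" if "a \<in> set (rev (l e))" for e a s
      using sz_elem[of a "l e"] that sz_append[of a s] by simp
  qed (intro PT_intros assms)+
  moreover have "fold (\<lambda>a s. a @ s) (rev l) s = concat l @ s" for s and l :: "'b list list"
    by (induction l arbitrary: s rule: list.induct) (auto simp: fold_append)
  ultimately show ?thesis by simp
qed

lemma PT_filter [PT_intros]:
  assumes "PT l" "PT (\<lambda>p. g (fst p) (snd p))"
  shows "PT (\<lambda>e. filter (g e) (l e))"
proof -
  have "PT (\<lambda>e. concat (map (\<lambda>a. if g e a then [a] else []) (l e)))"
    by (intro PT_intros assms)
  moreover have "concat (map (\<lambda>a. if g e a then [a] else []) l) = filter (g e) l" for e l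
    by (induction l) auto
  ultimately show ?thesis by simp
qed

lemma PT_ball [PT_intros]:
  assumes "PT l" "PT (\<lambda>p. g (fst p) (snd p))"
  shows "PT (\<lambda>e. \<forall>a \<in> set (l e). g e a)"
proof -
  have "PT (\<lambda>e. filter (\<lambda>a. \<not> g e a) (l e) = [])"
    by (intro PT_intros assms)
  then show ?thesis by (simp add: filter_empty_conv)
qed

lemma PT_bex [PT_intros]:
  assumes "PT l" "PT (\<lambda>p. g (fst p) (snd p))"
  shows "PT (\<lambda>e. \<exists>a \<in> set (l e). g e a)"
proof -
  have "PT (\<lambda>e. \<not> (\<forall>a \<in> set (l e). \<not> g e a))"
    by (intro PT_intros assms)
  then show ?thesis by simp
qed

text \<open>\<open>False\<close> is coded as a leaf, so a unary number and the list of that many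
  \<open>False\<close> are the same tree. Arithmetic on \<open>nat\<close> is thereby reduced to
  list functions.\<close>

lemma to_tree_replicate: "to_tree (replicate n False) = to_tree n"
  by (induction n) (auto simp: to_tree_simps)

lemma PT_replicate_False [PT_intros]: "PT f \<Longrightarrow> PT (\<lambda>e. replicate (f e) False)"
  by (rule PT_coerce_comp) (simp_all add: to_tree_replicate)

lemma PT_length [PT_intros]:
  assumes "PT l" shows "PT (\<lambda>e. length (l e))"
proof -
  have m: "PT (\<lambda>e. map (\<lambda>_. False) (l e))" by (intro PT_intros assms)
  have "PTon (\<lambda>l. \<exists>n. l = replicate n False) length"
    by (rule PTon_coerce) (auto simp: to_tree_replicate)
  from PTon_comp[OF m this] have "PT (\<lambda>e. length (map (\<lambda>_. False) (l e)))"
    by (auto simp: map_replicate_const)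
  then show ?thesis by simp
qed

lemma PT_replicate [PT_intros]:
  assumes "PT n" "PT x" shows "PT (\<lambda>e. replicate (n e) (x e))"
proof -
  have "PT (\<lambda>e. map (\<lambda>_. x e) (replicate (n e) False))"
    by (intro PT_intros assms PT_comp[OF PT_fst[OF PT_id] assms(2)])
  then show ?thesis by simp
qed

lemma PT_add [PT_intros]:
  assumes "PT m" "PT n" shows "PT (\<lambda>e. m e + n e :: nat)"
proof -
  have "PT (\<lambda>e. length (replicate (m e) False @ replicate (n e) False))" by (intro PT_intros assms)
  then show ?thesis by simp
qed

lemma PT_mult [PT_intros]:
  assumes "PT m" "PT n" shows "PT (\<lambda>e. m e * n e :: nat)"
proof -
  have "PT (\<lambda>e. length (concat (map (\<lambda>_. replicate (n e) False) (replicate (m e) False))))"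
    by (intro PT_intros assms PT_comp[OF PT_fst[OF PT_id] assms(2)])
  then show ?thesis by (simp add: length_concat comp_def sum_list_replicate)
qed

lemma PT_poly [PT_intros]:
  fixes p :: "nat poly"
  assumes "PT n" shows "PT (\<lambda>e. poly p (n e))"
proof (induction p)
  case (pCons a p)
  have "PT (\<lambda>e. a + n e * poly p (n e))" by (intro PT_intros assms pCons.IH)
  then show ?case by simp
qed (simp add: PT_const)

lemma PT_tl [PT_intros]: "PT l \<Longrightarrow> PT (\<lambda>e. tl (l e))"
proof -
  assume "PT l"
  then have "PT (\<lambda>e. case l e of [] \<Rightarrow> [] | a # r \<Rightarrow> r)" by (intro PT_intros)
  then show ?thesis by (simp add: tl_def)
qed

lemma PT_drop [PT_intros]:
  assumes "PT n" "PT l" shows "PT (\<lambda>e. drop (n e) (l e))"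
proof -
  have "sz (tl l) \<le> sz l" for l :: "'b list" by (cases l) auto
  then have "PT (\<lambda>e. fold (\<lambda>_ s. tl s) (replicate (n e) False) (l e))"
    by (intro PT_fold_add[where c="\<lambda>_. 0"] PT_intros assms) simp
  moreover have "fold (\<lambda>_ s. tl s) (replicate k False) l = drop k l" for k and l :: "'b list"
    by (induction k arbitrary: l) (auto simp: drop_Suc)
  ultimately show ?thesis by simp
qed

lemma PT_less [PT_intros]:
  assumes "PT m" "PT n" shows "PT (\<lambda>e. m e < (n e :: nat))"
proof -
  have "PT (\<lambda>e. \<not> (drop (m e) (replicate (n e) False) = []))" by (intro PT_intros assms)
  then show ?thesis by (simp add: not_le)
qed

lemma PT_le [PT_intros]:
  assumes "PT m" "PT n" shows "PT (\<lambda>e. m e \<le> (n e :: nat))"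
proof -
  have "PT (\<lambda>e. \<not> n e < m e)" by (intro PT_intros assms)
  then show ?thesis by (simp add: not_less)
qed

lemma PT_eq_nat [PT_intros]:
  assumes "PT m" "PT n" shows "PT (\<lambda>e. m e = (n e :: nat))"
proof -
  have "PT (\<lambda>e. m e \<le> n e \<and> n e \<le> m e)" by (intro PT_intros assms)
  then show ?thesis by (simp add: order_eq_iff)
qed

lemma PT_eq_prod [PT_intros]:
  assumes "PT (\<lambda>e. fst (f e) = fst (g e))" "PT (\<lambda>e. snd (f e) = snd (g e))"
  shows "PT (\<lambda>e. f e = g e)"
  using PT_conj[OF assms] by (simp add: prod_eq_iff)

text \<open>A total variant of indexing: \<open>PT\<close> concerns all arguments, including
  positions outside of the list.\<close>

definition nth_or :: "'a \<Rightarrow> 'a list \<Rightarrow> nat \<Rightarrow> 'a" where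
  "nth_or d l i = (case drop i l of [] \<Rightarrow> d | a # r \<Rightarrow> a)"

lemma nth_or [simp]: "i < length l \<Longrightarrow> nth_or d l i = l ! i"
  by (simp add: nth_or_def flip: Cons_nth_drop_Suc)

lemma PT_nth_or [PT_intros]:
  assumes "PT d" "PT l" "PT i" shows "PT (\<lambda>e. nth_or (d e) (l e) (i e))"
  unfolding nth_or_def by (intro PT_intros assms)

lemma PT_upt0:
  assumes "PT n" shows "PT (\<lambda>e. [0..<n e])"
proof -
  let ?f = "\<lambda>(_ :: bool) s. (Suc (fst s), fst s # snd s)"
  have it: "fold ?f (replicate k False) (0, []) = (k, rev [0..<k])" for k
    by (induction k) (auto simp: replicate_append_same[symmetric] simp del: replicate.simps)
  have "PT (\<lambda>e. fold ?f (replicate (n e) False) (0, []))"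
  proof (rule PT_fold)
    show "PB (\<lambda>e. 10 + 10 * (sz (n e) * (1 + sz (n e))))"
      by (intro PT_intros PB_sz assms)
    fix e k assume "k \<le> length (replicate (n e) False)"
    then have k: "k \<le> n e" by simp
    then have "sz [0..<k] \<le> 1 + length [0..<k] * (1 + sz (n e))"
      by (intro sz_list_le) auto
    also have "\<dots> \<le> 1 + sz (n e) * (1 + sz (n e))"
      using k by (intro add_left_mono mult_right_mono) auto
    finally have "sz [0..<k] \<le> 1 + sz (n e) * (1 + sz (n e))" .
    moreover have "k \<le> sz (n e) * (1 + sz (n e))"
      using k by simp
    ultimately have "sz (k, rev [0..<k]) \<le> 10 + 10 * (sz (n e) * (1 + sz (n e)))"
      unfolding sz_prod sz_rev sz_nat[of k] by linarith
    then show "sz (fold ?f (take k (replicate (n e) False)) (0, [])) \<le> 10 + 10 * (sz (n e) * (1 + sz (n e)))"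
      using k by (simp only: take_replicate min_absorb2 min.absorb1 it)
  qed (intro PT_intros assms)+
  then have "PT (\<lambda>e. rev (snd (fold ?f (replicate (n e) False) (0, []))))" by (intro PT_intros)
  then show ?thesis by (simp only: it snd_conv rev_rev_ident)
qed

lemma PT_upt [PT_intros]:
  assumes "PT m" "PT n" shows "PT (\<lambda>e. [m e..<n e])"
proof -
  have "PT (\<lambda>e. drop (m e) [0..<n e])" by (intro PT_intros PT_upt0 assms)
  then show ?thesis by (simp add: drop_upt)
qed

lemma PT_zip [PT_intros]:
  assumes "PT k" "PT l" shows "PT (\<lambda>e. zip (k e) (l e))"
proof -
  let ?f = "\<lambda>x s. case fst s of [] \<Rightarrow> s | y # r \<Rightarrow> (r, (x, y) # snd s)"
  have "PT (\<lambda>e. fold ?f (k e) (l e, []))"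
  proof (rule PT_fold_add)
    show "PB (\<lambda>e. sz (k e) + 1)" by (intro PT_intros PB_sz assms)
    fix e x and s :: "'c list \<times> ('b \<times> 'c) list" assume "x \<in> set (k e)"
    then show "sz (?f x s) \<le> sz s + (sz (k e) + 1)"
      using sz_elem[of x "k e"] by (cases s; cases "fst s") auto
  qed (intro PT_intros assms)+
  then have "PT (\<lambda>e. rev (snd (fold ?f (k e) (l e, []))))" by (intro PT_intros)
  moreover have "rev (snd (fold ?f k (l, s))) = rev s @ zip k l" for k :: "'b list" and l :: "'c list" and s
  proof (induction k arbitrary: l s)
    case (Cons x k) then show ?case by (cases l) auto
  qed auto
  ultimately show ?thesis by simp
qed

lemma PT_eq_bools [PT_intros]:
  assumes "PT k" "PT l" shows "PT (\<lambda>e. k e = (l e :: bool list))"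
proof -
  have "PT (\<lambda>e. length (k e) = length (l e) \<and> (\<forall>p \<in> set (zip (k e) (l e)). fst p = snd p))"
    by (intro PT_intros assms)
  moreover have "(length k = length l \<and> (\<forall>p \<in> set (zip k l). fst p = snd p)) \<longleftrightarrow> k = l" for k l :: "bool list"
  proof
    show "k = l" if "length k = length l \<and> (\<forall>p \<in> set (zip k l). fst p = snd p)"
      using that[THEN conjunct1] that by (induction k l rule: list_induct2) auto
  qed (auto simp: set_zip)
  ultimately show ?thesis by simp
qed

lemma PT_mem [PT_intros]:
  assumes "PT x" "PT l" "PT (\<lambda>p. fst p = (snd p :: 'b::enc))"
  shows "PT (\<lambda>e. x e \<in> set (l e :: 'b list))"
proof -
  have "PT (\<lambda>e. \<exists>a \<in> set (l e). x e = a)"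
    by (intro PT_intros assms(2)) (use PT_comp[of "\<lambda>p. (x (fst p), snd p)", OF _ assms(3)] in
      \<open>simp add: PT_intros PT_comp[OF PT_fst[OF PT_id] assms(1)]\<close>)
  then show ?thesis by simp
qed

lemma PT_remdups [PT_intros]:
  assumes "PT l" "PT (\<lambda>p. fst p = (snd p :: 'b::enc))"
  shows "PT (\<lambda>e. remdups (l e :: 'b list))"
proof -
  let ?f = "\<lambda>a s. if a \<in> set s then s else a # s"
  have "PT (\<lambda>e. fold ?f (rev (l e)) [])"
  proof (rule PT_fold_add)
    show "PB (\<lambda>e. sz (l e) + 1)" by (intro PT_intros PB_sz assms)
    fix e a and s :: "'b list" assume "a \<in> set (rev (l e))"
    then show "sz (?f a s) \<le> sz s + (sz (l e) + 1)"
      using sz_elem[of a "l e"] by auto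
  qed (intro PT_intros assms)+
  moreover have "fold ?f (rev l) [] = remdups l" for l :: "'b list"
    by (induction l) auto
  ultimately show ?thesis by simp
qed


section \<open>Input, output, and certificates\<close>

text \<open>\<open>tri\<close> preserves the input tapes without knowing them. For reading the input
  and writing the output, their contents and head positions have to be tracked exactly.\<close>

definition tri_io :: "com \<Rightarrow> (nat \<Rightarrow> tape) \<Rightarrow> (nat \<Rightarrow> bool list) \<Rightarrow> nat \<Rightarrow> (nat \<Rightarrow> tape) \<Rightarrow> (nat \<Rightarrow> bool list) \<Rightarrow> bool" where
  "tri_io c io st n io' st' \<longleftrightarrow> wf_com 6 c \<and> (\<forall>ts. stacks ts st \<longrightarrow> (\<forall>j<2. ts ! j = io j) \<longrightarrow>
     (\<exists>ts'. runs c ts n ts' \<and> stacks ts' st' \<and> (\<forall>j<2. ts' ! j = io' j)))"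

lemma less2: "(\<forall>j<2. P j) \<longleftrightarrow> P 0 \<and> P (1::nat)"
  by (auto simp: numeral_2_eq_2 less_Suc_eq)

lemma tri_io_tri: "tri c st n st' \<Longrightarrow> tri_io c io st n io st'"
  unfolding tri_def tri_io_def less2 by metis

lemma tri_io_mono: "tri_io c io st n io' st' \<Longrightarrow> n \<le> m \<Longrightarrow> tri_io c io st m io' st'"
  unfolding tri_io_def using runs_mono by blast

lemma tri_io_Seq:
  assumes "tri_io a io st n io1 st1" "tri_io b io1 st1 m io2 st2"
  shows "tri_io (Seq a b) io st (n + m + 1) io2 st2"
  unfolding tri_io_def
proof (intro conjI allI impI)
  fix ts assume s: "stacks ts st" "\<forall>j<2. ts ! j = io j"
  then obtain ts1 where 1: "runs a ts n ts1" "stacks ts1 st1" "\<forall>j<2. ts1 ! j = io1 j"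
    using assms(1) unfolding tri_io_def by blast
  then obtain ts2 where 2: "runs b ts1 m ts2" "stacks ts2 st2" "\<forall>j<2. ts2 ! j = io2 j"
    using assms(2) unfolding tri_io_def by blast
  show "\<exists>ts'. runs (Seq a b) ts (n + m + 1) ts' \<and> stacks ts' st2 \<and> (\<forall>j<2. ts' ! j = io2 j)"
    using runs_Seq[OF 1(1) 2(1)] 2(2,3) by blast
qed (use assms in \<open>auto simp: tri_io_def\<close>)

lemma tri_io_act:
  assumes "j < 2" "tape_act (g (tape_read (io j))) (io j) = t"
  shows "tri_io (act j g) io st 1 (io(j := t)) st"
  unfolding tri_io_def
proof (intro conjI allI impI)
  fix ts assume s: "stacks ts st" "\<forall>j<2. ts ! j = io j"
  note len = stacks_length[OF s(1)]
  have "runs (act j g) ts 1 (ts[j := t])"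
    using runs_act[of j ts g] len assms s(2) by simp
  moreover have "stacks (ts[j := t]) st"
    using s(1) assms(1) unfolding stacks_def by auto
  moreover have "\<forall>i<2. ts[j := t] ! i = (io(j := t)) i"
    using s(2) len by (auto simp: nth_list_update)
  ultimately show "\<exists>ts'. runs (act j g) ts 1 ts' \<and> stacks ts' st \<and> (\<forall>i<2. ts' ! i = (io(j := t)) i)"
    by blast
qed simp

definition reads :: "nat \<Rightarrow> symbol set \<Rightarrow> symbol list \<Rightarrow> bool" where
  "reads j S ss \<longleftrightarrow> ss ! j \<in> S"

lemma reads_io:
  "stacks ts st \<Longrightarrow> \<forall>j<2. ts ! j = io j \<Longrightarrow> j < 2 \<Longrightarrow> reads j S (map tape_read ts) \<longleftrightarrow> tape_read (io j) \<in> S"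
  using stacks_length[of ts st] by (simp add: reads_def)

lemma tri_io_If:
  assumes "j < 2" "wf_com 6 a" "wf_com 6 b" "tri_io (if tape_read (io j) \<in> S then a else b) io st n io' st'"
  shows "tri_io (If (reads j S) a b) io st (n + 1) io' st'"
  unfolding tri_io_def
proof (intro conjI allI impI)
  fix ts assume s: "stacks ts st" "\<forall>j<2. ts ! j = io j"
  then obtain ts' where 1: "runs (if tape_read (io j) \<in> S then a else b) ts n ts'" "stacks ts' st'" "\<forall>j<2. ts' ! j = io' j"
    using assms(4) unfolding tri_io_def by blast
  have "runs (If (reads j S) a b) ts (Suc n) ts'"
    by (rule runs_If) (use 1(1) reads_io[OF s assms(1)] in simp)
  then show "\<exists>ts'. runs (If (reads j S) a b) ts (n + 1) ts' \<and> stacks ts' st' \<and> (\<forall>j<2. ts' ! j = io' j)"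
    using 1 by auto
qed (use assms in simp)

lemma tri_io_While_False:
  assumes "j < 2" "wf_com 6 a" "tape_read (io j) \<notin> S"
  shows "tri_io (While (reads j S) a) io st 1 io st"
  unfolding tri_io_def
proof (intro conjI allI impI)
  fix ts assume s: "stacks ts st" "\<forall>j<2. ts ! j = io j"
  have "runs (While (reads j S) a) ts 1 ts"
    by (rule runs_While_False) (use reads_io[OF s assms(1)] assms(3) in simp)
  then show "\<exists>ts'. runs (While (reads j S) a) ts 1 ts' \<and> stacks ts' st \<and> (\<forall>j<2. ts' ! j = io j)"
    using s by blast
qed (use assms in simp)

lemma tri_io_While_gen:
  assumes "tri_io a io st n io1 st1" "tri_io (While p a) io1 st1 m io2 st2"
    and p: "\<And>ts. stacks ts st \<Longrightarrow> \<forall>j<2. ts ! j = io j \<Longrightarrow> p (map tape_read ts)"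
  shows "tri_io (While p a) io st (n + m + 2) io2 st2"
  unfolding tri_io_def
proof (intro conjI allI impI)
  fix ts assume s: "stacks ts st" "\<forall>j<2. ts ! j = io j"
  then obtain ts1 where 1: "runs a ts n ts1" "stacks ts1 st1" "\<forall>j<2. ts1 ! j = io1 j"
    using assms(1) unfolding tri_io_def by blast
  then obtain ts2 where 2: "runs (While p a) ts1 m ts2" "stacks ts2 st2" "\<forall>j<2. ts2 ! j = io2 j"
    using assms(2) unfolding tri_io_def by blast
  show "\<exists>ts'. runs (While p a) ts (n + m + 2) ts' \<and> stacks ts' st2 \<and> (\<forall>j<2. ts' ! j = io2 j)"
    using runs_While_True[OF p[OF s] 1(1) 2(1)] 2(2,3) by blast
qed (use assms in \<open>auto simp: tri_io_def\<close>)

lemma tri_io_While_True: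
  assumes "j < 2" "tape_read (io j) \<in> S"
    "tri_io a io st n io1 st1" "tri_io (While (reads j S) a) io1 st1 m io2 st2"
  shows "tri_io (While (reads j S) a) io st (n + m + 2) io2 st2"
proof (rule tri_io_While_gen[OF assms(3,4)])
  show "reads j S (map tape_read ts)" if "stacks ts st" "\<forall>j<2. ts ! j = io j" for ts
    using reads_io[OF that assms(1)] assms(2) by simp
qed

abbreviation word_cells :: "bool list \<Rightarrow> int \<Rightarrow> symbol" where
  "word_cells w \<equiv> \<lambda>z. if 0 \<le> z \<and> z < int (length w) then Some (w ! nat z) else None"

abbreviation go :: "nat \<Rightarrow> move \<Rightarrow> com" where
  "go j mv \<equiv> act j (\<lambda>s. (s, mv))"

lemma tri_io_go:
  "j < 2 \<Longrightarrow> io j = (c, h) \<Longrightarrow> tri_io (go j mv) io st 1 (io(j := (c, move_head mv h))) st"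
  by (rule tri_io_act) auto

text \<open>The code of a list begins with its head, so the stack is filled from the last digit of
  the word to the first, on top of the \<open>False\<close> that codes the empty list. The head
  finally returns to cell 0, where the output has to start.\<close>

definition read_word :: "nat \<Rightarrow> com" where
  "read_word j = Seq (While (reads j (- {None})) (go j MoveRight)) (Seq (go j MoveLeft) (Seq (push 0 False)
     (Seq (While (reads j (- {None})) (Seq (If (reads j {Some True}) (push_all 0 (True # cd True)) (push_all 0 (True # cd False))) (go j MoveLeft)))
        (go j MoveRight))))"

lemma tri_read_word:
  assumes j: "j < 2" and io: "io j = word_tape w"
  shows "tri_io (read_word j) io st (100 * (length w + 1)) io (st(0 := cd w @ st 0))"
proof -
  let ?c = "word_cells w"
  let ?p = "reads j (- {None})"
  let ?body = "Seq (If (reads j {Some True}) (push_all 0 (True # cd True)) (push_all 0 (True # cd False))) (go j MoveLeft)"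
  let ?at = "\<lambda>h. io(j := (?c, h))"
  have mv: "tri_io (go j m) (?at h) st' 1 (?at h') st'" if "h' = move_head m h" for m h h' st'
    using tri_io_go[OF j, of "?at h" ?c h m st'] that by simp
  have right: "tri_io (While ?p (go j MoveRight)) (?at (int (length w) - int k)) st (3 * k + 1) (?at (int (length w))) st"
    if "k \<le> length w" for k
    using that
  proof (induction k)
    case 0
    have e: "int (length w) - int 0 = int (length w)" by simp
    show ?case unfolding e by (rule tri_io_mono[OF tri_io_While_False[OF j]]) auto
  next
    case (Suc k)
    have 1: "tri_io (go j MoveRight) (?at (int (length w) - int (Suc k))) st 1 (?at (int (length w) - int k)) st"
      by (rule mv) simp
    show ?case
      by (rule tri_io_mono[OF tri_io_While_True[OF j _ 1 Suc.IH]]) (use Suc.prems in auto)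
  qed
  have left: "tri_io (While ?p ?body) (?at (int k - 1)) (st(0 := cd (drop k w) @ st 0)) (40 * k + 1) (?at (- 1)) (st(0 := cd w @ st 0))"
    if "k \<le> length w" for k
    using that
  proof (induction k)
    case 0
    have e: "int 0 - 1 = -1" by simp
    show ?case unfolding drop_0 e by (rule tri_io_mono[OF tri_io_While_False[OF j]]) auto
  next
    case (Suc k)
    let ?st = "st(0 := cd (drop (Suc k) w) @ st 0)" and ?st1 = "st(0 := cd (drop k w) @ st 0)"
    have d: "drop k w = w ! k # drop (Suc k) w" using Suc.prems by (simp add: Cons_nth_drop_Suc)
    have r: "tape_read (?at (int k) j) = Some (w ! k)" using Suc.prems by simp
    have "tri (push_all 0 (True # cd (w ! k))) ?st 20 (?st(0 := (True # cd (w ! k)) @ ?st 0))"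
      by (rule tri_mono[OF tri_push_all]) (auto simp: to_tree_simps)
    moreover have "?st(0 := (True # cd (w ! k)) @ ?st 0) = ?st1" by (simp add: d)
    ultimately have p: "tri_io (push_all 0 (True # cd (w ! k))) (?at (int k)) ?st 20 (?at (int k)) ?st1"
      by (intro tri_io_tri) simp
    have 1: "tri_io (If (reads j {Some True}) (push_all 0 (True # cd True)) (push_all 0 (True # cd False))) (?at (int k)) ?st (20 + 1) (?at (int k)) ?st1"
    proof (rule tri_io_If[OF j wf_push_all wf_push_all])
      show "tri_io (if tape_read (?at (int k) j) \<in> {Some True} then push_all 0 (True # cd True) else push_all 0 (True # cd False)) (?at (int k)) ?st 20 (?at (int k)) ?st1"
        unfolding r using p by (cases "w ! k") (simp_all del: push_all.simps)
    qed
    have 2: "tri_io (go j MoveLeft) (?at (int k)) ?st1 1 (?at (int k - 1)) ?st1"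
      by (rule mv) simp
    have e: "int (Suc k) - 1 = int k" by simp
    show ?case
      unfolding e
      by (rule tri_io_mono[OF tri_io_While_True[OF j _ tri_io_Seq[OF 1 2] Suc.IH]]) (use Suc.prems r in auto)
  qed
  have a0: "?at 0 = io" using io by (auto simp: word_tape_def)
  have 1: "tri_io (While ?p (go j MoveRight)) io st (3 * length w + 1) (?at (int (length w))) st"
    using right[of "length w"] a0 by simp
  have 2: "tri_io (go j MoveLeft) (?at (int (length w))) st 1 (?at (int (length w) - 1)) st"
    by (rule mv) simp
  have "tri (push 0 False) st 3 (st(0 := False # st 0))" by (rule tri_push) simp
  then have 3: "tri_io (push 0 False) (?at (int (length w) - 1)) st 3 (?at (int (length w) - 1)) (st(0 := cd (drop (length w) w) @ st 0))"
    by (intro tri_io_tri) simp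
  have "tri_io (go j MoveRight) (?at (- 1)) (st(0 := cd w @ st 0)) 1 (?at 0) (st(0 := cd w @ st 0))"
    by (rule mv) simp
  then have 4: "tri_io (go j MoveRight) (?at (- 1)) (st(0 := cd w @ st 0)) 1 io (st(0 := cd w @ st 0))"
    by (simp only: a0)
  show ?thesis
    unfolding read_word_def
    by (rule tri_io_mono[OF tri_io_Seq[OF 1 tri_io_Seq[OF 2 tri_io_Seq[OF 3 tri_io_Seq[OF left[OF order_refl] 4]]]]]) simp
qed

definition write_bit :: "bool \<Rightarrow> com" where
  "write_bit b = act 0 (\<lambda>_. (Some b, MoveRight))"

text \<open>A list cell shows as \<open>True\<close> followed by the code of its digit, which is
  \<open>True, False, False\<close> or just \<open>False\<close>; the pops remove exactly these
  symbols.\<close>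

definition write_body :: com where
  "write_body = Seq (pop 0) (If (top_true 0) (Seq (pop 0) (Seq (pop 0) (Seq (pop 0) (write_bit True)))) (Seq (pop 0) (write_bit False)))"

definition write_word :: com where
  "write_word = Seq (While (top_true 0) write_body) (act 0 (\<lambda>_. (None, MoveStay)))"

lemma wf_write [simp]: "wf_com 6 write_body" "wf_com 6 (write_bit b)"
  by (simp_all add: write_body_def write_bit_def)

lemma tri_io_If_top:
  assumes "st 0 = b # l" "wf_com 6 c1" "wf_com 6 c2" "tri_io (if b then c1 else c2) io st n io' st'"
  shows "tri_io (If (top_true 0) c1 c2) io st (n + 1) io' st'"
  unfolding tri_io_def
proof (intro conjI allI impI)
  fix ts assume s: "stacks ts st" "\<forall>j<2. ts ! j = io j"
  then obtain ts' where 1: "runs (if b then c1 else c2) ts n ts'" "stacks ts' st'" "\<forall>j<2. ts' ! j = io' j"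
    using assms(4) unfolding tri_io_def by blast
  have "runs (If (top_true 0) c1 c2) ts (Suc n) ts'"
    by (rule runs_If) (use 1(1) stacks_top[OF s(1) _ assms(1)] in simp)
  then show "\<exists>ts'. runs (If (top_true 0) c1 c2) ts (n + 1) ts' \<and> stacks ts' st' \<and> (\<forall>j<2. ts' ! j = io' j)"
    using 1 by auto
qed (use assms in simp)

lemma tri_write_body:
  assumes "io 0 = (c, h)" "st 0 = True # cd b @ s"
  shows "tri_io write_body io st 20 (io(0 := (c(h := Some b), h + 1))) (st(0 := s))"
proof -
  have w: "tri_io (write_bit b) io st' 1 (io(0 := (c(h := Some b), h + 1))) st'" for st'
    unfolding write_bit_def by (rule tri_io_act) (use assms in auto)
  have p: "tri_io (pop 0) io (st(0 := a # l)) 2 io (st(0 := l))" for a l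
    using tri_pop[of 0 "st(0 := a # l)" a l] by (intro tri_io_tri) simp
  have 1: "tri_io (pop 0) io st 2 io (st(0 := cd b @ s))"
    using tri_pop[of 0 st, OF _ assms(2)] by (intro tri_io_tri) simp
  have "tri_io (Seq (pop 0) (Seq (pop 0) (Seq (pop 0) (write_bit True)))) io (st(0 := cd b @ s)) 15 (io(0 := (c(h := Some b), h + 1))) (st(0 := s))" if b
  proof -
    from that have b: "cd b @ s = True # False # False # s" by (simp add: to_tree_simps)
    show ?thesis unfolding b
      by (rule tri_io_mono[OF tri_io_Seq[OF p tri_io_Seq[OF p tri_io_Seq[OF p]]]]) (use w that in auto)
  qed
  moreover have "tri_io (Seq (pop 0) (write_bit False)) io (st(0 := cd b @ s)) 15 (io(0 := (c(h := Some b), h + 1))) (st(0 := s))" if "\<not> b"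
  proof -
    from that have b: "cd b @ s = False # s" by (simp add: to_tree_simps)
    show ?thesis unfolding b
      by (rule tri_io_mono[OF tri_io_Seq[OF p]]) (use w that in auto)
  qed
  ultimately have "tri_io (If (top_true 0) (Seq (pop 0) (Seq (pop 0) (Seq (pop 0) (write_bit True)))) (Seq (pop 0) (write_bit False)))
      io (st(0 := cd b @ s)) (15 + 1) (io(0 := (c(h := Some b), h + 1))) (st(0 := s))"
    by (intro tri_io_If_top[where b=b and l="tl (cd b) @ s"]) (auto simp: to_tree_simps)
  from tri_io_Seq[OF 1 this] show ?thesis unfolding write_body_def by (rule tri_io_mono) simp
qed

text \<open>The induction over the rest \<open>w\<close> of the output has to remember the part
  \<open>v\<close> that is already on the tape.\<close>

lemma tri_write_loop:
  assumes "io 0 = (c, int (length v))" "\<forall>j < length v. c (int j) = Some (v ! j)" "st 0 = cd w @ s"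
  shows "\<exists>c' st'. tri_io (While (top_true 0) write_body) io st (22 * length w + 2) (io(0 := (c', int (length (v @ w))))) st'
    \<and> (\<forall>j < length (v @ w). c' (int j) = Some ((v @ w) ! j))"
  using assms
proof (induction w arbitrary: v io c st)
  case Nil
  then have "tri_io (While (top_true 0) write_body) io st 2 io st"
    by (intro tri_io_tri tri_While_False[where l=s]) auto
  moreover have "io(0 := (c, int (length (v @ [])))) = io" using Nil by (simp add: fun_upd_idem)
  ultimately show ?case using Nil.prems(2)
    by (intro exI[of _ c] exI[of _ st] conjI) (simp_all add: numeral_2_eq_2)
next
  case (Cons b w)
  let ?c = "c(int (length v) := Some b)"
  let ?io = "io(0 := (?c, int (length v) + 1))"
  have st: "st 0 = True # cd b @ (cd w @ s)" using Cons.prems(3) by simp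
  have 1: "tri_io write_body io st 20 ?io (st(0 := cd w @ s))"
    by (rule tri_write_body[where io=io and st=st and b=b and s="cd w @ s", OF Cons.prems(1) st])
  obtain c' st' where
    2: "tri_io (While (top_true 0) write_body) ?io (st(0 := cd w @ s)) (22 * length w + 2) (?io(0 := (c', int (length ((v @ [b]) @ w))))) st'"
    and 3: "\<forall>j < length ((v @ [b]) @ w). c' (int j) = Some (((v @ [b]) @ w) ! j)"
  proof -
    have p1: "?io 0 = (?c, int (length (v @ [b])))" by simp
    have p2: "\<forall>j < length (v @ [b]). ?c (int j) = Some ((v @ [b]) ! j)"
      using Cons.prems(2) by (simp add: nth_append less_Suc_eq)
    show ?thesis using Cons.IH[of ?io ?c "v @ [b]" "st(0 := cd w @ s)", OF p1 p2 fun_upd_same] that by blast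
  qed
  have "tri_io (While (top_true 0) write_body) io st (20 + (22 * length w + 2) + 2) (?io(0 := (c', int (length ((v @ [b]) @ w))))) st'"
    by (rule tri_io_While_gen[OF 1 2]) (use stacks_top[of _ st 0 True] st in simp)
  moreover have "?io(0 := (c', int (length ((v @ [b]) @ w)))) = io(0 := (c', int (length (v @ b # w))))"
    by simp
  moreover have "20 + (22 * length w + 2) + 2 = 22 * length (b # w) + 2" by simp
  ultimately have "tri_io (While (top_true 0) write_body) io st (22 * length (b # w) + 2) (io(0 := (c', int (length (v @ b # w))))) st'"
    by metis
  moreover have "\<forall>j < length (v @ b # w). c' (int j) = Some ((v @ b # w) ! j)" using 3 by simp
  ultimately show ?case by blast
qed

text \<open>A blank tape is read as the empty word, so one machine serves functions of a single word
  and relations between two words.\<close>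

lemma polytime_machine:
  fixes F :: "bool list \<times> bool list \<Rightarrow> bool list"
  assumes "PT F"
  shows "\<exists>M (p :: nat poly). tm_wf M \<and> 2 \<le> tm_tapes M \<and>
    (\<forall>x u. tm_computes M [x, u] (poly p (length x + length u)) (F (x, u))) \<and>
    (\<forall>x. tm_computes M [x] (poly p (length x)) (F (x, [])))"
proof -
  obtain c p where F: "computes (\<lambda>_. True) c p F" using assms unfolding PTon_def by blast
  let ?prog = "Seq (read_word 1) (Seq (read_word 0) (Seq (push 0 True) (Seq c write_word)))"
  have "wf_com 6 ?prog"
    using computesD(1)[OF F] by (simp add: read_word_def write_word_def)
  then obtain M where M: "tm_wf M" "tm_tapes M = 6"
    "\<And>ts n ts'. length ts = 6 \<Longrightarrow> runs ?prog ts n ts' \<Longrightarrow> (tm_step M ^^ n) (0, ts) = (1, ts')"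
    using machine_of_com[of 6 ?prog] by auto
  define q where "q = [:300, 100:] + [:300, 100:] + p + [:22:] * p + [:100:]"
  \<comment> \<open>A pair of words has size at most \<open>3 + 4 * (length x + length u)\<close>,
    as a list cell with its digit takes at most 4 symbols.\<close>
  define q' where "q' = pcompose q [:3, 4:]"
  have main: "tm_computes M ws (poly q' (length x + length u)) (F (x, u))"
    if ini: "snd (tm_init M ws) = word_tape x # word_tape u # rest" "length (snd (tm_init M ws)) = 6" for ws x u rest
  proof -
    let ?ts = "snd (tm_init M ws)"
    define io where "io = (\<lambda>j. ?ts ! j)"
    let ?n = "sz (x, u)"
    let ?st0 = "(\<lambda>_. []) :: nat \<Rightarrow> bool list"
    have s0: "stacks ?ts ?st0" using ini(2) by (simp add: stacks_def holds_stack_def)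
    have io: "io 0 = word_tape x" "io 1 = word_tape u" by (simp_all add: io_def ini(1))
    note io = io io(2)[unfolded One_nat_def]
    have 1: "tri_io (read_word 1) io ?st0 (100 * (length u + 1)) io (?st0(0 := cd u @ ?st0 0))" (is "tri_io _ _ _ _ _ ?st1")
      by (rule tri_read_word) (simp_all add: io)
    have 2: "tri_io (read_word 0) io ?st1 (100 * (length x + 1)) io (?st1(0 := cd x @ ?st1 0))" (is "tri_io _ _ _ _ _ ?st2")
      by (rule tri_read_word) (simp_all add: io)
    have 3: "tri_io (push 0 True) io ?st2 3 io (?st2(0 := True # ?st2 0))" (is "tri_io _ _ _ _ _ ?st3")
      by (rule tri_io_tri, rule tri_push) simp
    have 4: "tri_io c io ?st3 (poly p ?n) io (?st3(0 := cd (F (x, u)) @ []))" (is "tri_io _ _ _ _ _ ?st4")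
      by (rule tri_io_tri, rule computesD(3)[OF F]) (simp_all add: to_tree_simps)
    obtain c' st' where
      5: "tri_io (While (top_true 0) write_body) io ?st4 (22 * length (F (x, u)) + 2) (io(0 := (c', int (length (F (x, u)))))) st'"
      and c': "\<forall>j < length (F (x, u)). c' (int j) = Some (F (x, u) ! j)"
      using tri_write_loop[of io "word_cells x" "[]" ?st4 "F (x, u)" "[]"] io(1) by (auto simp: word_tape_def)
    let ?io5 = "io(0 := (c', int (length (F (x, u)))))"
    \<comment> \<open>Remnants of the input may follow the output on tape 0; the blank delimits the
      output word.\<close>
    have 6: "tri_io (act 0 (\<lambda>_. (None, MoveStay))) ?io5 st' 1 (?io5(0 := (c'(int (length (F (x, u))) := None), int (length (F (x, u)))))) st'"
      by (rule tri_io_act) simp_all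
    let ?T = "100 * (length u + 1) + (100 * (length x + 1) + (3 + (poly p ?n + (22 * length (F (x, u)) + 2 + 1 + 1) + 1) + 1) + 1) + 1"
    have "tri_io ?prog io ?st0 ?T (?io5(0 := (c'(int (length (F (x, u))) := None), int (length (F (x, u)))))) st'"
      unfolding write_word_def by (rule tri_io_Seq[OF 1 tri_io_Seq[OF 2 tri_io_Seq[OF 3 tri_io_Seq[OF 4 tri_io_Seq[OF 5 6]]]]])
    then obtain ts' where r: "runs ?prog ?ts ?T ts'" and out: "ts' ! 0 = (c'(int (length (F (x, u))) := None), int (length (F (x, u))))"
      unfolding tri_io_def less2 using s0 io_def by auto
    have n: "?n \<le> 3 + 4 * (length x + length u)"
      using sz_bools[of x] sz_bools[of u] by simp
    have "length (F (x, u)) \<le> poly p ?n"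
      using computesD(2)[OF F, of "(x, u)"] length_le_sz[of "F (x, u)"] by simp
    moreover have "length u < ?n" "length x < ?n"
      using length_le_sz[of x] length_le_sz[of u] by simp_all
    ultimately have "?T \<le> poly q ?n" unfolding q_def by (simp add: algebra_simps)
    also have "\<dots> \<le> poly q (3 + 4 * (length x + length u))" by (rule poly_nat_mono[OF n])
    finally have "?T \<le> poly q' (length x + length u)" by (simp add: q'_def poly_pcompose algebra_simps)
    from M(3)[OF ini(2) runs_mono[OF r this]]
    show ?thesis
      using out c' unfolding tm_computes_def by (simp add: tm_init_def tape_output_def)
  qed
  have "tm_computes M [x, u] (poly q' (length x + length u)) (F (x, u))" for x u
    by (rule main[of _ x u "map (\<lambda>_. word_tape []) [2..<6]"]) (simp_all add: tm_init_def M(2) upt_rec)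
  moreover have "tm_computes M [x] (poly q' (length x)) (F (x, []))" for x
    using main[of "[x]" x "[]" "map (\<lambda>_. word_tape []) [2..<6]"] by (simp add: tm_init_def M(2) upt_rec)
  ultimately show ?thesis using M(1,2) by (intro exI[of _ M] exI[of _ q']) auto
qed

lemma polytime_function_PT:
  assumes "PT (f :: bool list \<Rightarrow> bool list)" shows "polytime_function f"
proof -
  have "PT (\<lambda>p :: bool list \<times> bool list. f (fst p))" by (intro PT_comp[OF _ assms] PT_intros)
  from polytime_machine[OF this] show ?thesis unfolding polytime_function_def by auto
qed

text \<open>Reads a prefix code from its end with a stack of trees.\<close>

definition parse_step :: "bool \<Rightarrow> tree list \<Rightarrow> tree list" where
  "parse_step b s = (if b then (case s of [] \<Rightarrow> [] | l # s' \<Rightarrow> (case s' of [] \<Rightarrow> [] | r # s'' \<Rightarrow> Node l r # s''))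
     else Leaf # s)"

definition parse :: "bool list \<Rightarrow> tree list" where
  "parse u = fold parse_step (rev u) []"

lemma parse_code: "parse (code t) = [t]"
proof -
  have "fold parse_step (rev (code t)) s = t # s" for s
    by (induction t arbitrary: s) (simp_all add: parse_step_def)
  then show ?thesis by (simp add: parse_def)
qed

lemma PT_parse: "PT parse"
proof -
  have "PT (\<lambda>u. fold (\<lambda>b s. if b then (case s of [] \<Rightarrow> [] | l # s' \<Rightarrow> (case s' of [] \<Rightarrow> [] | r # s'' \<Rightarrow> from_tree (Node l r) # s''))
     else Leaf # s) (rev u) [])"
  proof (rule PT_fold_add[where c="\<lambda>_. 2"])
    have N: "PT (\<lambda>p :: tree \<times> tree. Node (fst p) (snd p))"
      by (rule PTon_coerce) (simp add: to_tree_simps)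
    show "PT (\<lambda>p :: bool list \<times> bool \<times> tree list. if fst (snd p) then (case snd (snd p) of [] \<Rightarrow> [] | l # s' \<Rightarrow> (case s' of [] \<Rightarrow> [] | r # s'' \<Rightarrow> from_tree (Node l r) # s''))
     else Leaf # snd (snd p))"
      unfolding from_tree_tree_id by (intro PT_intros PT_comp2[OF N])
    show "sz (if b then (case s of [] \<Rightarrow> [] | l # s' \<Rightarrow> (case s' of [] \<Rightarrow> [] | r # s'' \<Rightarrow> from_tree (Node l r) # s''))
     else Leaf # s) \<le> sz s + 2" for b and s :: "tree list"
      by (auto split: list.split)
  qed (intro PT_intros)+
  then show ?thesis
    unfolding from_tree_tree_id parse_def[abs_def] parse_step_def[abs_def] .
qed

lemma PT_from_bool: "PT (from_tree :: tree \<Rightarrow> bool)"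
proof -
  have "PT (\<lambda>t :: tree. if to_tree t \<noteq> Leaf then True else False)"
    by (rule PTon_branch) (auto intro: PTon_const PT_id)
  then show ?thesis by (rule PTon_cong) (simp add: from_tree_bool_def)
qed

lemma PT_from_prod:
  "PT (from_tree :: tree \<Rightarrow> 'a::enc) \<Longrightarrow> PT (from_tree :: tree \<Rightarrow> 'b::enc) \<Longrightarrow> PT (from_tree :: tree \<Rightarrow> 'a \<times> 'b)"
  unfolding from_tree_prod_def[abs_def]
  by (intro PT_Pair PT_comp[OF PT_left[OF PT_id]] PT_comp[OF PT_right[OF PT_id]])

lemma PT_spine: "PT spine"
proof (rule PTon_coerce)
  show "to_tree (spine t) = to_tree t" for t by (induction t) auto
qed

lemma PT_from_list:
  assumes "PT (from_tree :: tree \<Rightarrow> 'a::enc)" shows "PT (from_tree :: tree \<Rightarrow> 'a list)"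
  unfolding from_tree_list_def[abs_def]
  by (intro PT_map PT_spine PT_comp[OF PT_snd[OF PT_id] assms])

lemma PT_from_nat: "PT (from_tree :: tree \<Rightarrow> nat)"
  unfolding from_tree_nat_def[abs_def] by (intro PT_length PT_spine)

text \<open>The guessed word is the prefix code of a certificate. Whatever a malformed word is
  decoded to, soundness of \<open>W\<close> makes it harmless.\<close>

lemma in_NP_I:
  fixes W :: "bool list \<Rightarrow> 'c::enc \<Rightarrow> bool"
  assumes W: "PT (\<lambda>p. W (fst p) (snd p))" and from_tree: "PT (from_tree :: tree \<Rightarrow> 'c)"
    and sound: "\<And>x c. W x c \<Longrightarrow> x \<in> L"
    and complete: "\<And>x. x \<in> L \<Longrightarrow> \<exists>c. sz c \<le> poly q (length x) \<and> W x c"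
  shows "in_NP L"
proof -
  define V where "V x u = (case parse u of [] \<Rightarrow> False | t # r \<Rightarrow> W x (from_tree t))" for x u
  have "PT (\<lambda>p. [V (fst p) (snd p)])"
    unfolding V_def
    by (intro PT_intros PT_comp[OF PT_snd[OF PT_id] PT_parse] PT_comp2[OF W] PT_comp[OF _ from_tree])
  from polytime_machine[OF this] have "polytime_relation V"
    unfolding polytime_relation_def by auto
  moreover have "x \<in> L \<longleftrightarrow> (\<exists>u. length u \<le> poly q (length x) \<and> V x u)" for x
  proof
    assume "x \<in> L"
    then obtain c where "sz c \<le> poly q (length x)" "W x c" using complete by blast
    then show "\<exists>u. length u \<le> poly q (length x) \<and> V x u"
      by (intro exI[of _ "cd c"]) (simp add: V_def parse_code tsz_def)
  next
    assume "\<exists>u. length u \<le> poly q (length x) \<and> V x u"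
    then obtain u where "V x u" by blast
    then show "x \<in> L" by (cases "parse u") (auto simp: V_def intro: sound)
  qed
  ultimately show ?thesis unfolding in_NP_def by blast
qed


section \<open>From machines to clauses\<close>

type_synonym var = "nat \<times> nat \<times> nat \<times> nat"
type_synonym clause = "var list \<times> var list"

text \<open>A clause is an implication from the conjunction of its negated variables to the
  disjunction of the others, the form in which conditions on runs arise.\<close>

definition sat :: "(var \<Rightarrow> bool) \<Rightarrow> clause \<Rightarrow> bool" where
  "sat \<sigma> c \<longleftrightarrow> (\<forall>v \<in> set (fst c). \<sigma> v) \<longrightarrow> (\<exists>v \<in> set (snd c). \<sigma> v)"

definition symbol_code :: "symbol \<Rightarrow> nat" where
  "symbol_code s = (case s of None \<Rightarrow> 0 | Some b \<Rightarrow> if b then 2 else 1)"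

lemma symbol_code_inject [simp]: "symbol_code s = symbol_code s' \<longleftrightarrow> s = s'"
  by (auto simp: symbol_code_def split: option.splits if_splits)

lemma symbol_code_less: "symbol_code s < 3"
  by (auto simp: symbol_code_def split: option.splits)

fun mvn :: "move \<Rightarrow> nat" where
  "mvn MoveLeft = 0"
| "mvn MoveStay = 1"
| "mvn MoveRight = 2"

text \<open>Tape contents are indexed relative to the head, so that the transition is the same at all
  head positions. With an offset \<open>O'\<close> that keeps positions nonnegative, \<open>(2 + j, t, i, s)\<close> means that at time \<open>t\<close> the cell at
  distance \<open>i - O'\<close> from the head of tape \<open>j\<close> contains the symbol with code \<open>s\<close>, and \<open>(0, t, q, 0)\<close> that the state is \<open>q\<close>.
  The cell 0 of the output tape moves in this frame; \<open>(1, t, i, 0)\<close> means that it is at distance \<open>i - O'\<close>.\<close>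

definition rel_cell :: "tape \<Rightarrow> int \<Rightarrow> symbol" where
  "rel_cell t z = fst t (snd t + z)"

lemma rel_cell_act:
  "rel_cell (tape_act a t) z =
     (if z + int (mvn (snd a)) - 1 = 0 then fst a else rel_cell t (z + int (mvn (snd a)) - 1))"
  by (cases a; cases t; cases "snd a") (auto simp: rel_cell_def algebra_simps)

lemma head_act: "snd (tape_act a t) = snd t + int (mvn (snd a)) - 1"
  by (cases a; cases t; cases "snd a") auto

lemma tape_read_rel: "tape_read t = rel_cell t 0"
  by (cases t) (simp add: rel_cell_def)

lemma rel_cell_word: "rel_cell (word_tape w) z = word_cells w z" "snd (word_tape w) = 0"
  by (simp_all add: rel_cell_def word_tape_def)

text \<open>The halting state is made to idle, so that the tableau can always describe exactly
  \<open>T\<close> steps.\<close>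

definition delta :: "tm \<Rightarrow> nat \<Rightarrow> symbol list \<Rightarrow> nat \<times> (symbol \<times> move) list" where
  "delta M q ss = (if q = 1 then (1, idle ss) else tm_delta M q ss)"

lemma tm_step_delta:
  "tm_step M (q, ts) = (fst (delta M q (map tape_read ts)), map2 tape_act (snd (delta M q (map tape_read ts))) ts)"
  by (simp add: delta_def map2_idle split_beta)

type_synonym rule = "nat \<times> nat list \<times> nat \<times> (nat \<times> nat) list"

definition rule_of :: "tm \<Rightarrow> nat \<Rightarrow> symbol list \<Rightarrow> rule" where
  "rule_of M q ss = (q, map symbol_code ss, fst (delta M q ss), map (\<lambda>a. (symbol_code (fst a), mvn (snd a))) (snd (delta M q ss)))"

text \<open>For a fixed machine this list is a constant, which is how it enters the polynomial-time
  construction of the tableau.\<close>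

definition rules :: "tm \<Rightarrow> rule list" where
  "rules M = concat (map (\<lambda>q. map (rule_of M q) (List.n_lists (tm_tapes M) [None, Some False, Some True])) [0..<tm_states M])"

lemma set_rules: "set (rules M) = {rule_of M q ss | q ss. q < tm_states M \<and> length ss = tm_tapes M}"
proof -
  have "s \<in> {None, Some False, Some True}" for s :: symbol
    by (cases s; cases "the s") auto
  then have "set ss \<subseteq> {None, Some False, Some True}" for ss :: "symbol list" by blast
  then have "set (List.n_lists (tm_tapes M) [None, Some False, Some True]) = {ss. length ss = tm_tapes M}"
    by (auto simp: set_n_lists)
  then have "set (rules M) = (\<Union>q \<in> {0..<tm_states M}. rule_of M q ` {ss. length ss = tm_tapes M})"
    by (simp add: rules_def)
  also have "\<dots> = {rule_of M q ss | q ss. q < tm_states M \<and> length ss = tm_tapes M}"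
    by (auto simp only: atLeastLessThan_iff) blast+
  finally show ?thesis .
qed

definition pre :: "nat \<Rightarrow> nat \<Rightarrow> nat \<Rightarrow> rule \<Rightarrow> var list" where
  "pre K O' t r = (0, t, fst r, 0) # map (\<lambda>p. (2 + fst p, t, O', snd p)) (zip [0..<K] (fst (snd r)))"

text \<open>If \<open>d\<close> is the number of the move, the cell at index \<open>i\<close> after
  the step was at index \<open>i + d - 1\<close> before it, and the one at \<open>O'\<close> has
  just been overwritten. The marker for cell 0 of the output tape is shifted by the inverse map.
  Restricting \<open>i\<close> to \<open>[1..<N]\<close> keeps the truncated subtractions
  exact.\<close>

definition step_clauses :: "nat \<Rightarrow> nat \<Rightarrow> nat \<Rightarrow> nat \<Rightarrow> rule \<Rightarrow> clause list" where
  "step_clauses K O' N t r =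
     (pre K O' t r, [(0, Suc t, fst (snd (snd r)), 0)]) #
     concat (map (\<lambda>p. concat (map (\<lambda>i.
         if i + snd (snd p) - 1 = O' then [(pre K O' t r, [(2 + fst p, Suc t, i, fst (snd p))])]
         else map (\<lambda>s. ((2 + fst p, t, i + snd (snd p) - 1, s) # pre K O' t r, [(2 + fst p, Suc t, i, s)])) [0, 1, 2])
       [1..<N])) (zip [0..<K] (snd (snd (snd r))))) @
     map (\<lambda>i. ((1, t, i, 0) # pre K O' t r, [(1, Suc t, i + 1 - snd (nth_or (0, 0) (snd (snd (snd r))) 0), 0)])) [1..<N]"

text \<open>The cells \<open>O'\<close> to \<open>O' + L - 1\<close> of tape 1 are left open for the
  certificate: each gets some symbol, and a blank is followed by blanks, so that together they form
  a word of length at most \<open>L\<close>.\<close>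

definition init_clauses :: "nat \<Rightarrow> nat \<Rightarrow> nat \<Rightarrow> nat \<Rightarrow> bool list \<Rightarrow> clause list" where
  "init_clauses K O' N L x =
     [([], [(0, 0, 0, 0)]), ([], [(1, 0, O', 0)])] @
     concat (map (\<lambda>j. map (\<lambda>i. ([], [(2 + j, 0, i,
         if j = 0 \<and> O' \<le> i then (case drop (i - O') x of [] \<Rightarrow> 0 | b # _ \<Rightarrow> if b then 2 else 1) else 0)]))
       (filter (\<lambda>i. j = 1 \<longrightarrow> i < O' \<or> O' + L \<le> i) [0..<Suc (N + L)])) [0..<K]) @
     map (\<lambda>z. ([], [(3, 0, O' + z, 0), (3, 0, O' + z, 1), (3, 0, O' + z, 2)])) [0..<L] @
     map (\<lambda>z. ([(3, 0, O' + z, 0)], [(3, 0, O' + Suc z, 0)])) [0..<L]"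

text \<open>The clauses for steps only force variables to be true; acceptance is therefore stated by
  excluding the two symbols other than \<open>True\<close> at cell 0.\<close>

definition final_clauses :: "nat \<Rightarrow> nat \<Rightarrow> clause list" where
  "final_clauses N T = concat (map (\<lambda>i. map (\<lambda>s. ([(1, T, i, 0), (2, T, i, s)], [])) [0, 1]) [0..<Suc N])"

text \<open>Knowledge about the border is lost at a rate of one cell per step on either side. With
  offset \<open>2 * T\<close> and width \<open>4 * T\<close>, the indices from \<open>T\<close> to
  \<open>3 * T\<close> are still known at time \<open>T\<close>, which suffices because the head is
  then at distance at most \<open>T\<close> from cell 0.\<close>

definition tableau :: "tm \<Rightarrow> nat \<Rightarrow> nat \<Rightarrow> bool list \<Rightarrow> clause list" where
  "tableau M L T x =
     init_clauses (tm_tapes M) (2 * T) (4 * T) L x @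
     concat (map (\<lambda>t. concat (map (step_clauses (tm_tapes M) (2 * T) (4 * T) t) (rules M))) [0..<T]) @
     final_clauses (4 * T) T"

lemma PT_diff [PT_intros]:
  assumes "PT m" "PT n" shows "PT (\<lambda>e. m e - n e :: nat)"
proof -
  have "PT (\<lambda>e. length (drop (n e) (replicate (m e) False)))" by (intro PT_intros assms)
  then show ?thesis by simp
qed

lemma PT_tableau:
  assumes "PT L" "PT T" "PT x"
  shows "PT (\<lambda>e. tableau M (L e) (T e) (x e))"
  unfolding tableau_def init_clauses_def step_clauses_def final_clauses_def pre_def
  by (intro PT_intros assms PT_comp[OF _ assms(1)] PT_comp[OF _ assms(2)] PT_comp[OF _ assms(3)])

text \<open>Only the truth of the variables that describe the configuration is claimed; others may
  be true as well. This invariant is preserved by implications alone and is enough for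
  soundness.\<close>

definition tracks :: "(var \<Rightarrow> bool) \<Rightarrow> nat \<Rightarrow> nat \<Rightarrow> nat \<Rightarrow> config \<Rightarrow> bool" where
  "tracks \<sigma> O' N t cf \<longleftrightarrow> \<sigma> (0, t, fst cf, 0) \<and>
     (\<forall>j < length (snd cf). \<forall>i. t \<le> i \<longrightarrow> i + t \<le> N \<longrightarrow> \<sigma> (2 + j, t, i, symbol_code (rel_cell (snd cf ! j) (int i - int O')))) \<and>
     (\<exists>i. int i = int O' - snd (snd cf ! 0) \<and> \<sigma> (1, t, i, 0) \<and> \<bar>snd (snd cf ! 0)\<bar> \<le> int t)"

lemma delta_wf:
  assumes "tm_wf M" "q < tm_states M" "length ss = tm_tapes M"
  shows "fst (delta M q ss) < tm_states M" "length (snd (delta M q ss)) = tm_tapes M"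
  using assms unfolding tm_wf_def delta_def by (auto simp: idle_def)

lemma config_wf:
  assumes "tm_wf M"
  shows "fst ((tm_step M ^^ t) (tm_init M ws)) < tm_states M \<and> length (snd ((tm_step M ^^ t) (tm_init M ws))) = tm_tapes M"
proof (induction t)
  case 0
  then show ?case using assms by (simp add: tm_init_def tm_wf_def)
next
  case (Suc t)
  obtain q ts where "(tm_step M ^^ t) (tm_init M ws) = (q, ts)" by (cases "(tm_step M ^^ t) (tm_init M ws)")
  with Suc show ?case using delta_wf[OF assms, of q "map tape_read ts"] by (simp add: tm_step_delta del: tm_step.simps)
qed

lemma zip_upt: "length l = K \<Longrightarrow> zip [0..<K] l = map (\<lambda>j. (j, l ! j)) [0..<K]"
  by (intro nth_equalityI) auto

lemma ball_concat_map: "(\<forall>c \<in> set (concat (map f l)). P c) \<longleftrightarrow> (\<forall>a \<in> set l. \<forall>c \<in> set (f a). P c)"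
  by auto

lemma ball_map: "(\<forall>c \<in> set (map f l). P c) \<longleftrightarrow> (\<forall>a \<in> set l. P (f a))"
  by auto

lemma pre_holds_iff:
  assumes "length ss = K"
  shows "(\<forall>v \<in> set (pre K O' t (rule_of M q ss)). \<sigma> v) \<longleftrightarrow>
    \<sigma> (0, t, q, 0) \<and> (\<forall>j<K. \<sigma> (2 + j, t, O', symbol_code (ss ! j)))"
  using assms by (auto simp: pre_def rule_of_def zip_upt)

lemma sat_step_clauses:
  assumes len: "length ss = K" "length (snd (delta M q ss)) = K" and K: "0 < K"
    and r: "r = rule_of M q ss"
  shows "(\<forall>c \<in> set (step_clauses K O' N t r). sat \<sigma> c) \<longleftrightarrow>
   ((\<forall>v \<in> set (pre K O' t r). \<sigma> v) \<longrightarrow>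
     \<sigma> (0, Suc t, fst (delta M q ss), 0) \<and>
     (\<forall>j<K. \<forall>i. 1 \<le> i \<longrightarrow> i < N \<longrightarrow>
        (if i + mvn (snd (snd (delta M q ss) ! j)) - 1 = O' then \<sigma> (2 + j, Suc t, i, symbol_code (fst (snd (delta M q ss) ! j)))
         else \<forall>s<3. \<sigma> (2 + j, t, i + mvn (snd (snd (delta M q ss) ! j)) - 1, s) \<longrightarrow> \<sigma> (2 + j, Suc t, i, s))) \<and>
     (\<forall>i. 1 \<le> i \<longrightarrow> i < N \<longrightarrow> \<sigma> (1, t, i, 0) \<longrightarrow> \<sigma> (1, Suc t, i + 1 - mvn (snd (snd (delta M q ss) ! 0)), 0)))"
    (is "?lhs \<longleftrightarrow> (?P \<longrightarrow> ?A \<and> ?B \<and> ?C)")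
proof -
  let ?as = "snd (delta M q ss)"
  have s3: "(\<forall>s<3. Q s) \<longleftrightarrow> (\<forall>s \<in> set [0, 1, 2]. Q s)" for Q :: "nat \<Rightarrow> bool"
    by (auto simp: numeral_3_eq_3 numeral_2_eq_2 less_Suc_eq)
  have z: "zip [0..<K] (snd (snd (snd r))) = map (\<lambda>j. (j, symbol_code (fst (?as ! j)), mvn (snd (?as ! j)))) [0..<K]"
    using len by (simp add: r rule_of_def zip_upt)
  have n: "snd (nth_or (0, 0) (snd (snd (snd r))) 0) = mvn (snd (?as ! 0))"
    using len K by (simp add: r rule_of_def)
  have q': "fst (snd (snd r)) = fst (delta M q ss)" by (simp add: r rule_of_def)
  have "?lhs \<longleftrightarrow> (?P \<longrightarrow> ?A) \<and> (?P \<longrightarrow> ?B) \<and> (?P \<longrightarrow> ?C)"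
    unfolding step_clauses_def n q' z s3 list.set(2) ball_simps(7) set_append ball_Un ball_concat_map ball_map fst_conv snd_conv
    by (auto simp: sat_def split: if_splits)
  then show ?thesis by blast
qed

lemma tracks_step:
  assumes wf: "tm_wf M" and q: "q < tm_states M" and len: "length ts = tm_tapes M"
    and tr: "tracks \<sigma> O' (2 * O') t (q, ts)" and t: "t < O'"
    and sat: "\<forall>r \<in> set (rules M). \<forall>c \<in> set (step_clauses (tm_tapes M) O' (2 * O') t r). sat \<sigma> c"
  shows "tracks \<sigma> O' (2 * O') (Suc t) (tm_step M (q, ts))"
proof -
  let ?K = "tm_tapes M" and ?ss = "map tape_read ts" and ?N = "2 * O'"
  obtain q' as where d: "delta M q ?ss = (q', as)" by (cases "delta M q ?ss")
  have K: "0 < ?K" using wf by (simp add: tm_wf_def)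
  have as: "length as = ?K" using delta_wf(2)[OF wf q, of ?ss] len d by simp
  have cells: "\<sigma> (2 + j, t, i, symbol_code (rel_cell (ts ! j) (int i - int O')))"
    if "j < length ts" "t \<le> i" "i + t \<le> 2 * O'" for j i
    using tr that unfolding tracks_def fst_conv snd_conv by blast
  have p: "\<forall>v \<in> set (pre ?K O' t (rule_of M q ?ss)). \<sigma> v"
  proof (subst pre_holds_iff)
    show "\<sigma> (0, t, q, 0) \<and> (\<forall>j<?K. \<sigma> (2 + j, t, O', symbol_code (?ss ! j)))"
    proof (intro conjI allI impI)
      fix j assume "j < ?K"
      then have "\<sigma> (2 + j, t, O', symbol_code (rel_cell (ts ! j) (int O' - int O')))"
        using t len by (intro cells) auto
      then show "\<sigma> (2 + j, t, O', symbol_code (?ss ! j))" using \<open>j < ?K\<close> len by (simp add: tape_read_rel)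
    qed (use tr in \<open>simp add: tracks_def\<close>)
  qed (use len in simp)
  have rin: "rule_of M q ?ss \<in> set (rules M)"
    unfolding set_rules using q len by (intro CollectI exI[of _ q] exI[of _ ?ss]) simp
  have lss: "length ?ss = ?K" and lad: "length (snd (delta M q ?ss)) = ?K" using len as d by simp_all
  note all = sat_step_clauses[OF lss lad K refl, THEN iffD1, OF bspec[OF sat rin], THEN mp, OF p, unfolded d fst_conv snd_conv]
  have
    A: "\<sigma> (0, Suc t, q', 0)"
    and B: "\<And>j i. j < ?K \<Longrightarrow> 1 \<le> i \<Longrightarrow> i < ?N \<Longrightarrow>
        (if i + mvn (snd (as ! j)) - 1 = O' then \<sigma> (2 + j, Suc t, i, symbol_code (fst (as ! j)))
         else \<forall>s<3. \<sigma> (2 + j, t, i + mvn (snd (as ! j)) - 1, s) \<longrightarrow> \<sigma> (2 + j, Suc t, i, s))"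
    and C: "\<And>i. 1 \<le> i \<Longrightarrow> i < ?N \<Longrightarrow> \<sigma> (1, t, i, 0) \<Longrightarrow> \<sigma> (1, Suc t, i + 1 - mvn (snd (as ! 0)), 0)"
    using all by blast+
  let ?ts = "map2 tape_act as ts"
  have nth: "?ts ! j = tape_act (as ! j) (ts ! j)" if "j < ?K" for j using that len as by simp
  have mv2: "mvn m \<le> 2" for m by (cases m) auto
  show ?thesis
    unfolding tm_step_delta d tracks_def fst_conv snd_conv
  proof (intro conjI allI impI)
    fix j i assume j: "j < length ?ts" and i: "Suc t \<le> i" "i + Suc t \<le> ?N"
    have jK: "j < ?K" using j len as by simp
    let ?m = "mvn (snd (as ! j))" let ?i = "i + ?m - 1"
    have e: "int ?i - int O' = int i - int O' + int ?m - 1" using i by simp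
    note b = B[OF jK, of i]
    show "\<sigma> (2 + j, Suc t, i, symbol_code (rel_cell (?ts ! j) (int i - int O')))"
    proof (cases "?i = O'")
      case True
      then have "int i - int O' + int ?m - 1 = 0" using e by simp
      then show ?thesis using b True i by (simp add: nth[OF jK] rel_cell_act)
    next
      case False
      then have "int i - int O' + int ?m - 1 \<noteq> 0" using e by simp
      moreover have "\<sigma> (2 + j, t, ?i, symbol_code (rel_cell (ts ! j) (int ?i - int O')))"
        using jK len i mv2[of "snd (as ! j)"] by (intro cells) auto
      then have "\<sigma> (2 + j, Suc t, i, symbol_code (rel_cell (ts ! j) (int ?i - int O')))"
        using b False i symbol_code_less by simp
      ultimately show ?thesis unfolding nth[OF jK] rel_cell_act e by simp
    qed
  next
    obtain i where i: "int i = int O' - snd (ts ! 0)" "\<sigma> (1, t, i, 0)" "\<bar>snd (ts ! 0)\<bar> \<le> int t"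
      using tr unfolding tracks_def by auto
    let ?m = "mvn (snd (as ! 0))"
    have "1 \<le> i" "i < ?N" using i(1,3) t by auto
    from C[OF this i(2)] have "\<sigma> (1, Suc t, i + 1 - ?m, 0)" .
    moreover have "int (i + 1 - ?m) = int O' - snd (?ts ! 0)"
      using i(1) \<open>1 \<le> i\<close> mv2[of "snd (as ! 0)"] by (simp add: nth[OF K] head_act of_nat_diff)
    moreover have "\<bar>snd (?ts ! 0)\<bar> \<le> int (Suc t)"
      using i(3) mv2[of "snd (as ! 0)"] by (simp add: nth[OF K] head_act)
    ultimately show "\<exists>i. int i = int O' - snd (?ts ! 0) \<and> \<sigma> (1, Suc t, i, 0) \<and> \<bar>snd (?ts ! 0)\<bar> \<le> int (Suc t)"
      by blast
  qed (rule A)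
qed

lemma init_tape:
  assumes "j < tm_tapes M"
  shows "snd (tm_init M [x, u]) ! j = word_tape (if j = 0 then x else if j = 1 then u else [])"
  using assms by (auto simp: tm_init_def nth_Cons')

lemma init_sym:
  "(if O' \<le> i then (case drop (i - O') x of [] \<Rightarrow> 0 | b # _ \<Rightarrow> if b then 2 else 1) else 0)
     = symbol_code (rel_cell (word_tape x) (int i - int O'))"
proof (cases "O' \<le> i \<and> i - O' < length x")
  case True
  then have "drop (i - O') x = x ! (i - O') # drop (Suc (i - O')) x" by (simp add: Cons_nth_drop_Suc)
  with True show ?thesis by (auto simp: rel_cell_word symbol_code_def nat_diff_distrib)
qed (auto simp: rel_cell_word symbol_code_def)

lemma sat_init_clauses:
  "(\<forall>c \<in> set (init_clauses K O' N L x). sat \<sigma> c) \<longleftrightarrow>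
    \<sigma> (0, 0, 0, 0) \<and> \<sigma> (1, 0, O', 0) \<and>
    (\<forall>j<K. \<forall>i \<le> N + L. (j = 1 \<longrightarrow> i < O' \<or> O' + L \<le> i) \<longrightarrow>
       \<sigma> (2 + j, 0, i, if j = 0 then symbol_code (rel_cell (word_tape x) (int i - int O')) else 0)) \<and>
    (\<forall>z<L. \<exists>s<3. \<sigma> (3, 0, O' + z, s)) \<and>
    (\<forall>z<L. \<sigma> (3, 0, O' + z, 0) \<longrightarrow> \<sigma> (3, 0, O' + Suc z, 0))"
proof -
  have s3: "(\<exists>s<3. Q s) \<longleftrightarrow> (\<exists>s \<in> set [0, 1, 2]. Q s)" for Q :: "nat \<Rightarrow> bool"
    by (auto simp: numeral_3_eq_3 numeral_2_eq_2 less_Suc_eq)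
  have i: "(if j = 0 \<and> O' \<le> i then (case drop (i - O') x of [] \<Rightarrow> 0 | b # _ \<Rightarrow> if b then 2 else 1) else 0)
     = (if j = 0 then symbol_code (rel_cell (word_tape x) (int i - int O')) else 0)" for i and j :: nat
    using init_sym[of O' i x] by auto
  show ?thesis
    unfolding init_clauses_def i s3 set_append ball_Un ball_concat_map ball_map
    by (auto simp: sat_def less_Suc_eq_le simp del: upt_Suc)
qed

lemma tracks_init:
  assumes sat: "\<forall>c \<in> set (init_clauses (tm_tapes M) O' (2 * O') L x). sat \<sigma> c" and K: "2 \<le> tm_tapes M"
  shows "\<exists>u. length u \<le> L \<and> tracks \<sigma> O' (2 * O') 0 (tm_init M [x, u])"
proof -
  let ?K = "tm_tapes M" and ?N = "2 * O'"
  note s = sat[unfolded sat_init_clauses]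
  define l where "l = (LEAST z. z = L \<or> \<sigma> (3, 0, O' + z, 0))"
  have l: "l \<le> L" unfolding l_def by (rule Least_le) simp
  have "l = L \<or> \<sigma> (3, 0, O' + l, 0)" unfolding l_def by (rule LeastI[of _ L]) simp
  moreover have L0: "\<sigma> (3, 0, O' + L, 0)"
    using s[THEN conjunct2, THEN conjunct2, THEN conjunct1, rule_format, of 1 "O' + L"] K by simp
  ultimately have l0: "\<sigma> (3, 0, O' + l, 0)" by auto
  have before: "\<not> \<sigma> (3, 0, O' + z, 0)" "z < L" if "z < l" for z
    using not_less_Least[OF that[unfolded l_def]] that l by auto
  have after: "\<sigma> (3, 0, O' + (l + k), 0)" if "l + k \<le> L" for k
    using that
  proof (induction k)
    case (Suc k) then show ?case using s by simp
  qed (use l0 in simp)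
  define u where "u = map (\<lambda>z. \<sigma> (3, 0, O' + z, 2)) [0..<l]"
  have bit: "\<sigma> (3, 0, O' + z, symbol_code (Some (u ! z)))" if z: "z < l" for z
  proof -
    obtain s' where "s' < 3" "\<sigma> (3, 0, O' + z, s')" using s before(2)[OF z] by blast
    moreover have "s' \<noteq> 0" using calculation before(1)[OF z] by (cases "s' = 0") auto
    ultimately have "\<sigma> (3, 0, O' + z, 1) \<or> \<sigma> (3, 0, O' + z, 2)"
      by (auto simp: numeral_3_eq_3 numeral_2_eq_2 less_Suc_eq)
    then show ?thesis using z by (auto simp: u_def symbol_code_def)
  qed
  have i1: "snd (tm_init M [x, u]) ! 1 = word_tape u" using init_tape[of 1 M x u] K by simp
  note i1 = i1 i1[unfolded One_nat_def]
  have cell: "\<sigma> (2 + j, 0, i, symbol_code (rel_cell (snd (tm_init M [x, u]) ! j) (int i - int O')))"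
    if j: "j < ?K" and i: "i \<le> ?N" for j i
  proof (cases "j = 1")
    case False
    then show ?thesis
      using s[THEN conjunct2, THEN conjunct2, THEN conjunct1, rule_format, OF j, of i] i
      by (auto simp: init_tape[OF j] rel_cell_word symbol_code_def split: if_splits)
  next
    case j1: True
    consider "i < O' \<or> O' + L \<le> i" | z where "i = O' + z" "z < l" | k where "i = O' + (l + k)" "l + k < L"
      by (metis le_add_diff_inverse not_less add.assoc add_less_cancel_left)
    then show ?thesis
    proof cases
      case 1
      then have "\<sigma> (3, 0, i, 0)"
        using s[THEN conjunct2, THEN conjunct2, THEN conjunct1, rule_format, OF j, of i] i j1 by auto
      moreover have "rel_cell (word_tape u) (int i - int O') = None"
        using 1 l by (auto simp: rel_cell_word u_def)
      ultimately show ?thesis using j1 by (simp add: i1 symbol_code_def)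
    next
      case 2
      then have "rel_cell (word_tape u) (int i - int O') = Some (u ! z)"
        by (simp add: rel_cell_word u_def)
      then show ?thesis using bit[OF 2(2)] 2(1) j1 by (simp add: i1)
    next
      case 3
      then have "rel_cell (word_tape u) (int i - int O') = None"
        by (auto simp: rel_cell_word u_def)
      then show ?thesis using after[of k] 3 j1 by (simp add: i1 symbol_code_def)
    qed
  qed
  have "tracks \<sigma> O' ?N 0 (tm_init M [x, u])"
    unfolding tracks_def
  proof (intro conjI allI impI)
    show "\<sigma> (0, 0, fst (tm_init M [x, u]), 0)" using s by (simp add: tm_init_def)
    show "\<sigma> (2 + j, 0, i, symbol_code (rel_cell (snd (tm_init M [x, u]) ! j) (int i - int O')))"
      if "j < length (snd (tm_init M [x, u]))" "i + 0 \<le> ?N" for j i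
      using that by (intro cell) (simp_all add: tm_init_def)
    show "\<exists>i. int i = int O' - snd (snd (tm_init M [x, u]) ! 0) \<and> \<sigma> (1, 0, i, 0) \<and> \<bar>snd (snd (tm_init M [x, u]) ! 0)\<bar> \<le> int 0"
      using s K by (intro exI[of _ O']) (simp add: init_tape rel_cell_word)
  qed
  moreover have "length u \<le> L" using l by (simp add: u_def)
  ultimately show ?thesis by blast
qed

lemma tableau_sound:
  assumes wf: "tm_wf M" and K: "2 \<le> tm_tapes M" and sat: "\<forall>c \<in> set (tableau M L T x). sat \<sigma> c"
  shows "\<exists>u. length u \<le> L \<and> fst (snd ((tm_step M ^^ T) (tm_init M [x, u])) ! 0) 0 = Some True"
proof -
  let ?O = "2 * T"
  have N: "4 * T = 2 * ?O" by simp
  note s = sat[unfolded tableau_def N set_append ball_Un ball_concat_map]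
  obtain u where u: "length u \<le> L" "tracks \<sigma> ?O (2 * ?O) 0 (tm_init M [x, u])"
    using tracks_init[of M ?O L x \<sigma>] s K by auto
  let ?cf = "\<lambda>t. (tm_step M ^^ t) (tm_init M [x, u])"
  have "tracks \<sigma> ?O (2 * ?O) t (?cf t)" if "t \<le> T" for t
    using that
  proof (induction t)
    case 0 then show ?case using u by simp
  next
    case (Suc t)
    obtain q ts where c: "?cf t = (q, ts)" by (cases "?cf t")
    have "tracks \<sigma> ?O (2 * ?O) (Suc t) (tm_step M (q, ts))"
    proof (rule tracks_step[OF wf])
      show "\<forall>r \<in> set (rules M). \<forall>c \<in> set (step_clauses (tm_tapes M) ?O (2 * ?O) t r). sat \<sigma> c"
        using s[THEN conjunct2, THEN conjunct1, rule_format, of t] Suc.prems by simp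
    qed (use config_wf[OF wf, of t "[x, u]"] c Suc in auto)
    then show ?case using c by simp
  qed
  from this[of T] have tr: "tracks \<sigma> ?O (2 * ?O) T (?cf T)" by simp
  let ?t0 = "snd (?cf T) ! 0"
  obtain i where i: "int i = int ?O - snd ?t0" "\<sigma> (1, T, i, 0)" "\<bar>snd ?t0\<bar> \<le> int T"
    using tr unfolding tracks_def by blast
  have "0 < length (snd (?cf T))" using config_wf[OF wf, of T "[x, u]"] K by simp
  moreover have "T \<le> i" "i + T \<le> 2 * ?O" using i(1,3) by auto
  ultimately have "\<sigma> (2 + 0, T, i, symbol_code (rel_cell ?t0 (int i - int ?O)))"
    using tr unfolding tracks_def by blast
  then have c: "\<sigma> (2, T, i, symbol_code (fst ?t0 0))" by (simp add: rel_cell_def i(1))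
  have "\<not> \<sigma> (2, T, i, s)" if "s \<in> {0, 1}" for s
  proof -
    have "([(1, T, i, 0), (2, T, i, s)], []) \<in> set (final_clauses (2 * ?O) T)"
      using that \<open>i + T \<le> 2 * ?O\<close> by (auto simp: final_clauses_def simp del: upt_Suc)
    then have "sat \<sigma> ([(1, T, i, 0), (2, T, i, s)], [])" using s by auto
    then show ?thesis using i(2) by (simp add: sat_def)
  qed
  with c have "symbol_code (fst ?t0 0) \<notin> {0, 1}" by blast
  then have "fst ?t0 0 = Some True" by (auto simp: symbol_code_def split: option.splits if_splits)
  then show ?thesis using u(1) by blast
qed

text \<open>The assignment given by an actual run. Unlike \<open>tracks\<close> it also settles the
  false variables, for clauses whose premises do not fit the run must hold as well.\<close>

definition canonical :: "(nat \<Rightarrow> config) \<Rightarrow> nat \<Rightarrow> var \<Rightarrow> bool" where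
  "canonical cf O' v = (case v of (tag, t, a, b) \<Rightarrow>
     if tag = 0 then a = fst (cf t)
     else if tag = 1 then int a = int O' - snd (snd (cf t) ! 0)
     else b = symbol_code (rel_cell (snd (cf t) ! (tag - 2)) (int a - int O')))"

lemma tableau_complete:
  assumes wf: "tm_wf M" and K: "2 \<le> tm_tapes M" and u: "length u \<le> L"
    and acc: "fst (snd ((tm_step M ^^ T) (tm_init M [x, u])) ! 0) 0 = Some True"
  shows "\<exists>\<sigma>. \<forall>c \<in> set (tableau M L T x). sat \<sigma> c"
proof -
  let ?O = "2 * T" and ?K = "tm_tapes M"
  define cf where "cf t = (tm_step M ^^ t) (tm_init M [x, u])" for t
  let ?\<sigma> = "canonical cf ?O"
  have N: "4 * T = 2 * ?O" by simp
  have cwf: "fst (cf t) < tm_states M" "length (snd (cf t)) = ?K" for t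
    using config_wf[OF wf, of t "[x, u]"] by (simp_all add: cf_def)
  have nil: "rel_cell (word_tape []) z = None" for z by (simp add: rel_cell_word)
  have i0: "snd (cf 0) ! j = word_tape (if j = 0 then x else if j = 1 then u else [])" if "j < ?K" for j
    using init_tape[OF that] by (simp add: cf_def)
  have init: "\<forall>c \<in> set (init_clauses ?K ?O (2 * ?O) L x). sat ?\<sigma> c"
    unfolding sat_init_clauses
  proof (intro conjI allI impI)
    show "?\<sigma> (0, 0, 0, 0)" by (simp add: canonical_def cf_def tm_init_def)
    show "?\<sigma> (1, 0, ?O, 0)" using K by (simp add: canonical_def i0 rel_cell_word)
    fix j i assume j: "j < ?K" and ij: "j = 1 \<longrightarrow> i < ?O \<or> ?O + L \<le> i"
    show "?\<sigma> (2 + j, 0, i, if j = 0 then symbol_code (rel_cell (word_tape x) (int i - int ?O)) else 0)"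
      using j ij u by (auto simp: canonical_def i0 rel_cell_word(1) symbol_code_def split: if_splits)
  next
    fix z assume "z < L"
    have 1: "snd (cf 0) ! Suc 0 = word_tape u" using i0[of 1] K by simp
    show "\<exists>s<3. ?\<sigma> (3, 0, ?O + z, s)"
      by (rule exI[of _ "symbol_code (rel_cell (word_tape u) (int z))"]) (simp add: canonical_def 1 symbol_code_less)
    show "?\<sigma> (3, 0, ?O + Suc z, 0)" if "?\<sigma> (3, 0, ?O + z, 0)"
      using that by (auto simp: canonical_def 1 rel_cell_word(1) symbol_code_def split: if_splits option.splits)
  qed
  have step: "\<forall>c \<in> set (step_clauses ?K ?O (2 * ?O) t r). sat ?\<sigma> c" if r: "r \<in> set (rules M)" for t r
  proof -
    obtain q ss where q: "q < tm_states M" "length ss = ?K" and rr: "r = rule_of M q ss"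
      using r by (auto simp: set_rules)
    have K0: "0 < ?K" using K by simp
    show ?thesis
      unfolding sat_step_clauses[OF q(2) delta_wf(2)[OF wf q] K0 rr]
    proof (rule impI)
      assume "\<forall>v \<in> set (pre ?K ?O t r). ?\<sigma> v"
      then have qt: "q = fst (cf t)" and "\<forall>j<?K. symbol_code (ss ! j) = symbol_code (rel_cell (snd (cf t) ! j) 0)"
        unfolding rr pre_holds_iff[OF q(2)] by (simp_all add: canonical_def)
      then have ss: "ss = map tape_read (snd (cf t))"
        using q(2) cwf(2)[of t] by (intro nth_equalityI) (auto simp: tape_read_rel)
      obtain q' as where d: "delta M q ss = (q', as)" by (cases "delta M q ss")
      have las: "length as = ?K" using delta_wf(2)[OF wf q] d by simp
      have "cf (Suc t) = tm_step M (cf t)" by (simp add: cf_def)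
      also have "\<dots> = (q', map2 tape_act as (snd (cf t)))"
        using tm_step_delta[of M "fst (cf t)" "snd (cf t)"] d qt ss by simp
      finally have nx: "cf (Suc t) = (q', map2 tape_act as (snd (cf t)))" .
      have nth: "snd (cf (Suc t)) ! j = tape_act (as ! j) (snd (cf t) ! j)" if "j < ?K" for j
        using that nx las cwf(2)[of t] by simp
      have mv2: "mvn m \<le> 2" for m by (cases m) auto
      show "?\<sigma> (0, Suc t, fst (delta M q ss), 0) \<and>
       (\<forall>j<?K. \<forall>i. 1 \<le> i \<longrightarrow> i < 2 * ?O \<longrightarrow>
          (if i + mvn (snd (snd (delta M q ss) ! j)) - 1 = ?O then ?\<sigma> (2 + j, Suc t, i, symbol_code (fst (snd (delta M q ss) ! j)))
           else \<forall>s<3. ?\<sigma> (2 + j, t, i + mvn (snd (snd (delta M q ss) ! j)) - 1, s) \<longrightarrow> ?\<sigma> (2 + j, Suc t, i, s))) \<and>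
       (\<forall>i. 1 \<le> i \<longrightarrow> i < 2 * ?O \<longrightarrow> ?\<sigma> (1, t, i, 0) \<longrightarrow> ?\<sigma> (1, Suc t, i + 1 - mvn (snd (snd (delta M q ss) ! 0)), 0))"
        unfolding d fst_conv snd_conv
      proof (intro conjI allI impI)
        show "?\<sigma> (0, Suc t, q', 0)" by (simp add: canonical_def nx)
      next
        fix j i :: nat assume j: "j < ?K" and i: "1 \<le> i"
        let ?m = "mvn (snd (as ! j))" let ?i = "i + ?m - 1"
        have e: "int i - int ?O + int ?m - 1 = int ?i - int ?O" using i by simp
        have r: "rel_cell (snd (cf (Suc t)) ! j) (int i - int ?O) =
            (if ?i = ?O then fst (as ! j) else rel_cell (snd (cf t) ! j) (int ?i - int ?O))"
          unfolding nth[OF j] rel_cell_act e by auto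
        show "if ?i = ?O then ?\<sigma> (2 + j, Suc t, i, symbol_code (fst (as ! j)))
           else \<forall>s<3. ?\<sigma> (2 + j, t, ?i, s) \<longrightarrow> ?\<sigma> (2 + j, Suc t, i, s)"
          using r by (simp add: canonical_def)
      next
        fix i :: nat assume i: "1 \<le> i" and s: "?\<sigma> (1, t, i, 0)"
        then have "int i = int ?O - snd (snd (cf t) ! 0)" by (simp add: canonical_def)
        then show "?\<sigma> (1, Suc t, i + 1 - mvn (snd (as ! 0)), 0)"
          using i mv2[of "snd (as ! 0)"] by (simp add: canonical_def nth[OF K0] head_act of_nat_diff)
      qed
    qed
  qed
  have fin: "sat ?\<sigma> c" if cf: "c \<in> set (final_clauses (2 * ?O) T)" for c
  proof -
    obtain i s where c: "c = ([(1, T, i, 0), (2, T, i, s)], [])" "s \<in> {0, 1}"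
      using cf by (auto simp: final_clauses_def simp del: upt_Suc)
    have "\<not> (?\<sigma> (1, T, i, 0) \<and> ?\<sigma> (2, T, i, s))"
    proof
      assume a: "?\<sigma> (1, T, i, 0) \<and> ?\<sigma> (2, T, i, s)"
      then have "int i = int ?O - snd (snd (cf T) ! 0)" by (simp add: canonical_def)
      then have "rel_cell (snd (cf T) ! 0) (int i - int ?O) = Some True"
        using acc by (simp add: rel_cell_def cf_def)
      then show False using a c(2) by (auto simp: canonical_def symbol_code_def)
    qed
    then show ?thesis by (simp add: c sat_def)
  qed
  show ?thesis
    unfolding tableau_def N
    unfolding set_append ball_Un ball_concat_map
    by (intro exI[of _ ?\<sigma>]) (use init step fin in blast)
qed

lemma halted_stays: "(tm_step M ^^ n) (1, ts) = (1, ts)"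
  by (induction n) auto

text \<open>The Cook-Levin theorem. One time bound \<open>T x\<close> serves all certificates of
  length at most \<open>L x\<close>, because a halted machine keeps its configuration.\<close>

theorem NP_to_clauses:
  assumes "in_NP X"
  shows "\<exists>F :: bool list \<Rightarrow> clause list. PT F \<and> (\<forall>x. x \<in> X \<longleftrightarrow> (\<exists>\<sigma>. \<forall>c \<in> set (F x). sat \<sigma> c))"
proof -
  obtain V q where V: "polytime_relation V" "\<And>x. x \<in> X \<longleftrightarrow> (\<exists>u. length u \<le> poly q (length x) \<and> V x u)"
    using assms unfolding in_NP_def by blast
  obtain M p where M: "tm_wf M" "2 \<le> tm_tapes M"
    "\<And>x u. tm_computes M [x, u] (poly p (length x + length u)) [V x u]"
    using V(1) unfolding polytime_relation_def by blast
  define L where "L x = poly q (length x)" for x :: "bool list"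
  define T where "T x = poly p (length x + L x)" for x
  have fin: "fst (snd ((tm_step M ^^ T x) (tm_init M [x, u])) ! 0) 0 = Some (V x u)" if "length u \<le> L x" for x u
  proof -
    let ?n = "poly p (length x + length u)"
    have n: "?n \<le> T x" unfolding T_def using that by (intro poly_nat_mono) simp
    obtain ts where ts: "(tm_step M ^^ ?n) (tm_init M [x, u]) = (1, ts)" "tape_output (ts ! 0) [V x u]"
      using M(3)[of x u] unfolding tm_computes_def by (auto split: prod.splits)
    have "(tm_step M ^^ T x) (tm_init M [x, u]) = (tm_step M ^^ (T x - ?n)) ((tm_step M ^^ ?n) (tm_init M [x, u]))"
      using n funpow_add[of "T x - ?n" ?n "tm_step M"] by simp
    then show ?thesis using ts halted_stays by (simp add: tape_output_def)
  qed
  let ?F = "\<lambda>x. tableau M (L x) (T x) x"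
  have "PT ?F" unfolding L_def T_def by (intro PT_tableau PT_intros)
  moreover have "x \<in> X \<longleftrightarrow> (\<exists>\<sigma>. \<forall>c \<in> set (?F x). sat \<sigma> c)" for x
  proof
    assume "x \<in> X"
    then obtain u where "length u \<le> L x" "V x u" using V(2) L_def by auto
    then show "\<exists>\<sigma>. \<forall>c \<in> set (?F x). sat \<sigma> c"
      using tableau_complete[OF M(1,2)] fin by simp
  next
    assume "\<exists>\<sigma>. \<forall>c \<in> set (?F x). sat \<sigma> c"
    then obtain u where "length u \<le> L x" "fst (snd ((tm_step M ^^ T x) (tm_init M [x, u])) ! 0) 0 = Some True"
      using tableau_sound[OF M(1,2)] by blast
    then show "x \<in> X" using fin V(2) L_def by auto
  qed
  ultimately show ?thesis by blast
qed


section \<open>Instances as lists\<close>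

text \<open>An instance consists of the number of parameters, the rows of \<open>(A, B, b)\<close>, \<open>(C, c)\<close> and
  \<open>(D, d)\<close>, and the index; the entries are codes for rational numbers.\<close>

type_synonym 'e linst = "nat \<times> ('e list \<times> 'e list \<times> 'e) list \<times> ('e list \<times> 'e) list \<times> ('e list \<times> 'e) list \<times> nat"

text \<open>The valuation \<open>v\<close> of entries is a parameter because the reduction and the
  verifier represent rational numbers differently.\<close>

fun inst_of :: "('e \<Rightarrow> rat) \<Rightarrow> 'e linst \<Rightarrow> inverse_lp" where
  "inst_of v (k, R, C, D, i) = \<lparr>
     dim_m = length R, dim_n = length C, dim_k = k, dim_g = length D,
     A_of = mat (length R) (length C) (\<lambda>(r, j). v (fst (R ! r) ! j)),
     B_of = mat (length R) k (\<lambda>(r, j). v (fst (snd (R ! r)) ! j)),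
     b_of = vec (length R) (\<lambda>r. v (snd (snd (R ! r)))),
     C_of = mat (length C) k (\<lambda>(r, j). v (fst (C ! r) ! j)),
     c_of = vec (length C) (\<lambda>r. v (snd (C ! r))),
     D_of = mat (length D) k (\<lambda>(r, j). v (fst (D ! r) ! j)),
     d_of = vec (length D) (\<lambda>r. v (snd (D ! r))),
     ix = i\<rparr>"

fun shaped :: "'e linst \<Rightarrow> bool" where
  "shaped (k, R, C, D, i) \<longleftrightarrow> (\<forall>r \<in> set R. length (fst r) = length C \<and> length (fst (snd r)) = k) \<and>
     (\<forall>r \<in> set C. length (fst r) = k) \<and> (\<forall>r \<in> set D. length (fst r) = k) \<and> i < length C"

text \<open>The order is that of \<open>enc_instance\<close>, so that the encoding is a single
  concatenation over this list.\<close>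

fun entries :: "'e linst \<Rightarrow> 'e list" where
  "entries (k, R, C, D, i) = concat (map fst R) @ concat (map (\<lambda>r. fst (snd r)) R) @ map (\<lambda>r. snd (snd r)) R @
     concat (map fst C) @ map snd C @ concat (map fst D) @ map snd D"

fun enc_linst :: "('e \<Rightarrow> bool list) \<Rightarrow> 'e linst \<Rightarrow> bool list" where
  "enc_linst ec (k, R, C, D, i) = enc_nat (length R) @ enc_nat (length C) @ enc_nat k @ enc_nat (length D) @
     concat (map ec (entries (k, R, C, D, i))) @ enc_nat i"

lemma valid_inst_of: "shaped P \<Longrightarrow> valid_instance (inst_of v P)"
  by (cases P) (auto simp: valid_instance_def)

lemma rows_of_mat:
  assumes "\<And>r. r \<in> set R \<Longrightarrow> length (f r) = n"
  shows "concat (mat_to_list (mat (length R) n (\<lambda>(r, j). v (f (R ! r) ! j)))) = map v (concat (map f R))"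
proof -
  have "mat_to_list (mat (length R) n (\<lambda>(r, j). v (f (R ! r) ! j))) = map (\<lambda>r. map v (f r)) R"
    unfolding mat_to_list_def using assms by (auto intro!: nth_equalityI)
  then show ?thesis by (simp add: map_concat comp_def)
qed

lemma enc_inst_of:
  assumes "shaped P" "\<And>e. e \<in> set (entries P) \<Longrightarrow> enc_rat (v e) = ec e"
  shows "enc_instance (inst_of v P) = enc_linst ec P"
proof -
  obtain k R C D i where P: "P = (k, R, C, D, i)" by (cases P)
  have e: "concat (map enc_rat (map v l)) = concat (map ec l)" if "set l \<subseteq> set (entries P)" for l
  proof -
    have "map enc_rat (map v l) = map ec l" using that assms(2) by (simp add: subset_iff)
    then show ?thesis by (simp only:)
  qed
  have l: "list_of_vec (vec (length R) (\<lambda>r. v (snd (snd (R ! r))))) = map v (map (\<lambda>r. snd (snd r)) R)"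
    "list_of_vec (vec (length C) (\<lambda>r. v (snd (C ! r)))) = map v (map snd C)"
    "list_of_vec (vec (length D) (\<lambda>r. v (snd (D ! r)))) = map v (map snd D)"
    by (auto intro!: nth_equalityI)
  have m: "concat (mat_to_list (A_of (inst_of v P))) = map v (concat (map fst R))"
    "concat (mat_to_list (B_of (inst_of v P))) = map v (concat (map (\<lambda>r. fst (snd r)) R))"
    "concat (mat_to_list (C_of (inst_of v P))) = map v (concat (map fst C))"
    "concat (mat_to_list (D_of (inst_of v P))) = map v (concat (map fst D))"
    using assms(1) unfolding P by (auto intro!: rows_of_mat)
  have "enc_mat (A_of (inst_of v P)) = concat (map ec (concat (map fst R)))"
    "enc_mat (B_of (inst_of v P)) = concat (map ec (concat (map (\<lambda>r. fst (snd r)) R)))"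
    "enc_mat (C_of (inst_of v P)) = concat (map ec (concat (map fst C)))"
    "enc_mat (D_of (inst_of v P)) = concat (map ec (concat (map fst D)))"
    unfolding enc_mat_def m by (intro e; auto simp: P)+
  moreover have "enc_vec (b_of (inst_of v P)) = concat (map ec (map (\<lambda>r. snd (snd r)) R))"
    "enc_vec (c_of (inst_of v P)) = concat (map ec (map snd C))"
    "enc_vec (d_of (inst_of v P)) = concat (map ec (map snd D))"
    unfolding enc_vec_def P inst_of.simps inverse_lp.simps l
    by (intro e; auto simp: P)+
  ultimately show ?thesis by (simp add: enc_instance_def P)
qed

lemma inst_of_sel [simp]:
  "dim_m (inst_of v (k, R, C, D, i)) = length R" "dim_n (inst_of v (k, R, C, D, i)) = length C"
  "dim_k (inst_of v (k, R, C, D, i)) = k" "dim_g (inst_of v (k, R, C, D, i)) = length D"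
  "A_of (inst_of v (k, R, C, D, i)) = mat (length R) (length C) (\<lambda>(r, j). v (fst (R ! r) ! j))"
  "B_of (inst_of v (k, R, C, D, i)) = mat (length R) k (\<lambda>(r, j). v (fst (snd (R ! r)) ! j))"
  "b_of (inst_of v (k, R, C, D, i)) = vec (length R) (\<lambda>r. v (snd (snd (R ! r))))"
  "C_of (inst_of v (k, R, C, D, i)) = mat (length C) k (\<lambda>(r, j). v (fst (C ! r) ! j))"
  "c_of (inst_of v (k, R, C, D, i)) = vec (length C) (\<lambda>r. v (snd (C ! r)))"
  "D_of (inst_of v (k, R, C, D, i)) = mat (length D) k (\<lambda>(r, j). v (fst (D ! r) ! j))"
  "d_of (inst_of v (k, R, C, D, i)) = vec (length D) (\<lambda>r. v (snd (D ! r)))"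
  "ix (inst_of v (k, R, C, D, i)) = i"
  by simp_all

declare inst_of.simps [simp del]

definition rdot :: "('e \<Rightarrow> rat) \<Rightarrow> 'e list \<Rightarrow> real vec \<Rightarrow> real" where
  "rdot v r y = (\<Sum>j<length r. real_of_rat (v (r ! j)) * y $ j)"

lemma mult_mat_vec_rdot:
  assumes "r < length R" "length (f (R ! r)) = n" "y \<in> carrier_vec n"
  shows "(real_mat (mat (length R) n (\<lambda>(r, j). v (f (R ! r) ! j))) *\<^sub>v y) $ r = rdot v (f (R ! r)) y"
  using assms by (auto simp: scalar_prod_def rdot_def atLeast0LessThan intro!: sum.cong)

lemma X_set_inst_of:
  assumes "shaped (k, R, C, D, i)"
  shows "X_set (inst_of v (k, R, C, D, i)) =
    {x \<in> carrier_vec k. \<forall>r \<in> set D. rdot v (fst r) x \<le> real_of_rat (v (snd r))}"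
proof -
  have "(real_mat (D_of (inst_of v (k, R, C, D, i))) *\<^sub>v x \<le> real_vec (d_of (inst_of v (k, R, C, D, i)))) \<longleftrightarrow>
      (\<forall>r<length D. rdot v (fst (D ! r)) x \<le> real_of_rat (v (snd (D ! r))))" if "x \<in> carrier_vec k" for x
  proof -
    have "(real_mat (D_of (inst_of v (k, R, C, D, i))) *\<^sub>v x) $ r = rdot v (fst (D ! r)) x" if "r < length D" for r
      using mult_mat_vec_rdot[of r D fst k x v] that \<open>x \<in> carrier_vec k\<close> assms by simp
    then show ?thesis by (auto simp: less_eq_vec_def)
  qed
  then show ?thesis by (auto simp: X_set_def all_set_conv_all_nth)
qed

lemma lp_rhs_inst_of:
  assumes "shaped (k, R, C, D, i)" "x \<in> carrier_vec k" "r < length R"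
  shows "lp_rhs (inst_of v (k, R, C, D, i)) x $ r = rdot v (fst (snd (R ! r))) x + real_of_rat (v (snd (snd (R ! r))))"
  using mult_mat_vec_rdot[of r R "\<lambda>r. fst (snd r)" k x v] assms by (simp add: lp_rhs_def)

lemma dim_lp_rhs [simp]: "dim_vec (lp_rhs (inst_of v (k, R, C, D, i)) x) = length R"
  by (simp add: lp_rhs_def)

lemma feasible_Natural:
  assumes "shaped (k, R, C, D, i)" "x \<in> carrier_vec k"
  shows "lp_feasible Natural_Form (inst_of v (k, R, C, D, i)) x =
    {y \<in> carrier_vec (length C). \<forall>r \<in> set R. rdot v (fst r) y \<le> rdot v (fst (snd r)) x + real_of_rat (v (snd (snd r)))}"
proof -
  have "real_mat (A_of (inst_of v (k, R, C, D, i))) *\<^sub>v y \<le> lp_rhs (inst_of v (k, R, C, D, i)) x \<longleftrightarrow>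
    (\<forall>r<length R. rdot v (fst (R ! r)) y \<le> rdot v (fst (snd (R ! r))) x + real_of_rat (v (snd (snd (R ! r)))))"
    if y: "y \<in> carrier_vec (length C)" for y
  proof -
    have "(real_mat (A_of (inst_of v (k, R, C, D, i))) *\<^sub>v y) $ r = rdot v (fst (R ! r)) y" if "r < length R" for r
      using mult_mat_vec_rdot[of r R fst "length C" y v] that y assms by simp
    moreover have dimA: "dim_row (A_of (inst_of v (k, R, C, D, i))) = length R" by simp
    ultimately show ?thesis
      using lp_rhs_inst_of[OF assms] unfolding less_eq_vec_def by (simp add: dimA del: inst_of_sel(5) index_mult_mat_vec)
  qed
  then show ?thesis unfolding lp_feasible.simps inst_of_sel(2) all_set_conv_all_nth by blast
qed

lemma feasible_Standard:
  assumes "shaped (k, R, C, D, i)" "x \<in> carrier_vec k"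
  shows "lp_feasible Standard_Form (inst_of v (k, R, C, D, i)) x =
    {y \<in> carrier_vec (length C). (\<forall>r \<in> set R. rdot v (fst r) y = rdot v (fst (snd r)) x + real_of_rat (v (snd (snd r)))) \<and>
       (\<forall>j<length C. 0 \<le> y $ j)}"
proof -
  have "real_mat (A_of (inst_of v (k, R, C, D, i))) *\<^sub>v y = lp_rhs (inst_of v (k, R, C, D, i)) x \<longleftrightarrow>
    (\<forall>r<length R. rdot v (fst (R ! r)) y = rdot v (fst (snd (R ! r))) x + real_of_rat (v (snd (snd (R ! r)))))"
    if y: "y \<in> carrier_vec (length C)" for y
  proof -
    have "(real_mat (A_of (inst_of v (k, R, C, D, i))) *\<^sub>v y) $ r = rdot v (fst (R ! r)) y" if "r < length R" for r
      using mult_mat_vec_rdot[of r R fst "length C" y v] that y assms by simp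
    moreover have dimA: "dim_row (A_of (inst_of v (k, R, C, D, i))) = length R" by simp
    ultimately show ?thesis
      using lp_rhs_inst_of[OF assms] unfolding vec_eq_iff by (simp add: dimA del: inst_of_sel(5) index_mult_mat_vec)
  qed
  moreover have "0\<^sub>v (length C) \<le> y \<longleftrightarrow> (\<forall>j<length C. 0 \<le> y $ j)" if "y \<in> carrier_vec (length C)" for y :: "real vec"
    using that by (auto simp: less_eq_vec_def)
  ultimately show ?thesis unfolding lp_feasible.simps inst_of_sel(2) all_set_conv_all_nth by blast
qed

lemma objective_inst_of:
  assumes "shaped (k, R, C, D, i)" "x \<in> carrier_vec k" "y \<in> carrier_vec (length C)"
  shows "lp_objective (inst_of v (k, R, C, D, i)) x y =
    (\<Sum>j<length C. (rdot v (fst (C ! j)) x + real_of_rat (v (snd (C ! j)))) * y $ j)"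
proof -
  have "(real_mat (C_of (inst_of v (k, R, C, D, i))) *\<^sub>v x) $ r = rdot v (fst (C ! r)) x" if "r < length C" for r
    using mult_mat_vec_rdot[of r C fst k x v] that assms by simp
  then show ?thesis
    using assms(3) unfolding lp_objective_def by (auto simp: scalar_prod_def atLeast0LessThan intro!: sum.cong)
qed

text \<open>Every equation becomes two opposite inequalities and every sign constraint a row of its
  own. The operations on entries are parameters, for use with both representations;
  \<open>mo\<close> stands for any negative number.\<close>

fun to_natural :: "('e \<Rightarrow> 'e) \<Rightarrow> 'e \<Rightarrow> 'e \<Rightarrow> 'e linst \<Rightarrow> 'e linst" where
  "to_natural ng z mo (k, R, C, D, i) =
     (k, R @ map (\<lambda>r. (map ng (fst r), map ng (fst (snd r)), ng (snd (snd r)))) R @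
         map (\<lambda>j. (map (\<lambda>l. if l = j then mo else z) [0..<length C], replicate k z, z)) [0..<length C], C, D, i)"

lemma rdot_map: "rdot v (map f r) y = rdot (\<lambda>e. v (f e)) r y"
  by (simp add: rdot_def)

lemma rdot_upt: "rdot v (map f [0..<n]) y = (\<Sum>j<n. real_of_rat (v (f j)) * y $ j)"
  by (simp add: rdot_def)

lemma shaped_to_natural: "shaped P \<Longrightarrow> shaped (to_natural ng z mo P)"
  by (cases P) auto

lemma feasible_to_natural:
  assumes sh: "shaped P" and x: "x \<in> carrier_vec (fst P)"
    and v: "\<And>e. v (ng e) = - v e" "v z = 0" "v mo < 0"
  shows "lp_feasible Natural_Form (inst_of v (to_natural ng z mo P)) x = lp_feasible Standard_Form (inst_of v P) x"
proof -
  obtain k R C D i where P: "P = (k, R, C, D, i)" by (cases P)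
  let ?n = "length C"
  let ?N = "to_natural ng z mo P"
  let ?ok = "\<lambda>y r. rdot v (fst r) y \<le> rdot v (fst (snd r)) x + real_of_rat (v (snd (snd r)))"
  let ?neg = "\<lambda>r. (map ng (fst r), map ng (fst (snd r)), ng (snd (snd r)))"
  let ?u = "\<lambda>j. (map (\<lambda>l. if l = j then mo else z) [0..<?n], replicate k z, z)"
  have shN: "shaped (k, R @ map ?neg R @ map ?u [0..<?n], C, D, i)"
    using shaped_to_natural[OF sh, of ng z mo] by (simp add: P)
  have xk: "x \<in> carrier_vec k" using x by (simp add: P)
  have ng: "rdot (\<lambda>e. - v e) r y = - rdot v r y" for r y
    by (simp add: rdot_def of_rat_minus sum_negf)
  have neg: "?ok y (?neg r) \<longleftrightarrow> rdot v (fst r) y \<ge> rdot v (fst (snd r)) x + real_of_rat (v (snd (snd r)))" for y r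
    by (auto simp: rdot_map ng v(1) of_rat_minus)
  have u: "?ok y (?u j) \<longleftrightarrow> 0 \<le> y $ j" if "j < ?n" for y j
  proof -
    have "rdot v (map (\<lambda>l. if l = j then mo else z) [0..<?n]) y = (\<Sum>l<?n. if l = j then real_of_rat (v mo) * y $ l else 0)"
      unfolding rdot_upt by (intro sum.cong) (auto simp: v(2))
    also have "\<dots> = real_of_rat (v mo) * y $ j" using that by (simp add: sum.delta)
    finally show ?thesis using v(3) by (simp add: rdot_def v(2) mult_le_0_iff not_less)
  qed
  have "(\<forall>r \<in> set (R @ map ?neg R @ map ?u [0..<?n]). ?ok y r) \<longleftrightarrow>
      (\<forall>r \<in> set R. rdot v (fst r) y = rdot v (fst (snd r)) x + real_of_rat (v (snd (snd r)))) \<and> (\<forall>j<?n. 0 \<le> y $ j)" for y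
  proof -
    have "(\<forall>r \<in> set (R @ map ?neg R @ map ?u [0..<?n]). ?ok y r) \<longleftrightarrow>
      (\<forall>r \<in> set R. ?ok y r) \<and> (\<forall>r \<in> set R. ?ok y (?neg r)) \<and> (\<forall>j \<in> set [0..<?n]. ?ok y (?u j))"
      unfolding set_append ball_Un ball_map by blast
    also have "\<dots> \<longleftrightarrow> (\<forall>r \<in> set R. rdot v (fst r) y = rdot v (fst (snd r)) x + real_of_rat (v (snd (snd r)))) \<and> (\<forall>j<?n. 0 \<le> y $ j)"
      unfolding neg using u by (auto intro: antisym)
    finally show ?thesis .
  qed
  then show ?thesis
    unfolding P to_natural.simps feasible_Natural[OF shN xk] feasible_Standard[OF sh[unfolded P] xk] by blast
qed

lemma inst_of_to_natural_simps:
  "X_set (inst_of v (to_natural ng z mo P)) = X_set (inst_of v P)"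
  "Y_set (inst_of v (to_natural ng z mo P)) = Y_set (inst_of v P)"
  "lp_objective (inst_of v (to_natural ng z mo P)) = lp_objective (inst_of v P)"
  by (cases P, simp add: X_set_def Y_set_def lp_objective_def fun_eq_iff)+

lemma Opt_to_natural:
  assumes "shaped P" "x \<in> carrier_vec (fst P)" "\<And>e. v (ng e) = - v e" "v z = 0" "v mo < 0"
  shows "Opt Natural_Form (inst_of v (to_natural ng z mo P)) x = Opt Standard_Form (inst_of v P) x"
  using feasible_to_natural[OF assms] by (simp add: Opt_def inst_of_to_natural_simps)

lemma X_set_carrier: "x \<in> X_set (inst_of v P) \<Longrightarrow> x \<in> carrier_vec (fst P)"
  by (cases P) (simp add: X_set_def)

lemma scenarios_to_natural:
  assumes "shaped P" "\<And>e. v (ng e) = - v e" "v z = 0" "v mo < 0"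
  shows "optimistic Natural_Form (inst_of v (to_natural ng z mo P)) \<longleftrightarrow> optimistic Standard_Form (inst_of v P)"
    and "pessimistic Natural_Form (inst_of v (to_natural ng z mo P)) \<longleftrightarrow> pessimistic Standard_Form (inst_of v P)"
proof -
  have O: "Opt Natural_Form (inst_of v (to_natural ng z mo P)) x = Opt Standard_Form (inst_of v P) x"
    if "x \<in> X_set (inst_of v P)" for x
    by (rule Opt_to_natural[OF assms(1) X_set_carrier[OF that] assms(2-4)])
  show "optimistic Natural_Form (inst_of v (to_natural ng z mo P)) \<longleftrightarrow> optimistic Standard_Form (inst_of v P)"
    unfolding optimistic_def inst_of_to_natural_simps using O by auto
  show "pessimistic Natural_Form (inst_of v (to_natural ng z mo P)) \<longleftrightarrow> pessimistic Standard_Form (inst_of v P)"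
    unfolding pessimistic_def inst_of_to_natural_simps using O by auto
qed

section \<open>Binary numbers\<close>

fun inc :: "bool list \<Rightarrow> bool list" where
  "inc [] = [True]"
| "inc (False # l) = True # l"
| "inc (True # l) = False # inc l"

lemma nat_bits_0 [simp]: "nat_bits 0 = []"
  by (simp add: nat_bits.simps)

lemma nat_bits_pos: "0 < n \<Longrightarrow> nat_bits n = odd n # nat_bits (n div 2)"
  by (subst nat_bits.simps) simp

lemma nat_bits_Suc: "nat_bits (Suc n) = inc (nat_bits n)"
proof (induction n rule: less_induct)
  case (less n)
  show ?case
  proof (cases "even n")
    case True
    then have "nat_bits (Suc n) = True # nat_bits (n div 2)" by (simp add: nat_bits_pos)
    moreover have "inc (nat_bits n) = True # nat_bits (n div 2)"
      using True by (cases "n = 0") (simp_all add: nat_bits_pos)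
    ultimately show ?thesis by simp
  next
    case False
    then have n: "0 < n" by (cases n) auto
    have "Suc n div 2 = Suc (n div 2)" using False by simp
    then have "nat_bits (Suc n) = False # nat_bits (Suc (n div 2))"
      using False by (simp add: nat_bits_pos)
    also have "nat_bits (Suc (n div 2)) = inc (nat_bits (n div 2))" using n by (intro less) simp
    finally show ?thesis using n False by (simp add: nat_bits_pos[OF n])
  qed
qed

lemma length_inc: "length (inc l) \<le> Suc (length l)"
  by (induction l rule: inc.induct) auto

lemma length_nat_bits: "length (nat_bits n) \<le> n"
proof (induction n)
  case 0 then show ?case by simp
next
  case (Suc n) then show ?case using length_inc[of "nat_bits n"] by (simp add: nat_bits_Suc)
qed

definition inc_step :: "bool \<Rightarrow> bool \<times> bool list \<Rightarrow> bool \<times> bool list" where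
  "inc_step b s = (fst s \<and> b, (b \<noteq> fst s) # snd s)"

text \<open>The recursion is turned into a fold over the carry and the reversed output, for which
  polynomial time is available.\<close>

lemma inc_fold: "inc l = (let s = fold inc_step l (True, []) in rev (snd s) @ (if fst s then [True] else []))"
proof -
  have F: "fold inc_step l (False, out) = (False, rev l @ out)" for l out
    by (induction l arbitrary: out) (auto simp: inc_step_def)
  have "(let s = fold inc_step l (True, out) in rev (snd s) @ (if fst s then [True] else [])) = rev out @ inc l" for out
    by (induction l arbitrary: out rule: inc.induct) (auto simp: inc_step_def F)
  then show ?thesis by simp
qed

lemma PT_inc [PT_intros]:
  assumes "PT l" shows "PT (\<lambda>e. inc (l e))"
proof -
  have "PT (\<lambda>e. fold inc_step (l e) (True, []))"
  proof (rule PT_fold_add[where c="\<lambda>_. 8"])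
    show "sz (inc_step a s) \<le> sz s + 8" for a s
      using sz_bool[of "fst s \<and> a"] sz_bool[of "a \<noteq> fst s"] by (cases s) (simp add: inc_step_def)
    show "PT (\<lambda>p. inc_step (fst (snd p)) (snd (snd p)))"
      unfolding inc_step_def by (intro PT_intros)
  qed (intro PT_intros assms)+
  then show ?thesis unfolding inc_fold by (intro PT_intros) simp_all
qed

text \<open>The argument is unary, so counting up to it in binary takes polynomially many
  increments.\<close>

lemma PT_nat_bits [PT_intros]:
  assumes "PT n" shows "PT (\<lambda>e. nat_bits (n e))"
proof -
  have it: "fold (\<lambda>_. inc) (replicate k False) [] = nat_bits k" for k
    by (induction k) (simp_all add: nat_bits_Suc flip: replicate_append_same)
  have "PT (\<lambda>e. fold (\<lambda>_. inc) (replicate (n e) False) [])"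
  proof (rule PT_fold)
    show "PB (\<lambda>e. 1 + 4 * sz (n e))" by (intro PT_intros PB_sz assms)
    fix e k assume "k \<le> length (replicate (n e) False)"
    then have k: "k \<le> n e" by simp
    then have "sz (nat_bits k) \<le> 1 + 4 * sz (n e)"
      using sz_bools[of "nat_bits k"] length_nat_bits[of k] by simp
    then show "sz (fold (\<lambda>_. inc) (take k (replicate (n e) False)) []) \<le> 1 + 4 * sz (n e)"
      using k by (simp only: take_replicate min.absorb1 it)
  qed (intro PT_intros assms)+
  then show ?thesis by (simp only: it)
qed

definition enc_bits :: "bool list \<Rightarrow> bool list" where
  "enc_bits l = concat (map (\<lambda>b. [True, b]) l) @ [False]"

lemma enc_nat_bits: "enc_nat n = enc_bits (nat_bits n)"
  by (simp add: enc_nat_def enc_bits_def)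

lemma PT_enc_bits [PT_intros]: "PT l \<Longrightarrow> PT (\<lambda>e. enc_bits (l e))"
  unfolding enc_bits_def by (intro PT_intros)

lemma PT_enc_linst:
  fixes ec :: "'e::enc \<Rightarrow> bool list"
  assumes "PT ec" "PT P" shows "PT (\<lambda>x. enc_linst ec (P x))"
proof -
  have *: "enc_linst ec P = enc_linst ec (fst P, fst (snd P), fst (snd (snd P)), fst (snd (snd (snd P))), snd (snd (snd (snd P))))" for P :: "'e linst"
    by simp
  show ?thesis
    unfolding * enc_linst.simps entries.simps enc_nat_bits
    by (intro PT_intros assms PT_comp[OF PT_snd[OF PT_id] assms(1)])
qed


section \<open>From clauses to instances\<close>

text \<open>The reduction only produces small integers, for which unary magnitudes suffice.\<close>

type_synonym sint = "bool \<times> nat"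

definition sval :: "sint \<Rightarrow> rat" where
  "sval e = (if fst e then - of_nat (snd e) else of_nat (snd e))"

text \<open>The sign is dropped at zero, since \<open>enc_int\<close> encodes 0 as nonnegative. The
  trailing number is the denominator 1.\<close>

definition enc_sint :: "sint \<Rightarrow> bool list" where
  "enc_sint e = (fst e \<and> 0 < snd e) # enc_nat (snd e) @ enc_nat 1"

definition sneg :: "sint \<Rightarrow> sint" where
  "sneg e = (\<not> fst e, snd e)"

abbreviation zer :: sint where "zer \<equiv> (False, 0)"
abbreviation one :: sint where "one \<equiv> (False, 1)"
abbreviation mone :: sint where "mone \<equiv> (True, 1)"

lemma sval_simps [simp]: "sval zer = 0" "sval one = 1" "sval mone = -1" "sval (False, n) = of_nat n" "sval (True, n) = - of_nat n" "sval (sneg e) = - sval e"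
  by (simp_all add: sval_def sneg_def)

declare of_rat_minus [simp]

lemma enc_rat_sval: "enc_rat (sval e) = enc_sint e"
proof -
  define z where "z = (if fst e then - int (snd e) else int (snd e))"
  have "sval e = of_int z" by (simp add: sval_def z_def)
  then have "quotient_of (sval e) = (z, 1)" by simp
  then show ?thesis by (auto simp: enc_rat_def enc_int_def enc_sint_def z_def)
qed

definition clause_vars :: "clause list \<Rightarrow> var list" where
  "clause_vars F = remdups (concat (map (\<lambda>c. fst c @ snd c) F))"

text \<open>For each parameter \<open>x\<^sub>v\<close> the program has variables with \<open>y\<^sub>v + s\<^sub>v = x\<^sub>v\<close> and
  \<open>y\<^sub>v + s'\<^sub>v = 1 - x\<^sub>v\<close>, and it maximizes \<open>y\<^sub>0 = \<Sum> y\<^sub>v = \<Sum> min x\<^sub>v (1 - x\<^sub>v)\<close>. Hence the value is zero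
  if and only if \<open>x\<close> is a 0/1 vector.\<close>

definition lp_rows :: "nat \<Rightarrow> (sint list \<times> sint list \<times> sint) list" where
  "lp_rows V =
     (map (\<lambda>j. if j = 0 then one else if j \<le> V then mone else zer) [0..<1 + 3 * V], replicate V zer, zer) #
     map (\<lambda>v. (map (\<lambda>j. if j = 1 + v \<or> j = 1 + V + v then one else zer) [0..<1 + 3 * V],
               map (\<lambda>j. if j = v then one else zer) [0..<V], zer)) [0..<V] @
     map (\<lambda>v. (map (\<lambda>j. if j = 1 + v \<or> j = 1 + 2 * V + v then one else zer) [0..<1 + 3 * V],
               map (\<lambda>j. if j = v then mone else zer) [0..<V], one)) [0..<V]"

definition lp_cost :: "nat \<Rightarrow> (sint list \<times> sint) list" where
  "lp_cost V = map (\<lambda>j. (replicate V zer, if j = 0 then mone else zer)) [0..<1 + 3 * V]"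

text \<open>For the sets N and P of negated and positive variables, the row says that the sum over N
  minus the sum over P is at most \<open>card N - 1\<close>. Repeated literals must count once, and
  a variable in both sets has coefficient 0.\<close>

definition clause_row :: "var list \<Rightarrow> clause \<Rightarrow> sint list \<times> sint" where
  "clause_row vs c =
     (map (\<lambda>u. if u \<in> set (fst c) \<and> u \<notin> set (snd c) then one
               else if u \<notin> set (fst c) \<and> u \<in> set (snd c) then mone else zer) vs,
      case remdups (fst c) of [] \<Rightarrow> mone | a # r \<Rightarrow> (False, length r))"

definition clause_inst :: "clause list \<Rightarrow> sint linst" where
  "clause_inst F = (length (clause_vars F), lp_rows (length (clause_vars F)), lp_cost (length (clause_vars F)),
     map (clause_row (clause_vars F)) F, 0)"

lemma shaped_clause_inst: "shaped (clause_inst F)"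
  by (auto simp: clause_inst_def lp_rows_def lp_cost_def clause_row_def simp del: upt_Suc)

text \<open>At a 0/1 point the left side counts true negated variables minus true positive ones. It
  reaches the number of negated variables only if all of these and no positive ones are true, that
  is, if the clause is violated.\<close>

lemma clause_row_sum:
  assumes vs: "distinct vs" "set (fst c) \<subseteq> set vs" "set (snd c) \<subseteq> set vs" and x: "\<And>v. v < length vs \<Longrightarrow> x $ v = of_bool (\<sigma> (vs ! v))"
  shows "rdot sval (fst (clause_row vs c)) x \<le> real_of_rat (sval (snd (clause_row vs c))) \<longleftrightarrow> sat \<sigma> c"
proof -
  let ?N = "set (fst c)" and ?P = "set (snd c)"
  let ?co = "\<lambda>u. (if u \<in> ?N then of_bool (\<sigma> u) else 0) - (if u \<in> ?P then of_bool (\<sigma> u) else 0) :: real"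
  have "rdot sval (fst (clause_row vs c)) x = (\<Sum>v<length vs. ?co (vs ! v))"
    unfolding rdot_def clause_row_def by (intro sum.cong) (auto simp: x)
  also have "\<dots> = (\<Sum>u\<in>set vs. ?co u)"
    using sum.reindex_bij_betw[OF bij_betw_nth[OF vs(1) refl refl], of ?co] by (simp add: lessThan_def)
  also have "\<dots> = (\<Sum>u\<in>set vs. if u \<in> ?N then of_bool (\<sigma> u) else 0) - (\<Sum>u\<in>set vs. if u \<in> ?P then of_bool (\<sigma> u) else 0)"
    by (rule sum_subtractf)
  also have "(\<Sum>u\<in>set vs. if u \<in> ?N then of_bool (\<sigma> u) else (0::real)) = real (card {u \<in> ?N. \<sigma> u})"
    using vs(2) by (subst sum.inter_restrict[symmetric]) (auto simp: Int_absorb1 sum.If_cases of_bool_def Int_def intro!: arg_cong[of _ _ card])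
  also have "(\<Sum>u\<in>set vs. if u \<in> ?P then of_bool (\<sigma> u) else (0::real)) = real (card {u \<in> ?P. \<sigma> u})"
    using vs(3) by (subst sum.inter_restrict[symmetric]) (auto simp: Int_absorb1 sum.If_cases of_bool_def Int_def intro!: arg_cong[of _ _ card])
  finally have l: "rdot sval (fst (clause_row vs c)) x = real (card {u \<in> ?N. \<sigma> u}) - real (card {u \<in> ?P. \<sigma> u})" .
  have "real_of_rat (sval (snd (clause_row vs c))) = real (length (remdups (fst c))) - 1"
    by (simp add: clause_row_def split: list.split)
  then have r: "real_of_rat (sval (snd (clause_row vs c))) = real (card ?N) - 1"
    by (simp add: length_remdups_card_conv)
  have "real (card {u \<in> ?N. \<sigma> u}) - real (card {u \<in> ?P. \<sigma> u}) \<le> real (card ?N) - 1 \<longleftrightarrow>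
      card {u \<in> ?N. \<sigma> u} + 1 \<le> card ?N + card {u \<in> ?P. \<sigma> u}" by linarith
  also have "\<dots> \<longleftrightarrow> sat \<sigma> c"
  proof (cases "\<forall>u \<in> ?N. \<sigma> u")
    case True
    then have "{u \<in> ?N. \<sigma> u} = ?N" by auto
    moreover have "0 < card {u \<in> ?P. \<sigma> u} \<longleftrightarrow> (\<exists>u \<in> ?P. \<sigma> u)" by (auto simp: card_gt_0_iff)
    ultimately show ?thesis using True by (simp add: sat_def Suc_le_eq)
  next
    case False
    then have "{u \<in> ?N. \<sigma> u} \<subset> ?N" by auto
    then have "card {u \<in> ?N. \<sigma> u} < card ?N" by (intro psubset_card_mono) auto
    then show ?thesis using False by (auto simp: sat_def)
  qed
  finally show ?thesis unfolding l r .
qed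

lemma rdot_single:
  assumes "a < n"
  shows "rdot sval (map (\<lambda>j. if j = a then e else zer) [0..<n]) y = real_of_rat (sval e) * y $ a"
proof -
  have "rdot sval (map (\<lambda>j. if j = a then e else zer) [0..<n]) y = (\<Sum>j<n. if j = a then real_of_rat (sval e) * y $ j else 0)"
    unfolding rdot_upt by (intro sum.cong) auto
  then show ?thesis using assms by (simp add: sum.delta)
qed

lemma rdot_two:
  assumes "a < n" "b < n" "a \<noteq> b"
  shows "rdot sval (map (\<lambda>j. if j = a \<or> j = b then one else zer) [0..<n]) y = y $ a + y $ b"
proof -
  have "rdot sval (map (\<lambda>j. if j = a \<or> j = b then one else zer) [0..<n]) y
    = (\<Sum>j<n. (if j = a then y $ j else 0) + (if j = b then y $ j else 0))"
    unfolding rdot_upt using assms(3) by (intro sum.cong) auto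
  then show ?thesis using assms by (simp add: sum.distrib sum.delta)
qed

lemma rdot_first:
  "rdot sval (map (\<lambda>j. if j = 0 then one else if j \<le> V then mone else zer) [0..<1 + 3 * V]) y = y $ 0 - (\<Sum>v<V. y $ (1 + v))"
proof -
  have "rdot sval (map (\<lambda>j. if j = 0 then one else if j \<le> V then mone else zer) [0..<1 + 3 * V]) y
    = (\<Sum>j<Suc (3 * V). if j = 0 then y $ 0 else if j \<le> V then - y $ j else 0)"
    unfolding rdot_upt by (intro sum.cong) auto
  also have "\<dots> = y $ 0 + (\<Sum>j<3 * V. if j < V then - y $ Suc j else 0)"
    by (simp add: sum.lessThan_Suc_shift Suc_le_eq del: sum.lessThan_Suc)
  also have "(\<Sum>j<3 * V. if j < V then - y $ Suc j else 0) = (\<Sum>j<V. - y $ Suc j)"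
    by (subst sum.inter_filter[symmetric]) (auto intro!: sum.cong)
  finally show ?thesis by (simp add: sum_negf)
qed

lemma rdot_zer: "rdot sval (replicate n zer) y = 0"
  by (simp add: rdot_def)

lemma lp_feasible_clause_inst:
  assumes x: "x \<in> carrier_vec (length (clause_vars F))" and V: "V = length (clause_vars F)"
  shows "lp_feasible Standard_Form (inst_of sval (clause_inst F)) x =
    {y \<in> carrier_vec (1 + 3 * V). y $ 0 = (\<Sum>v<V. y $ (1 + v)) \<and>
       (\<forall>v<V. y $ (1 + v) + y $ (1 + V + v) = x $ v \<and> y $ (1 + v) + y $ (1 + 2 * V + v) = 1 - x $ v) \<and>
       (\<forall>j<1 + 3 * V. 0 \<le> y $ j)}"
proof -
  have sh: "shaped (V, lp_rows V, lp_cost V, map (clause_row (clause_vars F)) F, 0)"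
    using shaped_clause_inst[of F] by (simp add: clause_inst_def V del: shaped.simps)
  have C: "length (lp_cost V) = 1 + 3 * V" by (simp add: lp_cost_def)
  have "(\<forall>r \<in> set (lp_rows V). rdot sval (fst r) y = rdot sval (fst (snd r)) x + real_of_rat (sval (snd (snd r)))) \<longleftrightarrow>
    y $ 0 = (\<Sum>v<V. y $ (1 + v)) \<and>
       (\<forall>v<V. y $ (1 + v) + y $ (1 + V + v) = x $ v) \<and> (\<forall>v<V. y $ (1 + v) + y $ (1 + 2 * V + v) = 1 - x $ v)" for y
  proof -
    have "(\<forall>r \<in> set (lp_rows V). rdot sval (fst r) y = rdot sval (fst (snd r)) x + real_of_rat (sval (snd (snd r)))) \<longleftrightarrow>
      y $ 0 - (\<Sum>v<V. y $ (1 + v)) = 0 \<and>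
      (\<forall>v \<in> set [0..<V]. rdot sval (map (\<lambda>j. if j = 1 + v \<or> j = 1 + V + v then one else zer) [0..<1 + 3 * V]) y = x $ v) \<and>
      (\<forall>v \<in> set [0..<V]. rdot sval (map (\<lambda>j. if j = 1 + v \<or> j = 1 + 2 * V + v then one else zer) [0..<1 + 3 * V]) y = - x $ v + 1)"
      unfolding lp_rows_def list.set(2) ball_simps(7) set_append ball_Un ball_map fst_conv snd_conv rdot_first rdot_zer
      by (auto simp: rdot_single simp del: upt_Suc upt_conv_Cons)
    moreover have "rdot sval (map (\<lambda>j. if j = 1 + v \<or> j = 1 + V + v then one else zer) [0..<1 + 3 * V]) y = y $ (1 + v) + y $ (1 + V + v)"
      if "v < V" for v
      by (rule rdot_two) (use that in auto)
    moreover have "rdot sval (map (\<lambda>j. if j = 1 + v \<or> j = 1 + 2 * V + v then one else zer) [0..<1 + 3 * V]) y = y $ (1 + v) + y $ (1 + 2 * V + v)"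
      if "v < V" for v
      by (rule rdot_two) (use that in auto)
    ultimately show ?thesis by (auto simp: algebra_simps)
  qed
  then show ?thesis
    using feasible_Standard[OF sh x[folded V], of sval] C unfolding clause_inst_def V[symmetric] by auto
qed

lemma lp_objective_clause_inst:
  assumes x: "x \<in> carrier_vec (length (clause_vars F))" and y: "y \<in> carrier_vec (1 + 3 * length (clause_vars F))"
  shows "lp_objective (inst_of sval (clause_inst F)) x y = - y $ 0"
proof -
  let ?V = "length (clause_vars F)"
  have sh: "shaped (?V, lp_rows ?V, lp_cost ?V, map (clause_row (clause_vars F)) F, 0)"
    using shaped_clause_inst[of F] by (simp add: clause_inst_def del: shaped.simps)
  have C: "length (lp_cost ?V) = 1 + 3 * ?V" by (simp add: lp_cost_def)
  have "lp_objective (inst_of sval (clause_inst F)) x y =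
    (\<Sum>j<1 + 3 * ?V. (rdot sval (fst (lp_cost ?V ! j)) x + real_of_rat (sval (snd (lp_cost ?V ! j)))) * y $ j)"
    unfolding clause_inst_def using objective_inst_of[OF sh x] y by (simp add: C)
  also have "\<dots> = (\<Sum>j<1 + 3 * ?V. if j = 0 then - y $ j else 0)"
    by (intro sum.cong) (auto simp: lp_cost_def rdot_zer simp del: upt_Suc)
  also have "\<dots> = - y $ 0" by (simp add: sum.delta)
  finally show ?thesis .
qed

lemma X_set_clause_inst:
  "X_set (inst_of sval (clause_inst F)) = {x \<in> carrier_vec (length (clause_vars F)). \<forall>c \<in> set F.
     rdot sval (fst (clause_row (clause_vars F) c)) x \<le> real_of_rat (sval (snd (clause_row (clause_vars F) c)))}"
  using X_set_inst_of[OF shaped_clause_inst[of F, unfolded clause_inst_def], of sval]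
  by (simp add: clause_inst_def)

lemma clause_vars_props:
  "distinct (clause_vars F)" "c \<in> set F \<Longrightarrow> set (fst c) \<subseteq> set (clause_vars F)" "c \<in> set F \<Longrightarrow> set (snd c) \<subseteq> set (clause_vars F)"
  by (auto simp: clause_vars_def)

text \<open>At a 0/1 point one of the bounds \<open>x $ v\<close> and \<open>1 - x $ v\<close> is 0,
  so all feasible solutions have \<open>y $ 0 = 0\<close>. They are then all optimal, and it remains
  to exhibit one.\<close>

lemma satisfiable_pessimistic:
  assumes "\<forall>c \<in> set F. sat \<sigma> c"
  shows "pessimistic Standard_Form (inst_of sval (clause_inst F))"
proof -
  let ?vs = "clause_vars F" let ?V = "length ?vs" let ?I = "inst_of sval (clause_inst F)"
  define x where "x = vec ?V (\<lambda>v. of_bool (\<sigma> (?vs ! v)) :: real)"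
  have xV: "x \<in> carrier_vec ?V" by (simp add: x_def)
  have "x \<in> X_set ?I"
    unfolding X_set_clause_inst using clause_row_sum[of ?vs _ x \<sigma>] clause_vars_props assms xV by (auto simp: x_def)
  moreover have feas: "y $ 0 = 0" if "y \<in> lp_feasible Standard_Form ?I x" for y
  proof -
    have y: "y $ 0 = (\<Sum>v<?V. y $ (1 + v))"
      "\<And>v. v < ?V \<Longrightarrow> y $ (1 + v) + y $ (1 + ?V + v) = x $ v \<and> y $ (1 + v) + y $ (1 + 2 * ?V + v) = 1 - x $ v"
      "\<And>j. j < 1 + 3 * ?V \<Longrightarrow> 0 \<le> y $ j"
      using that unfolding lp_feasible_clause_inst[OF xV refl] by auto
    have "y $ (1 + v) = 0" if "v < ?V" for v
      using y(2)[OF that] y(3)[of "1 + v"] y(3)[of "1 + ?V + v"] y(3)[of "1 + 2 * ?V + v"] that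
      by (cases "\<sigma> (?vs ! v)") (auto simp: x_def)
    then show ?thesis using y(1) by simp
  qed
  moreover have "lp_feasible Standard_Form ?I x \<noteq> {}"
  proof -
    \<comment> \<open>The slack variables take the full values \<open>x\<close> and
      \<open>1 - x\<close>, and everything else is 0.\<close>
    define y where "y = vec (1 + 3 * ?V) (\<lambda>j. if j \<le> ?V then 0 else if j \<le> 2 * ?V then x $ (j - 1 - ?V) else 1 - x $ (j - 1 - 2 * ?V) :: real)"
    have "y \<in> lp_feasible Standard_Form ?I x"
      unfolding lp_feasible_clause_inst[OF xV refl]
    proof (intro CollectI conjI allI impI)
      show "y \<in> carrier_vec (1 + 3 * ?V)" by (simp add: y_def)
      show "y $ 0 = (\<Sum>v<?V. y $ (1 + v))" by (simp add: y_def)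
      fix v assume "v < ?V"
      then show "y $ (1 + v) + y $ (1 + ?V + v) = x $ v" "y $ (1 + v) + y $ (1 + 2 * ?V + v) = 1 - x $ v"
        by (auto simp: y_def)
    next
      fix j assume j: "j < 1 + 3 * ?V"
      have x01: "0 \<le> x $ v" "x $ v \<le> 1" if "v < ?V" for v using that by (auto simp: x_def)
      show "0 \<le> y $ j"
        using j x01[of "j - 1 - ?V"] x01[of "j - 1 - 2 * ?V"] by (auto simp: y_def)
    qed
    then show ?thesis by blast
  qed
  moreover have "dim_n ?I = 1 + 3 * ?V" "ix ?I = 0" by (simp_all add: clause_inst_def lp_cost_def)
  moreover have car: "y \<in> carrier_vec (1 + 3 * ?V)" if "y \<in> lp_feasible Standard_Form ?I x" for y
    using that unfolding lp_feasible_clause_inst[OF xV refl] by blast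
  moreover have "lp_objective ?I x y = - y $ 0" if "y \<in> lp_feasible Standard_Form ?I x" for y
    by (rule lp_objective_clause_inst[OF xV car[OF that]])
  ultimately have "Opt Standard_Form ?I x = lp_feasible Standard_Form ?I x" "lp_feasible Standard_Form ?I x \<subseteq> Y_set ?I"
    unfolding Opt_def Y_set_def by auto
  then show ?thesis
    unfolding pessimistic_def using \<open>x \<in> X_set ?I\<close> \<open>lp_feasible Standard_Form ?I x \<noteq> {}\<close> by auto
qed

lemma optimistic_satisfiable:
  assumes "optimistic Standard_Form (inst_of sval (clause_inst F))"
  shows "\<exists>\<sigma>. \<forall>c \<in> set F. sat \<sigma> c"
proof -
  let ?vs = "clause_vars F" let ?V = "length ?vs" let ?I = "inst_of sval (clause_inst F)"
  obtain x y where x: "x \<in> X_set ?I" and y: "y \<in> Opt Standard_Form ?I x" "y \<in> Y_set ?I"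
    using assms unfolding optimistic_def by auto
  have xV: "x \<in> carrier_vec ?V" using x by (simp add: X_set_clause_inst)
  have "ix ?I = 0" by (simp add: clause_inst_def)
  then have y0: "y $ 0 = 0" using y(2) by (simp add: Y_set_def)
  have yf: "y \<in> lp_feasible Standard_Form ?I x" using y(1) by (simp add: Opt_def)
  \<comment> \<open>The parameter polyhedron has no rows for the unit cube. A parameter outside of
    the cube makes the program infeasible, so it cannot have an optimal solution.\<close>
  have x01: "0 \<le> x $ v" "x $ v \<le> 1" if "v < ?V" for v
  proof -
    have "y $ (1 + v) + y $ (1 + ?V + v) = x $ v \<and> y $ (1 + v) + y $ (1 + 2 * ?V + v) = 1 - x $ v"
      "\<And>j. j < 1 + 3 * ?V \<Longrightarrow> 0 \<le> y $ j"
      using yf that unfolding lp_feasible_clause_inst[OF xV refl] by auto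
    from this(1) this(2)[of "1 + v"] this(2)[of "1 + ?V + v"] this(2)[of "1 + 2 * ?V + v"]
    show "0 \<le> x $ v" "x $ v \<le> 1" using that by auto
  qed
  let ?m = "\<lambda>v. min (x $ v) (1 - x $ v)"
  \<comment> \<open>Every summand is raised to its upper bound. As a competitor of the optimal
    \<open>y\<close>, this point shows that the sum of the bounds is at most
    \<open>y $ 0 = 0\<close>.\<close>
  define z where "z = vec (1 + 3 * ?V) (\<lambda>j. if j = 0 then (\<Sum>v<?V. ?m v) else if j \<le> ?V then ?m (j - 1)
    else if j \<le> 2 * ?V then x $ (j - 1 - ?V) - ?m (j - 1 - ?V) else 1 - x $ (j - 1 - 2 * ?V) - ?m (j - 1 - 2 * ?V))"
  have m0: "0 \<le> ?m v" if "v < ?V" for v using x01[OF that] by simp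
  have z0: "z $ 0 = (\<Sum>v<?V. ?m v)" by (simp add: z_def)
  have "z \<in> lp_feasible Standard_Form ?I x"
    unfolding lp_feasible_clause_inst[OF xV refl]
  proof (intro CollectI conjI allI impI)
    show "z \<in> carrier_vec (1 + 3 * ?V)" by (simp add: z_def)
    show "z $ 0 = (\<Sum>v<?V. z $ (1 + v))" unfolding z0 by (intro sum.cong) (auto simp: z_def)
    fix v assume "v < ?V"
    then show "z $ (1 + v) + z $ (1 + ?V + v) = x $ v" "z $ (1 + v) + z $ (1 + 2 * ?V + v) = 1 - x $ v"
      by (auto simp: z_def)
  next
    fix j assume j: "j < 1 + 3 * ?V"
    consider "j = 0" | "0 < j" "j \<le> ?V" | "?V < j" "j \<le> 2 * ?V" | "2 * ?V < j" by linarith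
    then show "0 \<le> z $ j"
    proof cases
      case 1 show ?thesis unfolding 1 z0 by (rule sum_nonneg) (use m0 in auto)
    next
      case 2 then show ?thesis using m0[of "j - 1"] j by (simp add: z_def)
    next
      case 3 then show ?thesis using j by (simp add: z_def)
    next
      case 4 then show ?thesis using j by (simp add: z_def)
    qed
  qed
  then have "lp_objective ?I x y \<le> lp_objective ?I x z" using y(1) by (simp add: Opt_def)
  moreover have "lp_objective ?I x u = - u $ 0" if "u \<in> lp_feasible Standard_Form ?I x" for u
    by (rule lp_objective_clause_inst[OF xV]) (use that in \<open>unfold lp_feasible_clause_inst[OF xV refl], blast\<close>)
  ultimately have "(\<Sum>v<?V. ?m v) \<le> 0"
    using yf \<open>z \<in> lp_feasible Standard_Form ?I x\<close> y0 z0 by simp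
  then have "(\<Sum>v<?V. ?m v) = 0" using m0 by (intro antisym sum_nonneg) auto
  then have "\<forall>v \<in> {..<?V}. ?m v = 0" using m0 by (subst (asm) sum_nonneg_eq_0_iff) auto
  then have bin: "x $ v = 0 \<or> x $ v = 1" if "v < ?V" for v using that by (auto simp: min_def split: if_splits)
  define \<sigma> where "\<sigma> u = (\<exists>v<?V. ?vs ! v = u \<and> x $ v = 1)" for u
  have "x $ v = of_bool (\<sigma> (?vs ! v))" if "v < ?V" for v
    using bin[OF that] that nth_eq_iff_index_eq[OF clause_vars_props(1)] by (auto simp: \<sigma>_def)
  then have "sat \<sigma> c" if "c \<in> set F" for c
    using clause_row_sum[of ?vs c x \<sigma>] clause_vars_props(1)[of F] clause_vars_props(2,3)[OF that] x that
    by (auto simp: X_set_clause_inst)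
  then show ?thesis by blast
qed

definition form_inst :: "lp_form \<Rightarrow> ('e \<Rightarrow> 'e) \<Rightarrow> 'e \<Rightarrow> 'e \<Rightarrow> 'e linst \<Rightarrow> 'e linst" where
  "form_inst form ng z mo P = (case form of Natural_Form \<Rightarrow> to_natural ng z mo P | Standard_Form \<Rightarrow> P)"

lemma shaped_form_inst: "shaped P \<Longrightarrow> shaped (form_inst form ng z mo P)"
  unfolding form_inst_def by (cases form) (simp_all only: lp_form.case shaped_to_natural)

lemma PT_to_natural:
  fixes ng :: "'e::enc \<Rightarrow> 'e"
  assumes "PT ng" "PT z" "PT mo" "PT P"
  shows "PT (\<lambda>e. to_natural ng (z e) (mo e) (P e))"
proof -
  have *: "to_natural ng z mo P = to_natural ng z mo (fst P, fst (snd P), fst (snd (snd P)), fst (snd (snd (snd P))), snd (snd (snd (snd P))))"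
    for P :: "'e linst" and z mo by simp
  show ?thesis
    unfolding * to_natural.simps
    by (intro PT_intros assms PT_comp[OF _ assms(1)] PT_comp[OF PT_fst[OF PT_id] assms(2)]
      PT_comp[OF PT_fst[OF PT_id] assms(4)] PT_comp[OF PT_fst[OF PT_fst[OF PT_id]] assms(2)]
      PT_comp[OF PT_fst[OF PT_fst[OF PT_id]] assms(3)])
qed

lemma PT_clause_inst: "PT clause_inst"
  unfolding clause_inst_def clause_vars_def lp_rows_def lp_cost_def clause_row_def
  by (intro PT_intros)

lemma PT_enc_sint: "PT enc_sint"
  unfolding enc_sint_def enc_nat_bits by (intro PT_intros)

lemma PT_sneg: "PT sneg"
  unfolding sneg_def by (intro PT_intros)

section \<open>Injectivity of the encoding of instances\<close>

definition prefix_inj :: "('a \<Rightarrow> bool list) \<Rightarrow> bool" where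
  "prefix_inj f \<longleftrightarrow> (\<forall>a b r s. f a @ r = f b @ s \<longrightarrow> a = b \<and> r = s)"

lemma prefix_injD: "prefix_inj f \<Longrightarrow> f a @ r = f b @ s \<Longrightarrow> a = b \<and> r = s"
  unfolding prefix_inj_def by blast

fun val :: "bool list \<Rightarrow> nat" where
  "val [] = 0"
| "val (b # l) = of_bool b + 2 * val l"

lemma val_nat_bits [simp]: "val (nat_bits n) = n"
proof (induction n rule: less_induct)
  case (less n)
  show ?case
  proof (cases "n = 0")
    case False
    then have "val (nat_bits n) = of_bool (odd n) + 2 * (n div 2)" using less[of "n div 2"] by (simp add: nat_bits_pos)
    then show ?thesis by (cases "even n") auto
  qed simp
qed

lemma prefix_inj_enc_bits: "prefix_inj enc_bits"
proof -
  have "a = b \<and> r = s" if "concat (map (\<lambda>b. [True, b]) a) @ False # r = concat (map (\<lambda>b. [True, b]) b) @ False # s" for a b r s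
    using that
  proof (induction a arbitrary: b)
    case Nil then show ?case by (cases b) auto
  next
    case (Cons x a)
    then obtain b' where "b = x # b'" by (cases b) auto
    then show ?case using Cons.IH[of b'] Cons.prems by simp
  qed
  note * = this
  show ?thesis
    unfolding prefix_inj_def enc_bits_def
  proof (intro allI impI)
    fix a b r s
    assume "(concat (map (\<lambda>b. [True, b]) a) @ [False]) @ r = (concat (map (\<lambda>b. [True, b]) b) @ [False]) @ s"
    then show "a = b \<and> r = s" using *[of a r b s] by simp
  qed
qed

lemma prefix_inj_enc_nat: "prefix_inj enc_nat"
  unfolding prefix_inj_def enc_nat_bits using prefix_injD[OF prefix_inj_enc_bits] val_nat_bits by metis

lemma prefix_inj_enc_rat: "prefix_inj enc_rat"
  unfolding prefix_inj_def
proof (intro allI impI)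
  fix a b r s assume e: "enc_rat a @ r = enc_rat b @ s"
  obtain p q p' q' where q: "quotient_of a = (p, q)" "quotient_of b = (p', q')" by fastforce
  have "(p < 0) = (p' < 0)" and 1: "enc_nat (nat \<bar>p\<bar>) @ enc_nat (nat q) @ r = enc_nat (nat \<bar>p'\<bar>) @ enc_nat (nat q') @ s"
    using e by (simp_all add: enc_rat_def enc_int_def q)
  moreover from prefix_injD[OF prefix_inj_enc_nat 1] have "nat \<bar>p\<bar> = nat \<bar>p'\<bar>" and 2: "enc_nat (nat q) @ r = enc_nat (nat q') @ s" by auto
  moreover from prefix_injD[OF prefix_inj_enc_nat 2] have "nat q = nat q'" "r = s" by auto
  moreover have "q > 0" "q' > 0" using q quotient_of_denom_pos by blast+
  ultimately have "p = p'" "q = q'" "r = s" by auto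
  then show "a = b \<and> r = s" using q by (metis quotient_of_inject)
qed

lemma concat_map_inj:
  "prefix_inj f \<Longrightarrow> length l = length l' \<Longrightarrow> concat (map f l) @ r = concat (map f l') @ s \<Longrightarrow> l = l' \<and> r = s"
proof (induction l arbitrary: l')
  case (Cons a l)
  then obtain a' l'' where "l' = a' # l''" by (cases l') auto
  with Cons.prems(3) have "f a @ (concat (map f l) @ r) = f a' @ (concat (map f l'') @ s)" by simp
  from prefix_injD[OF Cons.prems(1) this] show ?case using Cons.IH[of l''] Cons.prems \<open>l' = a' # l''\<close> by auto
qed simp

lemma enc_mat_inj:
  assumes "A \<in> carrier_mat m n" "A' \<in> carrier_mat m n" "enc_mat A @ r = enc_mat A' @ s"
  shows "A = A' \<and> r = s"
proof -
  have len: "length (mat_to_list B) = m" "\<And>row. row \<in> set (mat_to_list B) \<Longrightarrow> length row = n" if "B \<in> carrier_mat m n" for B :: "rat mat"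
    using that by (auto simp: mat_to_list_def)
  have "length (concat (mat_to_list B)) = m * n" if "B \<in> carrier_mat m n" for B :: "rat mat"
    using that by (simp add: mat_to_list_def length_concat comp_def sum_list_triv)
  then have c: "concat (mat_to_list A) = concat (mat_to_list A')" "r = s"
    using concat_map_inj[OF prefix_inj_enc_rat _ assms(3)[unfolded enc_mat_def]] assms(1,2) by auto
  have "mat_to_list A = mat_to_list A'"
  proof (rule concat_injective[OF c(1)])
    show "length (mat_to_list A) = length (mat_to_list A')" using len assms(1,2) by simp
    show "\<forall>(x, y) \<in> set (zip (mat_to_list A) (mat_to_list A')). length x = length y"
    proof clarify
      fix a b assume ab: "(a, b) \<in> set (zip (mat_to_list A) (mat_to_list A'))"
      show "length a = length b"
        using len(2)[OF assms(1) set_zip_leftD[OF ab]] len(2)[OF assms(2) set_zip_rightD[OF ab]] by simp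
    qed
  qed
  moreover have "B $$ (i, j) = mat_to_list B ! i ! j" if "B \<in> carrier_mat m n" "i < m" "j < n" for B :: "rat mat" and i j
    using that by (simp add: mat_to_list_def)
  ultimately have e: "A $$ (i, j) = A' $$ (i, j)" if "i < m" "j < n" for i j
    using assms(1,2) that by metis
  have "A = A'" by (rule eq_matI) (use assms(1,2) e in simp_all)
  then show ?thesis using c(2) by simp
qed

lemma enc_vec_inj:
  assumes "u \<in> carrier_vec n" "w \<in> carrier_vec n" "enc_vec u @ r = enc_vec w @ s"
  shows "u = w \<and> r = s"
proof -
  have "list_of_vec u = list_of_vec w \<and> r = s"
    using concat_map_inj[OF prefix_inj_enc_rat _ assms(3)[unfolded enc_vec_def]] assms(1,2) by simp
  then show ?thesis by (metis vec_list)
qed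

text \<open>The dimensions come first and tell how many entries each part has, so the parts can be
  peeled off one after another. Injectivity matters since membership of a word in the language only
  yields some instance with that encoding.\<close>

lemma enc_instance_inj:
  assumes P: "valid_instance P" and Q: "valid_instance Q" and e: "enc_instance P = enc_instance Q"
  shows "P = Q"
proof -
  note n = prefix_injD[OF prefix_inj_enc_nat]
  from e have "enc_nat (dim_m P) @ (enc_nat (dim_n P) @ (enc_nat (dim_k P) @ (enc_nat (dim_g P) @ (enc_mat (A_of P) @ (enc_mat (B_of P) @ (enc_vec (b_of P) @
     (enc_mat (C_of P) @ (enc_vec (c_of P) @ (enc_mat (D_of P) @ (enc_vec (d_of P) @ (enc_nat (ix P) @ []))))))))))) =
     enc_nat (dim_m Q) @ (enc_nat (dim_n Q) @ (enc_nat (dim_k Q) @ (enc_nat (dim_g Q) @ (enc_mat (A_of Q) @ (enc_mat (B_of Q) @ (enc_vec (b_of Q) @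
     (enc_mat (C_of Q) @ (enc_vec (c_of Q) @ (enc_mat (D_of Q) @ (enc_vec (d_of Q) @ (enc_nat (ix Q) @ [])))))))))))"
    by (simp add: enc_instance_def)
  note e = n[OF this]
  note e = e n[OF conjunct2[OF e]]
  note e = e n[OF conjunct2[OF e(2)]]
  note e = e n[OF conjunct2[OF e(3)]]
  have c: "A_of P \<in> carrier_mat (dim_m P) (dim_n P)" "B_of P \<in> carrier_mat (dim_m P) (dim_k P)"
     "b_of P \<in> carrier_vec (dim_m P)" "C_of P \<in> carrier_mat (dim_n P) (dim_k P)" "c_of P \<in> carrier_vec (dim_n P)"
     "D_of P \<in> carrier_mat (dim_g P) (dim_k P)" "d_of P \<in> carrier_vec (dim_g P)"
    "A_of Q \<in> carrier_mat (dim_m P) (dim_n P)" "B_of Q \<in> carrier_mat (dim_m P) (dim_k P)"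
     "b_of Q \<in> carrier_vec (dim_m P)" "C_of Q \<in> carrier_mat (dim_n P) (dim_k P)" "c_of Q \<in> carrier_vec (dim_n P)"
     "D_of Q \<in> carrier_mat (dim_g P) (dim_k P)" "d_of Q \<in> carrier_vec (dim_g P)"
    using P Q e by (simp_all add: valid_instance_def)
  note f = enc_mat_inj[OF c(1,8) conjunct2[OF e(4)]]
  note f = f enc_mat_inj[OF c(2,9) conjunct2[OF f]]
  note f = f enc_vec_inj[OF c(3,10) conjunct2[OF f(2)]]
  note f = f enc_mat_inj[OF c(4,11) conjunct2[OF f(3)]]
  note f = f enc_vec_inj[OF c(5,12) conjunct2[OF f(4)]]
  note f = f enc_mat_inj[OF c(6,13) conjunct2[OF f(5)]]
  note f = f enc_vec_inj[OF c(7,14) conjunct2[OF f(6)]]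
  note f = f n[OF conjunct2[OF f(7)]]
  show ?thesis using e f by (intro inverse_lp.equality) simp_all
qed

text \<open>The constructed instances have a fixed objective and do not distinguish the scenarios.
  So it suffices that \<open>Q\<close> lies between the strongest and the weakest condition in
  question, which covers all variants at once.\<close>

theorem NP_hard_problem_language:
  assumes Q: "\<And>P. Q P \<Longrightarrow> optimistic form P \<or> pessimistic form P"
    "\<And>P. \<lbrakk>fixed_objective P; optimistic form P; pessimistic form P\<rbrakk> \<Longrightarrow> Q P"
  shows "NP_hard (problem_language Q)"
  unfolding NP_hard_def
proof (intro allI impI)
  fix X assume "in_NP X"
  then obtain F :: "bool list \<Rightarrow> clause list" where F: "PT F" "\<And>x. x \<in> X \<longleftrightarrow> (\<exists>\<sigma>. \<forall>c \<in> set (F x). sat \<sigma> c)"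
    using NP_to_clauses by blast
  define G where "G = (\<lambda>x. form_inst form sneg zer mone (clause_inst (F x)))"
  define f where "f x = enc_linst enc_sint (G x)" for x
  have i: "PT (\<lambda>x. clause_inst (F x))" by (rule PT_comp[OF F(1) PT_clause_inst])
  have "PT G"
    unfolding G_def form_inst_def
    by (cases form) (simp_all add: i PT_to_natural[OF PT_sneg PT_const PT_const i])
  then have "PT f" unfolding f_def by (rule PT_enc_linst[OF PT_enc_sint])
  moreover have "x \<in> X \<longleftrightarrow> f x \<in> problem_language Q" for x
  proof -
    let ?P = "inst_of sval (G x)"
    have sh: "shaped (G x)"
      unfolding G_def by (rule shaped_form_inst[OF shaped_clause_inst])
    have enc: "enc_instance ?P = f x" unfolding f_def by (rule enc_inst_of[OF sh enc_rat_sval])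
    have valid: "valid_instance ?P" by (rule valid_inst_of[OF sh])
    have sc: "optimistic form ?P \<longleftrightarrow> optimistic Standard_Form (inst_of sval (clause_inst (F x)))"
      "pessimistic form ?P \<longleftrightarrow> pessimistic Standard_Form (inst_of sval (clause_inst (F x)))"
      unfolding G_def form_inst_def
      using scenarios_to_natural[OF shaped_clause_inst, where v=sval and ng=sneg and z=zer and mo=mone]
      by (cases form; simp)+
    have po: "pessimistic Standard_Form I \<Longrightarrow> optimistic Standard_Form I" for I
      unfolding pessimistic_def optimistic_def by blast
    have fo: "fixed_objective ?P"
    proof -
      have "fixed_objective (inst_of sval (clause_inst (F x)))"
        by (auto simp: fixed_objective_def clause_inst_def lp_cost_def simp del: upt_Suc)
      moreover have "C_of ?P = C_of (inst_of sval (clause_inst (F x)))" "dim_n ?P = dim_n (inst_of sval (clause_inst (F x)))"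
        "dim_k ?P = dim_k (inst_of sval (clause_inst (F x)))"
        unfolding G_def form_inst_def by (cases form; cases "clause_inst (F x)"; simp)+
      ultimately show ?thesis by (simp add: fixed_objective_def)
    qed
    show ?thesis
    proof
      assume "x \<in> X"
      then have "pessimistic Standard_Form (inst_of sval (clause_inst (F x)))"
        using F(2) satisfiable_pessimistic by blast
      then have "Q ?P" using Q(2) fo sc po by blast
      then show "f x \<in> problem_language Q"
        unfolding problem_language_def using enc[symmetric] valid by blast
    next
      assume "f x \<in> problem_language Q"
      then obtain P' where P': "f x = enc_instance P'" "valid_instance P'" "Q P'"
        unfolding problem_language_def by blast
      have "P' = ?P" using enc_instance_inj[OF P'(2) valid] P'(1) enc by simp
      then have "optimistic Standard_Form (inst_of sval (clause_inst (F x)))"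
        using Q(1) P'(3) sc po by blast
      then show "x \<in> X" using F(2) optimistic_satisfiable by blast
    qed
  qed
  ultimately show "polytime_reducible X (problem_language Q)"
    unfolding polytime_reducible_def using polytime_function_PT by blast
qed


section \<open>Linear inequalities\<close>

text \<open>A pair stands for the inequality \<open>(\<Sum>j. fst c j * z j) \<le> snd c\<close>.
  The inductive form keeps multipliers implicit, so that repeated elimination needs no bookkeeping
  of indices; \<open>combos_multipliers\<close> recovers them.\<close>

inductive_set combos :: "(('j \<Rightarrow> real) \<times> real) set \<Rightarrow> (('j \<Rightarrow> real) \<times> real) set" for C where
  base: "c \<in> C \<Longrightarrow> c \<in> combos C"
| add: "c \<in> combos C \<Longrightarrow> d \<in> combos C \<Longrightarrow> (\<lambda>j. fst c j + fst d j, snd c + snd d) \<in> combos C"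
| scale: "c \<in> combos C \<Longrightarrow> 0 \<le> r \<Longrightarrow> (\<lambda>j. r * fst c j, r * snd c) \<in> combos C"

lemma combos_mono: "C' \<subseteq> combos C \<Longrightarrow> combos C' \<subseteq> combos C"
proof
  fix c assume "C' \<subseteq> combos C" "c \<in> combos C'"
  from this(2,1) show "c \<in> combos C" by induction (auto intro: combos.intros)
qed

lemma between_bounds:
  fixes lo hi :: "'a \<Rightarrow> real"
  assumes "finite A" "finite B" "\<And>a b. a \<in> A \<Longrightarrow> b \<in> B \<Longrightarrow> lo a \<le> hi b"
  shows "\<exists>t. (\<forall>a \<in> A. lo a \<le> t) \<and> (\<forall>b \<in> B. t \<le> hi b)"
proof (cases "A = {}")
  case True
  show ?thesis
  proof (cases "B = {}")
    case False then show ?thesis using True assms(2) by (intro exI[of _ "Min (hi ` B)"]) auto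
  qed (use True in auto)
next
  case False
  then show ?thesis using assms by (intro exI[of _ "Max (lo ` A)"]) auto
qed

text \<open>By Fourier-Motzkin elimination of the unknowns in \<open>J\<close>.\<close>

lemma infeasible_combination:
  fixes J :: "'j set"
  assumes "finite J" "finite C" "\<And>c j. c \<in> C \<Longrightarrow> j \<notin> J \<Longrightarrow> fst c j = 0"
    and "\<nexists>z. \<forall>c \<in> C. (\<Sum>j\<in>J. fst c j * z j) \<le> snd c"
  shows "\<exists>c \<in> combos C. (\<forall>j. fst c j = 0) \<and> snd c < 0"
  using assms
proof (induction J arbitrary: C rule: finite_induct)
  case empty
  then obtain c where "c \<in> C" "snd c < 0" by (auto simp: not_le)
  then show ?case using empty.prems(2)[of c] by (intro bexI[of _ c]) (auto intro: combos.base)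
next
  case (insert k J)
  define P where "P = {c \<in> C. 0 < fst c k}"
  define N where "N = {c \<in> C. fst c k < 0}"
  \<comment> \<open>The coefficient of \<open>k\<close> cancels, and both factors are positive for
    \<open>c\<close> in \<open>P\<close> and \<open>d\<close> in \<open>N\<close>.\<close>
  define comb :: "(('j \<Rightarrow> real) \<times> real) \<times> (('j \<Rightarrow> real) \<times> real) \<Rightarrow> ('j \<Rightarrow> real) \<times> real" where "comb = (\<lambda>(c, d). (\<lambda>j. - fst d k * fst c j + fst c k * fst d j, - fst d k * snd c + fst c k * snd d))"
  define C' where "C' = {c \<in> C. fst c k = 0} \<union> comb ` (P \<times> N)"
  have comb: "comb (c, d) \<in> combos C" if "c \<in> P" "d \<in> N" for c d
  proof -
    have "(\<lambda>j. - fst d k * fst c j, - fst d k * snd c) \<in> combos C"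
      "(\<lambda>j. fst c k * fst d j, fst c k * snd d) \<in> combos C"
      using that combos.scale[OF combos.base, of c C "- fst d k"] combos.scale[OF combos.base, of d C "fst c k"]
      by (simp_all add: P_def N_def)
    from combos.add[OF this] show ?thesis by (simp add: comb_def)
  qed
  have sub: "combos C' \<subseteq> combos C"
    by (rule combos_mono) (auto simp: C'_def intro: combos.base comb)
  have fin: "finite C'" using insert.prems(1) by (simp add: C'_def P_def N_def)
  have supp: "fst c j = 0" if "c \<in> C'" "j \<notin> J" for c j
  proof (cases "j = k")
    case True then show ?thesis using that by (auto simp: C'_def comb_def)
  next
    case False
    then have z: "fst c' j = 0" if "c' \<in> C" for c' using insert.prems(2)[OF that, of j] \<open>j \<notin> J\<close> by simp
    consider "c \<in> C" | c1 c2 where "c1 \<in> C" "c2 \<in> C" "c = comb (c1, c2)"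
      using \<open>c \<in> C'\<close> unfolding C'_def P_def N_def by auto
    then show ?thesis by cases (simp_all add: z comb_def)
  qed
  have "\<nexists>z. \<forall>c \<in> C'. (\<Sum>j\<in>J. fst c j * z j) \<le> snd c"
  proof
    assume "\<exists>z. \<forall>c \<in> C'. (\<Sum>j\<in>J. fst c j * z j) \<le> snd c"
    then obtain z where z: "\<And>c. c \<in> C' \<Longrightarrow> (\<Sum>j\<in>J. fst c j * z j) \<le> snd c" by blast
    let ?s = "\<lambda>c. \<Sum>j\<in>J. fst c j * z j"
    let ?q = "\<lambda>c. (snd c - ?s c) / fst c k"
    \<comment> \<open>The combined inequalities say that each lower bound on the eliminated unknown,
      from \<open>N\<close>, is at most each upper bound, from \<open>P\<close>.\<close>
    have "?q d \<le> ?q c" if "d \<in> N" "c \<in> P" for c d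
    proof -
      have "(\<Sum>j\<in>J. fst (comb (c, d)) j * z j) \<le> snd (comb (c, d))"
        using that by (intro z) (auto simp: C'_def)
      moreover have "(\<Sum>j\<in>J. fst (comb (c, d)) j * z j) = - fst d k * ?s c + fst c k * ?s d"
        by (simp add: comb_def sum.distrib sum_distrib_left algebra_simps sum_subtractf sum_negf)
      ultimately have "- fst d k * ?s c + fst c k * ?s d \<le> - fst d k * snd c + fst c k * snd d"
        by (simp add: comb_def)
      moreover have "fst d k < 0" "0 < fst c k" using that by (auto simp: P_def N_def)
      ultimately show ?thesis by (simp add: field_simps)
    qed
    then obtain t where t: "\<And>d. d \<in> N \<Longrightarrow> ?q d \<le> t" "\<And>c. c \<in> P \<Longrightarrow> t \<le> ?q c"
    proof -
      have "finite N" "finite P" using insert.prems(1) by (auto simp: P_def N_def)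
      from between_bounds[OF this, of ?q ?q] \<open>\<And>d c. d \<in> N \<Longrightarrow> c \<in> P \<Longrightarrow> ?q d \<le> ?q c\<close>
      show thesis using that by blast
    qed
    have "(\<Sum>j\<in>insert k J. fst c j * (z(k := t)) j) \<le> snd c" if "c \<in> C" for c
    proof -
      have "(\<Sum>j\<in>J. fst c j * (z(k := t)) j) = ?s c"
        using insert.hyps(2) by (intro sum.cong) auto
      then have e: "(\<Sum>j\<in>insert k J. fst c j * (z(k := t)) j) = fst c k * t + ?s c"
        using insert.hyps by simp
      have "fst c k = 0 \<or> c \<in> P \<or> c \<in> N" using \<open>c \<in> C\<close> unfolding P_def N_def by force
      then consider "fst c k = 0" | "c \<in> P" | "c \<in> N" by blast
      then show ?thesis
      proof cases
        case 1 then show ?thesis using z[of c] \<open>c \<in> C\<close> e by (simp add: C'_def)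
      next
        case 2 then show ?thesis using t(2)[of c] e by (simp add: P_def field_simps)
      next
        case 3 then show ?thesis using t(1)[of c] e by (simp add: N_def field_simps)
      qed
    qed
    then show False using insert.prems(3) by blast
  qed
  from insert.IH[OF fin supp this] show ?case using sub by blast
qed

lemma combos_multipliers:
  assumes "finite I" "c \<in> combos ((\<lambda>i. (a i, b i)) ` I)"
  shows "\<exists>l. (\<forall>i\<in>I. 0 \<le> l i) \<and> (\<forall>j. fst c j = (\<Sum>i\<in>I. l i * a i j)) \<and> snd c = (\<Sum>i\<in>I. l i * b i)"
  using assms(2)
proof induction
  case (base c)
  then obtain i where "i \<in> I" "c = (a i, b i)" by auto
  then show ?case
    using assms(1) by (intro exI[of _ "\<lambda>i'. if i' = i then 1 else 0"]) (auto simp: if_distribR if_distrib[of "\<lambda>x. x * _"] sum.delta cong: if_cong)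
next
  case (add c d)
  then obtain l l' where "\<forall>i\<in>I. 0 \<le> l i" "\<forall>j. fst c j = (\<Sum>i\<in>I. l i * a i j)" "snd c = (\<Sum>i\<in>I. l i * b i)"
    "\<forall>i\<in>I. 0 \<le> l' i" "\<forall>j. fst d j = (\<Sum>i\<in>I. l' i * a i j)" "snd d = (\<Sum>i\<in>I. l' i * b i)" by blast
  then show ?case
    by (intro exI[of _ "\<lambda>i. l i + l' i"]) (auto simp: distrib_right sum.distrib)
next
  case (scale c r)
  then obtain l where "\<forall>i\<in>I. 0 \<le> l i" "\<forall>j. fst c j = (\<Sum>i\<in>I. l i * a i j)" "snd c = (\<Sum>i\<in>I. l i * b i)" by blast
  then show ?case
    using scale.hyps(2) by (intro exI[of _ "\<lambda>i. r * l i"]) (auto simp: sum_distrib_left mult.assoc)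
qed

lemma farkas:
  fixes a :: "'i \<Rightarrow> 'j \<Rightarrow> real"
  assumes "finite I" "finite J" "\<nexists>z. \<forall>i\<in>I. (\<Sum>j\<in>J. a i j * z j) \<le> b i"
  shows "\<exists>l. (\<forall>i\<in>I. 0 \<le> l i) \<and> (\<forall>j\<in>J. (\<Sum>i\<in>I. l i * a i j) = 0) \<and> (\<Sum>i\<in>I. l i * b i) < 0"
proof -
  define a' where "a' i j = (if j \<in> J then a i j else 0)" for i j
  let ?C = "(\<lambda>i. (a' i, b i)) ` I"
  have "\<exists>c \<in> combos ?C. (\<forall>j. fst c j = 0) \<and> snd c < 0"
    by (rule infeasible_combination[OF assms(2)]) (use assms(1,3) in \<open>auto simp: a'_def\<close>)
  then obtain c where c: "c \<in> combos ?C" "\<forall>j. fst c j = 0" "snd c < 0" by blast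
  from combos_multipliers[OF assms(1) c(1)] obtain l where
    l: "\<forall>i\<in>I. 0 \<le> l i" "\<forall>j. fst c j = (\<Sum>i\<in>I. l i * a' i j)" "snd c = (\<Sum>i\<in>I. l i * b i)" by blast
  have "(\<Sum>i\<in>I. l i * a i j) = 0" if "j \<in> J" for j
    using l(2)[rule_format, of j] c(2) that by (simp add: a'_def)
  then show ?thesis using l c(3) by auto
qed

text \<open>The step is the minimum of finitely many positive bounds. It keeps constraints with
  positive slack \<open>s\<close> satisfied in a direction along which they grow at rates
  \<open>t\<close>.\<close>

lemma small_step:
  fixes s :: "'a \<Rightarrow> real"
  assumes "finite S" "\<And>i. i \<in> S \<Longrightarrow> 0 < s i"
  shows "\<exists>e>0. \<forall>i\<in>S. e * t i \<le> s i"
  using assms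
proof (induction S rule: finite_induct)
  case empty then show ?case by (intro exI[of _ 1]) simp
next
  case (insert i S)
  then obtain e where e: "e > 0" "\<forall>i\<in>S. e * t i \<le> s i" by auto
  define e' where "e' = min e (s i / (\<bar>t i\<bar> + 1))"
  have pos: "0 < s i / (\<bar>t i\<bar> + 1)" using insert.prems[of i] by simp
  then have e': "0 < e'" "e' \<le> e" using e(1) by (auto simp: e'_def)
  have "e' * t i' \<le> s i'" if "i' \<in> S" for i'
  proof (cases "0 \<le> t i'")
    case True then show ?thesis using e e' that by (meson mult_right_mono order_trans)
  next
    case False then show ?thesis using e'(1) insert.prems[of i'] that
      by (meson insert_iff less_imp_le mult_pos_neg not_le order.strict_trans)
  qed
  moreover have "e' * t i \<le> s i"
  proof -
    have "e' * t i \<le> e' * (\<bar>t i\<bar> + 1)" using e'(1) by (intro mult_left_mono) auto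
    also have "\<dots> \<le> s i / (\<bar>t i\<bar> + 1) * (\<bar>t i\<bar> + 1)" by (intro mult_right_mono) (auto simp: e'_def)
    also have "\<dots> = s i" by simp
    finally show ?thesis .
  qed
  ultimately show ?case using e'(1) by (intro exI[of _ e']) auto
qed

text \<open>An improving direction of the active constraints is excluded by optimality, so Farkas' lemma applies.\<close>

lemma lp_multipliers:
  fixes a :: "'i \<Rightarrow> 'j \<Rightarrow> real"
  assumes fin: "finite I" "finite J" and feas: "\<forall>i\<in>I. (\<Sum>j\<in>J. a i j * y j) \<le> b i"
    and opt: "\<And>z. \<forall>i\<in>I. (\<Sum>j\<in>J. a i j * z j) \<le> b i \<Longrightarrow> (\<Sum>j\<in>J. c j * y j) \<le> (\<Sum>j\<in>J. c j * z j)"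
  shows "\<exists>l. (\<forall>i\<in>I. 0 \<le> l i \<and> (l i = 0 \<or> (\<Sum>j\<in>J. a i j * y j) = b i)) \<and> (\<forall>j\<in>J. (\<Sum>i\<in>I. l i * a i j) = - c j)"
proof -
  define T where "T = {i \<in> I. (\<Sum>j\<in>J. a i j * y j) = b i}"
  have T: "finite T" "T \<subseteq> I" using fin(1) by (auto simp: T_def)
  let ?I = "insert None (Some ` T)"
  define a' where "a' = case_option c a"
  \<comment> \<open>The row \<open>None\<close> demands that the objective decrease by 1 along the
    direction; any improving direction can be scaled to do so.\<close>
  define b' :: "'i option \<Rightarrow> real" where "b' = case_option (- 1) (\<lambda>_. 0)"
  have "\<nexists>d. \<forall>i\<in>?I. (\<Sum>j\<in>J. a' i j * d j) \<le> b' i"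
  proof
    assume "\<exists>d. \<forall>i\<in>?I. (\<Sum>j\<in>J. a' i j * d j) \<le> b' i"
    then obtain d where d: "(\<Sum>j\<in>J. c j * d j) \<le> - 1" "\<And>i. i \<in> T \<Longrightarrow> (\<Sum>j\<in>J. a i j * d j) \<le> 0"
      by (auto simp: a'_def b'_def)
    obtain e where e: "e > 0" "\<forall>i\<in>I - T. e * (\<Sum>j\<in>J. a i j * d j) \<le> b i - (\<Sum>j\<in>J. a i j * y j)"
      using small_step[of "I - T" "\<lambda>i. b i - (\<Sum>j\<in>J. a i j * y j)"] fin(1) feas by (force simp: T_def)
    have s: "(\<Sum>j\<in>J. f j * (y j + e * d j)) = (\<Sum>j\<in>J. f j * y j) + e * (\<Sum>j\<in>J. f j * d j)" for f
      by (simp add: algebra_simps sum.distrib sum_distrib_left)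
    have "\<forall>i\<in>I. (\<Sum>j\<in>J. a i j * (y j + e * d j)) \<le> b i"
    proof
      fix i assume "i \<in> I"
      show "(\<Sum>j\<in>J. a i j * (y j + e * d j)) \<le> b i"
      proof (cases "i \<in> T")
        case True
        then have "e * (\<Sum>j\<in>J. a i j * d j) \<le> 0" using d(2) e(1) by (simp add: mult_le_0_iff)
        then show ?thesis using True by (simp add: s T_def)
      next
        case False
        then have "e * (\<Sum>j\<in>J. a i j * d j) \<le> b i - (\<Sum>j\<in>J. a i j * y j)" using e(2) \<open>i \<in> I\<close> by blast
        then show ?thesis unfolding s by linarith
      qed
    qed
    from opt[OF this] have "0 \<le> e * (\<Sum>j\<in>J. c j * d j)" by (simp add: s)
    then show False using d(1) e(1) by (simp add: zero_le_mult_iff)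
  qed
  from farkas[OF _ fin(2) this] T(1) obtain l where
    l: "\<forall>i\<in>?I. 0 \<le> l i" "\<forall>j\<in>J. (\<Sum>i\<in>?I. l i * a' i j) = 0" "(\<Sum>i\<in>?I. l i * b' i) < 0" by auto
  have sum: "(\<Sum>i\<in>?I. f i) = f None + (\<Sum>i\<in>T. f (Some i))" for f :: "'i option \<Rightarrow> real"
    using T(1) by (simp add: sum.reindex)
  \<comment> \<open>Only the row \<open>None\<close> has a nonzero right-hand side, so its
    multiplier must be positive and the others can be divided by it.\<close>
  have pos: "0 < l None" using l(3) unfolding sum by (simp add: b'_def)
  define l' where "l' i = (if i \<in> T then l (Some i) / l None else 0)" for i
  have "(\<Sum>i\<in>I. l' i * a i j) = - c j" if "j \<in> J" for j
  proof -
    have "(\<Sum>i\<in>I. l' i * a i j) = (\<Sum>i\<in>T. l' i * a i j)"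
      using T fin(1) by (intro sum.mono_neutral_right) (auto simp: l'_def)
    also have "\<dots> = (\<Sum>i\<in>T. l (Some i) * a i j) / l None"
      by (simp add: l'_def sum_divide_distrib)
    also have "(\<Sum>i\<in>T. l (Some i) * a i j) = - (l None * c j)"
      using l(2)[rule_format, OF that] unfolding sum by (simp add: a'_def)
    finally show ?thesis using pos by simp
  qed
  moreover have "0 \<le> l' i \<and> (l' i = 0 \<or> (\<Sum>j\<in>J. a i j * y j) = b i)" if "i \<in> I" for i
    using l(1) pos by (auto simp: l'_def T_def)
  ultimately show ?thesis by blast
qed

section \<open>Small solutions\<close>

text \<open>Pigeonhole: there are \<open>(H + 1) ^ card V\<close> vectors with entries from 0 to
  \<open>H\<close>, while their images under the system lie in a box with fewer points, because
  \<open>(2 * card V * U + 1) ^ card E = H\<close> and \<open>card E < card V\<close>. The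
  difference of two vectors with equal image is the solution.\<close>

lemma siegel:
  fixes a :: "'e \<Rightarrow> 'v \<Rightarrow> int" and U :: nat
  assumes fin: "finite E" "finite V" and card: "card E < card V" and U: "\<And>e v. e \<in> E \<Longrightarrow> v \<in> V \<Longrightarrow> \<bar>a e v\<bar> \<le> int U"
    and H: "H = (2 * card V * U + 1) ^ card E"
  shows "\<exists>z. (\<exists>v\<in>V. z v \<noteq> 0) \<and> (\<forall>v\<in>V. \<bar>z v\<bar> \<le> int H) \<and> (\<forall>e\<in>E. (\<Sum>v\<in>V. a e v * z v) = 0)"
proof -
  let ?K = "card V * U * H"
  let ?B = "PiE V (\<lambda>_. {0..int H})" and ?R = "PiE E (\<lambda>_. {- int ?K..int ?K})"
  define f where "f z = restrict (\<lambda>e. \<Sum>v\<in>V. a e v * z v) E" for z :: "'v \<Rightarrow> int"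
  have "f z \<in> ?R" if z: "z \<in> ?B" for z
  proof -
    have "\<bar>\<Sum>v\<in>V. a e v * z v\<bar> \<le> int ?K" if e: "e \<in> E" for e
    proof -
      have "\<bar>\<Sum>v\<in>V. a e v * z v\<bar> \<le> (\<Sum>v\<in>V. \<bar>a e v * z v\<bar>)" by (rule sum_abs)
      also have "\<dots> \<le> (\<Sum>v\<in>V. int U * int H)"
      proof (rule sum_mono)
        fix v assume v: "v \<in> V"
        have "0 \<le> z v" "z v \<le> int H" using PiE_mem[OF z v] by auto
        then show "\<bar>a e v * z v\<bar> \<le> int U * int H"
          unfolding abs_mult using U[OF e v] by (intro mult_mono) auto
      qed
      finally show ?thesis by (simp add: algebra_simps)
    qed
    then show ?thesis by (auto simp: f_def abs_le_iff minus_le_iff)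
  qed
  then have sub: "f ` ?B \<subseteq> ?R" by blast
  have cB: "card ?B = (H + 1) ^ card V"
    using fin(2) by (simp add: card_PiE nat_add_distrib)
  have cR: "card ?R = (2 * ?K + 1) ^ card E"
    using fin(1) by (simp add: card_PiE nat_add_distrib nat_mult_distrib algebra_simps)
  have H1: "0 < H" by (simp add: H)
  have "2 * ?K + 1 \<le> (2 * card V * U + 1) * (H + 1)" by (simp add: algebra_simps)
  then have "card ?R \<le> ((2 * card V * U + 1) * (H + 1)) ^ card E"
    unfolding cR by (rule power_mono) simp
  also have "\<dots> = H * (H + 1) ^ card E" by (simp only: power_mult_distrib H)
  also have "\<dots> < (H + 1) * (H + 1) ^ card E" by simp
  also have "\<dots> = (H + 1) ^ Suc (card E)" by simp
  also have "\<dots> \<le> (H + 1) ^ card V" using card by (intro power_increasing) auto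
  finally have "card ?R < card ?B" unfolding cB .
  moreover have "finite ?R" using fin(1) by (intro finite_PiE) auto
  ultimately have "\<not> inj_on f ?B"
    using sub by (metis card_inj_on_le not_less)
  then obtain z1 z2 where z: "z1 \<in> ?B" "z2 \<in> ?B" "f z1 = f z2" "z1 \<noteq> z2" unfolding inj_on_def by blast
  define z where "z v = z1 v - z2 v" for v
  have "\<exists>v\<in>V. z v \<noteq> 0"
  proof (rule ccontr)
    assume "\<not> ?thesis"
    then have "z1 = z2" using z(1,2) by (intro PiE_ext[of z1 V _ z2]) (auto simp: z_def)
    then show False using z(4) by simp
  qed
  moreover have "\<bar>z v\<bar> \<le> int H" if "v \<in> V" for v
    using PiE_mem[OF z(1) that] PiE_mem[OF z(2) that] by (auto simp: z_def)
  moreover have "(\<Sum>v\<in>V. a e v * z v) = 0" if "e \<in> E" for e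
  proof -
    have "f z1 e = f z2 e" using z(3) by simp
    then show ?thesis using that by (simp add: f_def z_def right_diff_distrib sum_subtractf)
  qed
  ultimately show ?thesis by blast
qed

text \<open>A feasible point with a maximal set of active constraints is, after adding sign constraints,
  the unique solution of its active equations; hence it is determined by the Gram system of their
  coefficient matrix, whose size does not depend on the number of constraints.\<close>

lemma small_solution:
  fixes J :: "'j set" and cs :: "(('j \<Rightarrow> int) \<times> int) list" and U :: nat
  assumes J: "finite J" and U: "1 \<le> U" "\<And>c j. c \<in> set cs \<Longrightarrow> j \<in> J \<Longrightarrow> \<bar>fst c j\<bar> \<le> int U" "\<And>c. c \<in> set cs \<Longrightarrow> \<bar>snd c\<bar> \<le> int U"
    and z: "\<forall>c \<in> set cs. (\<Sum>j\<in>J. of_int (fst c j) * z0 j) \<le> (of_int (snd c) :: real)"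
    and H: "H = (2 * (card J + 1) * ((length cs + card J) * U\<^sup>2) + 1) ^ card J"
  shows "\<exists>Z t. 0 < t \<and> t \<le> int H \<and> (\<forall>j\<in>J. \<bar>Z j\<bar> \<le> int H) \<and> (\<forall>c \<in> set cs. (\<Sum>j\<in>J. fst c j * Z j) \<le> snd c * t)"
proof -
  \<comment> \<open>The sign constraints satisfied by \<open>z0\<close> confine the solutions to an
    orthant, which contains no line.\<close>
  define sg where "sg j = (if 0 \<le> z0 j then -1 else 1 :: int)" for j
  define C where "C = set cs \<union> (\<lambda>j. (\<lambda>i. if i = j then sg j else 0, 0)) ` J"
  define ev where "ev c w = (\<Sum>j\<in>J. of_int (fst c j) * w j)" for c :: "('j \<Rightarrow> int) \<times> int" and w :: "'j \<Rightarrow> real"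
  have ev_lin: "ev c (\<lambda>j. v j + e * w j) = ev c v + e * ev c w" for c v w e
    by (simp add: ev_def algebra_simps sum.distrib sum_distrib_left)
  have finC: "finite C" using J by (simp add: C_def)
  have cardC: "card C \<le> length cs + card J"
    unfolding C_def by (rule order_trans[OF card_Un_le]) (intro add_mono card_length card_image_le J)
  have UC: "\<bar>fst c j\<bar> \<le> int U" "\<bar>snd c\<bar> \<le> int U" if "c \<in> C" "j \<in> J" for c j
  proof -
    consider "c \<in> set cs" | j' where "c = (\<lambda>i. if i = j' then sg j' else 0, 0)" using \<open>c \<in> C\<close> by (auto simp: C_def)
    then have "\<bar>fst c j\<bar> \<le> int U \<and> \<bar>snd c\<bar> \<le> int U"
    proof cases
      case 1 then show ?thesis using U(2)[OF 1 \<open>j \<in> J\<close>] U(3)[OF 1] by simp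
    next
      case 2 then show ?thesis using U(1) by (simp add: sg_def)
    qed
    then show "\<bar>fst c j\<bar> \<le> int U" "\<bar>snd c\<bar> \<le> int U" by auto
  qed
  have ev_sg: "ev (\<lambda>i. if i = j then sg j else 0, 0) w = of_int (sg j) * w j" if "j \<in> J" for j w
  proof -
    have "ev (\<lambda>i. if i = j then sg j else 0, 0) w = (\<Sum>i\<in>J. if i = j then of_int (sg j) * w i else 0)"
      unfolding ev_def by (intro sum.cong) auto
    then show ?thesis using J that by (simp add: sum.delta)
  qed
  define F where "F w \<longleftrightarrow> (\<forall>c\<in>C. ev c w \<le> of_int (snd c))" for w
  define tight where "tight w = {c \<in> C. ev c w = of_int (snd c)}" for w
  have "F z0" using z ev_sg by (auto simp: F_def C_def ev_def[symmetric] sg_def)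
  moreover have "card (tight w) < Suc (card C)" for w
    using finC by (simp add: less_Suc_eq_le tight_def card_mono)
  ultimately obtain w where w: "F w" "\<And>w'. F w' \<Longrightarrow> card (tight w') \<le> card (tight w)"
    using ex_has_greatest_nat[of F z0 "\<lambda>w. card (tight w)"] by blast
  have unique: "v j = 0" if v: "\<forall>c \<in> tight w. ev c v = 0" and j: "j \<in> J" for v j
  proof (rule ccontr)
    assume "v j \<noteq> 0"
    \<comment> \<open>Of the directions \<open>v\<close> and \<open>- v\<close>, the one is taken
      that heads for the sign constraint of \<open>j\<close>, so that some further constraint
      eventually becomes tight.\<close>
    define v' where "v' i = (if 0 < of_int (sg j) * v j then v i else - v i)" for i
    have evv': "ev c v' = (if 0 < of_int (sg j) * v j then ev c v else - ev c v)" for c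
      by (simp add: ev_def v'_def sum_negf)
    have v't: "\<forall>c \<in> tight w. ev c v' = 0" using v by (simp add: evv')
    have "of_int (sg j) * v j \<noteq> 0" using \<open>v j \<noteq> 0\<close> by (simp add: sg_def)
    then have "0 < of_int (sg j) * v' j"
      by (cases "0 < of_int (sg j) * v j") (simp_all add: v'_def not_less less_le)
    then have "0 < ev (\<lambda>i. if i = j then sg j else 0, 0) v'" using ev_sg[OF j] by simp
    moreover define E where "E = {c \<in> C. 0 < ev c v'}"
    ultimately have "E \<noteq> {}" using j by (auto simp: C_def)
    define q where "q c = (of_int (snd c) - ev c w) / ev c v'" for c
    define \<theta> where "\<theta> = Min (q ` E)"
    have finE: "finite E" using finC by (simp add: E_def)
    obtain c0 where c0: "c0 \<in> E" "q c0 = \<theta>"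
    proof -
      have "\<theta> \<in> q ` E" unfolding \<theta>_def using finE \<open>E \<noteq> {}\<close> by (intro Min_in) auto
      then show thesis using that by blast
    qed
    have q: "\<theta> \<le> q c" "0 < q c" if "c \<in> E" for c
    proof -
      show "\<theta> \<le> q c" using that finE by (simp add: \<theta>_def)
      have "ev c w \<noteq> of_int (snd c)"
      proof
        assume "ev c w = of_int (snd c)"
        then have "c \<in> tight w" using that by (simp add: tight_def E_def)
        then show False using v't that by (simp add: E_def)
      qed
      then have "ev c w < of_int (snd c)" using w(1) that by (auto simp: F_def E_def less_le)
      then show "0 < q c" using that by (simp add: q_def E_def)
    qed
    define w' where "w' i = w i + \<theta> * v' i" for i
    have evw': "ev c w' = ev c w + \<theta> * ev c v'" for c unfolding w'_def by (rule ev_lin)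
    have "F w'"
      unfolding F_def
    proof
      fix c assume c: "c \<in> C"
      show "ev c w' \<le> of_int (snd c)"
      proof (cases "c \<in> E")
        case True
        then have "\<theta> * ev c v' \<le> of_int (snd c) - ev c w"
          using q(1)[OF True] by (simp add: q_def E_def field_simps)
        then show ?thesis by (simp add: evw')
      next
        case False
        then have "\<theta> * ev c v' \<le> 0" using q(2)[OF c0(1)] c0(2) c by (simp add: E_def mult_le_0_iff not_less)
        then show ?thesis using w(1) c by (auto simp: evw' F_def)
      qed
    qed
    moreover have "tight w \<subset> tight w'"
    proof
      show "tight w \<subseteq> tight w'" using v't by (auto simp: tight_def evw')
      have "ev c0 w' = of_int (snd c0)" using c0 by (auto simp: evw' q_def E_def)
      moreover have "c0 \<notin> tight w" using c0(1) v't by (auto simp: E_def)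
      ultimately show "tight w \<noteq> tight w'" using c0(1) by (auto simp: tight_def E_def)
    qed
    then have "card (tight w) < card (tight w')" using finC by (intro psubset_card_mono) (auto simp: tight_def)
    ultimately show False using w(2) by (simp add: not_less[symmetric])
  qed
  let ?T = "tight w"
  have T: "finite ?T" "?T \<subseteq> C" using finC by (auto simp: tight_def)
  \<comment> \<open>The homogenized Gram system: \<open>card J\<close> equations in the unknowns
    indexed by \<open>J\<close> and one more, \<open>None\<close>, which multiplies the right-hand
    side. There is always one unknown more than equations, as Siegel's lemma requires, however many
    constraints are tight.\<close>
  define G where "G e v = (case v of None \<Rightarrow> - (\<Sum>c\<in>?T. fst c e * snd c) | Some j \<Rightarrow> (\<Sum>c\<in>?T. fst c e * fst c j))" for e v
  let ?V = "insert None (Some ` J)"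
  let ?U = "(length cs + card J) * U\<^sup>2"
  have cV: "card ?V = card J + 1" using J by (simp add: card_image)
  have prod: "\<bar>p * q\<bar> \<le> int (U\<^sup>2)" if "\<bar>p\<bar> \<le> int U" "\<bar>q\<bar> \<le> int U" for p q
    using that by (simp add: abs_mult power2_eq_square mult_mono)
  have sumb: "\<bar>\<Sum>c\<in>?T. f c\<bar> \<le> int ?U" if "\<And>c. c \<in> ?T \<Longrightarrow> \<bar>f c\<bar> \<le> int (U\<^sup>2)" for f
  proof -
    have "\<bar>\<Sum>c\<in>?T. f c\<bar> \<le> (\<Sum>c\<in>?T. \<bar>f c\<bar>)" by (rule sum_abs)
    also have "\<dots> \<le> int (card ?T) * int (U\<^sup>2)" using that by (intro sum_bounded_above) auto
    also have "\<dots> \<le> int (length cs + card J) * int (U\<^sup>2)"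
      using cardC card_mono[OF finC T(2)] by (intro mult_right_mono) auto
    finally show ?thesis by simp
  qed
  have "\<bar>G e v\<bar> \<le> int ?U" if "e \<in> J" "v \<in> ?V" for e v
  proof -
    have c: "c \<in> C" if "c \<in> ?T" for c using that T(2) by blast
    have "\<bar>\<Sum>c\<in>?T. fst c e * snd c\<bar> \<le> int ?U"
      by (intro sumb prod UC c) (use \<open>e \<in> J\<close> in auto)
    moreover have "\<bar>\<Sum>c\<in>?T. fst c e * fst c j\<bar> \<le> int ?U" if "j \<in> J" for j
      by (intro sumb prod UC c) (use \<open>e \<in> J\<close> that in auto)
    ultimately show ?thesis using \<open>v \<in> ?V\<close> unfolding G_def by (cases v) (auto simp del: of_nat_mult of_nat_add)
  qed
  then obtain zz where zz: "\<exists>v\<in>?V. zz v \<noteq> 0" "\<forall>v\<in>?V. \<bar>zz v\<bar> \<le> int H" "\<forall>e\<in>J. (\<Sum>v\<in>?V. G e v * zz v) = 0"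
    using siegel[of J ?V G ?U H] J cV H by auto
  define t where "t = zz None"
  \<comment> \<open>The error of the integer vector against \<open>t\<close> times the vertex
    \<open>w\<close>.\<close>
  define d where "d j = of_int (zz (Some j)) - of_int t * w j" for j
  have eq0: "(\<Sum>c\<in>?T. of_int (fst c e) * ev c d) = 0" if e: "e \<in> J" for e
  proof -
    have "(\<Sum>v\<in>?V. G e v * zz v) = G e None * zz None + (\<Sum>j\<in>J. G e (Some j) * zz (Some j))"
      using J by (simp add: sum.reindex)
    also have "(\<Sum>j\<in>J. G e (Some j) * zz (Some j)) = (\<Sum>c\<in>?T. fst c e * (\<Sum>j\<in>J. fst c j * zz (Some j)))"
      by (simp add: G_def sum_distrib_left sum_distrib_right mult.assoc sum.swap[of _ J])
    finally have "(\<Sum>c\<in>?T. fst c e * ((\<Sum>j\<in>J. fst c j * zz (Some j)) - snd c * t)) = 0"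
      using zz(3) e by (simp add: G_def t_def right_diff_distrib sum_subtractf sum_distrib_right mult.assoc)
    then have "of_int (\<Sum>c\<in>?T. fst c e * ((\<Sum>j\<in>J. fst c j * zz (Some j)) - snd c * t)) = (0 :: real)" by simp
    moreover have "ev c d = of_int ((\<Sum>j\<in>J. fst c j * zz (Some j)) - snd c * t)" if "c \<in> ?T" for c
    proof -
      have "ev c d = (\<Sum>j\<in>J. of_int (fst c j * zz (Some j))) - of_int t * ev c w"
        by (simp add: ev_def d_def algebra_simps sum_subtractf sum_distrib_left)
      then show ?thesis using that by (simp add: tight_def mult.commute)
    qed
    ultimately show ?thesis by simp
  qed
  \<comment> \<open>The Gram equations say that the transposed tight matrix annihilates the vector
    of all \<open>ev c d\<close>. Pairing this with \<open>d\<close> gives a vanishing sum of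
    squares, so \<open>d\<close> satisfies the homogeneous tight equations and is 0 on
    \<open>J\<close> by \<open>unique\<close>.\<close>
  have "(\<Sum>c\<in>?T. (ev c d)\<^sup>2) = (\<Sum>c\<in>?T. \<Sum>e\<in>J. d e * (of_int (fst c e) * ev c d))"
  proof (rule sum.cong[OF refl])
    fix c
    have "(ev c d)\<^sup>2 = (\<Sum>e\<in>J. of_int (fst c e) * d e) * ev c d" by (simp add: power2_eq_square ev_def)
    then show "(ev c d)\<^sup>2 = (\<Sum>e\<in>J. d e * (of_int (fst c e) * ev c d))"
      by (simp add: sum_distrib_right mult.assoc mult.left_commute)
  qed
  also have "\<dots> = (\<Sum>e\<in>J. \<Sum>c\<in>?T. d e * (of_int (fst c e) * ev c d))" by (rule sum.swap)
  also have "\<dots> = (\<Sum>e\<in>J. d e * (\<Sum>c\<in>?T. of_int (fst c e) * ev c d))" by (simp add: sum_distrib_left)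
  also have "\<dots> = 0" using eq0 by simp
  finally have "\<forall>c\<in>?T. ev c d = 0" using T(1) by (simp add: sum_nonneg_eq_0_iff)
  then have dz: "of_int (zz (Some j)) = of_int t * w j" if "j \<in> J" for j
    using unique[of d j] that by (simp add: d_def)
  \<comment> \<open>With \<open>t = 0\<close> the unknowns in \<open>J\<close> would vanish as well,
    against the nontriviality in Siegel's lemma.\<close>
  have t0: "t \<noteq> 0"
  proof
    assume "t = 0"
    then have "zz (Some j) = 0" if "j \<in> J" for j using dz[OF that] by simp
    then show False using zz(1) \<open>t = 0\<close> by (auto simp: t_def)
  qed
  define Z where "Z j = sgn t * zz (Some j)" for j
  have "(\<Sum>j\<in>J. fst c j * Z j) \<le> snd c * \<bar>t\<bar>" if c: "c \<in> set cs" for c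
  proof -
    have "of_int (\<Sum>j\<in>J. fst c j * Z j) = of_int (sgn t) * (\<Sum>j\<in>J. of_int (fst c j) * of_int (zz (Some j)) :: real)"
      by (simp add: Z_def sum_distrib_left algebra_simps)
    also have "\<dots> = of_int (sgn t) * (\<Sum>j\<in>J. of_int (fst c j) * (of_int t * w j))" using dz by simp
    also have "\<dots> = of_int (sgn t * t) * ev c w" by (simp add: ev_def sum_distrib_left algebra_simps)
    also have "\<dots> = of_int \<bar>t\<bar> * ev c w" by (simp only: mult.commute[of "sgn t"] mult_sgn_abs abs_mult_sgn abs_sgn)
    also have "\<dots> \<le> of_int \<bar>t\<bar> * of_int (snd c)"
      using w(1) c by (intro mult_left_mono) (auto simp: F_def C_def)
    finally show ?thesis by (simp only: of_int_mult[symmetric] of_int_le_iff mult.commute)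
  qed
  moreover have "\<bar>Z j\<bar> \<le> int H" if "j \<in> J" for j
    using zz(2) that t0 by (simp add: Z_def abs_mult)
  moreover have "0 < \<bar>t\<bar>" "\<bar>t\<bar> \<le> int H" using t0 zz(2) by (auto simp: t_def)
  ultimately show ?thesis by blast
qed

section \<open>Optimality certificates\<close>

text \<open>For \<open>t = 1\<close>, a certificate consists of the parameter \<open>X\<close>, an optimal solution \<open>Y\<close> and
  multipliers \<open>L\<close> with complementary slackness. In the pessimistic scenario \<open>U\<close> and \<open>W\<close> prove
  \<open>y\<^sub>p \<le> 0\<close> and \<open>y\<^sub>p \<ge> 0\<close> on the optimal face: there, rows with positive multiplier hold with
  equality, so \<open>U\<close> and \<open>W\<close> may be negative on them. The factor \<open>t\<close> clears denominators.\<close>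

definition cert :: "bool \<Rightarrow> nat \<Rightarrow> nat \<Rightarrow> nat \<Rightarrow> nat \<Rightarrow> nat \<Rightarrow> (nat \<Rightarrow> nat \<Rightarrow> 'a) \<Rightarrow> (nat \<Rightarrow> nat \<Rightarrow> 'a) \<Rightarrow> (nat \<Rightarrow> 'a) \<Rightarrow>
    (nat \<Rightarrow> nat \<Rightarrow> 'a) \<Rightarrow> (nat \<Rightarrow> 'a) \<Rightarrow> (nat \<Rightarrow> nat \<Rightarrow> 'a) \<Rightarrow> (nat \<Rightarrow> 'a) \<Rightarrow>
    'a::linordered_idom \<Rightarrow> (nat \<Rightarrow> 'a) \<Rightarrow> (nat \<Rightarrow> 'a) \<Rightarrow> (nat \<Rightarrow> 'a) \<Rightarrow> (nat \<Rightarrow> 'a) \<Rightarrow> (nat \<Rightarrow> 'a) \<Rightarrow> bool" where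
  "cert pess m n k g p A B b C c D d t X Y L U W \<longleftrightarrow>
     0 < t \<and> (\<forall>r<g. (\<Sum>l<k. D r l * X l) \<le> d r * t) \<and> Y p = 0 \<and>
     (\<forall>i<m. (\<Sum>j<n. A i j * Y j) \<le> (\<Sum>l<k. B i l * X l) + b i * t \<and> 0 \<le> L i \<and>
        ((\<Sum>j<n. A i j * Y j) = (\<Sum>l<k. B i l * X l) + b i * t \<or> L i = 0 \<and> (pess \<longrightarrow> U i = 0 \<and> W i = 0)) \<and>
        (pess \<longrightarrow> L i = 0 \<longrightarrow> 0 \<le> U i \<and> 0 \<le> W i)) \<and>
     (\<forall>j<n. (\<Sum>i<m. L i * A i j) + ((\<Sum>l<k. C j l * X l) + c j * t) = 0) \<and>
     (pess \<longrightarrow> (\<forall>j<n. if j = p then 0 < (\<Sum>i<m. U i * A i j) \<and> (\<Sum>i<m. W i * A i j) < 0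
        else (\<Sum>i<m. U i * A i j) = 0 \<and> (\<Sum>i<m. W i * A i j) = 0))"

section \<open>Duality: soundness and existence of certificates over the reals\<close>

definition lp_opt :: "nat \<Rightarrow> nat \<Rightarrow> (nat \<Rightarrow> nat \<Rightarrow> real) \<Rightarrow> (nat \<Rightarrow> real) \<Rightarrow> (nat \<Rightarrow> real) \<Rightarrow> (nat \<Rightarrow> real) \<Rightarrow> bool" where
  "lp_opt m n A \<beta> \<gamma> y \<longleftrightarrow> (\<forall>i<m. (\<Sum>j<n. A i j * y j) \<le> \<beta> i) \<and>
     (\<forall>z. (\<forall>i<m. (\<Sum>j<n. A i j * z j) \<le> \<beta> i) \<longrightarrow> (\<Sum>j<n. \<gamma> j * y j) \<le> (\<Sum>j<n. \<gamma> j * z j))"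

lemma lagrange:
  fixes A :: "nat \<Rightarrow> nat \<Rightarrow> real"
  assumes "\<forall>j<n. (\<Sum>i<m. l i * A i j) = - \<gamma> j"
  shows "(\<Sum>j<n. \<gamma> j * z j) = - (\<Sum>i<m. l i * (\<Sum>j<n. A i j * z j))"
proof -
  have "(\<Sum>i<m. l i * (\<Sum>j<n. A i j * z j)) = (\<Sum>j<n. (\<Sum>i<m. l i * A i j) * z j)"
    by (simp add: sum_distrib_left sum_distrib_right mult.assoc sum.swap[of _ "{..<n}"])
  also have "\<dots> = (\<Sum>j<n. - \<gamma> j * z j)" using assms by (intro sum.cong) auto
  finally show ?thesis by (simp add: sum_negf)
qed

text \<open>Weak duality: by \<open>lagrange\<close> the objective is minus a nonnegative
  combination of the row values, and a row with positive multiplier takes its maximal value at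
  \<open>y\<close>.\<close>

lemma multipliers_opt:
  assumes feas: "\<forall>i<m. (\<Sum>j<n. A i j * y j) \<le> \<beta> i"
    and l: "\<forall>i<m. 0 \<le> l i \<and> ((\<Sum>j<n. A i j * y j) = \<beta> i \<or> l i = 0)" and st: "\<forall>j<n. (\<Sum>i<m. l i * A i j) = - \<gamma> j"
  shows "lp_opt m n A \<beta> \<gamma> y"
  unfolding lp_opt_def
proof (intro conjI feas allI impI)
  fix z assume z: "\<forall>i<m. (\<Sum>j<n. A i j * z j) \<le> \<beta> i"
  have "(\<Sum>i<m. l i * (\<Sum>j<n. A i j * z j)) \<le> (\<Sum>i<m. l i * (\<Sum>j<n. A i j * y j))"
  proof (rule sum_mono)
    fix i assume "i \<in> {..<m}"
    then show "l i * (\<Sum>j<n. A i j * z j) \<le> l i * (\<Sum>j<n. A i j * y j)"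
      using z l by (cases "l i = 0") (auto intro!: mult_left_mono)
  qed
  then show "(\<Sum>j<n. \<gamma> j * y j) \<le> (\<Sum>j<n. \<gamma> j * z j)" unfolding lagrange[OF st] by simp
qed

text \<open>The slacks of \<open>z\<close> weighted by \<open>l\<close> are nonnegative. As
  \<open>z\<close> is no worse than \<open>y\<close>, they sum to at most 0, so all of them vanish:
  complementary slackness holds for every optimal solution, not just for \<open>y\<close>.\<close>

lemma optimal_tight:
  assumes l: "\<forall>i<m. 0 \<le> l i \<and> ((\<Sum>j<n. A i j * y j) = \<beta> i \<or> l i = 0)" and st: "\<forall>j<n. (\<Sum>i<m. l i * A i j) = - \<gamma> j"
    and y: "\<forall>i<m. (\<Sum>j<n. A i j * y j) \<le> \<beta> i" and z: "lp_opt m n A \<beta> \<gamma> z" and i: "i < m" "l i \<noteq> 0"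
  shows "(\<Sum>j<n. A i j * z j) = \<beta> i"
proof -
  have zf: "\<forall>i<m. (\<Sum>j<n. A i j * z j) \<le> \<beta> i" using z by (simp add: lp_opt_def)
  have "(\<Sum>j<n. \<gamma> j * z j) \<le> (\<Sum>j<n. \<gamma> j * y j)" using z y by (simp add: lp_opt_def)
  then have "(\<Sum>i<m. l i * (\<Sum>j<n. A i j * y j)) \<le> (\<Sum>i<m. l i * (\<Sum>j<n. A i j * z j))"
    unfolding lagrange[OF st] by simp
  moreover have "(\<Sum>i<m. l i * (\<Sum>j<n. A i j * y j)) = (\<Sum>i<m. l i * \<beta> i)"
    using l by (intro sum.cong) auto
  ultimately have "(\<Sum>i<m. l i * (\<beta> i - (\<Sum>j<n. A i j * z j))) \<le> 0"
    by (simp add: right_diff_distrib sum_subtractf)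
  moreover have nn: "0 \<le> l i * (\<beta> i - (\<Sum>j<n. A i j * z j))" if "i < m" for i
    using that l zf by auto
  ultimately have "(\<Sum>i<m. l i * (\<beta> i - (\<Sum>j<n. A i j * z j))) = 0" by (intro antisym sum_nonneg) auto
  then have "\<forall>i \<in> {..<m}. l i * (\<beta> i - (\<Sum>j<n. A i j * z j)) = 0"
    using nn by (subst (asm) sum_nonneg_eq_0_iff) auto
  then show ?thesis using i by auto
qed

text \<open>Where \<open>u i\<close> may be negative, the multiplier \<open>l i\<close> is nonzero,
  so \<open>y\<close> and \<open>z\<close> agree on that row by \<open>optimal_tight\<close>. On the
  other rows with nonzero \<open>u i\<close>, the maximum is attained at \<open>y\<close>.\<close>

lemma bound_on_face:
  fixes A :: "nat \<Rightarrow> nat \<Rightarrow> real"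
  assumes l: "\<forall>i<m. 0 \<le> l i \<and> ((\<Sum>j<n. A i j * y j) = \<beta> i \<or> l i = 0)" and st: "\<forall>j<n. (\<Sum>i<m. l i * A i j) = - \<gamma> j"
    and y: "\<forall>i<m. (\<Sum>j<n. A i j * y j) \<le> \<beta> i" and z: "lp_opt m n A \<beta> \<gamma> z"
    and u: "\<forall>i<m. ((\<Sum>j<n. A i j * y j) = \<beta> i \<or> u i = 0) \<and> (l i = 0 \<longrightarrow> 0 \<le> u i)"
    and p: "p < n" "\<forall>j<n. j \<noteq> p \<longrightarrow> (\<Sum>i<m. u i * A i j) = 0"
  shows "(\<Sum>i<m. u i * A i p) * z p \<le> (\<Sum>i<m. u i * A i p) * y p"
proof -
  have e: "(\<Sum>i<m. u i * A i p) * w p = (\<Sum>i<m. u i * (\<Sum>j<n. A i j * w j))" for w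
  proof -
    have "(\<Sum>i<m. u i * (\<Sum>j<n. A i j * w j)) = (\<Sum>j<n. (\<Sum>i<m. u i * A i j) * w j)"
      by (simp add: sum_distrib_left sum_distrib_right mult.assoc sum.swap[of _ "{..<n}"])
    also have "\<dots> = (\<Sum>j<n. if j = p then (\<Sum>i<m. u i * A i p) * w p else 0)"
      using p by (intro sum.cong) auto
    finally show ?thesis using p(1) by (simp add: sum.delta)
  qed
  have zf: "\<forall>i<m. (\<Sum>j<n. A i j * z j) \<le> \<beta> i" using z by (simp add: lp_opt_def)
  show ?thesis
    unfolding e
  proof (rule sum_mono)
    fix i assume "i \<in> {..<m}"
    then have i: "i < m" by simp
    show "u i * (\<Sum>j<n. A i j * z j) \<le> u i * (\<Sum>j<n. A i j * y j)"
    proof (cases "u i = 0")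
      case False
      then have t: "(\<Sum>j<n. A i j * y j) = \<beta> i" using u i by auto
      show ?thesis
      proof (cases "l i = 0")
        case True then show ?thesis using u zf i t by (auto intro!: mult_left_mono)
      next
        case False then show ?thesis using optimal_tight[OF l st y z i] t by simp
      qed
    qed simp
  qed
qed

lemma cert_sound:
  fixes t :: real
  assumes cert: "cert pess m n k g p A B b C c D d t X Y L U W" and p: "p < n"
  defines "x \<equiv> \<lambda>l. X l / t" and "y \<equiv> \<lambda>j. Y j / t"
  defines "\<beta> \<equiv> \<lambda>i. (\<Sum>l<k. B i l * x l) + b i" and "\<gamma> \<equiv> \<lambda>j. (\<Sum>l<k. C j l * x l) + c j"
  shows "\<forall>r<g. (\<Sum>l<k. D r l * x l) \<le> d r" and "lp_opt m n A \<beta> \<gamma> y" and "y p = 0"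
    and "pess \<Longrightarrow> lp_opt m n A \<beta> \<gamma> z \<Longrightarrow> z p = 0"
proof -
  have t: "0 < t" using cert by (simp add: cert_def)
  have div: "(\<Sum>l<q. f l * (v l / t)) = (\<Sum>l<q. f l * v l) / t" for q and f v :: "nat \<Rightarrow> real"
    by (simp add: sum_divide_distrib)
  have \<beta>: "\<beta> i = ((\<Sum>l<k. B i l * X l) + b i * t) / t" for i
    using t unfolding \<beta>_def x_def div by (simp add: add_divide_distrib)
  have \<gamma>: "\<gamma> j = ((\<Sum>l<k. C j l * X l) + c j * t) / t" for j
    using t unfolding \<gamma>_def x_def div by (simp add: add_divide_distrib)
  show "\<forall>r<g. (\<Sum>l<k. D r l * x l) \<le> d r"
    using cert t unfolding x_def div by (simp add: cert_def divide_le_eq)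
  show "y p = 0" using cert by (simp add: y_def cert_def)
  define l where "l i = L i / t" for i
  have yf: "\<forall>i<m. (\<Sum>j<n. A i j * y j) \<le> \<beta> i"
    using cert t unfolding y_def div \<beta> cert_def by (simp add: divide_right_mono)
  have l: "\<forall>i<m. 0 \<le> l i \<and> ((\<Sum>j<n. A i j * y j) = \<beta> i \<or> l i = 0)"
    using cert t unfolding y_def div \<beta> cert_def l_def by (auto simp: add_divide_distrib)
  have st: "\<forall>j<n. (\<Sum>i<m. l i * A i j) = - \<gamma> j"
  proof (intro allI impI)
    fix j assume "j < n"
    then have "(\<Sum>i<m. L i * A i j) = - ((\<Sum>l<k. C j l * X l) + c j * t)" using cert by (auto simp: cert_def add_eq_0_iff2)
    moreover have "(\<Sum>i<m. l i * A i j) = (\<Sum>i<m. L i * A i j) / t" by (simp add: l_def sum_divide_distrib)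
    ultimately show "(\<Sum>i<m. l i * A i j) = - \<gamma> j" unfolding \<gamma> minus_divide_left by (simp only:)
  qed
  show "lp_opt m n A \<beta> \<gamma> y" by (rule multipliers_opt[OF yf l st])
  assume pess: "pess" and z: "lp_opt m n A \<beta> \<gamma> z"
  have y0: "y p = 0" using cert by (simp add: y_def cert_def)
  have t0: "(\<Sum>j<n. A i j * y j) = \<beta> i \<longleftrightarrow> (\<Sum>j<n. A i j * Y j) = (\<Sum>l<k. B i l * X l) + b i * t" for i
    using t unfolding y_def div \<beta> by (auto simp: field_simps)
  have l0: "l i = 0 \<longleftrightarrow> L i = 0" for i using t by (simp add: l_def)
  have "(\<Sum>i<m. U i * A i p) * z p \<le> (\<Sum>i<m. U i * A i p) * y p"
    by (rule bound_on_face[OF l st yf z _ p]) (use cert pess in \<open>auto simp: cert_def t0 l0\<close>)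
  moreover have "(\<Sum>i<m. W i * A i p) * z p \<le> (\<Sum>i<m. W i * A i p) * y p"
    by (rule bound_on_face[OF l st yf z _ p]) (use cert pess in \<open>auto simp: cert_def t0 l0\<close>)
  moreover have "0 < (\<Sum>i<m. U i * A i p)" "(\<Sum>i<m. W i * A i p) < 0"
    using cert pess p by (auto simp: cert_def)
  ultimately show "z p = 0" using y0 by (simp add: mult_le_0_iff)
qed

text \<open>The optimal face consists of the feasible points that satisfy one extra row: the
  objective is at most its value at \<open>y\<close>. Minimizing \<open>h\<close> over it gives
  nonnegative multipliers for the old rows and for the extra one.\<close>

lemma face_multipliers:
  fixes A :: "nat \<Rightarrow> nat \<Rightarrow> real"
  assumes y: "lp_opt m n A \<beta> \<gamma> y"
    and l: "\<forall>i<m. 0 \<le> l i \<and> (l i = 0 \<or> (\<Sum>j<n. A i j * y j) = \<beta> i)" and st: "\<forall>j<n. (\<Sum>i<m. l i * A i j) = - \<gamma> j"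
    and h: "\<And>z. lp_opt m n A \<beta> \<gamma> z \<Longrightarrow> (\<Sum>j<n. h j * y j) \<le> (\<Sum>j<n. h j * z j)"
  shows "\<exists>u. (\<forall>i<m. ((\<Sum>j<n. A i j * y j) = \<beta> i \<or> u i = 0) \<and> (l i = 0 \<longrightarrow> 0 \<le> u i)) \<and>
    (\<forall>j<n. (\<Sum>i<m. u i * A i j) = - h j)"
proof -
  let ?I = "insert None (Some ` {..<m})"
  define a' where "a' = case_option \<gamma> A"
  define b' where "b' = case_option (\<Sum>j<n. \<gamma> j * y j) \<beta>"
  have I: "(\<forall>i\<in>?I. P i) \<longleftrightarrow> P None \<and> (\<forall>i<m. P (Some i))" for P by auto
  have feas: "\<forall>i\<in>?I. (\<Sum>j<n. a' i j * y j) \<le> b' i"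
    using y by (simp add: I a'_def b'_def lp_opt_def)
  have "\<exists>l. (\<forall>i\<in>?I. 0 \<le> l i \<and> (l i = 0 \<or> (\<Sum>j<n. a' i j * y j) = b' i)) \<and> (\<forall>j\<in>{..<n}. (\<Sum>i\<in>?I. l i * a' i j) = - h j)"
  proof (rule lp_multipliers[OF _ _ feas])
    fix z assume z: "\<forall>i\<in>?I. (\<Sum>j<n. a' i j * z j) \<le> b' i"
    then have "(\<Sum>j<n. \<gamma> j * z j) \<le> (\<Sum>j<n. \<gamma> j * y j)" "\<forall>i<m. (\<Sum>j<n. A i j * z j) \<le> \<beta> i"
      by (simp_all add: I a'_def b'_def)
    then have "lp_opt m n A \<beta> \<gamma> z" using y unfolding lp_opt_def by (meson order_trans)
    then show "(\<Sum>j<n. h j * y j) \<le> (\<Sum>j<n. h j * z j)" by (rule h)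
  qed auto
  then obtain \<mu> where \<mu>: "\<forall>i\<in>?I. 0 \<le> \<mu> i \<and> (\<mu> i = 0 \<or> (\<Sum>j<n. a' i j * y j) = b' i)"
    "\<forall>j<n. (\<Sum>i\<in>?I. \<mu> i * a' i j) = - h j" by auto
  \<comment> \<open>The extra row is minus the combination of the rows with multipliers
    \<open>l\<close>; this substitution is what can make \<open>u\<close> negative where
    \<open>l\<close> is positive.\<close>
  define u where "u i = \<mu> (Some i) - \<mu> None * l i" for i
  have "(\<Sum>i<m. u i * A i j) = - h j" if "j < n" for j
  proof -
    have "(\<Sum>i\<in>?I. \<mu> i * a' i j) = \<mu> None * \<gamma> j + (\<Sum>i<m. \<mu> (Some i) * A i j)"
      by (simp add: sum.reindex a'_def)
    moreover have "(\<Sum>i<m. u i * A i j) = (\<Sum>i<m. \<mu> (Some i) * A i j) - \<mu> None * (\<Sum>i<m. l i * A i j)"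
      by (simp add: u_def left_diff_distrib sum_subtractf sum_distrib_left mult.assoc)
    ultimately show ?thesis using \<mu>(2) st that by simp
  qed
  moreover have "((\<Sum>j<n. A i j * y j) = \<beta> i \<or> u i = 0) \<and> (l i = 0 \<longrightarrow> 0 \<le> u i)" if "i < m" for i
  proof -
    have "0 \<le> \<mu> (Some i)" "\<mu> (Some i) = 0 \<or> (\<Sum>j<n. A i j * y j) = \<beta> i"
      using \<mu>(1) that by (simp_all add: a'_def b'_def)
    then show ?thesis using l that by (auto simp: u_def)
  qed
  ultimately show ?thesis by blast
qed

text \<open>In the pessimistic case coordinate \<open>p\<close> is constantly 0 on the optimal face,
  so \<open>y\<close> minimizes both the coordinate and its negative there. The sums in column
  \<open>p\<close> are normalized to 1 and -1 so that the strict conditions of \<open>cert\<close>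
  can become linear equations.\<close>

lemma cert_exists:
  fixes x y b c :: "nat \<Rightarrow> real" and B C :: "nat \<Rightarrow> nat \<Rightarrow> real" and k :: nat
  defines "\<beta> \<equiv> \<lambda>i. (\<Sum>l<k. B i l * x l) + b i" and "\<gamma> \<equiv> \<lambda>j. (\<Sum>l<k. C j l * x l) + c j"
  assumes X: "\<forall>r<g. (\<Sum>l<k. D r l * x l) \<le> d r" and y: "lp_opt m n A \<beta> \<gamma> y" "y p = 0" and p: "p < n"
    and pess: "\<And>z. pess \<Longrightarrow> lp_opt m n A \<beta> \<gamma> z \<Longrightarrow> z p = 0"
  shows "\<exists>L U W. cert pess m n k g p A B b C c D d 1 x y L U W \<and>
    (pess \<longrightarrow> (\<Sum>i<m. U i * A i p) = 1 \<and> (\<Sum>i<m. W i * A i p) = -1)"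
proof -
  have "\<exists>l. (\<forall>i\<in>{..<m}. 0 \<le> l i \<and> (l i = 0 \<or> (\<Sum>j<n. A i j * y j) = \<beta> i)) \<and> (\<forall>j\<in>{..<n}. (\<Sum>i<m. l i * A i j) = - \<gamma> j)"
    by (rule lp_multipliers) (use y(1) in \<open>auto simp: lp_opt_def\<close>)
  then obtain l where l: "\<forall>i<m. 0 \<le> l i \<and> (l i = 0 \<or> (\<Sum>j<n. A i j * y j) = \<beta> i)"
    and st: "\<forall>j<n. (\<Sum>i<m. l i * A i j) = - \<gamma> j" by auto
  have ex: "\<exists>u. pess \<longrightarrow> (\<forall>i<m. ((\<Sum>j<n. A i j * y j) = \<beta> i \<or> u i = 0) \<and> (l i = 0 \<longrightarrow> 0 \<le> u i)) \<and>
    (\<forall>j<n. (\<Sum>i<m. u i * A i j) = (if j = p then s else 0))" for s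
  proof (cases pess)
    case True
    have e: "(\<Sum>j<n. (if j = p then - s else 0) * w j) = - s * w p" for w
    proof -
      have "(\<Sum>j<n. (if j = p then - s else 0) * w j) = (\<Sum>j<n. if j = p then - s * w j else 0)"
        by (intro sum.cong) auto
      then show ?thesis using p by (simp add: sum.delta)
    qed
    obtain u where "(\<forall>i<m. ((\<Sum>j<n. A i j * y j) = \<beta> i \<or> u i = 0) \<and> (l i = 0 \<longrightarrow> 0 \<le> u i))"
      "\<forall>j<n. (\<Sum>i<m. u i * A i j) = - (if j = p then - s else 0)"
      using face_multipliers[OF y(1) l st, of "\<lambda>j. if j = p then - s else 0"] pess[OF True] y(2) unfolding e by force
    then show ?thesis by (intro exI[of _ u]) auto
  qed simp
  obtain u w where
    "pess \<longrightarrow> (\<forall>i<m. ((\<Sum>j<n. A i j * y j) = \<beta> i \<or> u i = 0) \<and> (l i = 0 \<longrightarrow> 0 \<le> u i)) \<and>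
      (\<forall>j<n. (\<Sum>i<m. u i * A i j) = (if j = p then 1 else 0))"
    "pess \<longrightarrow> (\<forall>i<m. ((\<Sum>j<n. A i j * y j) = \<beta> i \<or> w i = 0) \<and> (l i = 0 \<longrightarrow> 0 \<le> w i)) \<and>
      (\<forall>j<n. (\<Sum>i<m. w i * A i j) = (if j = p then - 1 else 0))"
    using ex[of 1] ex[of "-1"] by blast
  then have "cert pess m n k g p A B b C c D d 1 x y l u w \<and>
    (pess \<longrightarrow> (\<Sum>i<m. u i * A i p) = 1 \<and> (\<Sum>i<m. w i * A i p) = -1)"
    using X y l st p unfolding cert_def lp_opt_def \<beta>_def \<gamma>_def by auto
  then show ?thesis by blast
qed


text \<open>For a fixed set \<open>T\<close> of tight rows and a fixed set \<open>S\<close> of zero multipliers, the conditions of a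
  certificate are linear in the unknowns \<open>X\<close>, \<open>Y\<close>, \<open>L\<close>, \<open>U\<close>, \<open>W\<close>, which are indexed by pairs.\<close>

definition unknowns :: "nat \<Rightarrow> nat \<Rightarrow> nat \<Rightarrow> (nat \<times> nat) set" where
  "unknowns k n m = {0} \<times> {..<k} \<union> {1} \<times> {..<n} \<union> {2} \<times> {..<m} \<union> {3} \<times> {..<m} \<union> {4} \<times> {..<m} \<union> {5} \<times> {..<1}"

text \<open>Tag 5 belongs to the common denominator \<open>t\<close>, which is an unknown as
  well.\<close>

definition coeffs :: "(nat \<Rightarrow> 'a) \<Rightarrow> (nat \<Rightarrow> 'a) \<Rightarrow> (nat \<Rightarrow> 'a) \<Rightarrow> (nat \<Rightarrow> 'a) \<Rightarrow> (nat \<Rightarrow> 'a) \<Rightarrow> 'a \<Rightarrow> nat \<times> nat \<Rightarrow> 'a" where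
  "coeffs fx fy fl fu fw ft q = (if fst q = 0 then fx (snd q) else if fst q = 1 then fy (snd q) else if fst q = 2 then fl (snd q)
     else if fst q = 3 then fu (snd q) else if fst q = 4 then fw (snd q) else ft)"

lemma finite_unknowns: "finite (unknowns k n m)"
  by (simp add: unknowns_def)

lemma card_unknowns: "card (unknowns k n m) \<le> k + n + 3 * m + 1"
proof -
  have "card (unknowns k n m) \<le> card ({0::nat} \<times> {..<k}) + card ({1::nat} \<times> {..<n}) + card ({2::nat} \<times> {..<m})
     + card ({3::nat} \<times> {..<m}) + card ({4::nat} \<times> {..<m}) + card ({5::nat} \<times> {..<1::nat})"
    unfolding unknowns_def by (meson add_le_mono1 card_Un_le order_trans)
  then show ?thesis by (simp add: card_cartesian_product)
qed

lemma sum_unknowns: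
  fixes z :: "nat \<times> nat \<Rightarrow> 'a::linordered_idom"
  shows "(\<Sum>q\<in>unknowns k n m. of_int (coeffs fx fy fl fu fw ft q) * z q) =
    (\<Sum>l<k. of_int (fx l) * z (0, l)) + (\<Sum>j<n. of_int (fy j) * z (1, j)) + (\<Sum>i<m. of_int (fl i) * z (2, i)) +
    (\<Sum>i<m. of_int (fu i) * z (3, i)) + (\<Sum>i<m. of_int (fw i) * z (4, i)) + of_int ft * z (5, 0)"
proof -
  let ?f = "\<lambda>q. of_int (coeffs fx fy fl fu fw ft q) * z q"
  have s: "(\<Sum>q\<in>{a} \<times> {..<N}. ?f q) = (\<Sum>l<N. ?f (a, l))" for a N
  proof -
    have "{a} \<times> {..<N} = Pair a ` {..<N}" by auto
    then show ?thesis by (simp add: sum.reindex inj_on_def)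
  qed
  have "(\<Sum>q\<in>unknowns k n m. ?f q) = (\<Sum>q\<in>{0} \<times> {..<k}. ?f q) + (\<Sum>q\<in>{1} \<times> {..<n}. ?f q) + (\<Sum>q\<in>{2} \<times> {..<m}. ?f q) +
    (\<Sum>q\<in>{3} \<times> {..<m}. ?f q) + (\<Sum>q\<in>{4} \<times> {..<m}. ?f q) + (\<Sum>q\<in>{5} \<times> {..<1}. ?f q)"
    unfolding unknowns_def by (subst sum.union_disjoint, simp, simp, force)+ simp
  then show ?thesis unfolding s by (simp add: coeffs_def)
qed

definition unit_coeff :: "int \<Rightarrow> nat \<Rightarrow> nat \<Rightarrow> int" where
  "unit_coeff e i q = (if q = i then e else 0)"

lemma sum_unit_coeff:
  assumes "i < N"
  shows "(\<Sum>q<N. of_int (unit_coeff e i q) * f q) = (of_int e * f i :: 'a::linordered_idom)"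
proof -
  have "(\<Sum>q<N. of_int (unit_coeff e i q) * f q) = (\<Sum>q<N. if q = i then of_int e * f q else 0)"
    by (intro sum.cong) (auto simp: unit_coeff_def)
  then show ?thesis using assms by (simp add: sum.delta)
qed

text \<open>Equations appear as two inequalities. The strict conditions on \<open>t\<close> and on
  the multipliers outside of \<open>S\<close> are replaced by lower bounds 1, which costs nothing
  since all other rows are homogeneous; the two sums in column \<open>p\<close> are set to
  \<open>t\<close> and \<open>- t\<close>.\<close>

definition cert_system :: "bool \<Rightarrow> nat \<Rightarrow> nat \<Rightarrow> nat \<Rightarrow> (nat \<Rightarrow> nat \<Rightarrow> int) \<Rightarrow> (nat \<Rightarrow> nat \<Rightarrow> int) \<Rightarrow> (nat \<Rightarrow> int) \<Rightarrow>
    (nat \<Rightarrow> nat \<Rightarrow> int) \<Rightarrow> (nat \<Rightarrow> int) \<Rightarrow> (nat \<Rightarrow> nat \<Rightarrow> int) \<Rightarrow> (nat \<Rightarrow> int) \<Rightarrow> nat \<Rightarrow> (nat \<Rightarrow> bool) \<Rightarrow> (nat \<Rightarrow> bool) \<Rightarrow>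
    ((nat \<times> nat \<Rightarrow> int) \<times> int) list" where
  "cert_system pess m n g A B b C c D d p T S =
    (let o0 = \<lambda>_. 0; e = unit_coeff; s = (\<lambda>j. if j = p then 1 else 0); sel = (\<lambda>Q. filter Q [0..<m]) in
     map (\<lambda>r. (coeffs (D r) o0 o0 o0 o0 (- d r), 0)) [0..<g] @
     map (\<lambda>i. (coeffs (\<lambda>l. - B i l) (A i) o0 o0 o0 (- b i), 0)) (sel (\<lambda>_. True)) @
     map (\<lambda>i. (coeffs (B i) (\<lambda>j. - A i j) o0 o0 o0 (b i), 0)) (sel T) @
     map (\<lambda>i. (coeffs o0 o0 (e (-1) i) o0 o0 0, 0)) (sel (\<lambda>_. True)) @
     map (\<lambda>i. (coeffs o0 o0 (e 1 i) o0 o0 0, 0)) (sel S) @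
     map (\<lambda>i. (coeffs o0 o0 (e (-1) i) o0 o0 0, -1)) (sel (\<lambda>i. \<not> S i)) @
     map (\<lambda>j. (coeffs (C j) o0 (\<lambda>i. A i j) o0 o0 (c j), 0)) [0..<n] @
     map (\<lambda>j. (coeffs (\<lambda>l. - C j l) o0 (\<lambda>i. - A i j) o0 o0 (- c j), 0)) [0..<n] @
     map (\<lambda>j. (coeffs o0 (e 1 p) o0 o0 o0 0, 0)) [0..<1] @
     map (\<lambda>j. (coeffs o0 (e (-1) p) o0 o0 o0 0, 0)) [0..<1] @
     map (\<lambda>j. (coeffs o0 o0 o0 o0 o0 (-1), -1)) [0..<1] @
     (if pess then
       map (\<lambda>i. (coeffs o0 o0 o0 (e (-1) i) o0 0, 0)) (sel S) @ map (\<lambda>i. (coeffs o0 o0 o0 o0 (e (-1) i) 0, 0)) (sel S) @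
       map (\<lambda>i. (coeffs o0 o0 o0 (e 1 i) o0 0, 0)) (sel (\<lambda>i. \<not> T i)) @ map (\<lambda>i. (coeffs o0 o0 o0 o0 (e 1 i) 0, 0)) (sel (\<lambda>i. \<not> T i)) @
       map (\<lambda>j. (coeffs o0 o0 o0 (\<lambda>i. A i j) o0 (- s j), 0)) [0..<n] @ map (\<lambda>j. (coeffs o0 o0 o0 (\<lambda>i. - A i j) o0 (s j), 0)) [0..<n] @
       map (\<lambda>j. (coeffs o0 o0 o0 o0 (\<lambda>i. - A i j) (- s j), 0)) [0..<n] @ map (\<lambda>j. (coeffs o0 o0 o0 o0 (\<lambda>i. A i j) (s j), 0)) [0..<n]
      else []))"

lemma length_cert_system: "length (cert_system pess m n g A B b C c D d p T S) \<le> g + 9 * m + 6 * n + 3"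
proof -
  have "length (filter P [0..<m]) \<le> m" for P using length_filter_le[of P "[0..<m]"] by simp
  from this[of T] this[of "\<lambda>i. \<not> T i"] this[of S] this[of "\<lambda>i. \<not> S i"] show ?thesis by (simp add: cert_system_def Let_def)
qed

text \<open>The factor \<open>\<tau>\<close> is the denominator under which
  \<open>small_solution\<close> returns its integers; it affects only the rows with right-hand side
  -1. The statement is used over the reals with factor 1 and over the integers.\<close>

lemma cert_system_iff:
  fixes z :: "nat \<times> nat \<Rightarrow> 'a::linordered_idom"
  assumes p: "p < n"
  defines "X \<equiv> \<lambda>l. z (0, l)" and "Y \<equiv> \<lambda>j. z (1, j)" and "L \<equiv> \<lambda>i. z (2, i)" and "U \<equiv> \<lambda>i. z (3, i)" and "W \<equiv> \<lambda>i. z (4, i)"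
    and "t \<equiv> z (5, 0)"
  shows "(\<forall>q \<in> set (cert_system pess m n g A B b C c D d p T S).
      (\<Sum>j\<in>unknowns k n m. of_int (fst q j) * z j) \<le> of_int (snd q) * \<tau>) \<longleftrightarrow>
    (\<forall>r<g. (\<Sum>l<k. of_int (D r l) * X l) - of_int (d r) * t \<le> 0) \<and>
    (\<forall>i<m. - (\<Sum>l<k. of_int (B i l) * X l) + (\<Sum>j<n. of_int (A i j) * Y j) - of_int (b i) * t \<le> 0) \<and>
    (\<forall>i<m. T i \<longrightarrow> (\<Sum>l<k. of_int (B i l) * X l) - (\<Sum>j<n. of_int (A i j) * Y j) + of_int (b i) * t \<le> 0) \<and>
    (\<forall>i<m. - L i \<le> 0) \<and> (\<forall>i<m. S i \<longrightarrow> L i \<le> 0) \<and> (\<forall>i<m. \<not> S i \<longrightarrow> - L i \<le> - \<tau>) \<and>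
    (\<forall>j<n. (\<Sum>l<k. of_int (C j l) * X l) + (\<Sum>i<m. of_int (A i j) * L i) + of_int (c j) * t \<le> 0) \<and>
    (\<forall>j<n. - (\<Sum>l<k. of_int (C j l) * X l) - (\<Sum>i<m. of_int (A i j) * L i) - of_int (c j) * t \<le> 0) \<and>
    Y p \<le> 0 \<and> - Y p \<le> 0 \<and> - t \<le> - \<tau> \<and>
    (pess \<longrightarrow> (\<forall>i<m. S i \<longrightarrow> - U i \<le> 0) \<and> (\<forall>i<m. S i \<longrightarrow> - W i \<le> 0) \<and> (\<forall>i<m. \<not> T i \<longrightarrow> U i \<le> 0) \<and> (\<forall>i<m. \<not> T i \<longrightarrow> W i \<le> 0) \<and>
      (\<forall>j<n. (\<Sum>i<m. of_int (A i j) * U i) - of_int (if j = p then 1 else 0) * t \<le> 0) \<and>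
      (\<forall>j<n. - (\<Sum>i<m. of_int (A i j) * U i) + of_int (if j = p then 1 else 0) * t \<le> 0) \<and>
      (\<forall>j<n. - (\<Sum>i<m. of_int (A i j) * W i) - of_int (if j = p then 1 else 0) * t \<le> 0) \<and>
      (\<forall>j<n. (\<Sum>i<m. of_int (A i j) * W i) + of_int (if j = p then 1 else 0) * t \<le> 0))"
proof -
  have up: "(\<forall>x \<in> set [0..<N]. P x) \<longleftrightarrow> (\<forall>x<N. P x)" "(\<forall>x \<in> set (filter Q [0..<N]). P x) \<longleftrightarrow> (\<forall>x<N. Q x \<longrightarrow> P x)" for N P Q
    by auto
  have mp: "(\<forall>q \<in> set (map f l). P q) \<longleftrightarrow> (\<forall>a \<in> set l. P (f a))" for f :: "nat \<Rightarrow> (nat \<times> nat \<Rightarrow> int) \<times> int" and l P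
    by auto
  have pe: "(\<forall>q \<in> set (if pess then l else []). P q) \<longleftrightarrow> (pess \<longrightarrow> (\<forall>q \<in> set l. P q))" for l P by (cases pess) simp_all
  have z0: "of_int 0 * w = (0::'a)" "of_int (- 1) * w = - w" "of_int 1 * w = w" "of_int (- v) * w = - (of_int v * w)"
    "x + 0 = x" "0 + x = x" "x + - y = (x - y :: 'a)" "(\<forall>a<1::nat. E) = E" "(\<forall>x<N. True \<longrightarrow> P x) = (\<forall>x<N. P x)"
    for N w v x y E P by simp_all
  have e: "(\<forall>i<m. Q i \<longrightarrow> (\<Sum>q<m. of_int (unit_coeff v i q) * f q) \<le> x) = (\<forall>i<m. Q i \<longrightarrow> of_int v * f i \<le> x)"
    "(\<forall>i<m. (\<Sum>q<m. of_int (unit_coeff v i q) * f q) \<le> x) = (\<forall>i<m. of_int v * f i \<le> x)" for f and x :: 'a and v Q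
    by (auto simp: sum_unit_coeff)
  show ?thesis
    unfolding cert_system_def Let_def set_append ball_Un pe mp up fst_conv snd_conv sum_unknowns z0 sum_unit_coeff[OF p]
      X_def Y_def L_def U_def W_def t_def
    by (simp only: sum_negf sum.neutral_const add_0_left add_0_right diff_0 diff_0_right e z0)
qed

lemma coeffs_bound:
  fixes v :: int
  assumes "j \<in> unknowns k n m" "\<And>l. l < k \<Longrightarrow> \<bar>fx l\<bar> \<le> v" "\<And>l. l < n \<Longrightarrow> \<bar>fy l\<bar> \<le> v" "\<And>i. i < m \<Longrightarrow> \<bar>fl i\<bar> \<le> v"
    "\<And>i. i < m \<Longrightarrow> \<bar>fu i\<bar> \<le> v" "\<And>i. i < m \<Longrightarrow> \<bar>fw i\<bar> \<le> v" "\<bar>ft\<bar> \<le> v"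
  shows "\<bar>coeffs fx fy fl fu fw ft j\<bar> \<le> v"
  using assms by (auto simp: coeffs_def unknowns_def)

lemma cert_small:
  fixes A B C D :: "nat \<Rightarrow> nat \<Rightarrow> int" and b c d :: "nat \<Rightarrow> int" and V :: nat
  assumes cert: "cert pess m n k g p (\<lambda>i j. real_of_int (A i j)) (\<lambda>i l. of_int (B i l)) (\<lambda>i. of_int (b i)) (\<lambda>j l. of_int (C j l))
      (\<lambda>j. of_int (c j)) (\<lambda>r l. of_int (D r l)) (\<lambda>r. of_int (d r)) 1 x y L U W"
    and norm: "pess \<longrightarrow> (\<Sum>i<m. U i * real_of_int (A i p)) = 1 \<and> (\<Sum>i<m. W i * real_of_int (A i p)) = -1"
    and p: "p < n" and V: "1 \<le> V" "\<And>i j. i < m \<Longrightarrow> j < n \<Longrightarrow> \<bar>A i j\<bar> \<le> int V" "\<And>i l. i < m \<Longrightarrow> l < k \<Longrightarrow> \<bar>B i l\<bar> \<le> int V"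
      "\<And>i. i < m \<Longrightarrow> \<bar>b i\<bar> \<le> int V" "\<And>j l. j < n \<Longrightarrow> l < k \<Longrightarrow> \<bar>C j l\<bar> \<le> int V" "\<And>j. j < n \<Longrightarrow> \<bar>c j\<bar> \<le> int V"
      "\<And>r l. r < g \<Longrightarrow> l < k \<Longrightarrow> \<bar>D r l\<bar> \<le> int V" "\<And>r. r < g \<Longrightarrow> \<bar>d r\<bar> \<le> int V"
    and H: "H = (2 * (k + n + 3 * m + 2) * ((g + 12 * m + 7 * n + k + 4) * V\<^sup>2) + 1) ^ (k + n + 3 * m + 1)"
  shows "\<exists>t X Y L U W. cert pess m n k g p A B b C c D d t X Y L U W \<and> t \<le> int H \<and>
    (\<forall>i. \<bar>X i\<bar> \<le> int H \<and> \<bar>Y i\<bar> \<le> int H \<and> \<bar>L i\<bar> \<le> int H \<and> \<bar>U i\<bar> \<le> int H \<and> \<bar>W i\<bar> \<le> int H) \<and>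
    (\<forall>i\<ge>k. X i = 0) \<and> (\<forall>i\<ge>n. Y i = 0) \<and> (\<forall>i\<ge>m. L i = 0 \<and> U i = 0 \<and> W i = 0)"
proof -
  define T where "T i \<longleftrightarrow> (\<Sum>j<n. of_int (A i j) * y j) = (\<Sum>l<k. of_int (B i l) * x l) + real_of_int (b i)" for i
  define S where "S i \<longleftrightarrow> L i = 0" for i
  let ?cs = "cert_system pess m n g A B b C c D d p T S"
  let ?J = "unknowns k n m"
  \<comment> \<open>Scaling by \<open>M\<close> lifts every nonzero multiplier, and the factor
    \<open>t = 1\<close>, to at least 1.\<close>
  define M where "M = 1 + (\<Sum>i<m. if L i = 0 then 0 else 1 / L i)"
  have L0: "0 \<le> L i" if "i < m" for i using cert that by (simp add: cert_def)
  have Ms: "0 \<le> (\<Sum>i<m. if L i = 0 then 0 else 1 / L i)" using L0 by (intro sum_nonneg) auto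
  then have M1: "1 \<le> M" by (simp add: M_def)
  have Mge: "1 \<le> M * L i" if "i < m" "L i \<noteq> 0" for i
  proof -
    have "1 / L i \<le> (\<Sum>i<m. if L i = 0 then 0 else 1 / L i)"
      using member_le_sum[of i "{..<m}" "\<lambda>i. if L i = 0 then 0 else 1 / L i"] that L0 by auto
    then have "1 / L i \<le> M" by (simp add: M_def)
    then show ?thesis using L0[OF that(1)] that(2) by (simp add: field_simps)
  qed
  define z where "z q = M * coeffs x y L U W 1 q" for q
  have sM: "(\<Sum>l<N. f l * (M * h l)) = M * (\<Sum>l<N. f l * h l)" for f h and N :: nat
    by (simp add: sum_distrib_left mult.left_commute)
  have zs: "z (0, l) = M * x l" "z (1, l) = M * y l" "z (2, l) = M * L l" "z (3, l) = M * U l" "z (4, l) = M * W l" "z (5, l) = M" for l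
    by (simp_all add: z_def coeffs_def)
  have neg: "M * v \<le> 0 \<longleftrightarrow> v \<le> 0" for v using M1 by (simp add: mult_le_0_iff)
  have "(\<forall>q \<in> set ?cs. (\<Sum>j\<in>?J. of_int (fst q j) * z j) \<le> of_int (snd q) * 1)"
  proof (subst cert_system_iff[OF p], unfold zs sM, intro conjI impI allI)
    fix r assume "r < g"
    then have "(\<Sum>l<k. of_int (D r l) * x l) - of_int (d r) \<le> 0" using cert by (simp add: cert_def)
    then have "M * ((\<Sum>l<k. of_int (D r l) * x l) - of_int (d r)) \<le> 0" by (simp only: neg)
    then show "M * (\<Sum>l<k. of_int (D r l) * x l) - of_int (d r) * M \<le> 0" by (simp add: algebra_simps)
  next
    fix i assume i: "i < m"
    have "(\<Sum>j<n. of_int (A i j) * y j) \<le> (\<Sum>l<k. of_int (B i l) * x l) + real_of_int (b i)" using cert i by (simp add: cert_def)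
    then have "- (\<Sum>l<k. of_int (B i l) * x l) + (\<Sum>j<n. of_int (A i j) * y j) - real_of_int (b i) \<le> 0" by linarith
    then have "M * (- (\<Sum>l<k. of_int (B i l) * x l) + (\<Sum>j<n. of_int (A i j) * y j) - of_int (b i)) \<le> 0" by (simp only: neg)
    then show "- (M * (\<Sum>l<k. of_int (B i l) * x l)) + M * (\<Sum>j<n. of_int (A i j) * y j) - of_int (b i) * M \<le> 0" by (simp add: algebra_simps)
    show "M * (\<Sum>l<k. of_int (B i l) * x l) - M * (\<Sum>j<n. of_int (A i j) * y j) + of_int (b i) * M \<le> 0" if "T i"
      using that by (simp add: T_def algebra_simps)
    show "- (M * L i) \<le> 0" using L0[OF i] M1 by simp
    show "M * L i \<le> 0" if "S i" using that by (simp add: S_def)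
    show "- (M * L i) \<le> - 1" if "\<not> S i" using Mge[OF i] that by (simp add: S_def)
  next
    fix i assume i: "i < m" "S i" and pess
    then have "0 \<le> U i" "0 \<le> W i" using cert by (auto simp: cert_def S_def)
    then show "- (M * U i) \<le> 0" "- (M * W i) \<le> 0" using M1 by simp_all
  next
    fix i assume i: "i < m" "\<not> T i" and pess
    then have "U i = 0" "W i = 0" using cert by (auto simp: cert_def T_def)
    then show "M * U i \<le> 0" "M * W i \<le> 0" by simp_all
  next
    fix j assume "j < n"
    then have "(\<Sum>i<m. L i * of_int (A i j)) + ((\<Sum>l<k. of_int (C j l) * x l) + of_int (c j)) = 0" using cert by (simp add: cert_def)
    moreover have "(\<Sum>i<m. of_int (A i j) * L i) = (\<Sum>i<m. L i * of_int (A i j))" by (simp add: mult.commute)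
    ultimately have e: "M * ((\<Sum>l<k. of_int (C j l) * x l) + (\<Sum>i<m. of_int (A i j) * L i) + of_int (c j)) = 0" by simp
    show "M * (\<Sum>l<k. of_int (C j l) * x l) + M * (\<Sum>i<m. of_int (A i j) * L i) + of_int (c j) * M \<le> 0"
      "- (M * (\<Sum>l<k. of_int (C j l) * x l)) - M * (\<Sum>i<m. of_int (A i j) * L i) - of_int (c j) * M \<le> 0"
      using e by (simp_all add: algebra_simps)
  next
    fix j assume "j < n" and pess
    then have "(\<Sum>i<m. U i * of_int (A i j)) = (if j = p then 1 else 0)" "(\<Sum>i<m. W i * of_int (A i j)) = - (if j = p then 1 else 0)"
      using cert norm by (auto simp: cert_def)
    then have "(\<Sum>i<m. of_int (A i j) * U i) = (if j = p then 1 else 0)" "(\<Sum>i<m. of_int (A i j) * W i) = - (if j = p then 1 else 0)"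
      by (simp_all add: mult.commute)
    then show "M * (\<Sum>i<m. of_int (A i j) * U i) - of_int (if j = p then 1 else 0) * M \<le> 0"
      "- (M * (\<Sum>i<m. of_int (A i j) * U i)) + of_int (if j = p then 1 else 0) * M \<le> 0"
      "- (M * (\<Sum>i<m. of_int (A i j) * W i)) - of_int (if j = p then 1 else 0) * M \<le> 0"
      "M * (\<Sum>i<m. of_int (A i j) * W i) + of_int (if j = p then 1 else 0) * M \<le> 0"
      by simp_all
  next
    have "y p = 0" using cert by (simp add: cert_def)
    then show "M * y p \<le> 0" "- (M * y p) \<le> 0" by simp_all
  qed (use M1 in simp)
  then have real: "\<forall>q \<in> set ?cs. (\<Sum>j\<in>?J. of_int (fst q j) * z j) \<le> of_int (snd q)" by simp
  \<comment> \<open>There are at most \<open>k + n + 3 * m + 1\<close> unknowns and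
    \<open>g + 9 * m + 6 * n + 3\<close> inequalities, whence the constants in
    \<open>H\<close>.\<close>
  define H' where "H' = (2 * (card ?J + 1) * ((length ?cs + card ?J) * V\<^sup>2) + 1) ^ card ?J"
  have HH: "H' \<le> H"
  proof -
    have 1: "length ?cs + card ?J \<le> g + 12 * m + 7 * n + k + 4"
      using length_cert_system[of pess m n g A B b C c D d p T S] card_unknowns[of k n m] by linarith
    have 2: "2 * (card ?J + 1) \<le> 2 * (k + n + 3 * m + 2)" using card_unknowns[of k n m] by simp
    have "2 * (card ?J + 1) * ((length ?cs + card ?J) * V\<^sup>2) \<le> 2 * (k + n + 3 * m + 2) * ((g + 12 * m + 7 * n + k + 4) * V\<^sup>2)"
      by (intro mult_le_mono[OF 2] mult_le_mono[OF 1] order_refl)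
    then have "H' \<le> (2 * (k + n + 3 * m + 2) * ((g + 12 * m + 7 * n + k + 4) * V\<^sup>2) + 1) ^ card ?J"
      unfolding H'_def by (intro power_mono) simp_all
    also have "\<dots> \<le> H" unfolding H using card_unknowns[of k n m] by (intro power_increasing) auto
    finally show ?thesis .
  qed
  have V0: "0 \<le> int V" "1 \<le> int V" using V(1) by simp_all
  have up: "(\<forall>x \<in> set [0..<N]. P x) \<longleftrightarrow> (\<forall>x<N. P x)" "(\<forall>x \<in> set (filter Q [0..<N]). P x) \<longleftrightarrow> (\<forall>x<N. Q x \<longrightarrow> P x)" for N P Q
    by auto
  have mp: "(\<forall>q \<in> set (map f l). P q) \<longleftrightarrow> (\<forall>a \<in> set l. P (f a))" for f :: "nat \<Rightarrow> (nat \<times> nat \<Rightarrow> int) \<times> int" and l P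
    by auto
  have pe: "(\<forall>q \<in> set (if pess then l else []). P q) \<longleftrightarrow> (pess \<longrightarrow> (\<forall>q \<in> set l. P q))" for l P by (cases pess) simp_all
  have un: "\<bar>unit_coeff e i q\<bar> \<le> int V" if "\<bar>e\<bar> \<le> 1" for e i q
    using that V0 by (simp add: unit_coeff_def)
  note V1 = V(1)[unfolded One_nat_def]
  have "\<forall>q \<in> set ?cs. \<forall>j \<in> ?J. \<bar>fst q j\<bar> \<le> int V \<and> \<bar>snd q\<bar> \<le> int V"
    unfolding cert_system_def Let_def set_append ball_Un pe mp up fst_conv snd_conv
    by (intro conjI allI impI ballI; (rule coeffs_bound, assumption)?) (simp_all add: V V1 V0 un)
  then have bnd: "\<bar>fst q j\<bar> \<le> int V" "\<bar>snd q\<bar> \<le> int V" if "q \<in> set ?cs" "j \<in> ?J" for q j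
    using that by blast+
  have bnd2: "\<bar>snd q\<bar> \<le> int V" if "q \<in> set ?cs" for q
    by (rule bnd(2)[OF that, of "(1, p)"]) (use p in \<open>simp add: unknowns_def\<close>)
  obtain Z \<tau> where Z: "0 < \<tau>" "\<tau> \<le> int H'" "\<forall>j\<in>?J. \<bar>Z j\<bar> \<le> int H'" "\<forall>c \<in> set ?cs. (\<Sum>q\<in>?J. fst c q * Z q) \<le> snd c * \<tau>"
    using small_solution[OF finite_unknowns V(1) bnd(1) bnd2 real H'_def] by blast
  \<comment> \<open>Zero beyond the dimensions, so that finite lists can represent these
    functions.\<close>
  define pick where "pick a N i = (if i < N then Z (a, i) else 0)" for a N i :: nat
  have sums: "(\<Sum>l<N. f l * pick a N l) = (\<Sum>l<N. f l * Z (a, l))" "(\<Sum>l<N. pick a N l * f l) = (\<Sum>l<N. f l * Z (a, l))" for f a N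
    by (simp_all add: pick_def mult.commute)
  have pk: "pick a N i = Z (a, i)" if "i < N" for a N i using that by (simp add: pick_def)
  \<comment> \<open>The denominator \<open>\<tau>\<close> can be forgotten: the conditions of a
    certificate are homogeneous, so the integers themselves form one with scaling factor
    \<open>Z (5, 0) \<ge> \<tau>\<close>.\<close>
  let ?t = "Z (5, 0)"
  have "\<forall>c \<in> set ?cs. (\<Sum>q\<in>?J. of_int (fst c q) * Z q) \<le> of_int (snd c) * \<tau>" using Z(4) by simp
  note sys = this[unfolded cert_system_iff[OF p], unfolded of_int_eq_id id_apply]
  have TS: "L i \<noteq> 0 \<Longrightarrow> T i" if "i < m" for i using cert that by (auto simp: cert_def T_def)
  note c2 = sys[THEN conjunct2] note c3 = c2[THEN conjunct2] note c4 = c3[THEN conjunct2] note c5 = c4[THEN conjunct2]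
  note c6 = c5[THEN conjunct2] note c7 = c6[THEN conjunct2] note c8 = c7[THEN conjunct2] note c9 = c8[THEN conjunct2]
  note c10 = c9[THEN conjunct2] note c11 = c10[THEN conjunct2] note c12 = c11[THEN conjunct2]
  have s1: "\<forall>r<g. (\<Sum>l<k. D r l * Z (0, l)) \<le> d r * ?t"
    using sys[THEN conjunct1] by simp
  have s2: "\<forall>i<m. (\<Sum>j<n. A i j * Z (1, j)) \<le> (\<Sum>l<k. B i l * Z (0, l)) + b i * ?t"
    using c2[THEN conjunct1] by (simp add: algebra_simps)
  have s3: "\<forall>i<m. T i \<longrightarrow> (\<Sum>l<k. B i l * Z (0, l)) + b i * ?t \<le> (\<Sum>j<n. A i j * Z (1, j))"
    using c3[THEN conjunct1] by (simp add: algebra_simps)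
  have s4: "\<forall>i<m. 0 \<le> Z (2, i)" using c4[THEN conjunct1] by simp
  have s5: "\<forall>i<m. S i \<longrightarrow> Z (2, i) \<le> 0" using c5[THEN conjunct1] by simp
  have s6: "\<forall>i<m. \<not> S i \<longrightarrow> \<tau> \<le> Z (2, i)" using c6[THEN conjunct1] by simp
  have s7: "\<forall>j<n. (\<Sum>l<k. C j l * Z (0, l)) + (\<Sum>i<m. A i j * Z (2, i)) + c j * ?t = 0"
  proof (intro allI impI)
    fix j assume "j < n"
    then show "(\<Sum>l<k. C j l * Z (0, l)) + (\<Sum>i<m. A i j * Z (2, i)) + c j * ?t = 0"
      using c7[THEN conjunct1, rule_format, of j] c8[THEN conjunct1, rule_format, of j] by linarith
  qed
  have s8: "Z (1, p) = 0" using c9[THEN conjunct1] c10[THEN conjunct1] by simp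
  have s9: "\<tau> \<le> ?t" using c11[THEN conjunct1] by simp
  have s10: "\<forall>i<m. S i \<longrightarrow> 0 \<le> Z (3, i) \<and> 0 \<le> Z (4, i)" if pess
    using c12[rule_format, OF that, THEN conjunct1]
      c12[rule_format, OF that, THEN conjunct2, THEN conjunct1] by simp
  note p3 = c12[rule_format, THEN conjunct2, THEN conjunct2]
  have s11: "\<forall>i<m. \<not> T i \<longrightarrow> Z (3, i) \<le> 0 \<and> Z (4, i) \<le> 0" if pess
    using p3[OF that, THEN conjunct1] p3[OF that, THEN conjunct2, THEN conjunct1] by simp
  note p5 = p3[THEN conjunct2, THEN conjunct2]
  note p6 = p5[THEN conjunct2]
  note p7 = p6[THEN conjunct2]
  have s12: "\<forall>j<n. (\<Sum>i<m. A i j * Z (3, i)) = (if j = p then ?t else 0) \<and> (\<Sum>i<m. A i j * Z (4, i)) = - (if j = p then ?t else 0)" if pess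
  proof (intro allI impI)
    fix j assume j: "j < n"
    have m: "(if j = p then 1 else 0) * ?t = (if j = p then ?t else 0)" by simp
    show "(\<Sum>i<m. A i j * Z (3, i)) = (if j = p then ?t else 0) \<and> (\<Sum>i<m. A i j * Z (4, i)) = - (if j = p then ?t else 0)"
      using p5[OF that, THEN conjunct1, rule_format, OF j] p6[OF that, THEN conjunct1, rule_format, OF j]
        p7[OF that, THEN conjunct1, rule_format, OF j] p7[OF that, THEN conjunct2, rule_format, OF j] unfolding m by linarith
  qed
  have "cert pess m n k g p A B b C c D d ?t (pick 0 k) (pick 1 n) (pick 2 m) (pick 3 m) (pick 4 m)"
    unfolding cert_def sums
  proof (intro conjI allI impI)
    show "0 < ?t" using s9 Z(1) by simp
    show "pick 1 n p = 0" using s8 p by (simp add: pk)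
    fix i assume i: "i < m"
    show "0 \<le> pick 2 m i" using s4 i by (simp add: pk)
    show "(\<Sum>j<n. A i j * Z (1, j)) = (\<Sum>l<k. B i l * Z (0, l)) + b i * ?t \<or>
        pick 2 m i = 0 \<and> (pess \<longrightarrow> pick 3 m i = 0 \<and> pick 4 m i = 0)"
    proof (cases "T i")
      case True then show ?thesis using s2 s3 i by (auto intro: antisym)
    next
      case False
      then have "S i" using TS[OF i] by (auto simp: S_def)
      then have "Z (2, i) = 0" using s4 s5 i by (auto intro: antisym)
      moreover have "Z (3, i) = 0 \<and> Z (4, i) = 0" if pess using s10[OF that] s11[OF that] i \<open>S i\<close> False by (auto intro: antisym)
      ultimately show ?thesis using i by (simp add: pk)
    qed
    show "0 \<le> pick 3 m i" "0 \<le> pick 4 m i" if pess and "pick 2 m i = 0"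
    proof -
      have "Z (2, i) = 0" using that(2) i by (simp add: pk)
      then have "S i" using s6[rule_format, OF i] Z(1) by (cases "S i") simp_all
      then show "0 \<le> pick 3 m i" "0 \<le> pick 4 m i" using s10[OF that(1)] i by (simp_all add: pk)
    qed
    show "(\<Sum>j<n. A i j * Z (1, j)) \<le> (\<Sum>l<k. B i l * Z (0, l)) + b i * ?t" using s2 i by simp
  next
    fix r assume "r < g" then show "(\<Sum>l<k. D r l * Z (0, l)) \<le> d r * ?t" using s1 by simp
  next
    fix j assume "j < n" then show "(\<Sum>i<m. A i j * Z (2, i)) + ((\<Sum>l<k. C j l * Z (0, l)) + c j * ?t) = 0"
      using s7 by (simp add: algebra_simps)
  next
    fix j assume pess "j < n"
    then show "if j = p then 0 < (\<Sum>i<m. A i j * Z (3, i)) \<and> (\<Sum>i<m. A i j * Z (4, i)) < 0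
       else (\<Sum>i<m. A i j * Z (3, i)) = 0 \<and> (\<Sum>i<m. A i j * Z (4, i)) = 0"
      using s12 s9 Z(1) by simp
  qed
  moreover have bound: "\<bar>pick a N i\<bar> \<le> int H" if "{a} \<times> {..<N} \<subseteq> ?J" for a N i
  proof (cases "i < N")
    case True
    then have "\<bar>Z (a, i)\<bar> \<le> int H'" using Z(3) that by auto
    then show ?thesis using True HH by (simp add: pick_def)
  qed (simp add: pick_def)
  moreover have "?t \<le> int H"
  proof -
    have "(5, 0) \<in> ?J" by (simp add: unknowns_def)
    then have "\<bar>?t\<bar> \<le> int H'" using Z(3) by blast
    then show ?thesis using HH by simp
  qed
  ultimately have "cert pess m n k g p A B b C c D d ?t (pick 0 k) (pick 1 n) (pick 2 m) (pick 3 m) (pick 4 m) \<and> ?t \<le> int H \<and>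
    (\<forall>i. \<bar>pick 0 k i\<bar> \<le> int H \<and> \<bar>pick 1 n i\<bar> \<le> int H \<and> \<bar>pick 2 m i\<bar> \<le> int H \<and> \<bar>pick 3 m i\<bar> \<le> int H \<and> \<bar>pick 4 m i\<bar> \<le> int H) \<and>
    (\<forall>i\<ge>k. pick 0 k i = 0) \<and> (\<forall>i\<ge>n. pick 1 n i = 0) \<and> (\<forall>i\<ge>m. pick 2 m i = 0 \<and> pick 3 m i = 0 \<and> pick 4 m i = 0)"
  proof (intro conjI allI)
    show "\<bar>pick 0 k i\<bar> \<le> int H" "\<bar>pick 1 n i\<bar> \<le> int H" "\<bar>pick 2 m i\<bar> \<le> int H" "\<bar>pick 3 m i\<bar> \<le> int H" "\<bar>pick 4 m i\<bar> \<le> int H" for i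
      by (rule bound; force simp: unknowns_def)+
  qed (simp_all add: pick_def)
  then show ?thesis by blast
qed


section \<open>Arithmetic on binary numbers\<close>

lemma val_append: "val (k @ l) = val k + 2 ^ length k * val l"
  by (induction k) (simp_all add: algebra_simps)

lemma val_replicate_False [simp]: "val (replicate n False) = 0"
  by (induction n) simp_all

lemma val_less: "val l < 2 ^ length l"
  by (induction l) (auto simp: of_bool_def)

definition add_step :: "bool \<times> bool \<Rightarrow> bool \<times> bool list \<Rightarrow> bool \<times> bool list" where
  "add_step p s = ((fst p \<and> snd p) \<or> (fst s \<and> (fst p \<or> snd p)), ((fst p \<noteq> snd p) \<noteq> fst s) # snd s)"

text \<open>Padding each number by the length of the other gives equal lengths without comparing
  them.\<close>

definition pad :: "bool list \<Rightarrow> bool list \<Rightarrow> bool list" where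
  "pad k l = k @ replicate (length l) False"

definition add_bits :: "bool list \<Rightarrow> bool list \<Rightarrow> bool list" where
  "add_bits k l = (let s = fold add_step (zip (pad k l) (pad l k)) (False, []) in rev (snd s) @ [fst s])"

lemma length_pad: "length (pad k l) = length k + length l"
  by (simp add: pad_def)

lemma val_pad [simp]: "val (pad k l) = val k"
  by (simp add: pad_def val_append)

lemma fold_add_step:
  assumes "length k = length l"
  shows "val (rev (snd (fold add_step (zip k l) s)) @ [fst (fold add_step (zip k l) s)]) =
      val (rev (snd s)) + 2 ^ length (snd s) * (of_bool (fst s) + val k + val l) \<and>
    length (snd (fold add_step (zip k l) s)) = length (snd s) + length k"
  using assms
proof (induction k l arbitrary: s rule: list_induct2)
  case (Cons a k b l)
  show ?case
    using Cons.IH[of "add_step (a, b) s"]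
    by (cases a; cases b; cases "fst s") (simp_all add: add_step_def val_append algebra_simps)
qed (simp add: val_append)

lemma val_add_bits [simp]: "val (add_bits k l) = val k + val l"
  using fold_add_step[of "pad k l" "pad l k" "(False, [])"] by (simp add: add_bits_def Let_def length_pad)

lemma length_add_bits: "length (add_bits k l) = Suc (length k + length l)"
  using fold_add_step[of "pad k l" "pad l k" "(False, [])"] by (simp add: add_bits_def Let_def length_pad)

text \<open>The least significant digit comes first, hence a later difference overrides the
  comparison so far; the initial value decides the case of equality.\<close>

definition le_step :: "bool \<times> bool \<Rightarrow> bool \<Rightarrow> bool" where
  "le_step p s = (if fst p = snd p then s else snd p)"

lemma fold_le_step:
  assumes "length k = length l"
  shows "fold le_step (zip k l) s \<longleftrightarrow> val k < val l + of_bool s"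
  using assms
proof (induction k l arbitrary: s rule: list_induct2)
  case (Cons a k b l)
  have "fold le_step (zip (a # k) (b # l)) s \<longleftrightarrow> val k < val l + of_bool (le_step (a, b) s)"
    using Cons.IH by simp
  also have "\<dots> \<longleftrightarrow> val (a # k) < val (b # l) + of_bool s"
    by (cases a; cases b; cases s) (simp_all add: le_step_def, presburger+)
  finally show ?case .
qed simp

lemma PT_add_bits [PT_intros]:
  assumes "PT k" "PT l" shows "PT (\<lambda>e. add_bits (k e) (l e))"
proof -
  have "PT (\<lambda>e. fold add_step (zip (pad (k e) (l e)) (pad (l e) (k e))) (False, []))"
  proof (rule PT_fold_add)
    show "sz (add_step p s) \<le> sz s + 8" for e p s
      using sz_bool[of "fst (add_step p s)"] sz_bool[of "hd (snd (add_step p s))"] sz_pos[of "fst s"]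
      by (cases s) (simp add: add_step_def)
  qed (unfold add_step_def pad_def, (intro PT_intros assms)+)
  then show ?thesis unfolding add_bits_def Let_def by (intro PT_intros)
qed

lemma PT_val_le [PT_intros]:
  assumes "PT k" "PT l" shows "PT (\<lambda>e. val (k e) \<le> val (l e))"
proof -
  have "PT (\<lambda>e. fold le_step (zip (pad (k e) (l e)) (pad (l e) (k e))) True)"
  proof (rule PT_fold_add)
    show "sz (le_step p s) \<le> sz s + 3" for e p s
      using sz_bool[of "le_step p s"] by linarith
  qed (unfold le_step_def pad_def, (intro PT_intros assms)+)
  then show ?thesis by (simp add: fold_le_step length_pad less_Suc_eq_le)
qed

text \<open>\<open>NPT f\<close>: binary digits of \<open>f e\<close>, possibly with leading zeros, can be computed from \<open>e\<close> in
  polynomial time. \<open>IPT f\<close>: the same for a representation of \<open>f e\<close> as a difference.\<close>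

definition NPT :: "('e::enc \<Rightarrow> nat) \<Rightarrow> bool" where
  "NPT f \<longleftrightarrow> (\<exists>d. PT d \<and> (\<forall>e. val (d e) = f e))"

definition IPT :: "('e::enc \<Rightarrow> int) \<Rightarrow> bool" where
  "IPT f \<longleftrightarrow> (\<exists>p q. NPT p \<and> NPT q \<and> (\<forall>e. f e = int (p e) - int (q e)))"

named_theorems IPT_intros

lemma NPT_val: "PT l \<Longrightarrow> NPT (\<lambda>e. val (l e))"
  unfolding NPT_def by blast

lemma NPT_const: "NPT (\<lambda>_. c)"
  using NPT_val[OF PT_const, of "nat_bits c"] by simp

lemma NPT_if: "PT b \<Longrightarrow> NPT f \<Longrightarrow> NPT g \<Longrightarrow> NPT (\<lambda>e. if b e then f e else g e)"
proof -
  assume b: "PT b" and "NPT f" "NPT g"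
  then obtain d d' where "PT d" "\<And>e. val (d e) = f e" "PT d'" "\<And>e. val (d' e) = g e" unfolding NPT_def by blast
  then show ?thesis unfolding NPT_def by (intro exI[of _ "\<lambda>e. if b e then d e else d' e"]) (simp add: PT_if b)
qed

lemma NPT_add: assumes "NPT f" "NPT g" shows "NPT (\<lambda>e. f e + g e)"
proof -
  obtain d d' where "PT d" "\<And>e. val (d e) = f e" "PT d'" "\<And>e. val (d' e) = g e"
    using assms unfolding NPT_def by blast
  then show ?thesis unfolding NPT_def by (intro exI[of _ "\<lambda>e. add_bits (d e) (d' e)"]) (simp add: PT_add_bits)
qed

lemma PT_NPT_le: assumes "NPT f" "NPT g" shows "PT (\<lambda>e. f e \<le> g e)"
proof -
  obtain d d' where "PT d" "\<And>e. val (d e) = f e" "PT d'" "\<And>e. val (d' e) = g e"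
    using assms unfolding NPT_def by blast
  then show ?thesis using PT_val_le[of d d'] by simp
qed

text \<open>A sum has one digit more than both summands together, so the accumulator grows by at
  most the size of each summand and stays linear in the size of the list, although leading zeros are
  never removed.\<close>

lemma length_fold_add_bits: "length (fold add_bits l s) + 1 \<le> length s + sz l"
proof (induction l arbitrary: s)
  case (Cons a l)
  have "length (fold add_bits l (add_bits a s)) + 1 \<le> length (add_bits a s) + sz l" by (rule Cons.IH)
  then show ?case using length_le_sz[of a] by (simp add: length_add_bits)
qed simp

lemma sz_take: "sz (take n l) \<le> sz l"
proof (induction l arbitrary: n)
  case (Cons a l) show ?case using Cons.IH[of "n - 1"] by (cases n) simp_all
qed simp

lemma NPT_sum:
  fixes n :: "'e::enc \<Rightarrow> nat"
  assumes n: "PT n" and f: "NPT (\<lambda>p. f (fst p) (snd p))"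
  shows "NPT (\<lambda>e. \<Sum>l<n e. f e l)"
proof -
  obtain d where d: "PT d" "\<And>p. val (d p) = f (fst p) (snd p)" using f unfolding NPT_def by blast
  let ?l = "\<lambda>e. map (\<lambda>l. d (e, l)) [0..<n e]"
  have l: "PT ?l" by (intro PT_intros n PT_comp[OF _ d(1)])
  have "PT (\<lambda>e. fold add_bits (?l e) [])"
  proof (rule PT_fold[OF l])
    show "PB (\<lambda>e. 1 + 4 * sz (?l e))" by (intro PT_intros PB_sz l)
    fix e k
    show "sz (fold add_bits (take k (?l e)) []) \<le> 1 + 4 * sz (?l e)"
      using sz_bools[of "fold add_bits (take k (?l e)) []"] length_fold_add_bits[of "take k (?l e)" "[]"] sz_take[of k "?l e"]
      by simp
  qed (intro PT_intros)+
  moreover have "val (fold add_bits l s) = val s + sum_list (map val l)" for l s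
    by (induction l arbitrary: s) simp_all
  then have "val (fold add_bits (?l e) []) = (\<Sum>l<n e. f e l)" for e
    by (simp add: d comp_def interv_sum_list_conv_sum_set_nat atLeast0LessThan)
  ultimately show ?thesis unfolding NPT_def by blast
qed

lemma val_sum: "val l = (\<Sum>i<length l. if l ! i then 2 ^ i else 0)"
proof (induction l)
  case (Cons b l)
  have "(\<Sum>i<length (b # l). if (b # l) ! i then 2 ^ i else 0) =
      (if b then 1 else 0) + (\<Sum>i<length l. if l ! i then 2 ^ Suc i else (0::nat))"
    unfolding length_Cons lessThan_Suc_eq_insert_0
    by (subst sum.insert) (auto simp: sum.reindex)
  then show ?case using Cons by (auto simp: sum_distrib_left intro!: sum.cong)
qed simp

text \<open>The school method: copies of the second factor, shifted by prepending zeros, are summed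
  over the digits 1 of the first factor.\<close>

lemma NPT_mult: assumes "NPT f" "NPT g" shows "NPT (\<lambda>e. f e * g e)"
proof -
  obtain d d' where d: "PT d" "\<And>e. val (d e) = f e" "PT d'" "\<And>e. val (d' e) = g e"
    using assms unfolding NPT_def by blast
  have "NPT (\<lambda>e. \<Sum>i<length (d e). if nth_or False (d e) i then val (replicate i False @ d' e) else 0)"
    by (intro NPT_sum NPT_if NPT_val NPT_const PT_intros d(1) PT_comp[OF PT_fst[OF PT_id] d(1)] PT_comp[OF PT_fst[OF PT_id] d(3)])
  moreover have "(\<Sum>i<length (d e). if nth_or False (d e) i then val (replicate i False @ d' e) else 0) = f e * g e" for e
  proof -
    have "(\<Sum>i<length (d e). if nth_or False (d e) i then val (replicate i False @ d' e) else 0) =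
        (\<Sum>i<length (d e). (if d e ! i then 2 ^ i else 0) * g e)"
      by (intro sum.cong) (simp_all add: val_append d)
    then show ?thesis unfolding d(2)[symmetric, of e] val_sum[of "d e"] by (simp add: sum_distrib_right)
  qed
  ultimately show ?thesis by simp
qed

lemma IPT_of_nat: "NPT f \<Longrightarrow> IPT (\<lambda>e. int (f e))"
  unfolding IPT_def by (intro exI[of _ f] exI[of _ "\<lambda>_. 0"]) (simp add: NPT_const)

lemma IPT_0 [IPT_intros]: "IPT (\<lambda>_. 0)" and IPT_1 [IPT_intros]: "IPT (\<lambda>_. 1)"
  using IPT_of_nat[OF NPT_const, of 0] IPT_of_nat[OF NPT_const, of 1] by simp_all

lemma IPT_val [IPT_intros]: "PT l \<Longrightarrow> IPT (\<lambda>e. int (val (l e)))"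
  by (intro IPT_of_nat NPT_val)

lemma IPT_minus [IPT_intros]: "IPT f \<Longrightarrow> IPT (\<lambda>e. - f e)"
  unfolding IPT_def by (metis minus_diff_eq)

lemma IPT_add [IPT_intros]: assumes "IPT f" "IPT g" shows "IPT (\<lambda>e. f e + g e)"
proof -
  obtain p q p' q' where "NPT p" "NPT q" "\<And>e. f e = int (p e) - int (q e)" "NPT p'" "NPT q'" "\<And>e. g e = int (p' e) - int (q' e)"
    using assms unfolding IPT_def by blast
  then show ?thesis
    unfolding IPT_def by (intro exI[of _ "\<lambda>e. p e + p' e"] exI[of _ "\<lambda>e. q e + q' e"]) (simp add: NPT_add)
qed

lemma IPT_mult [IPT_intros]: assumes "IPT f" "IPT g" shows "IPT (\<lambda>e. f e * g e)"
proof -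
  obtain p q p' q' where *: "NPT p" "NPT q" "\<And>e. f e = int (p e) - int (q e)" "NPT p'" "NPT q'" "\<And>e. g e = int (p' e) - int (q' e)"
    using assms unfolding IPT_def by blast
  have "f e * g e = int (p e * p' e + q e * q' e) - int (p e * q' e + q e * p' e)" for e
    unfolding * by (simp add: algebra_simps)
  then show ?thesis
    unfolding IPT_def by (intro exI[of _ "\<lambda>e. p e * p' e + q e * q' e"] exI[of _ "\<lambda>e. p e * q' e + q e * p' e"])
      (intro conjI NPT_add NPT_mult * allI)
qed

lemma IPT_sum [IPT_intros]:
  fixes n :: "'e::enc \<Rightarrow> nat"
  assumes "PT n" "IPT (\<lambda>p. f (fst p) (snd p))" shows "IPT (\<lambda>e. \<Sum>l<n e. f e l)"
proof -
  obtain p q where *: "NPT p" "NPT q" "\<And>x. f (fst x) (snd x) = int (p x) - int (q x)"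
    using assms(2) unfolding IPT_def by blast
  have "f e l = int (p (e, l)) - int (q (e, l))" for e l using *(3)[of "(e, l)"] by simp
  then show ?thesis
    using * unfolding IPT_def by (intro exI[of _ "\<lambda>e. \<Sum>l<n e. p (e, l)"] exI[of _ "\<lambda>e. \<Sum>l<n e. q (e, l)"])
      (simp add: NPT_sum assms(1) sum_subtractf)
qed

lemma IPT_if [IPT_intros]:
  assumes "PT b" "IPT f" "IPT g" shows "IPT (\<lambda>e. if b e then f e else g e)"
proof -
  obtain p q p' q' where "NPT p" "NPT q" "\<And>e. f e = int (p e) - int (q e)" "NPT p'" "NPT q'" "\<And>e. g e = int (p' e) - int (q' e)"
    using assms unfolding IPT_def by blast
  then show ?thesis
    unfolding IPT_def by (intro exI[of _ "\<lambda>e. if b e then p e else p' e"] exI[of _ "\<lambda>e. if b e then q e else q' e"])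
      (simp add: NPT_if assms(1))
qed

lemma PT_int_le [PT_intros]: assumes "IPT f" "IPT g" shows "PT (\<lambda>e. f e \<le> g e)"
proof -
  obtain p q p' q' where *: "NPT p" "NPT q" "\<And>e. f e = int (p e) - int (q e)" "NPT p'" "NPT q'" "\<And>e. g e = int (p' e) - int (q' e)"
    using assms unfolding IPT_def by blast
  have "PT (\<lambda>e. p e + q' e \<le> p' e + q e)" by (intro PT_NPT_le NPT_add *)
  moreover have "p e + q' e \<le> p' e + q e \<longleftrightarrow> f e \<le> g e" for e unfolding * by linarith
  ultimately show ?thesis by simp
qed

lemma PT_int_less [PT_intros]: "IPT f \<Longrightarrow> IPT g \<Longrightarrow> PT (\<lambda>e. f e < g e)"
  using PT_not[OF PT_int_le, of g f] by (simp add: not_le)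

lemma PT_int_eq [PT_intros]: "IPT f \<Longrightarrow> IPT g \<Longrightarrow> PT (\<lambda>e. f e = g e)"
  using PT_conj[OF PT_int_le PT_int_le, of f g g f] by (simp add: order_eq_iff)

lemma PT_all_less [PT_intros]:
  fixes n :: "'e::enc \<Rightarrow> nat"
  assumes "PT n" "PT (\<lambda>p. P (fst p) (snd p))" shows "PT (\<lambda>e. \<forall>i<n e. P e i)"
proof -
  have "PT (\<lambda>e. \<forall>i \<in> set [0..<n e]. P e i)" by (intro PT_intros assms)
  moreover have "(\<forall>i \<in> set [0..<N]. Q i) \<longleftrightarrow> (\<forall>i<N. Q i)" for N Q by auto
  ultimately show ?thesis by simp
qed


section \<open>Scenarios of scaled instances\<close>

context
  fixes sc :: "'e \<Rightarrow> int" and z :: 'e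
begin

text \<open>The context fixes a function \<open>sc\<close>, meant to give the integer value of an
  entry after multiplication by a common denominator, and an entry \<open>z\<close> that is returned
  by lookups outside of the instance.\<close>

definition lp_A :: "'e linst \<Rightarrow> nat \<Rightarrow> nat \<Rightarrow> int" where
  "lp_A F i j = sc (nth_or z (fst (nth_or ([], [], z) (fst (snd F)) i)) j)"
definition lp_B :: "'e linst \<Rightarrow> nat \<Rightarrow> nat \<Rightarrow> int" where
  "lp_B F i l = sc (nth_or z (fst (snd (nth_or ([], [], z) (fst (snd F)) i))) l)"
definition lp_b :: "'e linst \<Rightarrow> nat \<Rightarrow> int" where
  "lp_b F i = sc (snd (snd (nth_or ([], [], z) (fst (snd F)) i)))"
definition lp_C :: "'e linst \<Rightarrow> nat \<Rightarrow> nat \<Rightarrow> int" where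
  "lp_C F j l = sc (nth_or z (fst (nth_or ([], z) (fst (snd (snd F))) j)) l)"
definition lp_c :: "'e linst \<Rightarrow> nat \<Rightarrow> int" where
  "lp_c F j = sc (snd (nth_or ([], z) (fst (snd (snd F))) j))"
definition lp_D :: "'e linst \<Rightarrow> nat \<Rightarrow> nat \<Rightarrow> int" where
  "lp_D F r l = sc (nth_or z (fst (nth_or ([], z) (fst (snd (snd (snd F)))) r)) l)"
definition lp_d :: "'e linst \<Rightarrow> nat \<Rightarrow> int" where
  "lp_d F r = sc (snd (nth_or ([], z) (fst (snd (snd (snd F)))) r))"

definition icert :: "bool \<Rightarrow> 'e linst \<Rightarrow> int \<Rightarrow> (nat \<Rightarrow> int) \<Rightarrow> (nat \<Rightarrow> int) \<Rightarrow> (nat \<Rightarrow> int) \<Rightarrow> (nat \<Rightarrow> int) \<Rightarrow> (nat \<Rightarrow> int) \<Rightarrow> bool" where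
  "icert pess F = cert pess (length (fst (snd F))) (length (fst (snd (snd F)))) (fst F) (length (fst (snd (snd (snd F)))))
     (snd (snd (snd (snd F)))) (lp_A F) (lp_B F) (lp_b F) (lp_C F) (lp_c F) (lp_D F) (lp_d F)"

definition lp_opt_at :: "'e linst \<Rightarrow> (nat \<Rightarrow> real) \<Rightarrow> (nat \<Rightarrow> real) \<Rightarrow> bool" where
  "lp_opt_at F x = lp_opt (length (fst (snd F))) (length (fst (snd (snd F)))) (\<lambda>i j. of_int (lp_A F i j))
     (\<lambda>i. (\<Sum>l<fst F. of_int (lp_B F i l) * x l) + of_int (lp_b F i)) (\<lambda>j. (\<Sum>l<fst F. of_int (lp_C F j l) * x l) + of_int (lp_c F j))"

definition in_X :: "'e linst \<Rightarrow> (nat \<Rightarrow> real) \<Rightarrow> bool" where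
  "in_X F x \<longleftrightarrow> (\<forall>r<length (fst (snd (snd (snd F)))). (\<Sum>l<fst F. of_int (lp_D F r l) * x l) \<le> of_int (lp_d F r))"

lemma rdot_scaled:
  assumes "length r = q" "\<And>e. e \<in> set r \<Longrightarrow> of_int (sc e) = s * real_of_rat (v e)"
  shows "(\<Sum>j<q. of_int (sc (nth_or z r j)) * f j) = s * rdot v r (vec q f)"
  using assms by (auto simp: rdot_def sum_distrib_left mult.assoc intro!: sum.cong)

lemma ball_carrier: "(\<forall>w \<in> {w \<in> carrier_vec n. P w}. Q w) \<longleftrightarrow> (\<forall>f. P (vec n f) \<longrightarrow> Q (vec n f))"
proof
  assume h: "\<forall>f. P (vec n f) \<longrightarrow> Q (vec n f)"
  show "\<forall>w \<in> {w \<in> carrier_vec n. P w}. Q w"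
  proof clarify
    fix w assume "w \<in> carrier_vec n" "P w"
    moreover have "vec n (($) w) = w" using \<open>w \<in> carrier_vec n\<close> by auto
    ultimately show "Q w" using h[rule_format, of "($) w"] by simp
  qed
qed auto

text \<open>All rows and the objective are multiplied by the same positive number \<open>s\<close>,
  which changes neither the feasible nor the optimal solutions.\<close>

lemma opt_at_iff:
  assumes sh: "shaped F" and s: "0 < s" and sc: "\<And>e. e \<in> set (entries F) \<Longrightarrow> of_int (sc e) = s * real_of_rat (v e)"
  shows "vec (length (fst (snd (snd F)))) y \<in> Opt Natural_Form (inst_of v F) (vec (fst F) x) \<longleftrightarrow> lp_opt_at F x y"
    and "vec (fst F) x \<in> X_set (inst_of v F) \<longleftrightarrow> in_X F x"
proof -
  obtain k R C D i where F: "F = (k, R, C, D, i)" by (cases F)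
  note sh' = sh[unfolded F]
  let ?x = "vec k x"
  have len: "length (fst (R ! i)) = length C" "length (fst (snd (R ! i))) = k" if "i < length R" for i
    using sh' nth_mem[OF that] by auto
  have lenC: "length (fst (C ! j)) = k" if "j < length C" for j using sh' nth_mem[OF that] by auto
  have lenD: "length (fst (D ! j)) = k" if "j < length D" for j using sh' nth_mem[OF that] by auto
  have eR: "set (fst r) \<subseteq> set (entries F)" "set (fst (snd r)) \<subseteq> set (entries F)" "snd (snd r) \<in> set (entries F)" if "r \<in> set R" for r
    using that by (auto simp: F)
  have eC: "set (fst r) \<subseteq> set (entries F)" "snd r \<in> set (entries F)" if "r \<in> set C \<union> set D" for r
    using that by (auto simp: F)
  have sR: "\<And>e. e \<in> set (fst (R ! i)) \<Longrightarrow> of_int (sc e) = s * real_of_rat (v e)"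
    "\<And>e. e \<in> set (fst (snd (R ! i))) \<Longrightarrow> of_int (sc e) = s * real_of_rat (v e)"
    "of_int (sc (snd (snd (R ! i)))) = s * real_of_rat (v (snd (snd (R ! i))))" if "i < length R" for i
    using eR[OF nth_mem[OF that]] sc by blast+
  have sC: "\<And>e. e \<in> set (fst (C ! i)) \<Longrightarrow> of_int (sc e) = s * real_of_rat (v e)"
    "of_int (sc (snd (C ! i))) = s * real_of_rat (v (snd (C ! i)))" if "i < length C" for i
    using eC[OF UnI1[OF nth_mem[OF that]]] sc by blast+
  have sD: "\<And>e. e \<in> set (fst (D ! i)) \<Longrightarrow> of_int (sc e) = s * real_of_rat (v e)"
    "of_int (sc (snd (D ! i))) = s * real_of_rat (v (snd (D ! i)))" if "i < length D" for i
    using eC[OF UnI2[OF nth_mem[OF that]]] sc by blast+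
  have A: "(\<Sum>j<length C. of_int (lp_A F i j) * f j) = s * rdot v (fst (R ! i)) (vec (length C) f)" if "i < length R" for i f
    using rdot_scaled[OF len(1)[OF that] sR(1)[OF that]] that by (simp add: lp_A_def F)
  have B: "(\<Sum>l<k. of_int (lp_B F i l) * x l) + of_int (lp_b F i) = s * (rdot v (fst (snd (R ! i))) ?x + real_of_rat (v (snd (snd (R ! i)))))"
    if "i < length R" for i
    using rdot_scaled[OF len(2)[OF that] sR(2)[OF that]] sR(3)[OF that] that by (simp add: lp_B_def lp_b_def F distrib_left)
  have C: "(\<Sum>l<k. of_int (lp_C F i l) * x l) + of_int (lp_c F i) = s * (rdot v (fst (C ! i)) ?x + real_of_rat (v (snd (C ! i))))"
    if "i < length C" for i
    using rdot_scaled[OF lenC[OF that] sC(1)[OF that]] sC(2)[OF that] that by (simp add: lp_C_def lp_c_def F distrib_left)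
  have Dx: "(\<Sum>l<k. of_int (lp_D F i l) * x l) = s * rdot v (fst (D ! i)) ?x" "of_int (lp_d F i) = s * real_of_rat (v (snd (D ! i)))"
    if "i < length D" for i
    using rdot_scaled[OF lenD[OF that] sD(1)[OF that]] sD(2)[OF that] that by (simp_all add: lp_D_def lp_d_def F)
  have xk: "?x \<in> carrier_vec k" by simp
  have feas: "(\<forall>i<length R. (\<Sum>j<length C. of_int (lp_A F i j) * f j) \<le> (\<Sum>l<k. of_int (lp_B F i l) * x l) + of_int (lp_b F i)) \<longleftrightarrow>
     (\<forall>r \<in> set R. rdot v (fst r) (vec (length C) f) \<le> rdot v (fst (snd r)) ?x + real_of_rat (v (snd (snd r))))" for f
    using s by (simp add: A B all_set_conv_all_nth)
  have obj: "(\<Sum>j<length C. ((\<Sum>l<k. of_int (lp_C F j l) * x l) + of_int (lp_c F j)) * f j) =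
      s * lp_objective (inst_of v F) ?x (vec (length C) f)" for f
  proof -
    have "lp_objective (inst_of v F) ?x (vec (length C) f) = (\<Sum>j<length C. (rdot v (fst (C ! j)) ?x + real_of_rat (v (snd (C ! j)))) * f j)"
      unfolding F objective_inst_of[OF sh' xk vec_carrier] by simp
    then show ?thesis by (simp add: sum_distrib_left C mult.assoc)
  qed
  have dims: "fst F = k" "fst (snd F) = R" "fst (snd (snd F)) = C" "fst (snd (snd (snd F))) = D" by (simp_all add: F)
  show "vec (length (fst (snd (snd F)))) y \<in> Opt Natural_Form (inst_of v F) (vec (fst F) x) \<longleftrightarrow> lp_opt_at F x y"
    unfolding lp_opt_at_def lp_opt_def dims feas obj Opt_def
    unfolding F feasible_Natural[OF sh' xk] ball_carrier
    using s by simp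
  show "vec (fst F) x \<in> X_set (inst_of v F) \<longleftrightarrow> in_X F x"
    unfolding in_X_def dims unfolding F X_set_inst_of[OF sh'] using s
    by (auto simp: Dx[unfolded F] all_set_conv_all_nth)
qed

definition scenario :: "lp_form \<Rightarrow> bool \<Rightarrow> inverse_lp \<Rightarrow> bool" where
  "scenario form pess P \<longleftrightarrow> (if pess then pessimistic form P else optimistic form P)"

lemma scenario_iff:
  assumes sh: "shaped F" and s: "0 < s" and sc: "\<And>e. e \<in> set (entries F) \<Longrightarrow> of_int (sc e) = s * real_of_rat (v e)"
  shows "scenario Natural_Form pess (inst_of v F) \<longleftrightarrow>
    (\<exists>x y. in_X F x \<and> lp_opt_at F x y \<and> y (snd (snd (snd (snd F)))) = 0 \<and>
      (pess \<longrightarrow> (\<forall>w. lp_opt_at F x w \<longrightarrow> w (snd (snd (snd (snd F)))) = 0)))"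
proof -
  obtain k R C D i where F: "F = (k, R, C, D, i)" by (cases F)
  have i: "i < length C" using sh by (simp add: F)
  have dims: "fst F = k" "fst (snd (snd F)) = C" "snd (snd (snd (snd F))) = i" by (simp_all add: F)
  note iff = opt_at_iff[OF sh s sc, unfolded dims]
  have Y: "Y_set (inst_of v F) = {y \<in> carrier_vec (length C). y $ i = 0}" by (simp add: Y_set_def F)
  have Xc: "x \<in> carrier_vec k" if "x \<in> X_set (inst_of v F)" for x using X_set_carrier[OF that] by (simp add: F)
  have Oc: "y \<in> carrier_vec (length C)" if "y \<in> Opt Natural_Form (inst_of v F) x" for x y
    using that by (simp add: Opt_def F)
  have ex: "(\<exists>x \<in> X_set (inst_of v F). P x) \<longleftrightarrow> (\<exists>x. in_X F x \<and> P (vec k x))" for P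
  proof
    assume "\<exists>x \<in> X_set (inst_of v F). P x"
    then obtain x where x: "x \<in> X_set (inst_of v F)" "P x" by blast
    have "vec k (($) x) = x" using Xc[OF x(1)] by auto
    then show "\<exists>x. in_X F x \<and> P (vec k x)" using x iff(2)[of "($) x"] by (intro exI[of _ "($) x"]) simp
  qed (use iff(2) in blast)
  have exO: "(\<exists>y \<in> Opt Natural_Form (inst_of v F) (vec k x). P y) \<longleftrightarrow> (\<exists>y. lp_opt_at F x y \<and> P (vec (length C) y))" for x P
  proof
    assume "\<exists>y \<in> Opt Natural_Form (inst_of v F) (vec k x). P y"
    then obtain y where y: "y \<in> Opt Natural_Form (inst_of v F) (vec k x)" "P y" by blast
    have "vec (length C) (($) y) = y" using Oc[OF y(1)] by auto
    then show "\<exists>y. lp_opt_at F x y \<and> P (vec (length C) y)" using y iff(1)[of "($) y" x] by (intro exI[of _ "($) y"]) simp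
  qed (use iff(1) in blast)
  have opti: "optimistic Natural_Form (inst_of v F) \<longleftrightarrow> (\<exists>x y. in_X F x \<and> lp_opt_at F x y \<and> y i = 0)"
  proof -
    have "optimistic Natural_Form (inst_of v F) \<longleftrightarrow> (\<exists>x \<in> X_set (inst_of v F). \<exists>y \<in> Opt Natural_Form (inst_of v F) x. y $ i = 0)"
      unfolding optimistic_def Y using Oc by blast
    then show ?thesis unfolding ex exO using i by simp
  qed
  have pessi: "pessimistic Natural_Form (inst_of v F) \<longleftrightarrow>
      (\<exists>x. in_X F x \<and> (\<exists>y. lp_opt_at F x y) \<and> (\<forall>w. lp_opt_at F x w \<longrightarrow> w i = 0))"
  proof -
    have "pessimistic Natural_Form (inst_of v F) \<longleftrightarrow> (\<exists>x \<in> X_set (inst_of v F). (\<exists>y \<in> Opt Natural_Form (inst_of v F) x. True) \<and>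
        \<not> (\<exists>y \<in> Opt Natural_Form (inst_of v F) x. y $ i \<noteq> 0))"
      unfolding pessimistic_def Y using Oc by blast
    then show ?thesis unfolding ex exO using i by simp
  qed
  show ?thesis
    unfolding scenario_def opti pessi dims by (cases pess) (simp, blast, simp)
qed

lemma cert_of_int:
  assumes "cert pess m n k g p A B b C c D d (t :: int) X Y L U W"
  shows "cert pess m n k g p (\<lambda>i j. real_of_int (A i j)) (\<lambda>i l. of_int (B i l)) (\<lambda>i. of_int (b i)) (\<lambda>j l. of_int (C j l))
      (\<lambda>j. of_int (c j)) (\<lambda>r l. of_int (D r l)) (\<lambda>r. of_int (d r)) (of_int t) (\<lambda>i. of_int (X i)) (\<lambda>i. of_int (Y i))
      (\<lambda>i. of_int (L i)) (\<lambda>i. of_int (U i)) (\<lambda>i. of_int (W i))"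
proof -
  have e: "real_of_int a * real_of_int b = real_of_int (a * b)" "real_of_int a + real_of_int b = real_of_int (a + b)" for a b by simp_all
  show ?thesis
    using assms unfolding cert_def e of_int_sum[symmetric] of_int_le_iff of_int_eq_iff of_int_eq_0_iff of_int_0_le_iff of_int_0_less_iff of_int_less_0_iff .
qed

lemma icert_sound:
  assumes sh: "shaped F" and s: "0 < s" and sc: "\<And>e. e \<in> set (entries F) \<Longrightarrow> of_int (sc e) = s * real_of_rat (v e)"
    and cert: "icert pess F t X Y L U W"
  shows "scenario Natural_Form pess (inst_of v F)"
proof -
  have p: "snd (snd (snd (snd F))) < length (fst (snd (snd F)))" using sh by (cases F) simp
  note c = cert_sound[OF cert_of_int[OF cert[unfolded icert_def]] p]
  have iff: "scenario Natural_Form pess (inst_of v F) \<longleftrightarrow>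
    (\<exists>x y. in_X F x \<and> lp_opt_at F x y \<and> y (snd (snd (snd (snd F)))) = 0 \<and>
      (pess \<longrightarrow> (\<forall>w. lp_opt_at F x w \<longrightarrow> w (snd (snd (snd (snd F)))) = 0)))"
    by (rule scenario_iff[OF sh s sc])
  show ?thesis
    unfolding iff in_X_def lp_opt_at_def
    by (intro exI[of _ "\<lambda>l. of_int (X l) / of_int t"] exI[of _ "\<lambda>j. of_int (Y j) / of_int t"] conjI impI allI c)
qed

lemma icert_complete:
  fixes V :: nat
  assumes sh: "shaped F" and s: "0 < s" and sc: "\<And>e. e \<in> set (entries F) \<Longrightarrow> of_int (sc e) = s * real_of_rat (v e)"
    and scen: "scenario Natural_Form pess (inst_of v F)"
    and V: "1 \<le> V" "\<And>e. e \<in> set (entries F) \<Longrightarrow> \<bar>sc e\<bar> \<le> int V"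
    and dims: "m = length (fst (snd F))" "n = length (fst (snd (snd F)))" "k = fst F" "g = length (fst (snd (snd (snd F))))"
    and H: "H = (2 * (k + n + 3 * m + 2) * ((g + 12 * m + 7 * n + k + 4) * V\<^sup>2) + 1) ^ (k + n + 3 * m + 1)"
  shows "\<exists>t X Y L U W. icert pess F t X Y L U W \<and> 0 < t \<and> t \<le> int H \<and>
    (\<forall>i. \<bar>X i\<bar> \<le> int H \<and> \<bar>Y i\<bar> \<le> int H \<and> \<bar>L i\<bar> \<le> int H \<and> \<bar>U i\<bar> \<le> int H \<and> \<bar>W i\<bar> \<le> int H) \<and>
    (\<forall>i\<ge>k. X i = 0) \<and> (\<forall>i\<ge>n. Y i = 0) \<and> (\<forall>i\<ge>m. L i = 0 \<and> U i = 0 \<and> W i = 0)"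
proof -
  obtain K R C D i where F: "F = (K, R, C, D, i)" by (cases F)
  have p: "snd (snd (snd (snd F))) < n" using sh by (simp add: F dims)
  obtain x y where xy: "in_X F x" "lp_opt_at F x y" "y (snd (snd (snd (snd F)))) = 0"
    "pess \<longrightarrow> (\<forall>w. lp_opt_at F x w \<longrightarrow> w (snd (snd (snd (snd F)))) = 0)"
    using iffD1[OF scenario_iff[where v=v and s=s] scen] sh s sc by blast
  obtain L U W where c: "cert pess m n k g (snd (snd (snd (snd F)))) (\<lambda>i j. real_of_int (lp_A F i j)) (\<lambda>i l. of_int (lp_B F i l))
      (\<lambda>i. of_int (lp_b F i)) (\<lambda>j l. of_int (lp_C F j l)) (\<lambda>j. of_int (lp_c F j)) (\<lambda>r l. of_int (lp_D F r l)) (\<lambda>r. of_int (lp_d F r)) 1 x y L U W"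
    "pess \<longrightarrow> (\<Sum>i<m. U i * real_of_int (lp_A F i (snd (snd (snd (snd F)))))) = 1 \<and> (\<Sum>i<m. W i * real_of_int (lp_A F i (snd (snd (snd (snd F)))))) = -1"
    using cert_exists[OF xy(1)[unfolded in_X_def, folded dims] xy(2)[unfolded lp_opt_at_def, folded dims] xy(3) p, where pess=pess]
      xy(4)[unfolded lp_opt_at_def, folded dims] by blast
  have len: "\<And>r. r \<in> set R \<Longrightarrow> length (fst r) = n \<and> length (fst (snd r)) = k" "\<And>r. r \<in> set C \<union> set D \<Longrightarrow> length (fst r) = k"
    using sh by (auto simp: F dims)
  have eR: "set (fst r) \<subseteq> set (entries F)" "set (fst (snd r)) \<subseteq> set (entries F)" "snd (snd r) \<in> set (entries F)" if "r \<in> set R" for r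
    using that by (auto simp: F)
  have eC: "set (fst r) \<subseteq> set (entries F)" "snd r \<in> set (entries F)" if "r \<in> set C \<union> set D" for r
    using that by (auto simp: F)
  have d: "m = length R" "n = length C" "g = length D" by (simp_all add: dims F)
  have bA: "\<bar>lp_A F i j\<bar> \<le> int V" if "i < m" "j < n" for i j
  proof -
    have i: "i < length R" using that by (simp add: d)
    have "fst (R ! i) ! j \<in> set (entries F)"
      by (rule subsetD[OF eR(1)[OF nth_mem[OF i]] nth_mem]) (use len(1)[OF nth_mem[OF i]] that in simp)
    then show ?thesis using V(2) len(1)[OF nth_mem[OF i]] that i by (simp add: lp_A_def F)
  qed
  have bB: "\<bar>lp_B F i j\<bar> \<le> int V" if "i < m" "j < k" for i j
  proof -
    have i: "i < length R" using that by (simp add: d)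
    have "fst (snd (R ! i)) ! j \<in> set (entries F)"
      by (rule subsetD[OF eR(2)[OF nth_mem[OF i]] nth_mem]) (use len(1)[OF nth_mem[OF i]] that in simp)
    then show ?thesis using V(2) len(1)[OF nth_mem[OF i]] that i by (simp add: lp_B_def F)
  qed
  have bb: "\<bar>lp_b F i\<bar> \<le> int V" if "i < m" for i
    using V(2)[OF eR(3)[OF nth_mem[of i R]]] that by (simp add: lp_b_def d F)
  have bC: "\<bar>lp_C F i j\<bar> \<le> int V" if "i < n" "j < k" for i j
  proof -
    have i: "i < length C" using that by (simp add: d)
    have "fst (C ! i) ! j \<in> set (entries F)"
      by (rule subsetD[OF eC(1)[OF UnI1[OF nth_mem[OF i]]] nth_mem]) (use len(2)[OF UnI1[OF nth_mem[OF i]]] that in simp)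
    then show ?thesis using V(2) len(2)[OF UnI1[OF nth_mem[OF i]]] that i by (simp add: lp_C_def F)
  qed
  have bc: "\<bar>lp_c F i\<bar> \<le> int V" if "i < n" for i
    using V(2)[OF eC(2)[OF UnI1[OF nth_mem[of i C]]]] that by (simp add: lp_c_def d F)
  have bD: "\<bar>lp_D F i j\<bar> \<le> int V" if "i < g" "j < k" for i j
  proof -
    have i: "i < length D" using that by (simp add: d)
    have "fst (D ! i) ! j \<in> set (entries F)"
      by (rule subsetD[OF eC(1)[OF UnI2[OF nth_mem[OF i]]] nth_mem]) (use len(2)[OF UnI2[OF nth_mem[OF i]]] that in simp)
    then show ?thesis using V(2) len(2)[OF UnI2[OF nth_mem[OF i]]] that i by (simp add: lp_D_def F)
  qed
  have bd: "\<bar>lp_d F i\<bar> \<le> int V" if "i < g" for i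
    using V(2)[OF eC(2)[OF UnI2[OF nth_mem[of i D]]]] that by (simp add: lp_d_def d F)
  obtain t X Y L U W where r: "cert pess m n k g (snd (snd (snd (snd F)))) (lp_A F) (lp_B F) (lp_b F) (lp_C F) (lp_c F) (lp_D F) (lp_d F) t X Y L U W"
    "t \<le> int H" "\<forall>i. \<bar>X i\<bar> \<le> int H \<and> \<bar>Y i\<bar> \<le> int H \<and> \<bar>L i\<bar> \<le> int H \<and> \<bar>U i\<bar> \<le> int H \<and> \<bar>W i\<bar> \<le> int H"
    "(\<forall>i\<ge>k. X i = 0) \<and> (\<forall>i\<ge>n. Y i = 0) \<and> (\<forall>i\<ge>m. L i = 0 \<and> U i = 0 \<and> W i = 0)"
    using cert_small[OF c p V(1) bA bB bb bC bc bD bd H] by blast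
  have "0 < t" using r(1) by (simp add: cert_def)
  then show ?thesis unfolding icert_def using r unfolding dims by blast
qed

end


section \<open>The verifier\<close>

text \<open>An integer is represented as a difference, and an entry \<open>((s, P, Q), S, u, w)\<close> consists of the
  sign and the digits of a fraction, an integer \<open>S\<close> that is the value of the fraction times a
  common denominator, and Bezout coefficients which show that the fraction is reduced.\<close>

type_synonym dint = "bool list \<times> bool list"
type_synonym entry = "(bool \<times> bool list \<times> bool list) \<times> dint \<times> dint \<times> dint"

definition ival :: "dint \<Rightarrow> int" where
  "ival d = int (val (fst d)) - int (val (snd d))"

definition dint :: "int \<Rightarrow> dint" where
  "dint z = (nat_bits (nat z), nat_bits (nat (- z)))"

definition numer :: "entry \<Rightarrow> int" where
  "numer e = (if fst (fst e) then - int (val (fst (snd (fst e)))) else int (val (fst (snd (fst e)))))"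

definition denom :: "entry \<Rightarrow> int" where
  "denom e = int (val (snd (snd (fst e))))"

definition multiple :: "entry \<Rightarrow> int" where
  "multiple e = ival (fst (snd e))"

definition entry_code :: "entry \<Rightarrow> bool list" where
  "entry_code e = fst (fst e) # enc_bits (fst (snd (fst e))) @ enc_bits (snd (snd (fst e)))"

definition entry_val :: "entry \<Rightarrow> rat" where
  "entry_val e = of_int (numer e) / of_int (denom e)"

text \<open>The most significant digit comes last, so these are the digit lists without leading
  zeros, the values of \<open>nat_bits\<close>.\<close>

fun normal :: "bool list \<Rightarrow> bool" where
  "normal [] \<longleftrightarrow> True"
| "normal (b # l) \<longleftrightarrow> (if l = [] then b else normal l)"

text \<open>These conditions make \<open>entry_code\<close> agree with \<open>enc_rat\<close>. In
  particular a negative sign on 0 is excluded, which \<open>enc_int\<close> never produces.\<close>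

definition reduced :: "entry \<Rightarrow> bool" where
  "reduced e \<longleftrightarrow> normal (fst (snd (fst e))) \<and> normal (snd (snd (fst e))) \<and> (fst (fst e) \<longrightarrow> fst (snd (fst e)) \<noteq> []) \<and>
     ival (fst (snd (snd e))) * numer e + ival (snd (snd (snd e))) * denom e = 1"

definition scaled :: "int \<Rightarrow> entry \<Rightarrow> bool" where
  "scaled N e \<longleftrightarrow> 0 < denom e \<and> numer e * N = multiple e * denom e"

text \<open>The Bezout coefficients are carried along unchanged: derived rows have to be
  \<open>scaled\<close>, while \<open>reduced\<close> is checked for the entries of the given
  instance.\<close>

definition entry_neg :: "entry \<Rightarrow> entry" where
  "entry_neg e = ((\<not> fst (fst e), snd (fst e)), (snd (fst (snd e)), fst (fst (snd e))), snd (snd e))"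

definition entry_zero :: entry where
  "entry_zero = ((False, [], [True]), ([], []), ([], []), ([], []))"

definition entry_mone :: "bool list \<Rightarrow> entry" where
  "entry_mone N = ((True, [True], [True]), ([], N), ([], []), ([], []))"

lemma ival_dint [simp]: "ival (dint z) = z"
  by (simp add: ival_def dint_def)

lemma nat_bits_val: "normal l \<Longrightarrow> nat_bits (val l) = l"
proof (induction l)
  case (Cons b l)
  show ?case
  proof (cases "l = []")
    case True then show ?thesis using Cons by (simp add: nat_bits_pos)
  next
    case False
    then have l: "nat_bits (val l) = l" using Cons by simp
    then have "0 < val l" using False by (cases "val l = 0") auto
    then show ?thesis using l by (simp add: nat_bits_pos)
  qed
qed simp

lemma normal_nat_bits: "normal (nat_bits n)"
proof (induction n rule: less_induct)
  case (less n)
  show ?case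
  proof (cases "n = 0")
    case False
    have "nat_bits (n div 2) = [] \<Longrightarrow> odd n"
      using False val_nat_bits[of "n div 2"] by (cases "even n") auto
    then show ?thesis using False less[of "n div 2"] by (simp add: nat_bits_pos)
  qed simp
qed

lemma normal_rev: "normal l \<longleftrightarrow> (case rev l of [] \<Rightarrow> True | b # _ \<Rightarrow> b)"
proof (induction l)
  case (Cons b l) then show ?case by (cases "rev l") (auto split: list.splits)
qed simp

lemma enc_rat_entry_val:
  assumes "reduced e" "scaled N e" shows "enc_rat (entry_val e) = entry_code e"
proof -
  obtain s P Q S u w where e: "e = ((s, P, Q), S, u, w)" by (metis prod.exhaust)
  have "coprime (numer e) (denom e)"
  proof (rule coprimeI)
    fix c assume c: "c dvd numer e" "c dvd denom e"
    have "c dvd ival (fst (snd (snd e))) * numer e + ival (snd (snd (snd e))) * denom e" by (intro dvd_add dvd_mult c)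
    then show "is_unit c" using assms(1) by (simp add: reduced_def)
  qed
  moreover have "entry_val e = Fract (numer e) (denom e)" by (simp add: entry_val_def Fract_of_int_quotient)
  ultimately have q: "quotient_of (entry_val e) = (numer e, denom e)"
    using assms(2) by (simp add: quotient_of_Fract normalize_stable scaled_def)
  have P: "nat_bits (val P) = P" "nat_bits (val Q) = Q" using assms(1) by (simp_all add: reduced_def e nat_bits_val)
  then have "0 < val P" if s using assms(1) that by (cases "val P = 0") (auto simp: reduced_def e)
  then have "(numer e < 0) = s" "nat \<bar>numer e\<bar> = val P" by (auto simp: numer_def e)
  then show ?thesis
    unfolding enc_rat_def q by (simp add: enc_int_def enc_nat_bits P entry_code_def e denom_def)
qed

lemma entry_simps [simp]:
  "numer (entry_neg e) = - numer e" "denom (entry_neg e) = denom e" "multiple (entry_neg e) = - multiple e"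
  "numer entry_zero = 0" "denom entry_zero = 1" "multiple entry_zero = 0"
  "numer (entry_mone N) = - 1" "denom (entry_mone N) = 1" "multiple (entry_mone N) = - int (val N)"
  by (simp_all add: numer_def denom_def multiple_def ival_def entry_neg_def entry_zero_def entry_mone_def)

lemma entry_val_simps [simp]: "entry_val (entry_neg e) = - entry_val e" "entry_val entry_zero = 0" "entry_val (entry_mone N) = -1"
  by (simp_all add: entry_val_def)

lemma scaled_simps [simp]: "scaled N (entry_neg e) \<longleftrightarrow> scaled N e" "scaled N entry_zero" "scaled (int (val N')) (entry_mone N')"
  by (simp_all add: scaled_def)

lemma multiple_eq:
  assumes "scaled N e" shows "real_of_int (multiple e) = real_of_int N * real_of_rat (entry_val e)"
proof -
  have "real_of_int (numer e) * real_of_int N = real_of_int (multiple e) * real_of_int (denom e)"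
    using assms unfolding scaled_def by (metis of_int_mult)
  moreover have "0 < real_of_int (denom e)" using assms by (simp add: scaled_def)
  ultimately show ?thesis by (simp add: entry_val_def of_rat_divide field_simps)
qed

definition natural_inst :: "lp_form \<Rightarrow> bool list \<Rightarrow> entry linst \<Rightarrow> entry linst" where
  "natural_inst form N P = (case form of Natural_Form \<Rightarrow> P | Standard_Form \<Rightarrow> to_natural entry_neg entry_zero (entry_mone N) P)"

lemma shaped_natural_inst: "shaped P \<Longrightarrow> shaped (natural_inst form N P)"
  unfolding natural_inst_def by (cases form) (simp_all only: lp_form.case shaped_to_natural)

lemma scenario_natural_inst:
  assumes "shaped P"
  shows "scenario Natural_Form pess (inst_of entry_val (natural_inst form N P)) \<longleftrightarrow> scenario form pess (inst_of entry_val P)"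
  using scenarios_to_natural[OF assms, where v=entry_val and ng=entry_neg and z=entry_zero and mo="entry_mone N"]
  unfolding natural_inst_def scenario_def by (cases form) simp_all

lemma entries_natural_inst:
  "set (entries (natural_inst form N P)) \<subseteq> set (entries P) \<union> entry_neg ` set (entries P) \<union> {entry_zero, entry_mone N}"
proof (cases form)
  case Standard_Form
  obtain k R C D i where P: "P = (k, R, C, D, i)" by (cases P)
  define rs :: "(entry list \<times> entry list \<times> entry) list \<Rightarrow> entry set"
    where "rs R = (\<Union>r\<in>set R. set (fst r) \<union> set (fst (snd r)) \<union> {snd (snd r)})" for R
  define T where "T = set (concat (map fst C) @ map snd C @ concat (map fst D) @ map snd D)"
  have e: "set (entries (k, R, C, D, i)) = rs R \<union> T" for R unfolding rs_def T_def by auto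
  have a: "rs (R @ R') = rs R \<union> rs R'" for R R' unfolding rs_def by auto
  have b: "rs (map (\<lambda>r. (map entry_neg (fst r), map entry_neg (fst (snd r)), entry_neg (snd (snd r)))) R) = entry_neg ` rs R"
    unfolding rs_def by (simp add: image_UN image_Un)
  have c: "rs (map (\<lambda>j. (map (\<lambda>l. if l = j then entry_mone N else entry_zero) [0..<n], replicate k entry_zero, entry_zero)) [0..<n])
      \<subseteq> {entry_zero, entry_mone N}" for n
    unfolding rs_def by auto
  show ?thesis
    unfolding natural_inst_def Standard_Form P lp_form.case to_natural.simps e a b image_Un using c[of "length C"] by blast
qed (auto simp: natural_inst_def)

lemma dims_natural_inst:
  "fst (natural_inst form N P) = fst P" "snd (snd (natural_inst form N P)) = snd (snd P)"
  "length (fst (snd (natural_inst form N P))) \<le> 2 * length (fst (snd P)) + length (fst (snd (snd P)))"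
  unfolding natural_inst_def by (cases form; cases P; simp)+

definition entry_at :: "dint list \<Rightarrow> nat \<Rightarrow> int" where
  "entry_at l i = ival (nth_or ([], []) l i)"

type_synonym certificate = "entry linst \<times> bool list \<times> dint \<times> dint list \<times> dint list \<times> dint list \<times> dint list \<times> dint list"

text \<open>Equality of \<open>x\<close> with the recomputed encoding ties the guessed list
  \<open>P\<close> to the input word. The optimality certificate then speaks about the inequality
  form of \<open>P\<close> with all entries multiplied by \<open>N\<close>.\<close>

definition verify :: "lp_form \<Rightarrow> bool \<Rightarrow> bool \<Rightarrow> bool list \<Rightarrow> entry linst \<Rightarrow> bool list \<Rightarrow> dint \<Rightarrow>
    dint list \<Rightarrow> dint list \<Rightarrow> dint list \<Rightarrow> dint list \<Rightarrow> dint list \<Rightarrow> bool" where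
  "verify form pess fixed x P N t X Y L U W \<longleftrightarrow> shaped P \<and> enc_linst entry_code P = x \<and>
     (\<forall>e \<in> set (entries P). reduced e \<and> scaled (int (val N)) e) \<and> 0 < int (val N) \<and>
     (fixed \<longrightarrow> (\<forall>r \<in> set (fst (snd (snd P))). \<forall>e \<in> set (fst r). numer e = 0)) \<and>
     icert multiple entry_zero pess (natural_inst form N P) (ival t) (entry_at X) (entry_at Y) (entry_at L) (entry_at U) (entry_at W)"

definition verifier :: "lp_form \<Rightarrow> bool \<Rightarrow> bool \<Rightarrow> bool list \<Rightarrow> certificate \<Rightarrow> bool" where
  "verifier form pess fixed x c = (case c of (P, N, t, X, Y, L, U, W) \<Rightarrow> verify form pess fixed x P N t X Y L U W)"

abbreviation problem :: "lp_form \<Rightarrow> bool \<Rightarrow> bool \<Rightarrow> bool list set" where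
  "problem form pess fixed \<equiv> problem_language (\<lambda>P. (fixed \<longrightarrow> fixed_objective P) \<and> scenario form pess P)"

lemma fixed_objective_inst_of:
  assumes "shaped P"
  shows "fixed_objective (inst_of v P) \<longleftrightarrow> (\<forall>r \<in> set (fst (snd (snd P))). \<forall>e \<in> set (fst r). v e = 0)"
proof -
  obtain k R C D i where P: "P = (k, R, C, D, i)" by (cases P)
  have "fixed_objective (inst_of v P) \<longleftrightarrow> (\<forall>r<length C. \<forall>j<k. v (fst (C ! r) ! j) = 0)"
    by (auto simp: fixed_objective_def P mat_eq_iff)
  also have "\<dots> \<longleftrightarrow> (\<forall>r \<in> set C. \<forall>e \<in> set (fst r). v e = 0)"
  proof -
    have "length (fst r) = k" if "r \<in> set C" for r using assms that by (simp add: P)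
    then show ?thesis unfolding all_set_conv_all_nth by simp
  qed
  finally show ?thesis by (simp add: P)
qed

lemma scaled_natural_inst:
  assumes "\<forall>e \<in> set (entries P). scaled (int (val N)) e" "e \<in> set (entries (natural_inst form N P))"
  shows "scaled (int (val N)) e"
  using subsetD[OF entries_natural_inst assms(2)] assms(1) by auto

lemma verify_sound:
  assumes "verify form pess fixed x P N t X Y L U W"
  shows "x \<in> problem form pess fixed"
proof -
  note v = assms[unfolded verify_def]
  let ?I = "inst_of entry_val P"
  have sh: "shaped P" and sc: "\<forall>e \<in> set (entries P). scaled (int (val N)) e" using v by blast+
  have "enc_instance ?I = enc_linst entry_code P"
    by (rule enc_inst_of[OF sh]) (use v enc_rat_entry_val in blast)
  then have "x = enc_instance ?I" using v by simp
  moreover have "scenario form pess ?I"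
    unfolding scenario_natural_inst[OF sh, where N=N, symmetric]
  proof (rule icert_sound[OF shaped_natural_inst[OF sh]])
    show "0 < real_of_int (int (val N))" using v by simp
    show "real_of_int (multiple e) = real_of_int (int (val N)) * real_of_rat (entry_val e)"
      if "e \<in> set (entries (natural_inst form N P))" for e
      by (rule multiple_eq[OF scaled_natural_inst[OF sc that]])
  qed (use v in blast)
  moreover have "fixed_objective ?I" if fixed
    unfolding fixed_objective_inst_of[OF sh] using v that by (simp add: entry_val_def)
  ultimately show ?thesis unfolding problem_language_def using valid_inst_of[OF sh] by blast
qed

lemma PT_verifier: "PT (\<lambda>p. verifier form pess fixed (fst p) (snd p))"
proof -
  have shaped: "shaped P \<longleftrightarrow> (\<forall>r \<in> set (fst (snd P)). length (fst r) = length (fst (snd (snd P))) \<and> length (fst (snd r)) = fst P) \<and>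
     (\<forall>r \<in> set (fst (snd (snd P))). length (fst r) = fst P) \<and> (\<forall>r \<in> set (fst (snd (snd (snd P)))). length (fst r) = fst P) \<and>
     snd (snd (snd (snd P))) < length (fst (snd (snd P)))"
    and entries: "entries P = concat (map fst (fst (snd P))) @ concat (map (\<lambda>r. fst (snd r)) (fst (snd P))) @ map (\<lambda>r. snd (snd r)) (fst (snd P)) @
     concat (map fst (fst (snd (snd P)))) @ map snd (fst (snd (snd P))) @ concat (map fst (fst (snd (snd (snd P))))) @ map snd (fst (snd (snd (snd P))))"
    for P :: "entry linst"
    by (cases P; simp)+
  have s: "PT (\<lambda>P :: entry linst. shaped P)" unfolding shaped by (intro PT_intros)
  have e: "PT (\<lambda>P :: entry linst. entries P)" unfolding entries by (intro PT_intros)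
  have c: "PT entry_code" unfolding entry_code_def by (intro PT_intros)
  have num: "IPT (\<lambda>x. numer (f x))" and den: "IPT (\<lambda>x. denom (f x))" and mul: "IPT (\<lambda>x. multiple (f x))" if "PT f" for f :: "'x::enc \<Rightarrow> entry"
    unfolding numer_def denom_def multiple_def ival_def diff_conv_add_uminus by (intro IPT_intros PT_intros that)+
  have iv: "IPT (\<lambda>x. ival (f x))" if "PT f" for f :: "'x::enc \<Rightarrow> dint"
    unfolding ival_def diff_conv_add_uminus by (intro IPT_intros PT_intros that)+
  have at: "IPT (\<lambda>x. entry_at (f x) (i x))" if "PT f" "PT i" for f :: "'x::enc \<Rightarrow> dint list" and i
    unfolding entry_at_def by (intro iv PT_intros that)
  have neg: "PT entry_neg" unfolding entry_neg_def by (intro PT_intros)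
  have mone: "PT entry_mone" unfolding entry_mone_def by (intro PT_intros)
  have nat: "PT (\<lambda>x. natural_inst form (N x) (P x))" if "PT N" "PT P" for N :: "'x::enc \<Rightarrow> bool list" and P
    unfolding natural_inst_def by (cases form) (simp_all add: that PT_to_natural[OF neg PT_const PT_comp[OF that(1) mone] that(2)])
  have ic: "PT (\<lambda>x :: entry linst \<times> dint \<times> dint list \<times> dint list \<times> dint list \<times> dint list \<times> dint list.
      icert multiple entry_zero pess (fst x) (ival (fst (snd x))) (entry_at (fst (snd (snd x)))) (entry_at (fst (snd (snd (snd x)))))
        (entry_at (fst (snd (snd (snd (snd x)))))) (entry_at (fst (snd (snd (snd (snd (snd x)))))))
        (entry_at (snd (snd (snd (snd (snd (snd x))))))))"
    unfolding icert_def cert_def lp_A_def lp_B_def lp_b_def lp_C_def lp_c_def lp_D_def lp_d_def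
    by (intro PT_intros IPT_intros mul iv at)
  have "PT (\<lambda>p. (natural_inst form (fst (snd (snd p))) (fst (snd p)), snd (snd (snd p))) ::
      entry linst \<times> dint \<times> dint list \<times> dint list \<times> dint list \<times> dint list \<times> dint list)"
    by (intro PT_Pair nat PT_intros)
  note ic' = PT_comp[OF this ic, unfolded fst_conv snd_conv]
  have "PT (\<lambda>p :: bool list \<times> certificate. shaped (fst (snd p)) \<and> enc_linst entry_code (fst (snd p)) = fst p \<and>
     (\<forall>e \<in> set (entries (fst (snd p))). reduced e \<and> scaled (int (val (fst (snd (snd p))))) e) \<and> 0 < int (val (fst (snd (snd p)))) \<and>
     (fixed \<longrightarrow> (\<forall>r \<in> set (fst (snd (snd (fst (snd p))))). \<forall>e \<in> set (fst r). numer e = 0)))"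
    unfolding reduced_def scaled_def normal_rev
    by (intro PT_intros IPT_intros PT_enc_linst[OF c] PT_comp[OF _ s] PT_comp[OF _ e] num den mul iv)
  from PT_conj[OF this ic'] show ?thesis
    unfolding verifier_def verify_def case_prod_beta conj_assoc .
qed


section \<open>Certificates of polynomial size\<close>

lemma length_nat_bits_le: "n < 2 ^ B \<Longrightarrow> length (nat_bits n) \<le> B"
proof (induction B arbitrary: n)
  case (Suc B) then show ?case using Suc.IH[of "n div 2"] by (cases "n = 0") (auto simp: nat_bits_pos)
qed simp

lemma less_length_nat_bits: "n < 2 ^ length (nat_bits n)"
  using val_less[of "nat_bits n"] by simp

lemma sz_dint:
  assumes "\<bar>z\<bar> \<le> 2 ^ B" shows "sz (dint z) \<le> 11 + 8 * B"
proof -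
  have "z \<le> 2 ^ B" "- z \<le> 2 ^ B" using assms by auto
  then have "nat z \<le> 2 ^ B" "nat (- z) \<le> 2 ^ B" by (simp_all add: nat_le_iff)
  then have "nat z < 2 ^ Suc B" "nat (- z) < 2 ^ Suc B" by (simp_all add: less_le_trans[of _ "2 ^ B + 1"] le_imp_less_Suc)
  note length_nat_bits_le[OF this(1)] length_nat_bits_le[OF this(2)]
  then show ?thesis using sz_bools[of "nat_bits (nat z)"] sz_bools[of "nat_bits (nat (- z))"] by (simp add: dint_def)
qed

text \<open>Reducing \<open>u\<close> modulo \<open>b\<close> bounds it, and then \<open>w\<close>
  is determined and bounded by the identity. The bounds keep certificates small.\<close>

lemma bezout_bounded:
  fixes a b :: int
  assumes "coprime a b" "0 < b"
  shows "\<exists>u w. u * a + w * b = 1 \<and> \<bar>u\<bar> \<le> b \<and> \<bar>w\<bar> \<le> \<bar>a\<bar> + 1"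
proof -
  obtain u v where uv: "u * a + v * b = 1" using bezout_int[of a b] assms(1) by auto
  let ?u = "u mod b"
  have "b dvd 1 - ?u * a"
  proof -
    have "1 - ?u * a = (v + (u div b) * a) * b"
      using uv by (simp add: minus_div_mult_eq_mod[symmetric] algebra_simps)
    then show ?thesis by simp
  qed
  then obtain w where w: "1 - ?u * a = b * w" by blast
  have u: "0 \<le> ?u" "?u < b" using assms(2) by simp_all
  have "\<bar>b * w\<bar> \<le> 1 + \<bar>?u * a\<bar>" unfolding w[symmetric] by linarith
  also have "\<bar>?u * a\<bar> \<le> b * \<bar>a\<bar>" using u by (simp add: abs_mult mult_right_mono)
  also have "1 + b * \<bar>a\<bar> \<le> b * (\<bar>a\<bar> + 1)" using assms(2) by (simp add: distrib_left)
  finally have "b * \<bar>w\<bar> \<le> b * (\<bar>a\<bar> + 1)" using assms(2) by (simp add: abs_mult)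
  then have "\<bar>w\<bar> \<le> \<bar>a\<bar> + 1" using assms(2) by simp
  then show ?thesis using w u by (intro exI[of _ ?u] exI[of _ w]) (auto simp: mult.commute)
qed

text \<open>The digits of numerator \<open>a\<close> and denominator \<open>b\<close> occur in the
  encoding, which bounds both by \<open>2 ^ L\<close>. With \<open>N = b * c\<close> the scaled
  value is \<open>a * c\<close>.\<close>

lemma entry_exists:
  assumes L: "length (enc_rat q) \<le> L" and N: "snd (quotient_of q) dvd N" "0 < N" "N \<le> 2 ^ M"
  shows "\<exists>e. entry_val e = q \<and> reduced e \<and> scaled N e \<and> \<bar>multiple e\<bar> \<le> 2 ^ (L + M) \<and> sz e \<le> 100 + 40 * (L + M)"
proof -
  obtain a b where q: "quotient_of q = (a, b)" by fastforce
  have b: "0 < b" and ab: "coprime a b" using quotient_of_denom_pos[OF q] quotient_of_coprime[OF q] by auto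
  have len_enc: "length (enc_nat n) = 2 * length (nat_bits n) + 1" for n
    by (simp add: enc_nat_def length_concat comp_def sum_list_triv)
  have "length (nat_bits (nat \<bar>a\<bar>)) \<le> L" "length (nat_bits (nat b)) \<le> L"
    using L by (simp_all add: enc_rat_def enc_int_def q len_enc)
  note len = this
  have lt: "n < 2 ^ L" if "length (nat_bits n) \<le> L" for n
    using less_length_nat_bits[of n] power_increasing[OF that, of "2::nat"] by linarith
  have a: "\<bar>a\<bar> < 2 ^ L" and bL: "b < 2 ^ L" using lt[OF len(1)] lt[OF len(2)] b by (simp_all add: nat_less_iff)
  have LM: "(2::int) ^ L \<le> 2 ^ (L + M)" by (rule power_increasing) auto
  obtain u w where uw: "u * a + w * b = 1" "\<bar>u\<bar> \<le> b" "\<bar>w\<bar> \<le> \<bar>a\<bar> + 1" using bezout_bounded[OF ab b] by blast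
  obtain c where c: "N = b * c" using N(1) q by auto
  have c0: "0 < c" using N(2) b c by (simp add: zero_less_mult_iff)
  have "c \<le> N" using b c0 unfolding c by simp
  then have "\<bar>a * c\<bar> \<le> 2 ^ L * 2 ^ M" using a c0 N(3) unfolding abs_mult by (intro mult_mono) auto
  then have ac: "\<bar>a * c\<bar> \<le> 2 ^ (L + M)" by (simp add: power_add)
  let ?e = "((a < 0, nat_bits (nat \<bar>a\<bar>), nat_bits (nat b)), dint (a * c), dint u, dint w)"
  have num: "numer ?e = a" "denom ?e = b" "multiple ?e = a * c" using b by (auto simp: numer_def denom_def multiple_def)
  have e1: "entry_val ?e = q" unfolding entry_val_def num using quotient_of_div[OF q] by simp
  have "nat_bits (nat \<bar>a\<bar>) \<noteq> []" if "a < 0"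
    using that less_length_nat_bits[of "nat \<bar>a\<bar>"] by auto
  then have e2: "reduced ?e" unfolding reduced_def num by (simp add: normal_nat_bits uw(1))
  have e3: "scaled N ?e" unfolding scaled_def num using b by (simp add: c)
  have e4: "sz ?e \<le> 100 + 40 * (L + M)"
  proof -
    have "\<bar>u\<bar> \<le> 2 ^ (L + M)" "\<bar>w\<bar> \<le> 2 ^ (L + M)" using uw(2,3) a bL LM by linarith+
    note uw' = sz_dint[OF this(1)] sz_dint[OF this(2)]
    have arith: "1 + (1 + x0 + (1 + x1 + x2)) + (1 + x3 + (1 + x4 + x5)) \<le> 100 + 40 * (L + M)"
      if "x4 \<le> 11 + 8 * (L + M)" "x5 \<le> 11 + 8 * (L + M)" "x3 \<le> 11 + 8 * (L + M)" "x0 \<le> 3" "x1 \<le> 1 + 4 * l1" "x2 \<le> 1 + 4 * l2" "l1 \<le> L" "l2 \<le> L"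
      for x0 x1 x2 x3 x4 x5 l1 l2 :: nat using that by simp
    show ?thesis unfolding sz_prod by (rule arith[OF uw' sz_dint[OF ac] sz_bool sz_bools sz_bools len])
  qed
  have "\<bar>multiple ?e\<bar> \<le> 2 ^ (L + M)" using ac unfolding num .
  with e1 e2 e3 e4 show ?thesis by (intro exI[of _ ?e] conjI)
qed

definition lin_of :: "(rat \<Rightarrow> 'e) \<Rightarrow> inverse_lp \<Rightarrow> 'e linst" where
  "lin_of f P = (dim_k P,
     map (\<lambda>r. (map (\<lambda>j. f (A_of P $$ (r, j))) [0..<dim_n P], map (\<lambda>l. f (B_of P $$ (r, l))) [0..<dim_k P], f (b_of P $ r))) [0..<dim_m P],
     map (\<lambda>r. (map (\<lambda>l. f (C_of P $$ (r, l))) [0..<dim_k P], f (c_of P $ r))) [0..<dim_n P],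
     map (\<lambda>r. (map (\<lambda>l. f (D_of P $$ (r, l))) [0..<dim_k P], f (d_of P $ r))) [0..<dim_g P], ix P)"

lemma shaped_lin_of: "valid_instance P \<Longrightarrow> shaped (lin_of f P)"
  by (auto simp: lin_of_def valid_instance_def)

lemma inst_of_lin_of:
  assumes "valid_instance P" "\<And>q. v (f q) = q" shows "inst_of v (lin_of f P) = P"
  using assms(1) unfolding lin_of_def valid_instance_def
  by (intro inverse_lp.equality eq_matI eq_vecI) (auto simp: assms(2))

lemma entries_lin_of: "entries (lin_of f P) = map f (entries (lin_of (\<lambda>q. q) P))"
  by (simp add: lin_of_def map_concat comp_def)

lemma dims_le_entries:
  assumes "valid_instance P"
  shows "dim_m P \<le> length (entries (lin_of f P))" "dim_n P \<le> length (entries (lin_of f P))"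
    "dim_g P \<le> length (entries (lin_of f P))" "dim_k P \<le> length (entries (lin_of f P))" "ix P < dim_n P"
proof -
  show i: "ix P < dim_n P" using assms by (simp add: valid_instance_def)
  then have "dim_k P \<le> dim_n P * dim_k P" by (cases "dim_n P") auto
  also have "\<dots> \<le> length (entries (lin_of f P))"
    by (simp add: lin_of_def length_concat comp_def sum_list_triv)
  finally show "dim_k P \<le> length (entries (lin_of f P))" .
qed (simp_all add: lin_of_def)

lemma entry_at_map:
  assumes "\<forall>i\<ge>n. X i = 0" shows "entry_at (map (\<lambda>i. dint (X i)) [0..<n]) = X"
proof
  show "entry_at (map (\<lambda>i. dint (X i)) [0..<n]) i = X i" for i
    using assms by (cases "i < n") (simp_all add: entry_at_def, simp add: nth_or_def ival_def)
qed

lemma sz_dint_list: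
  assumes "\<And>i. \<bar>X i\<bar> \<le> 2 ^ B" shows "sz (map (\<lambda>i. dint (X i)) [0..<n]) \<le> 1 + n * (12 + 8 * B)"
proof -
  have "sz (map (\<lambda>i. dint (X i)) [0..<n]) \<le> 1 + length (map (\<lambda>i. dint (X i)) [0..<n]) * (1 + (11 + 8 * B))"
    by (rule sz_list_le) (use sz_dint[OF assms] in auto)
  then show ?thesis by simp
qed

text \<open>The bound of \<open>entry_exists\<close> for \<open>L = s\<close> and
  \<open>M = s * s\<close>: the common denominator is a product of at most \<open>s\<close> numbers
  up to \<open>2 ^ s\<close>.\<close>

definition entry_bound :: "nat \<Rightarrow> nat" where
  "entry_bound s = 100 + 40 * (s + s * s)"
definition row_bound :: "nat \<Rightarrow> nat" where
  "row_bound s = 3 + entry_bound s + 2 * (1 + s * (1 + entry_bound s))"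
definition lin_bound :: "nat \<Rightarrow> nat" where
  "lin_bound s = 9 + 4 * s + 3 * (1 + s * (1 + row_bound s))"
text \<open>An exponent of 2 that bounds the numbers in a certificate. The factor
  \<open>11 * s + 1\<close> bounds the number of unknowns, where the conversion from standard form
  may produce \<open>3 * s\<close> rows; the other factor is an exponent for the base of the power
  in \<open>cert_small\<close>.\<close>

definition bits_bound :: "nat \<Rightarrow> nat" where
  "bits_bound s = (2 * (s * s) + 58 * s + 8) * (11 * s + 1)"
definition cert_bound :: "nat \<Rightarrow> nat" where
  "cert_bound s = lin_bound s + (12 + 4 * (s * s)) + (11 + 8 * bits_bound s) + 5 * (1 + 3 * s * (12 + 8 * bits_bound s))"

lemma cert_bound_poly: "\<exists>q. \<forall>s. cert_bound s \<le> poly q s"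
proof -
  have s: "PB (\<lambda>s :: nat. s)" by (rule PB_le[OF PB_sz[OF PT_id]]) simp
  have "PB cert_bound"
    unfolding cert_bound_def lin_bound_def row_bound_def entry_bound_def bits_bound_def by (intro PT_intros s)
  then obtain p where p: "\<And>s. cert_bound s \<le> poly p (Suc (s + s))" unfolding PB_def by (auto simp: mult_2)
  show ?thesis using p by (intro exI[of _ "pcompose p [:1, 2:]"]) (simp add: poly_pcompose mult_2_right)
qed

lemma sz_linst:
  assumes sh: "shaped (k, R, C, D, i)" and dims: "length R \<le> s" "length C \<le> s" "length D \<le> s" "k \<le> s"
    and e: "\<And>e. e \<in> set (entries (k, R, C, D, i)) \<Longrightarrow> sz e \<le> entry_bound s"
  shows "sz (k, R, C, D, i) \<le> lin_bound s"
proof -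
  have list: "sz l \<le> 1 + s * (1 + c)" if "\<And>a. a \<in> set l \<Longrightarrow> sz a \<le> c" "length l \<le> s" for l :: "'x::enc list" and c
  proof -
    have "sz l \<le> 1 + length l * (1 + c)" by (rule sz_list_le) (use that in blast)
    also have "\<dots> \<le> 1 + s * (1 + c)" using that(2) by (intro add_left_mono mult_right_mono) auto
    finally show ?thesis .
  qed
  let ?E = "1 + s * (1 + entry_bound s)"
  have entries: "sz l \<le> ?E" if "set l \<subseteq> set (entries (k, R, C, D, i))" "length l \<le> s" for l
    by (rule list) (use e that in blast)+
  have "sz r \<le> row_bound s" if r: "r \<in> set R" for r
  proof -
    have "sz (fst r) \<le> ?E" by (rule entries) (use r sh dims in auto)
    moreover have "sz (fst (snd r)) \<le> ?E" by (rule entries) (use r sh dims in auto)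
    moreover have "sz (snd (snd r)) \<le> entry_bound s" by (rule e) (use r in auto)
    moreover obtain a b c where "r = (a, b, c)" by (cases r)
    ultimately show ?thesis unfolding row_bound_def by simp
  qed
  then have "sz R \<le> 1 + s * (1 + row_bound s)" by (intro list dims)
  moreover have CD: "sz r \<le> row_bound s" if r: "r \<in> set C \<union> set D" for r
  proof -
    have "sz (fst r) \<le> ?E" by (rule entries) (use r sh dims in auto)
    moreover have "sz (snd r) \<le> entry_bound s" by (rule e) (use r in auto)
    moreover have "sz r = 1 + sz (fst r) + sz (snd r)" by (metis prod.collapse sz_prod)
    moreover have "1 + x + y \<le> 3 + e + 2 * E" if "x \<le> E" "y \<le> e" for x y e E :: nat using that by simp
    ultimately show ?thesis unfolding row_bound_def by presburger
  qed
  moreover have "sz C \<le> 1 + s * (1 + row_bound s)" by (intro list dims CD) simp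
  moreover have "sz D \<le> 1 + s * (1 + row_bound s)" by (intro list dims CD) simp
  moreover have "i < s" using sh dims by simp
  moreover have "1 + (2 * k + 1) + (1 + x + (1 + y + (1 + z + (2 * i + 1)))) \<le> 9 + 4 * s + 3 * E"
    if "x \<le> E" "y \<le> E" "z \<le> E" "i < s" "k \<le> s" for x y z E :: nat using that by simp
  ultimately show ?thesis using dims(4) unfolding sz_prod sz_nat lin_bound_def by presburger
qed

lemma bits_bound:
  assumes "k \<le> s" "n \<le> s" "g \<le> s" "m \<le> 3 * s" and V: "V = 2 ^ (s + s * s)"
  shows "(2 * (k + n + 3 * m + 2) * ((g + 12 * m + 7 * n + k + 4) * V\<^sup>2) + 1) ^ (k + n + 3 * m + 1) \<le> (2 :: nat) ^ bits_bound s"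
proof -
  let ?a = "2 * (s * s) + 58 * s + 8"
  have V2: "V\<^sup>2 = 2 ^ ((s + s * s) * 2)" unfolding V power_mult ..
  have le: "x \<le> 2 ^ x" for x :: nat by (rule less_imp_le[OF less_exp])
  have "k + n + 3 * m + 2 \<le> 11 * s + 2" "g + 12 * m + 7 * n + k + 4 \<le> 45 * s + 4" using assms by linarith+
  then have "k + n + 3 * m + 2 \<le> 2 ^ (11 * s + 2)" "g + 12 * m + 7 * n + k + 4 \<le> 2 ^ (45 * s + 4)"
    using le[of "11 * s + 2"] le[of "45 * s + 4"] by linarith+
  then have "2 * (k + n + 3 * m + 2) * ((g + 12 * m + 7 * n + k + 4) * V\<^sup>2) \<le> 2 * 2 ^ (11 * s + 2) * (2 ^ (45 * s + 4) * V\<^sup>2)"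
    by (intro mult_le_mono order_refl)
  also have "\<dots> = 2 ^ (1 + (11 * s + 2) + ((45 * s + 4) + (s + s * s) * 2))"
    unfolding V2 power_add by simp
  also have "1 + (11 * s + 2) + ((45 * s + 4) + (s + s * s) * 2) = 2 * (s * s) + 58 * s + 7" by simp
  finally have "2 * (k + n + 3 * m + 2) * ((g + 12 * m + 7 * n + k + 4) * V\<^sup>2) + 1 \<le> 2 ^ (2 * (s * s) + 58 * s + 7) + 2 ^ (2 * (s * s) + 58 * s + 7)"
    by (intro add_mono) auto
  also have "\<dots> = 2 ^ ?a" by (simp add: power_add)
  finally have "(2 * (k + n + 3 * m + 2) * ((g + 12 * m + 7 * n + k + 4) * V\<^sup>2) + 1) ^ (k + n + 3 * m + 1) \<le> (2 ^ ?a) ^ (k + n + 3 * m + 1)"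
    by (intro power_mono) auto
  also have "\<dots> \<le> (2 ^ ?a) ^ (11 * s + 1)" using assms by (intro power_increasing) auto
  finally show ?thesis unfolding bits_bound_def power_mult .
qed

lemma verify_complete:
  assumes x: "x \<in> problem form pess fixed"
  shows "\<exists>c. sz c \<le> cert_bound (length x) \<and> verifier form pess fixed x c"
proof -
  obtain P where P: "x = enc_instance P" "valid_instance P" "fixed \<longrightarrow> fixed_objective P" "scenario form pess P"
    using x unfolding problem_language_def by blast
  let ?qs = "entries (lin_of (\<lambda>q. q) P)"
  let ?s = "length x"
  have "enc_instance (inst_of (\<lambda>q. q) (lin_of (\<lambda>q. q) P)) = enc_linst enc_rat (lin_of (\<lambda>q. q) P)"
    by (rule enc_inst_of[OF shaped_lin_of[OF P(2)]]) simp
  then have "x = enc_linst enc_rat (lin_of (\<lambda>q. q) P)" by (simp add: inst_of_lin_of[OF P(2)] P(1))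
  then have s: "length (concat (map enc_rat ?qs)) \<le> ?s" by (simp add: lin_of_def)
  have enc_pos: "1 \<le> length (enc_rat q)" for q by (simp add: enc_rat_def enc_int_def split: prod.splits)
  have "length l \<le> length (concat (map enc_rat l))" for l
  proof (induction l)
    case (Cons q l) then show ?case using enc_pos[of q] by simp
  qed simp
  then have qs: "length ?qs \<le> ?s" using s le_trans by blast
  have enc_le: "length (enc_rat q) \<le> ?s" if "q \<in> set ?qs" for q
  proof -
    have "length (enc_rat q) \<le> length (concat (map enc_rat ?qs))"
      using that member_le_sum_list[of "length (enc_rat q)" "map (length \<circ> enc_rat) ?qs"] by (simp add: length_concat comp_def)
    then show ?thesis using s by simp
  qed
  note dims = le_trans[OF dims_le_entries(1)[OF P(2)] qs] le_trans[OF dims_le_entries(2)[OF P(2)] qs]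
    le_trans[OF dims_le_entries(3)[OF P(2)] qs] le_trans[OF dims_le_entries(4)[OF P(2)] qs]
  \<comment> \<open>The product of all denominators is a common denominator; its size stays
    polynomial since there are at most \<open>length x\<close> factors, each at most
    \<open>2 ^ length x\<close>.\<close>
  define N where "N = prod_list (map (\<lambda>q. snd (quotient_of q)) ?qs)"
  have den_pos: "0 < snd (quotient_of q)" for q by (rule quotient_of_denom_pos')
  have den_le: "snd (quotient_of q) \<le> 2 ^ ?s" if "q \<in> set ?qs" for q
  proof -
    have "length (nat_bits (nat (snd (quotient_of q)))) \<le> length (enc_rat q)"
      by (simp add: enc_rat_def enc_nat_def length_concat comp_def sum_list_triv split: prod.splits)
    then have "nat (snd (quotient_of q)) < 2 ^ ?s"
      using less_length_nat_bits[of "nat (snd (quotient_of q))"] power_increasing[of _ ?s "2::nat"] enc_le[OF that]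
      by (meson le_trans less_le_trans one_le_numeral)
    then show ?thesis using den_pos[of q] by (simp add: nat_less_iff)
  qed
  have prod: "0 < prod_list (map (\<lambda>q. snd (quotient_of q)) l) \<and> prod_list (map (\<lambda>q. snd (quotient_of q)) l) \<le> (2 ^ ?s) ^ length l"
    if "set l \<subseteq> set ?qs" for l
    using that
  proof (induction l)
    case (Cons q l) then show ?case using den_le[of q] den_pos[of q] by (auto intro!: mult_mono)
  qed simp
  have N0: "0 < N" using prod[of ?qs] by (simp add: N_def)
  have "N \<le> (2 ^ ?s) ^ length ?qs" using prod[of ?qs] by (simp add: N_def)
  also have "\<dots> \<le> (2 ^ ?s) ^ ?s" using qs by (intro power_increasing) auto
  finally have N: "N \<le> 2 ^ (?s * ?s)" by (simp add: power_mult)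
  have dvd: "snd (quotient_of q) dvd N" if "q \<in> set ?qs" for q
    unfolding N_def using split_list[OF that] by auto
  \<comment> \<open>A representation is chosen for every rational number, with size bounds for those
    that occur, because \<open>inst_of_lin_of\<close> asks that \<open>f\<close> be inverted by
    \<open>entry_val\<close> everywhere.\<close>
  have "\<exists>e. entry_val e = q \<and> (q \<in> set ?qs \<longrightarrow> reduced e \<and> scaled N e \<and> \<bar>multiple e\<bar> \<le> 2 ^ (?s + ?s * ?s) \<and> sz e \<le> entry_bound ?s)" for q
  proof (cases "q \<in> set ?qs")
    case True
    then show ?thesis using entry_exists[OF enc_le[OF True] dvd[OF True] N0 N] by (auto simp: entry_bound_def)
  next
    case False
    have "snd (quotient_of q) \<le> 2 ^ nat (snd (quotient_of q))"
    proof -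
      have "int (nat (snd (quotient_of q))) \<le> int (2 ^ nat (snd (quotient_of q)))"
        using less_imp_le[OF less_exp] by (simp only: of_nat_le_iff)
      then show ?thesis using den_pos[of q] by simp
    qed
    then show ?thesis using entry_exists[OF order_refl dvd_refl den_pos[of q]] False by blast
  qed
  then obtain f where f: "\<And>q. entry_val (f q) = q"
    "\<And>q. q \<in> set ?qs \<Longrightarrow> reduced (f q) \<and> scaled N (f q) \<and> \<bar>multiple (f q)\<bar> \<le> 2 ^ (?s + ?s * ?s) \<and> sz (f q) \<le> entry_bound ?s"
    by metis
  let ?P = "lin_of f P"
  have fe: "reduced e \<and> scaled N e \<and> \<bar>multiple e\<bar> \<le> 2 ^ (?s + ?s * ?s) \<and> sz e \<le> entry_bound ?s" if "e \<in> set (entries ?P)" for e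
    using that f(2) unfolding entries_lin_of[of f] by auto
  have inst: "inst_of entry_val ?P = P" by (rule inst_of_lin_of[OF P(2)]) (rule f(1))
  have sh: "shaped ?P" by (rule shaped_lin_of[OF P(2)])
  define Nb where "Nb = nat_bits (nat N)"
  have Nb: "int (val Nb) = N" using N0 by (simp add: Nb_def)
  let ?F = "natural_inst form Nb ?P"
  have scF: "scaled (int (val Nb)) e" if "e \<in> set (entries ?F)" for e
    by (rule scaled_natural_inst[OF _ that]) (use fe Nb in auto)
  define m where "m = length (fst (snd ?F))"
  have dF: "fst ?F = dim_k P" "length (fst (snd (snd ?F))) = dim_n P" "length (fst (snd (snd (snd ?F)))) = dim_g P" "m \<le> 3 * ?s"
    using dims_natural_inst[of form Nb ?P] dims unfolding m_def by (simp_all add: lin_of_def)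
  define V :: nat where "V = 2 ^ (?s + ?s * ?s)"
  have V: "\<bar>multiple e\<bar> \<le> int V" if e: "e \<in> set (entries ?F)" for e
  proof -
    have NV: "N \<le> 2 ^ (?s + ?s * ?s)" using order_trans[OF N, of "2 ^ (?s + ?s * ?s)"] by (simp add: power_increasing)
    consider "e \<in> set (entries ?P)" | e' where "e' \<in> set (entries ?P)" "e = entry_neg e'" | "e = entry_zero" | "e = entry_mone Nb"
      using subsetD[OF entries_natural_inst e] by blast
    then show ?thesis
    proof cases
      case 2 then show ?thesis using fe[of e'] by (simp add: V_def)
    qed (use fe[of e] N0 NV in \<open>simp_all add: V_def Nb\<close>)
  qed
  have "scenario Natural_Form pess (inst_of entry_val ?F)"
    using scenario_natural_inst[OF sh] inst P(4) by simp
  define H where "H = (2 * (dim_k P + dim_n P + 3 * m + 2) * ((dim_g P + 12 * m + 7 * dim_n P + dim_k P + 4) * V\<^sup>2) + 1) ^ (dim_k P + dim_n P + 3 * m + 1)"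
  have "0 < real_of_int (int (val Nb))" "1 \<le> V" using N0 by (simp_all add: Nb V_def)
  then obtain t X Y L U W where c: "icert multiple entry_zero pess ?F t X Y L U W" "0 < t" "t \<le> int H"
    "\<forall>i. \<bar>X i\<bar> \<le> int H \<and> \<bar>Y i\<bar> \<le> int H \<and> \<bar>L i\<bar> \<le> int H \<and> \<bar>U i\<bar> \<le> int H \<and> \<bar>W i\<bar> \<le> int H"
    "\<forall>i\<ge>dim_k P. X i = 0" "\<forall>i\<ge>dim_n P. Y i = 0" "\<forall>i\<ge>m. L i = 0 \<and> U i = 0 \<and> W i = 0"
    using icert_complete[OF shaped_natural_inst[OF sh] _ multiple_eq[OF scF] \<open>scenario Natural_Form pess _\<close> _ V m_def
      dF(2)[symmetric] dF(1)[symmetric] dF(3)[symmetric] H_def, where z=entry_zero] by blast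
  have "H \<le> 2 ^ bits_bound ?s" unfolding H_def by (rule bits_bound[OF dims(4,2,3) dF(4) V_def])
  then have H: "int H \<le> 2 ^ bits_bound ?s" by (metis of_nat_le_iff of_nat_numeral of_nat_power)
  let ?l = "\<lambda>n X. map (\<lambda>i. dint (X i)) [0..<n]"
  have "verify form pess fixed x ?P Nb (dint t) (?l (dim_k P) X) (?l (dim_n P) Y) (?l m L) (?l m U) (?l m W)"
    unfolding verify_def ival_dint
  proof (intro conjI impI ballI)
    show "enc_linst entry_code ?P = x"
    proof -
      have "enc_instance (inst_of entry_val ?P) = enc_linst entry_code ?P"
        by (rule enc_inst_of[OF sh]) (use enc_rat_entry_val fe in blast)
      then show ?thesis unfolding inst P(1) ..
    qed
    show "numer e = 0" if "fixed" "r \<in> set (fst (snd (snd ?P)))" "e \<in> set (fst r)" for r e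
    proof -
      have "e \<in> set (entries ?P)" using that(2,3) by (cases ?P) auto
      moreover have "entry_val e = 0" using P(3) that fixed_objective_inst_of[OF sh, of entry_val] inst by auto
      ultimately show ?thesis using fe[of e] by (auto simp: entry_val_def scaled_def)
    qed
    show "icert multiple entry_zero pess ?F t (entry_at (?l (dim_k P) X)) (entry_at (?l (dim_n P) Y)) (entry_at (?l m L))
      (entry_at (?l m U)) (entry_at (?l m W))"
      using c by (simp add: entry_at_map)
  qed (use sh fe Nb N0 in auto)
  moreover have "sz (?P, Nb, dint t, ?l (dim_k P) X, ?l (dim_n P) Y, ?l m L, ?l m U, ?l m W) \<le> cert_bound ?s"
  proof -
    have "nat N < 2 ^ Suc (?s * ?s)" using N N0 by (simp add: nat_less_iff)
    then have "length Nb \<le> Suc (?s * ?s)" unfolding Nb_def by (rule length_nat_bits_le)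
    then have 1: "sz Nb \<le> 1 + 4 * Suc (?s * ?s)" by (intro le_trans[OF sz_bools]) simp
    have 2: "sz (dint t) \<le> 11 + 8 * bits_bound ?s" by (rule sz_dint) (use c(2) order_trans[OF c(3) H] in simp)
    have 3: "sz (?l n Z) \<le> 1 + 3 * ?s * (12 + 8 * bits_bound ?s)" if "\<And>i. \<bar>Z i\<bar> \<le> int H" "n \<le> 3 * ?s" for n Z
    proof -
      have "sz (?l n Z) \<le> 1 + n * (12 + 8 * bits_bound ?s)" by (rule sz_dint_list) (use that(1) H order_trans in blast)
      also have "\<dots> \<le> 1 + 3 * ?s * (12 + 8 * bits_bound ?s)" by (intro add_left_mono mult_right_mono that(2)) simp
      finally show ?thesis .
    qed
    have 4: "sz ?P \<le> lin_bound ?s"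
      using sz_linst[OF sh[unfolded lin_of_def], folded lin_of_def] dims fe by simp
    have d: "dim_k P \<le> 3 * ?s" "dim_n P \<le> 3 * ?s" using dims by simp_all
    have X: "sz (?l (dim_k P) X) \<le> 1 + 3 * ?s * (12 + 8 * bits_bound ?s)" by (rule 3) (use c(4) d in blast)+
    have Y: "sz (?l (dim_n P) Y) \<le> 1 + 3 * ?s * (12 + 8 * bits_bound ?s)" by (rule 3) (use c(4) d in blast)+
    have L: "sz (?l m L) \<le> 1 + 3 * ?s * (12 + 8 * bits_bound ?s)" by (rule 3) (use c(4) dF(4) in blast)+
    have U: "sz (?l m U) \<le> 1 + 3 * ?s * (12 + 8 * bits_bound ?s)" by (rule 3) (use c(4) dF(4) in blast)+
    have W: "sz (?l m W) \<le> 1 + 3 * ?s * (12 + 8 * bits_bound ?s)" by (rule 3) (use c(4) dF(4) in blast)+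
    have arith: "1 + a + (1 + b + (1 + c + (1 + x + (1 + y + (1 + l + (1 + u + w)))))) \<le> a' + (12 + 4 * S) + c' + 5 * q"
      if "a \<le> a'" "b \<le> 1 + 4 * Suc S" "c \<le> c'" "x \<le> q" "y \<le> q" "l \<le> q" "u \<le> q" "w \<le> q"
      for a a' b c c' x y l u w q S :: nat using that by simp
    show ?thesis unfolding sz_prod cert_bound_def by (rule arith[OF 4 1 2 X Y L U W])
  qed
  ultimately show ?thesis
    by (intro exI[of _ "(?P, Nb, dint t, ?l (dim_k P) X, ?l (dim_n P) Y, ?l m L, ?l m U, ?l m W)"] conjI)
      (simp_all only: verifier_def prod.case)
qed

lemma in_NP_problem: "in_NP (problem form pess fixed)"
proof -
  obtain q where q: "\<And>s. cert_bound s \<le> poly q s" using cert_bound_poly by blast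
  show ?thesis
  proof (rule in_NP_I[OF PT_verifier])
    show "PT (from_tree :: tree \<Rightarrow> certificate)"
      by (intro PT_from_prod PT_from_list PT_from_bool PT_from_nat)
    show "x \<in> problem form pess fixed" if "verifier form pess fixed x c" for x c
      using that verify_sound unfolding verifier_def by (auto split: prod.splits)
    show "\<exists>c. sz c \<le> poly q (length x) \<and> verifier form pess fixed x c" if "x \<in> problem form pess fixed" for x
      using verify_complete[OF that] q le_trans by blast
  qed
qed

lemma NP_complete_problem: "NP_complete (problem form pess fixed)"
proof -
  have "NP_hard (problem form pess fixed)"
    by (rule NP_hard_problem_language[where form=form]) (auto simp: scenario_def split: if_splits)
  then show ?thesis unfolding NP_complete_def using in_NP_problem by blast
qed

theorem theorem9:
  fixes form :: lp_form
  shows "NP_complete (problem_language (optimistic form))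
       \<and> NP_complete (problem_language (pessimistic form))
       \<and> NP_complete (problem_language (\<lambda>P. fixed_objective P \<and> optimistic form P))
       \<and> NP_complete (problem_language (\<lambda>P. fixed_objective P \<and> pessimistic form P))"
  using NP_complete_problem[where form=form and pess=False and fixed=False] NP_complete_problem[where form=form and pess=True and fixed=False]
    NP_complete_problem[where form=form and pess=False and fixed=True] NP_complete_problem[where form=form and pess=True and fixed=True]
  by (simp add: scenario_def)

end
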